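(* Let $T$ be a non-empty finite subset of $\{\nu\in\mathbb N\mid\nu\ge2\}$, let $L=\{L_w\}_{w\in W_*}\in T^{W_*}$, let $G(L)$ be the inhomogeneous Sierpinski gasket generated by $L$, and let $(\mathcal E,\mathcal F)$ be the canonical Dirichlet form on it. Let $q=\{q_v\}_{v\in S}\in\mathcal A$. Suppose that at least one of the following two conditions holds. (A) $q_{i^\nu}\ne r^{(\nu)}$ for all $i\in S_0$ and $\nu\in T$. (B) For each $l_0,l_1\in\mathbb N$ there exists $l_2\in\mathbb N$ such that the following property ($\star$) holds for $\lambda_q$-a.e. $\omega\in\Sigma$: ($\star$) there exist infinitely many $k\in\mathbb Z_+$ such that, for every $i,j\in S_0$, the relation $$[\omega]_k\, i^{\nu_{k+1}}\cdots i^{\nu_{k+l_0}}\,j^{\nu_{k+l_0+1}}\cdots j^{\nu_{k+l_0+l_1}}\,j^{\nu_{k+l_0+l_1+1}}\cdots j^{\nu_{k+l_0+l_1+l_2}}\in \tilde W_{k+l_0+l_1+l_2}$$ (with $\nu_{k+1},\dots,\nu_{k+l_0+l_1+l_2}\in T$) implies $$\{\nu_{m}\mid k+l_0+1\le m\le k+l_0+l_1\}\subset \{\nu_{m}\mid k+l_0+l_1+1\le m\le k+l_0+l_1+l_2\}.$$ Then, for every $f\in\mathcal F$, the energy measure $\mu_{\langle f\rangle}$ and the measure $\mu_q$ are mutually singular.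
   Context: Notation: $\mathbb Z_+=\mathbb N\cup\{0\}$; $l(X)$ is the set of real-valued functions on a set $X$; $C(X)$ the real-valued continuous functions. Level-$\nu$ data. Let $\tilde K\subset\mathbb R^2$ be a (filled) equilateral triangle with vertex set $V_0=\{p_1,p_2,p_3\}$, and $S_0=\{1,2,3\}$. For $\nu\ge2$ let $N(\nu)=\nu(\nu+1)/2$. Divide each side of $\tilde K$ into $\nu$ equal parts, giving a subdivision of $\tilde K$ into triangles of side ratio $1/\nu$; let $K^{(\nu)}_1,\dots,K^{(\nu)}_{N(\nu)}$ be the (filled) small triangles with the same orientation as $\tilde K$, and $\psi^{(\nu)}_i$ the map $z\mapsto \nu^{-1}z+\alpha^{(\nu)}_i$ taking $\tilde K$ onto $K^{(\nu)}_i$. (Equivalently, these are the maps $z\mapsto \nu^{-1}(z+ap_1+bp_2+cp_3)$ with $a,b,c\in\mathbb Z_+$, $a+b+c=\nu-1$.) Labels are chosen so that for $i\in S_0$, $K_i^{(\nu)}$ contains $p_i$, i.e. $\psi^{(\nu)}_i(p_i)=p_i$. Let $V_1^{(\nu)}=\bigcup_{i}\psi_i^{(\nu)}(V_0)$. For $x,y\in l(V_0)$ let $Q(x,y)=\sum_{(a,b)\in\{(1,2),(2,3),(3,1)\}}(x(p_a)-x(p_b))(y(p_a)-y(p_b))$. There is a unique $r^{(\nu)}>0$ such that for every $x\in l(V_0)$, $Q(x,x)=\inf\{\sum_{i=1}^{N(\nu)}\frac1{r^{(\nu)}}Q(y\circ\psi_i^{(\nu)}|_{V_0},y\circ\psi_i^{(\nu)}|_{V_0})\mid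 y\in l(V_1^{(\nu)}),\ y|_{V_0}=x\}$; this $r^{(\nu)}$ is fixed. Words. For $\nu\in T$, $S^{(\nu)}$ is the set of formal letters $i^\nu$, $i=1,\dots,N(\nu)$ (the $\nu$ is a label, not a power; different $\nu$ give different letters), and $S=\bigcup_{\nu\in T}S^{(\nu)}$. $\Sigma=S^{\mathbb N}$; $W_0=\{\emptyset\}$, $W_m=S^m$, $W_*=\bigcup_{m\in\mathbb Z_+}W_m$. For $\omega\in\Sigma$, $[\omega]_n=\omega_1\cdots\omega_n$, $[\omega]_0=\emptyset$. For $w\in W_m$, $\Sigma_w=\{\omega\in\Sigma\mid[\omega]_m=w\}$. Put $\psi_{i^\nu}=\psi_i^{(\nu)}$, $r_{i^\nu}=r^{(\nu)}$, and for $w=w_1\cdots w_m$: $\psi_w=\psi_{w_1}\circ\cdots\circ\psi_{w_m}$, $r_w=r_{w_1}\cdots r_{w_m}$ ($\psi_\emptyset=\mathrm{id}$, $r_\emptyset=1$). $\pi:\Sigma\to\tilde K$ sends $\omega$ to the unique point of $\bigcap_{m}\psi_{[\omega]_m}(\tilde K)$. The gasket. Given $L=\{L_w\}_{w\in W_*}\in T^{W_*}$, set $\tilde W_0=\{\emptyset\}$, $\tilde W_m=\bigcup_{w\in\tilde W_{m-1}}\{wv\mid v\in S^{(L_w)}\}$, $\tilde W_*=\bigcup_m\tilde W_m$, $\tilde\Sigma=\{\omega\in\Sigma\mid[\omega]_m\in\tilde W_m\ \forall m\in\mathbb Z_+\}$, and $G(L)=\pi(\tilde\Sigma)$ with the relative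 topology of $\mathbb R^2$. Let $V_m=\bigcup_{w\in\tilde W_m}\psi_w(V_0)$. Reference measures. $\mathcal A$ is the set of $q=\{q_v\}_{v\in S}$ with $q_v>0$ for all $v\in S$ and $\sum_{v\in S^{(\nu)}}q_v=1$ for each $\nu\in T$. For $q\in\mathcal A$, $\lambda_q$ is the unique Borel probability measure on $\Sigma$ with $\lambda_q(\Sigma_w)=q_{w_1}\cdots q_{w_m}$ if $w=w_1\cdots w_m\in\tilde W_m$ and $\lambda_q(\Sigma_w)=0$ if $w\notin\tilde W_*$ (so $\lambda_q(\Sigma\setminus\tilde\Sigma)=0$); $\mu_q$ is the image measure of $\lambda_q$ under $\pi|_{\tilde\Sigma}:\tilde\Sigma\to G(L)$. Dirichlet form. For $x,y\in l(V_m)$ let $\mathcal E^{(m)}(x,y)=\sum_{w\in\tilde W_m}\frac1{r_w}Q(x\circ\psi_w|_{V_0},y\circ\psi_w|_{V_0})$. For $f\in C(G(L))$ the sequence $\mathcal E^{(m)}(f|_{V_m},f|_{V_m})$ is non-decreasing in $m$; $\mathcal F=\{f\in C(G(L))\mid\lim_{m}\mathcal E^{(m)}(f|_{V_m},f|_{V_m})<\infty\}$ and $\mathcal E(f,g)=\lim_m\mathcal E^{(m)}(f|_{V_m},g|_{V_m})$ for $f,g\in\mathcal F$. It is known that $(\mathcal E,\mathcal F)$ is a strongly local regular Dirichlet form on $L^2(G(L),\mu_q)$ for every $q\in\mathcal A$. The energy measure $\mu_{\langle f\rangle}$ of $f\in\mathcal F$ is the finite Borel measure on $G(L)$ characterized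 by $\int_{G(L)}g\,d\mu_{\langle f\rangle}=2\mathcal E(f,fg)-\mathcal E(f^2,g)$ for all $g\in\mathcal F$. *)

theory Defs
  imports "HOL-Probability.Probability"
begin

text \<open>
  The letter \<open>i\<^sup>\<nu>\<close> is the pair \<open>(i, \<nu>)\<close>, and finite words are lists of letters. An infinite word
  \<open>\<omega>\<^sub>1\<omega>\<^sub>2\<dots>\<close> is a function on \<open>nat\<close>, so \<open>\<omega>\<^sub>n\<close> is the value at \<open>n - 1\<close>.
\<close>

type_synonym letter = "nat \<times> nat"
type_synonym plane = "real ^ 2"

definition letters :: "nat \<Rightarrow> letter set" where
  "letters \<nu> = {(i, \<nu>) | i. i \<in> {1..\<nu> * (\<nu> + 1) div 2}}"

definition initial_word :: "nat \<Rightarrow> (nat \<Rightarrow> letter) \<Rightarrow> letter list" where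
  "initial_word n \<omega> = map \<omega> [0..<n]"

definition mutually_singular :: "'a measure \<Rightarrow> 'a measure \<Rightarrow> bool" where
  "mutually_singular M N \<longleftrightarrow>
     sets M = sets N \<and> (\<exists>A\<in>sets M. emeasure M A = 0 \<and> emeasure N (space N - A) = 0)"

text \<open>
  \<open>\<psi> \<nu> i\<close> is the map $\psi^{(\nu)}_i$; its numbering is arbitrary apart from the three corner maps.
  Only the values of \<open>p\<close> at \<open>1, 2, 3\<close> and of \<open>L\<close> on words over the alphabet matter.
\<close>

locale inhomogeneous_gasket =
  fixes p :: "nat \<Rightarrow> plane"
    and \<psi> :: "nat \<Rightarrow> nat \<Rightarrow> plane \<Rightarrow> plane"
    and T :: "nat set"
    and L :: "letter list \<Rightarrow> nat"
  assumes equilateral: "dist (p 1) (p 2) = dist (p 2) (p 3)" "dist (p 2) (p 3) = dist (p 3) (p 1)"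
    and nondegenerate: "p 1 \<noteq> p 2"
    and subdivision: "\<nu> \<ge> 2 \<Longrightarrow> bij_betw (\<psi> \<nu>) {1..\<nu> * (\<nu> + 1) div 2}
          {\<lambda>z. (1 / real \<nu>) *\<^sub>R (z + real a *\<^sub>R p 1 + real b *\<^sub>R p 2 + real c *\<^sub>R p 3) | a b c.
             a + b + c = \<nu> - 1}"
    and corners: "\<nu> \<ge> 2 \<Longrightarrow> i \<in> {1, 2, 3} \<Longrightarrow> \<psi> \<nu> i (p i) = p i"
    and T_finite: "finite T" and T_nonempty: "T \<noteq> {}" and T_ge_2: "T \<subseteq> {2..}"
    and L_in_T: "w \<in> lists (\<Union>\<nu>\<in>T. letters \<nu>) \<Longrightarrow> L w \<in> T"
begin

definition triangle :: "plane set" where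
  "triangle = convex hull {p 1, p 2, p 3}"

text \<open>
  Functions on a subset of the plane (on the vertex sets and on the gasket) are represented by
  functions on the whole plane, whose values elsewhere play no role.
\<close>

definition Q :: "(plane \<Rightarrow> real) \<Rightarrow> (plane \<Rightarrow> real) \<Rightarrow> real" where
  "Q x y = (\<Sum>(a, b)\<in>{(1, 2), (2, 3), (3, 1)}. (x (p a) - x (p b)) * (y (p a) - y (p b)))"

definition r :: "nat \<Rightarrow> real" where
  "r \<nu> = (THE \<rho>. \<rho> > 0 \<and>
     (\<forall>x. Q x x = Inf {\<Sum>i = 1..\<nu> * (\<nu> + 1) div 2. 1 / \<rho> * Q (y \<circ> \<psi> \<nu> i) (y \<circ> \<psi> \<nu> i) | y.
                        \<forall>v\<in>{p 1, p 2, p 3}. y v = x v}))"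

definition alphabet :: "letter set" where
  "alphabet = (\<Union>\<nu>\<in>T. letters \<nu>)"

text \<open>
  The alphabet is finite, so this product \<open>\<sigma>\<close>-algebra is the Borel \<open>\<sigma>\<close>-algebra of the product of
  discrete topologies; its underlying space consists of all sequences of letters of the alphabet.
\<close>

definition word_space :: "(nat \<Rightarrow> letter) measure" where
  "word_space = (\<Pi>\<^sub>M n\<in>UNIV. count_space alphabet)"

definition cylinder :: "letter list \<Rightarrow> (nat \<Rightarrow> letter) set" where
  "cylinder w = {\<omega> \<in> space word_space. initial_word (length w) \<omega> = w}"

primrec \<psi>_word :: "letter list \<Rightarrow> plane \<Rightarrow> plane" where
  "\<psi>_word [] = id"
| "\<psi>_word (v # w) = \<psi> (snd v) (fst v) \<circ> \<psi>_word w"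

definition r_word :: "letter list \<Rightarrow> real" where
  "r_word w = (\<Prod>v\<leftarrow>w. r (snd v))"

definition coding :: "(nat \<Rightarrow> letter) \<Rightarrow> plane" where
  "coding \<omega> = (THE z. \<forall>m. z \<in> \<psi>_word (initial_word m \<omega>) ` triangle)"

primrec adm_words :: "nat \<Rightarrow> letter list set" where
  "adm_words 0 = {[]}"
| "adm_words (Suc m) = (\<Union>w\<in>adm_words m. {w @ [v] | v. v \<in> letters (L w)})"

definition adm_sequences :: "(nat \<Rightarrow> letter) set" where
  "adm_sequences = {\<omega> \<in> space word_space. \<forall>m. initial_word m \<omega> \<in> adm_words m}"

definition gasket :: "plane set" where
  "gasket = coding ` adm_sequences"

definition weights :: "(letter \<Rightarrow> real) set" where
  "weights = {q. (\<forall>v\<in>alphabet. q v > 0) \<and> (\<forall>\<nu>\<in>T. (\<Sum>v\<in>letters \<nu>. q v) = 1)}"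

definition path_measure :: "(letter \<Rightarrow> real) \<Rightarrow> (nat \<Rightarrow> letter) measure" where
  "path_measure q = (THE M. sets M = sets word_space \<and> prob_space M \<and>
     (\<forall>w\<in>lists alphabet.
        measure M (cylinder w) = (if w \<in> (\<Union>m. adm_words m) then \<Prod>v\<leftarrow>w. q v else 0)))"

definition gasket_measure :: "(letter \<Rightarrow> real) \<Rightarrow> plane measure" where
  "gasket_measure q =
     distr (restrict_space (path_measure q) adm_sequences) (restrict_space borel gasket) coding"

definition level_energy :: "nat \<Rightarrow> (plane \<Rightarrow> real) \<Rightarrow> (plane \<Rightarrow> real) \<Rightarrow> real" where
  "level_energy m x y = (\<Sum>w\<in>adm_words m. 1 / r_word w * Q (x \<circ> \<psi>_word w) (y \<circ> \<psi>_word w))"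

definition form_domain :: "(plane \<Rightarrow> real) set" where
  "form_domain = {f. continuous_on gasket f \<and> lim (\<lambda>m. ereal (level_energy m f f)) < \<infinity>}"

definition form :: "(plane \<Rightarrow> real) \<Rightarrow> (plane \<Rightarrow> real) \<Rightarrow> real" where
  "form f g = lim (\<lambda>m. level_energy m f g)"

definition energy_measure :: "(plane \<Rightarrow> real) \<Rightarrow> plane measure" where
  "energy_measure f = (THE M. sets M = sets (restrict_space borel gasket) \<and> finite_measure M \<and>
     (\<forall>g\<in>form_domain.
        (\<integral>x. g x \<partial>M) = 2 * form f (\<lambda>x. f x * g x) - form (\<lambda>x. (f x)\<^sup>2) g))"

end

end

theory Submission
  imports Defs "HOL-Combinatorics.Permutations"
begin

text \<open>
  The energy measure \<open>\<mu>\<^sub>f\<close> and \<open>\<mu>\<^sub>q\<close> are images under the coding map of measures on the word space, whose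
  values on the cylinder of an admissible word \<open>w\<close> are twice the energy of \<open>f\<close> in the cell of \<open>w\<close> and
  the weight \<open>q\<^sub>w\<close>. Since \<open>\<mu>\<^sub>q\<close> does not charge the countable set of vertices, they are mutually
  singular as soon as the Hellinger sums \<open>\<Sum>\<^sub>w sqrt (\<mu>\<^sub>f(w) \<mu>\<^sub>q(w))\<close> over the words of length \<open>n\<close> tend to 0.
  Approximating \<open>f\<close> in energy by its harmonic interpolants, it suffices to consider \<open>f\<close> that is harmonic
  in all cells of some level.

  For such \<open>f\<close> the Hellinger sum below \<open>w\<close> shrinks by a fixed factor whenever the density
  \<open>\<mu>\<^sub>f/\<mu>\<^sub>q\<close> cannot stay nearly constant on all words that extend \<open>w\<close> by boundedly many letters. Restriction to
  the cell at the corner \<open>p\<^sub>i\<close> is diagonal: the part of a harmonic function symmetric under the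
  reflection fixing \<open>p\<^sub>i\<close> is multiplied by \<open>r\<close>, the antisymmetric part by some \<open>s\<close> with \<open>\<bar>s\<bar> < r\<close>. Along
  \<open>i\<^sup>\<nu>i\<^sup>\<nu>\<^sup>'\<dots>\<close> the density is therefore multiplied at each step by \<open>(r/q)(1 - (1 - s\<^sup>2/r\<^sup>2)\<tau>)\<close>, where the
  antisymmetric share \<open>\<tau>\<close> of the energy decays geometrically. Under (A) this factor stays away from 1 once \<open>\<tau>\<close> is
  small. Under (B), take a corner \<open>j\<close> for which both parts are substantial; when the same \<open>\<nu>\<close> occurs a
  second time on the way into \<open>p\<^sub>j\<close>, the factors \<open>r/q\<close> and \<open>s/r\<close> are the same but \<open>\<tau>\<close> is smaller, so the two
  factors cannot both be close to 1.
\<close>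

section \<open>Harmonic functions on the first subdivision\<close>

text \<open>Hellinger sums suffice because \<open>min a b \<le> sqrt a * sqrt b\<close>: at one
  level, splitting the words by which mass is smaller already separates the measures up to the sum.
  The obstacle to their decay is that good words recur along almost every path but at no uniform
  rate, so no fixed number of levels contracts. The limit of the sums below a word is therefore
  used: it is additive over children and can be carried to the first good word on each path. The
  coding map is not injective at vertices. These are kept out of the set that must be small for the
  energy measure; they fall to the side where only \<open>\<mu>\<^sub>q\<close> has to be small, so
  the energy of a vertex never has to be computed. The renormalisation factor, the coding, the path
  measure and the energy measure are definite descriptions, each resolved by existence and
  uniqueness. Uniqueness of the energy measure needs many continuous functions of finite energy;
  this is one reason why harmonic functions are extended continuously to the whole gasket, the other
  being the approximation of \<open>f\<close>.\<close>

text \<open>The Dirichlet problem in abstract form: values are prescribed off \<open>I\<close>, and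
  the form is definite on functions supported on \<open>I\<close>. The induction is Gram-Schmidt:
  the solution \<open>y\<close> for the smaller set is corrected by a multiple of \<open>h\<close>,
  which is 1 at the new point and orthogonal to everything supported on \<open>I\<close>.\<close>

lemma ex_orthogonal_extension:
  fixes B :: "('a \<Rightarrow> real) \<Rightarrow> ('a \<Rightarrow> real) \<Rightarrow> real"
  assumes "finite I"
    and add: "\<And>x y z. B (\<lambda>a. x a + y a) z = B x z + B y z"
    and scale: "\<And>c x z. B (\<lambda>a. c * x a) z = c * B x z"
    and sym: "\<And>x y. B x y = B y x"
    and pos: "\<And>y. (\<forall>a. a \<notin> I \<longrightarrow> y a = 0) \<Longrightarrow> \<exists>a. y a \<noteq> 0 \<Longrightarrow> B y y > 0"
  shows "\<exists>y. (\<forall>a. a \<notin> I \<longrightarrow> y a = x a) \<and> (\<forall>z. (\<forall>a. a \<notin> I \<longrightarrow> z a = 0) \<longrightarrow> B y z = 0)"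
  using assms(1) pos
proof (induction I arbitrary: x rule: finite_induct)
  case empty
  have zero: "B y (\<lambda>_. 0) = 0" for y
    using scale[of 0 "\<lambda>_. 0" y] sym by simp
  show ?case
  proof (rule exI[of _ x], intro conjI allI impI)
    fix z :: "'a \<Rightarrow> real" assume "\<forall>a. a \<notin> {} \<longrightarrow> z a = 0"
    then have "z = (\<lambda>_. 0)" by auto
    then show "B x z = 0" using zero by simp
  qed auto
next
  case (insert i I)
  have IH: "\<exists>y. (\<forall>a. a \<notin> I \<longrightarrow> y a = x a) \<and> (\<forall>z. (\<forall>a. a \<notin> I \<longrightarrow> z a = 0) \<longrightarrow> B y z = 0)" for x
    by (rule insert.IH, rule insert.prems) auto
  define d where "d = (\<lambda>a. if a = i then 1 else 0 :: real)"
  obtain y where y: "\<And>a. a \<notin> I \<Longrightarrow> y a = x a"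
    "\<And>z. (\<forall>a. a \<notin> I \<longrightarrow> z a = 0) \<Longrightarrow> B y z = 0"
    using IH[of x] by blast
  obtain h where h: "\<And>a. a \<notin> I \<Longrightarrow> h a = d a"
    "\<And>z. (\<forall>a. a \<notin> I \<longrightarrow> z a = 0) \<Longrightarrow> B h z = 0"
    using IH[of d] by blast
  have add2: "B x (\<lambda>a. y a + z a) = B x y + B x z" for x y z
    using add sym by metis
  have scale2: "B x (\<lambda>a. c * y a) = c * B x y" for c x y
    using scale sym by metis
  have hpos: "B h h > 0"
  proof (rule insert.prems)
    show "\<forall>a. a \<notin> insert i I \<longrightarrow> h a = 0" using h(1) by (auto simp: d_def)
    show "\<exists>a. h a \<noteq> 0" using h(1)[OF insert.hyps(2)] by (auto simp: d_def intro!: exI[of _ i])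
  qed
  have hd: "B h d = B h h"
  proof -
    have "B h (\<lambda>a. d a + (h a + (-1) * d a)) = B h d + B h (\<lambda>a. h a + (-1) * d a)"
      by (rule add2)
    moreover have "B h (\<lambda>a. h a + (-1) * d a) = 0"
      by (rule h(2)) (simp add: h(1))
    ultimately show ?thesis by simp
  qed
  \<comment> \<open>Chosen so that \<open>B u d = 0\<close>; \<open>B h d = B h h\<close> because
    \<open>h - d\<close> is supported on \<open>I\<close>.\<close>
  define t where "t = - B y d / B h h"
  define u where "u = (\<lambda>a. y a + t * h a)"
  have uz: "B u z = B y z + t * B h z" for z
    unfolding u_def by (simp add: add scale)
  show ?case
  proof (rule exI[of _ u], intro conjI allI impI)
    fix a assume "a \<notin> insert i I"
    then show "u a = x a" using y(1) h(1) by (auto simp: u_def d_def)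
  next
    fix z assume z: "\<forall>a. a \<notin> insert i I \<longrightarrow> z a = (0::real)"
    define z' where "z' = (\<lambda>a. z a + (- z i) * d a)"
    have zz: "z = (\<lambda>a. z i * d a + z' a)" by (auto simp: z'_def)
    have 0: "B y z' = 0" "B h z' = 0"
      using z by (auto intro!: y(2) h(2) simp: z'_def d_def)
    have "B u z = z i * B u d + B u z'"
      by (subst zz) (simp only: add2 scale2)
    also have "\<dots> = 0"
      using hpos by (simp add: uz 0 hd t_def)
    finally show "B u z = 0" .
  qed
qed

text \<open>Keeps the corner index \<open>1\<close> in this form instead of \<open>Suc 0\<close>, so
  that rules about the indices \<open>{1,2,3}\<close> go on matching.\<close>

declare One_nat_def [simp del]

context inhomogeneous_gasket
begin

abbreviation V0 :: "plane set" where "V0 \<equiv> p ` {1, 2, 3}"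

lemma Q_eq: "Q x y = (x (p 1) - x (p 2)) * (y (p 1) - y (p 2)) +
    (x (p 2) - x (p 3)) * (y (p 2) - y (p 3)) + (x (p 3) - x (p 1)) * (y (p 3) - y (p 1))"
  by (simp add: Q_def)

text \<open>Each edge is counted twice. Unlike the cyclic sum, this form is visibly invariant under
  relabelling of the corners.\<close>

lemma Q_double_sum: "Q x y = (\<Sum>a\<in>{1,2,3}. \<Sum>b\<in>{1,2,3}. (x (p a) - x (p b)) * (y (p a) - y (p b))) / 2"
  by (simp add: Q_eq algebra_simps)

lemma Q_cong: "(\<And>a. a \<in> {1,2,3} \<Longrightarrow> x (p a) = x' (p a)) \<Longrightarrow> (\<And>a. a \<in> {1,2,3} \<Longrightarrow> y (p a) = y' (p a)) \<Longrightarrow> Q x y = Q x' y'"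
  by (simp add: Q_eq)

lemma Q_sym: "Q x y = Q y x"
  by (simp add: Q_eq mult.commute)

lemma Q_nonneg: "Q x x \<ge> 0"
  by (simp add: Q_eq)

lemma Q_edge_le:
  assumes "a \<in> {1,2,3}" "b \<in> {1,2,3}"
  shows "\<bar>x (p a) - x (p b)\<bar> \<le> sqrt (Q x x)"
proof -
  have "(x (p a) - x (p b))\<^sup>2 \<le> Q x x"
    using assms by (auto simp: Q_eq power2_eq_square[symmetric] power2_commute[of "x (p 2)" "x (p 1)"]
        power2_commute[of "x (p 3)" "x (p 2)"] power2_commute[of "x (p 1)" "x (p 3)"])
  then show ?thesis
    by (metis real_sqrt_abs real_sqrt_le_iff)
qed

section \<open>Barycentric coordinates and the cells of one subdivision\<close>

definition side2 :: real where "side2 = (dist (p 1) (p 2))\<^sup>2"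

definition centroid :: plane where "centroid = (1/3) *\<^sub>R (p 1 + p 2 + p 3)"

text \<open>Barycentric coordinates, as affine functions on the whole plane. Seen from the centroid,
  an equilateral triangle has inner products \<open>side2 / 3\<close> (same corner) and
  \<open>- side2 / 6\<close> (different corners), which fixes the factor \<open>2 / side2\<close>
  and the summand \<open>1 / 3\<close>.\<close>

definition bary :: "nat \<Rightarrow> plane \<Rightarrow> real" where
  "bary a z = 1 / 3 + 2 * ((z - centroid) \<bullet> (p a - centroid)) / side2"

lemma side2_pos: "side2 > 0"
  using nondegenerate by (simp add: side2_def)

lemma bary_p:
  assumes "a \<in> {1,2,3}" "b \<in> {1,2,3}"
  shows "bary a (p b) = (if a = b then 1 else 0)"
proof -
  \<comment> \<open>Two sides at \<open>p 1\<close>, of equal length and at an angle of 60 degrees;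
    every inner product below is expressed through them.\<close>
  define u where "u = p 1 - p 2"
  define v where "v = p 1 - p 3"
  have uu: "u \<bullet> u = side2"
    by (simp add: u_def side2_def dist_norm power2_norm_eq_inner)
  have vv: "v \<bullet> v = side2"
    using equilateral by (simp add: v_def side2_def dist_norm power2_norm_eq_inner[symmetric] norm_minus_commute)
  have "(u - v) \<bullet> (u - v) = side2"
    using equilateral
    by (simp add: u_def v_def side2_def dist_norm power2_norm_eq_inner[symmetric] norm_minus_commute)
  then have uv: "u \<bullet> v = side2 / 2"
    using uu vv by (simp add: inner_diff_left inner_diff_right inner_commute)
  have e: "p 1 - centroid = (1/3) *\<^sub>R (u + v)" "p 2 - centroid = (1/3) *\<^sub>R (v - 2 *\<^sub>R u)"
    "p 3 - centroid = (1/3) *\<^sub>R (u - 2 *\<^sub>R v)"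
    unfolding centroid_def u_def v_def
    by (simp_all add: vec_eq_iff field_simps)
  have vu: "v \<bullet> u = side2 / 2" using uv by (simp add: inner_commute)
  have "(p 1 - centroid) \<bullet> (p 1 - centroid) = side2 / 3" "(p 2 - centroid) \<bullet> (p 2 - centroid) = side2 / 3"
     "(p 3 - centroid) \<bullet> (p 3 - centroid) = side2 / 3"
    by (simp_all only: e inner_add_left inner_add_right inner_diff_left inner_diff_right uu vv uv vu
        inner_scaleR_left inner_scaleR_right) (auto simp: field_simps)
  then have i: "(p a - centroid) \<bullet> (p a - centroid) = side2 / 3" if "a \<in> {1,2,3}" for a
    using that by auto
  have "(p 1 - centroid) \<bullet> (p 2 - centroid) = - side2 / 6" "(p 1 - centroid) \<bullet> (p 3 - centroid) = - side2 / 6"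
     "(p 2 - centroid) \<bullet> (p 3 - centroid) = - side2 / 6"
    by (simp_all only: e inner_add_left inner_add_right inner_diff_left inner_diff_right uu vv uv vu
        inner_scaleR_left inner_scaleR_right) (auto simp: field_simps)
  then have j: "(p b - centroid) \<bullet> (p a - centroid) = - side2 / 6" if "a \<noteq> b"
    using that assms by (auto simp: inner_commute)
  show ?thesis
    using side2_pos unfolding bary_def by (cases "a = b") (simp_all add: i[OF assms(2)] j)
qed

lemma bary_p_simps [simp]:
  "bary 1 (p 1) = 1" "bary 1 (p 2) = 0" "bary 1 (p 3) = 0"
  "bary 2 (p 1) = 0" "bary 2 (p 2) = 1" "bary 2 (p 3) = 0"
  "bary 3 (p 1) = 0" "bary 3 (p 2) = 0" "bary 3 (p 3) = 1"
  by (simp_all add: bary_p)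

lemma bary_eq: "bary a z = 2 * (z \<bullet> (p a - centroid)) / side2 + bary a 0"
  by (simp add: bary_def inner_diff_left diff_divide_distrib)

lemma inj_p: "inj_on p {1,2,3}"
proof (rule inj_onI)
  fix a b assume "a \<in> {1,2,3::nat}" "b \<in> {1,2,3::nat}" "p a = p b"
  then show "a = b" using bary_p[of a b] bary_p[of a a] by (auto split: if_splits)
qed

lemma bary_sum: "(\<Sum>a\<in>{1,2,3}. bary a z) = 1"
proof -
  have "(p 1 - centroid) + (p 2 - centroid) + (p 3 - centroid) = 0"
    by (simp add: centroid_def vec_eq_iff field_simps)
  then have "0 = 2 * ((z - centroid) \<bullet> ((p 1 - centroid) + (p 2 - centroid) + (p 3 - centroid))) / side2"
    by (simp only: inner_zero_right)
  also have "\<dots> = (\<Sum>a\<in>{1,2,3}. bary a z) - 1"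
    unfolding inner_add_right bary_def by (simp only: distrib_left add_divide_distrib) simp
  finally show ?thesis by simp
qed

lemma bary_linear_combination:
  assumes "(\<Sum>a\<in>{1,2,3}. t a) = 1" "b \<in> {1,2,3}"
  shows "bary b (\<Sum>a\<in>{1,2,3}. t a *\<^sub>R p a) = t b"
proof -
  have "bary b (\<Sum>a\<in>{1,2,3}. t a *\<^sub>R p a) = (\<Sum>a\<in>{1,2,3}. t a * bary b (p a)) - (\<Sum>a\<in>{1,2,3}. t a) * bary b 0 + bary b 0"
    unfolding bary_eq[of b "p _"] bary_eq[of b "sum _ _"]
    by (simp add: inner_add_left add_divide_distrib distrib_left distrib_right mult.left_commute)
  also have "\<dots> = t b"
    unfolding assms(1) using assms(2) by (elim insertE emptyE) (simp_all add: bary_p)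
  finally show ?thesis .
qed

text \<open>The exponents (a, b, c) of a subdivision map, as a function of the corner index. The
  numbering of \<open>\<psi> \<nu>\<close> is arbitrary, whereas on these indices a permutation of
  the corners acts by composition. The value 0 outside \<open>{1,2,3}\<close> makes equal cells
  equal functions.\<close>

definition cells :: "nat \<Rightarrow> (nat \<Rightarrow> nat) set" where
  "cells \<nu> = {c. (\<forall>a. a \<notin> {1,2,3} \<longrightarrow> c a = 0) \<and> (\<Sum>a\<in>{1,2,3}. c a) = \<nu> - 1}"

definition cell_map :: "nat \<Rightarrow> (nat \<Rightarrow> nat) \<Rightarrow> plane \<Rightarrow> plane" where
  "cell_map \<nu> c z = (1 / real \<nu>) *\<^sub>R (z + (\<Sum>a\<in>{1,2,3}. real (c a) *\<^sub>R p a))"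

definition corner_cell :: "nat \<Rightarrow> nat \<Rightarrow> nat \<Rightarrow> nat" where
  "corner_cell \<nu> i = (\<lambda>a. if a = i then \<nu> - 1 else 0)"

text \<open>The point counts with weight 1 and the corners with weights \<open>c\<close>; together
  these sum to \<open>\<nu>\<close>, so the affine constants cancel.\<close>

lemma bary_cell_map:
  assumes "c \<in> cells \<nu>" "\<nu> \<ge> 2" "a \<in> {1,2,3}"
  shows "bary a (cell_map \<nu> c z) = (bary a z + real (c a)) / real \<nu>"
proof -
  have \<nu>: "real \<nu> = 1 + (\<Sum>b\<in>{1,2,3}. real (c b))"
    using assms(1,2) by (simp add: cells_def of_nat_sum[symmetric] del: of_nat_sum sum.insert)
  have "real \<nu> * (bary a (cell_map \<nu> c z) - bary a 0)
      = (bary a z - bary a 0) + (\<Sum>b\<in>{1,2,3}. real (c b) * (bary a (p b) - bary a 0))"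
    using assms(2) side2_pos unfolding bary_eq[of a "cell_map \<nu> c z"] bary_eq[of a z] bary_eq[of a "p _"]
    unfolding cell_map_def by (simp add: inner_add_left field_simps)
  also have "\<dots> = bary a z + (\<Sum>b\<in>{1,2,3}. real (c b) * bary a (p b)) - real \<nu> * bary a 0"
    unfolding \<nu> by (simp add: algebra_simps)
  also have "(\<Sum>b\<in>{1,2,3}. real (c b) * bary a (p b)) = real (c a)"
    using assms(3) by (elim insertE emptyE) simp_all
  finally show ?thesis
    using assms(2) by (simp add: field_simps)
qed

lemma cell_map_inj:
  assumes "c \<in> cells \<nu>" "c' \<in> cells \<nu>" "\<nu> \<ge> 2" "cell_map \<nu> c z = cell_map \<nu> c' z"
  shows "c = c'"
proof
  fix a
  show "c a = c' a"
  proof (cases "a \<in> {1,2,3}")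
    case True
    have "(bary a z + real (c a)) / real \<nu> = (bary a z + real (c' a)) / real \<nu>"
      using bary_cell_map[OF assms(1,3) True, of z] bary_cell_map[OF assms(2,3) True, of z] assms(4) by metis
    then have "bary a z + real (c a) = bary a z + real (c' a)"
      using assms(3) by (metis divide_cancel_right not_numeral_le_zero of_nat_eq_0_iff)
    then show ?thesis by (metis add_left_cancel of_nat_eq_iff)
  next
    case False
    then show ?thesis using assms(1,2) by (simp add: cells_def)
  qed
qed

lemma cells_image:
  assumes "\<nu> \<ge> 2"
  shows "cell_map \<nu> ` cells \<nu> = \<psi> \<nu> ` {1..\<nu> * (\<nu> + 1) div 2}"
proof -
  have "cell_map \<nu> ` cells \<nu> = {\<lambda>z. (1 / real \<nu>) *\<^sub>R (z + real a *\<^sub>R p 1 + real b *\<^sub>R p 2 + real c *\<^sub>R p 3) | a b c.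
             a + b + c = \<nu> - 1}" (is "?L = ?R")
  proof
    show "?L \<subseteq> ?R"
    proof
      fix f assume "f \<in> ?L"
      then obtain c where c: "c \<in> cells \<nu>" "f = cell_map \<nu> c" by auto
      then have "c 1 + c 2 + c 3 = \<nu> - 1" by (simp add: cells_def add.assoc)
      moreover have "f = (\<lambda>z. (1 / real \<nu>) *\<^sub>R (z + real (c 1) *\<^sub>R p 1 + real (c 2) *\<^sub>R p 2 + real (c 3) *\<^sub>R p 3))"
        unfolding c(2) cell_map_def by (simp add: add.assoc)
      ultimately show "f \<in> ?R" by blast
    qed
    show "?R \<subseteq> ?L"
    proof
      fix f assume "f \<in> ?R"
      then obtain a b c where f: "f = (\<lambda>z. (1 / real \<nu>) *\<^sub>R (z + real a *\<^sub>R p 1 + real b *\<^sub>R p 2 + real c *\<^sub>R p 3))"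
        and abc: "a + b + c = \<nu> - 1" by auto
      define d where "d = (\<lambda>x::nat. if x = 1 then a else if x = 2 then b else if x = 3 then c else 0)"
      have "d \<in> cells \<nu>" using abc by (simp add: cells_def d_def)
      moreover have "f = cell_map \<nu> d" unfolding f cell_map_def by (simp add: d_def add.assoc)
      ultimately show "f \<in> ?L" by blast
    qed
  qed
  then show ?thesis using subdivision[OF assms] by (simp add: bij_betw_def)
qed

lemma inj_cell_map: "\<nu> \<ge> 2 \<Longrightarrow> inj_on (cell_map \<nu>) (cells \<nu>)"
  by (rule inj_onI) (auto intro: cell_map_inj)

lemma finite_cells: "\<nu> \<ge> 2 \<Longrightarrow> finite (cells \<nu>)"
  using cells_image inj_cell_map by (metis finite_atLeastAtMost finite_imageI finite_image_iff)

lemma sum_cells: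
  assumes "\<nu> \<ge> 2"
  shows "(\<Sum>i = 1..\<nu> * (\<nu> + 1) div 2. F (\<psi> \<nu> i)) = (\<Sum>c\<in>cells \<nu>. F (cell_map \<nu> c))"
proof -
  have "(\<Sum>i = 1..\<nu> * (\<nu> + 1) div 2. F (\<psi> \<nu> i)) = (\<Sum>f\<in>\<psi> \<nu> ` {1..\<nu> * (\<nu> + 1) div 2}. F f)"
    using sum.reindex[OF bij_betw_imp_inj_on[OF subdivision[OF assms]], of F] by simp
  also have "\<dots> = (\<Sum>c\<in>cells \<nu>. F (cell_map \<nu> c))"
    unfolding cells_image[OF assms, symmetric] using inj_cell_map[OF assms] by (simp add: sum.reindex)
  finally show ?thesis .
qed

lemma \<psi>_cell:
  assumes "\<nu> \<ge> 2" "i \<in> {1..\<nu> * (\<nu> + 1) div 2}"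
  obtains c where "c \<in> cells \<nu>" "\<psi> \<nu> i = cell_map \<nu> c"
proof -
  have "\<psi> \<nu> i \<in> cell_map \<nu> ` cells \<nu>" using cells_image[OF assms(1)] assms(2) by auto
  then show ?thesis using that by auto
qed

lemma corner_index: "\<nu> \<ge> 2 \<Longrightarrow> {1,2,3} \<subseteq> {1..\<nu> * (\<nu> + 1) div 2 :: nat}"
proof -
  assume "\<nu> \<ge> 2"
  then have "2 * 3 \<le> \<nu> * (\<nu> + 1)" by (intro mult_mono) auto
  then have "3 \<le> \<nu> * (\<nu> + 1) div 2" by simp
  then show ?thesis by auto
qed

lemma corner_cell_in: "i \<in> {1,2,3} \<Longrightarrow> corner_cell \<nu> i \<in> cells \<nu>"
  by (auto simp: cells_def corner_cell_def)

text \<open>In coordinates, \<open>p i\<close> being a fixed point reads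
  \<open>\<nu> * bary a (p i) = bary a (p i) + c a\<close>, which determines every
  \<open>c a\<close>.\<close>

lemma \<psi>_corner:
  assumes "\<nu> \<ge> 2" "i \<in> {1,2,3}"
  shows "\<psi> \<nu> i = cell_map \<nu> (corner_cell \<nu> i)"
proof -
  obtain c where c: "c \<in> cells \<nu>" "\<psi> \<nu> i = cell_map \<nu> c"
    using \<psi>_cell[OF assms(1), of i] corner_index[OF assms(1)] assms(2) by blast
  have "c a = corner_cell \<nu> i a" for a
  proof (cases "a \<in> {1,2,3}")
    case True
    have "bary a (p i) = (bary a (p i) + real (c a)) / real \<nu>"
      using bary_cell_map[OF c(1) assms(1) True, of "p i"] corners[OF assms] c(2) by simp
    then have "real \<nu> * bary a (p i) = bary a (p i) + real (c a)"
      using assms(1) by (simp add: field_simps)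
    then show ?thesis
      using bary_p[OF True assms(2)] assms(1) by (auto simp: corner_cell_def of_nat_diff)
  next
    case False
    then show ?thesis using c(1) assms(2) by (auto simp: cells_def corner_cell_def)
  qed
  then show ?thesis using c(2) by presburger
qed

section \<open>The energy of one subdivision and its connectedness\<close>

definition E1 :: "nat \<Rightarrow> (plane \<Rightarrow> real) \<Rightarrow> (plane \<Rightarrow> real) \<Rightarrow> real" where
  "E1 \<nu> y z = (\<Sum>c\<in>cells \<nu>. Q (y \<circ> cell_map \<nu> c) (z \<circ> cell_map \<nu> c))"

definition V1 :: "nat \<Rightarrow> plane set" where
  "V1 \<nu> = {cell_map \<nu> c (p a) | c a. c \<in> cells \<nu> \<and> a \<in> {1,2,3}}"

lemma V1I: "c \<in> cells \<nu> \<Longrightarrow> a \<in> {1,2,3} \<Longrightarrow> cell_map \<nu> c (p a) \<in> V1 \<nu>"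
  unfolding V1_def by blast

lemma finite_V1: "\<nu> \<ge> 2 \<Longrightarrow> finite (V1 \<nu>)"
proof -
  assume "\<nu> \<ge> 2"
  moreover have "V1 \<nu> = (\<lambda>(c, a). cell_map \<nu> c (p a)) ` (cells \<nu> \<times> {1,2,3})"
    unfolding V1_def by auto
  ultimately show ?thesis using finite_cells by simp
qed

lemma corner_fixed: "\<nu> \<ge> 2 \<Longrightarrow> i \<in> {1,2,3} \<Longrightarrow> cell_map \<nu> (corner_cell \<nu> i) (p i) = p i"
  using \<psi>_corner corners by metis

lemma V0_subset_V1: "\<nu> \<ge> 2 \<Longrightarrow> V0 \<subseteq> V1 \<nu>"
  using V1I[OF corner_cell_in] corner_fixed by (metis image_subsetI)

lemma E1_cong: "(\<And>v. v \<in> V1 \<nu> \<Longrightarrow> y v = y' v) \<Longrightarrow> (\<And>v. v \<in> V1 \<nu> \<Longrightarrow> z v = z' v) \<Longrightarrow> E1 \<nu> y z = E1 \<nu> y' z'"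
  unfolding E1_def by (intro sum.cong Q_cong) (auto simp: V1I)

lemma E1_sym: "E1 \<nu> y z = E1 \<nu> z y"
  unfolding E1_def by (simp add: Q_sym)

lemma Q_add: "Q (\<lambda>v. x v + y v) z = Q x z + Q y z"
  by (simp add: Q_eq algebra_simps)

lemma Q_scale: "Q (\<lambda>v. t * x v) z = t * Q x z"
  by (simp add: Q_eq algebra_simps)

lemma E1_add: "E1 \<nu> (\<lambda>v. x v + y v) z = E1 \<nu> x z + E1 \<nu> y z"
  unfolding E1_def by (simp add: sum.distrib[symmetric] Q_add[symmetric] comp_def)

lemma E1_scale: "E1 \<nu> (\<lambda>v. t * x v) z = t * E1 \<nu> x z"
  unfolding E1_def by (simp add: sum_distrib_left Q_scale[symmetric] comp_def)

lemma E1_nonneg: "E1 \<nu> y y \<ge> 0"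
  unfolding E1_def by (intro sum_nonneg Q_nonneg)

lemma Q_le_E1: "\<nu> \<ge> 2 \<Longrightarrow> c \<in> cells \<nu> \<Longrightarrow> Q (y \<circ> cell_map \<nu> c) (y \<circ> cell_map \<nu> c) \<le> E1 \<nu> y y"
  unfolding E1_def by (rule member_le_sum) (auto intro: Q_nonneg finite_cells)

lemma E1_cell_diff_le:
  assumes "\<nu> \<ge> 2" "c \<in> cells \<nu>" "a \<in> {1,2,3}" "b \<in> {1,2,3}"
  shows "\<bar>y (cell_map \<nu> c (p a)) - y (cell_map \<nu> c (p b))\<bar> \<le> sqrt (E1 \<nu> y y)"
  using Q_edge_le[OF assms(3,4), of "y \<circ> cell_map \<nu> c"] Q_le_E1[OF assms(1,2), of y]
  by (metis comp_apply order_trans real_sqrt_le_iff)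

text \<open>One unit moved from coordinate \<open>b\<close> to coordinate \<open>a\<close> gives the
  adjacent small triangle. The two touch in one point, which is corner \<open>a\<close> of the old
  cell and corner \<open>b\<close> of the new one.\<close>

lemma neighbour_cell:
  assumes c: "c \<in> cells \<nu>" and ab: "a \<in> {1,2,3}" "b \<in> {1,2,3}" "a \<noteq> b" "c b > 0"
  defines "c' \<equiv> c(a := c a + 1, b := c b - 1)"
  shows "c' \<in> cells \<nu>" "cell_map \<nu> c' (p b) = cell_map \<nu> c (p a)"
proof -
  show "c' \<in> cells \<nu>"
    using c ab by (auto simp: cells_def c'_def)
  have "real (c b - 1) = real (c b) - 1" using ab by auto
  then show "cell_map \<nu> c' (p b) = cell_map \<nu> c (p a)"
    using ab unfolding cell_map_def c'_def by (auto simp: scaleR_left_distrib scaleR_left_diff_distrib)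
qed

text \<open>Walk towards corner 1, raising \<open>c 1\<close> by one at each step. Consecutive cells
  share a vertex, and crossing a cell costs at most the square root of the energy.\<close>

lemma E1_diff_corner_le:
  assumes "\<nu> \<ge> 2" "c \<in> cells \<nu>" "a \<in> {1,2,3}"
  shows "\<bar>y (cell_map \<nu> c (p a)) - y (p 1)\<bar> \<le> real (\<nu> - c 1) * sqrt (E1 \<nu> y y)"
  using assms(2,3)
proof (induction "\<nu> - 1 - c 1" arbitrary: c a)
  case 0
  then have le: "c 1 \<le> \<nu> - 1" "c 1 \<ge> \<nu> - 1" "c 2 + c 3 = \<nu> - 1 - c 1" by (auto simp: cells_def)
  then have c1: "c 1 = \<nu> - 1" by simp
  have "c = corner_cell \<nu> 1"
  proof
    fix x show "c x = corner_cell \<nu> 1 x"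
      using 0(2) le c1 by (cases "x \<in> {1,2,3}") (auto simp: cells_def corner_cell_def)
  qed
  then have "cell_map \<nu> c (p 1) = p 1" using corner_fixed[OF assms(1), of 1] by simp
  then show ?case
    using E1_cell_diff_le[OF assms(1) 0(2,3), of 1 y] c1 assms(1) by simp
next
  case (Suc k)
  then have "c 2 > 0 \<or> c 3 > 0" by (auto simp: cells_def)
  then obtain b where b: "b \<in> {2,3}" "c b > 0" by auto
  define c' where "c' = c(1 := c 1 + 1, b := c b - 1)"
  have c': "c' \<in> cells \<nu>" "cell_map \<nu> c' (p b) = cell_map \<nu> c (p 1)"
    using neighbour_cell[OF Suc(3), of 1 b] b unfolding c'_def by auto
  have c1: "c' 1 = c 1 + 1" using b by (auto simp: c'_def)
  have "\<bar>y (cell_map \<nu> c' (p b)) - y (p 1)\<bar> \<le> real (\<nu> - c' 1) * sqrt (E1 \<nu> y y)"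
    using Suc.hyps(2) b by (intro Suc.hyps(1) c'(1)) (auto simp: c1)
  moreover have "\<bar>y (cell_map \<nu> c (p a)) - y (cell_map \<nu> c (p 1))\<bar> \<le> sqrt (E1 \<nu> y y)"
    by (rule E1_cell_diff_le[OF assms(1) Suc(3,4)]) auto
  moreover have "real (\<nu> - c 1) = real (\<nu> - c' 1) + 1"
    using Suc.hyps(2) c1 by linarith
  ultimately show ?case
    unfolding c'(2) by (simp add: distrib_right)
qed

lemma E1_diff_le:
  assumes "\<nu> \<ge> 2" "u \<in> V1 \<nu>" "v \<in> V1 \<nu>"
  shows "\<bar>y u - y v\<bar> \<le> 2 * real \<nu> * sqrt (E1 \<nu> y y)"
proof -
  have *: "\<bar>y u - y (p 1)\<bar> \<le> real \<nu> * sqrt (E1 \<nu> y y)" if u: "u \<in> V1 \<nu>" for u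
  proof -
    obtain c a where ca: "c \<in> cells \<nu>" "a \<in> {1,2,3}" "u = cell_map \<nu> c (p a)"
      using u unfolding V1_def by blast
    have "real (\<nu> - c 1) * sqrt (E1 \<nu> y y) \<le> real \<nu> * sqrt (E1 \<nu> y y)"
      by (intro mult_right_mono) (auto simp: E1_nonneg)
    then show ?thesis using E1_diff_corner_le[OF assms(1) ca(1,2), of y] ca(3) by simp
  qed
  show ?thesis using *[OF assms(2)] *[OF assms(3)] by linarith
qed

lemma E1_zero_const: "\<nu> \<ge> 2 \<Longrightarrow> E1 \<nu> y y = 0 \<Longrightarrow> u \<in> V1 \<nu> \<Longrightarrow> v \<in> V1 \<nu> \<Longrightarrow> y u = y v"
  using E1_diff_le[of \<nu> u v y] by simp

section \<open>Discrete harmonic functions and the minimum principle\<close>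

text \<open>Weak form of harmonicity: orthogonality to all functions vanishing at the three corners.
  It is linear in \<open>y\<close> and depends on \<open>V1 \<nu>\<close> only.\<close>

definition harm :: "nat \<Rightarrow> (plane \<Rightarrow> real) \<Rightarrow> bool" where
  "harm \<nu> y \<longleftrightarrow> (\<forall>z. (\<forall>a\<in>{1,2,3}. z (p a) = 0) \<longrightarrow> E1 \<nu> y z = 0)"

text \<open>The form is definite on functions supported on the interior vertices because the
  subdivision is connected: zero energy forces a constant, and its value at \<open>p 1\<close> is
  0.\<close>

lemma harm_exists:
  assumes "\<nu> \<ge> 2"
  shows "\<exists>y. harm \<nu> y \<and> (\<forall>a\<in>{1,2,3}. y (p a) = x (p a))"
proof -
  have "\<exists>y. (\<forall>v. v \<notin> V1 \<nu> - V0 \<longrightarrow> y v = x v) \<and>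
      (\<forall>z. (\<forall>v. v \<notin> V1 \<nu> - V0 \<longrightarrow> z v = 0) \<longrightarrow> E1 \<nu> y z = 0)"
  proof (rule ex_orthogonal_extension)
    show "finite (V1 \<nu> - V0)" using finite_V1[OF assms] by simp
    show "E1 \<nu> (\<lambda>a. x a + y a) z = E1 \<nu> x z + E1 \<nu> y z" for x y z by (rule E1_add)
    show "E1 \<nu> (\<lambda>a. c * x a) z = c * E1 \<nu> x z" for x z c by (rule E1_scale)
    show "E1 \<nu> x y = E1 \<nu> y x" for x y by (rule E1_sym)
    fix y :: "plane \<Rightarrow> real" assume y: "\<forall>a. a \<notin> V1 \<nu> - V0 \<longrightarrow> y a = 0" "\<exists>a. y a \<noteq> 0"
    then obtain v where v: "v \<in> V1 \<nu>" "y v \<noteq> 0" by auto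
    have "y (p 1) = 0" using y by auto
    moreover have "p 1 \<in> V1 \<nu>" using V0_subset_V1[OF assms] by auto
    ultimately have "E1 \<nu> y y \<noteq> 0" using E1_zero_const[OF assms, of y v "p 1"] v by auto
    then show "E1 \<nu> y y > 0" using E1_nonneg[of \<nu> y] by simp
  qed
  then obtain y where y: "\<And>v. v \<notin> V1 \<nu> - V0 \<Longrightarrow> y v = x v"
    "\<And>z. (\<And>v. v \<notin> V1 \<nu> - V0 \<Longrightarrow> z v = 0) \<Longrightarrow> E1 \<nu> y z = 0" by metis
  have "harm \<nu> y"
    unfolding harm_def
  proof (intro allI impI)
    fix z assume z: "\<forall>a\<in>{1,2,3}. z (p a) = (0::real)"
    have "E1 \<nu> y z = E1 \<nu> y (\<lambda>v. if v \<in> V1 \<nu> then z v else 0)" by (rule E1_cong) auto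
    also have "\<dots> = 0" by (rule y(2)) (use z in auto)
    finally show "E1 \<nu> y z = 0" .
  qed
  moreover have "\<forall>a\<in>{1,2,3}. y (p a) = x (p a)" using y(1) by blast
  ultimately show ?thesis by blast
qed

lemma harm_add: "harm \<nu> x \<Longrightarrow> harm \<nu> y \<Longrightarrow> harm \<nu> (\<lambda>v. x v + y v)"
  by (simp add: harm_def E1_add)

lemma harm_scale: "harm \<nu> x \<Longrightarrow> harm \<nu> (\<lambda>v. t * x v)"
  by (simp add: harm_def E1_scale)

lemma harm_cong: "harm \<nu> x \<Longrightarrow> (\<And>v. v \<in> V1 \<nu> \<Longrightarrow> x v = y v) \<Longrightarrow> harm \<nu> y"
  unfolding harm_def using E1_cong by metis

lemma harm_const: "harm \<nu> (\<lambda>v. t)"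
  by (simp add: harm_def E1_def Q_eq)

lemma harm_unique:
  assumes "\<nu> \<ge> 2" "harm \<nu> x" "harm \<nu> y" "\<And>a. a \<in> {1,2,3} \<Longrightarrow> x (p a) = y (p a)" "v \<in> V1 \<nu>"
  shows "x v = y v"
proof -
  define d where "d = (\<lambda>v. x v + (-1) * y v)"
  have "harm \<nu> d" unfolding d_def by (intro harm_add harm_scale assms)
  moreover have "\<forall>a\<in>{1,2,3}. d (p a) = 0" using assms(4) by (simp add: d_def)
  ultimately have "E1 \<nu> d d = 0" by (simp add: harm_def)
  then have "d v = d (p 1)"
    using E1_zero_const[OF assms(1)] assms(5) V0_subset_V1[OF assms(1)] by auto
  then show ?thesis using assms(4)[of 1] by (simp add: d_def)
qed

text \<open>Pythagoras: the difference \<open>d\<close> vanishes at the corners, is therefore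
  orthogonal to \<open>y\<close>, and the energies add.\<close>

lemma harm_minimal:
  assumes "\<nu> \<ge> 2" "harm \<nu> y" "\<And>a. a \<in> {1,2,3} \<Longrightarrow> x (p a) = y (p a)"
  shows "E1 \<nu> y y \<le> E1 \<nu> x x"
    and "E1 \<nu> x x \<le> E1 \<nu> y y \<Longrightarrow> v \<in> V1 \<nu> \<Longrightarrow> x v = y v"
proof -
  define d where "d = (\<lambda>v. x v + (-1) * y v)"
  have x: "x = (\<lambda>v. y v + d v)" by (simp add: d_def)
  have d0: "\<forall>a\<in>{1,2,3}. d (p a) = 0" using assms(3) by (simp add: d_def)
  then have yd: "E1 \<nu> y d = 0" using assms(2) by (simp add: harm_def)
  have "E1 \<nu> x x = E1 \<nu> y x + E1 \<nu> d x" by (subst (1) x) (rule E1_add)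
  also have "E1 \<nu> y x = E1 \<nu> y y" by (subst E1_sym, subst x, simp add: E1_add E1_sym[of \<nu> d y] yd)
  also have "E1 \<nu> d x = E1 \<nu> d d" by (subst E1_sym, subst x, simp add: E1_add yd)
  finally have eq: "E1 \<nu> x x = E1 \<nu> y y + E1 \<nu> d d" .
  then show "E1 \<nu> y y \<le> E1 \<nu> x x" using E1_nonneg[of \<nu> d] by simp
  assume "E1 \<nu> x x \<le> E1 \<nu> y y" "v \<in> V1 \<nu>"
  then have "E1 \<nu> d d = 0" using eq E1_nonneg[of \<nu> d] by simp
  then have "d v = d (p 1)"
    using E1_zero_const[OF assms(1)] \<open>v \<in> V1 \<nu>\<close> V0_subset_V1[OF assms(1)] by auto
  then show "x v = y v" using d0 by (simp add: d_def)
qed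

text \<open>Taking absolute values does not raise the energy and keeps the corner values, so by
  uniqueness of the minimiser it changes nothing on \<open>V1 \<nu>\<close>.\<close>

lemma harm_nonneg:
  assumes "\<nu> \<ge> 2" "harm \<nu> y" "\<And>a. a \<in> {1,2,3} \<Longrightarrow> y (p a) \<ge> 0" "v \<in> V1 \<nu>"
  shows "y v \<ge> 0"
proof -
  define x where "x = (\<lambda>v. \<bar>y v\<bar>)"
  have edge: "(\<bar>a\<bar> - \<bar>b\<bar>) * (\<bar>a\<bar> - \<bar>b\<bar>) \<le> (a - b) * (a - b)" for a b :: real
    by (simp only: power2_eq_square[symmetric] power2_le_iff_abs_le[OF abs_ge_zero] abs_le_square_iff[symmetric])
  have "Q (x \<circ> f) (x \<circ> f) \<le> Q (y \<circ> f) (y \<circ> f)" for f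
    unfolding Q_eq x_def comp_def by (intro add_mono edge)
  then have "E1 \<nu> x x \<le> E1 \<nu> y y" unfolding E1_def by (intro sum_mono)
  then have "x v = y v"
    using harm_minimal(2)[OF assms(1,2), of x v] assms(3,4) by (simp add: x_def)
  then show ?thesis by (simp add: x_def abs_if split: if_splits)
qed

text \<open>Strong minimum principle. Testing with the indicator of a zero of \<open>y\<close> gives
  edge terms that are all non-positive and sum to 0; hence each vanishes, and so does
  \<open>y\<close> at every neighbour.\<close>

lemma harm_zero_neighbour:
  assumes "\<nu> \<ge> 2" "harm \<nu> y" "\<And>a. a \<in> {1,2,3} \<Longrightarrow> y (p a) \<ge> 0"
    and c: "c \<in> cells \<nu>" "a \<in> {1,2,3}" "b \<in> {1,2,3}"
    and z: "cell_map \<nu> c (p a) \<notin> V0" "y (cell_map \<nu> c (p a)) = 0"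
  shows "y (cell_map \<nu> c (p b)) = 0"
proof -
  define v where "v = cell_map \<nu> c (p a)"
  define d where "d = (\<lambda>u. if u = v then 1 else 0 :: real)"
  define x where "x c = (\<lambda>a. y (cell_map \<nu> c (p a)))" for c
  define e where "e c = (\<lambda>a. d (cell_map \<nu> c (p a)))" for c
  have xpos: "x c a \<ge> 0" if "c \<in> cells \<nu>" "a \<in> {1,2,3}" for c a
    unfolding x_def by (rule harm_nonneg[OF assms(1-3)]) (use that in \<open>auto intro: V1I\<close>)
  have ex: "e c a = 0 \<or> e c a = 1 \<and> x c a = 0" for c a
    using z(2) by (auto simp: e_def d_def x_def v_def)
  have le: "(x1 - x2) * (e1 - e2) \<le> 0"
    if "e1 = 0 \<or> e1 = 1 \<and> x1 = 0" "e2 = 0 \<or> e2 = 1 \<and> x2 = 0" "x1 \<ge> 0" "x2 \<ge> 0" for x1 x2 e1 e2 :: real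
    using that by auto
  have Qe: "Q (y \<circ> cell_map \<nu> c) (d \<circ> cell_map \<nu> c) = (x c 1 - x c 2) * (e c 1 - e c 2) +
      (x c 2 - x c 3) * (e c 2 - e c 3) + (x c 3 - x c 1) * (e c 3 - e c 1)" for c
    by (simp add: Q_eq x_def e_def)
  have le2: "(x c a - x c b) * (e c a - e c b) \<le> 0" if "c \<in> cells \<nu>" "a \<in> {1,2,3}" "b \<in> {1,2,3}" for c a b
    using that by (intro le ex xpos)
  have Qle: "Q (y \<circ> cell_map \<nu> c) (d \<circ> cell_map \<nu> c) \<le> 0" if "c \<in> cells \<nu>" for c
    unfolding Qe using that by (intro add_nonpos_nonpos le2) auto
  have "E1 \<nu> y d = 0"
    using assms(2) z(1) unfolding harm_def by (auto simp: d_def v_def)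
  then have "Q (y \<circ> cell_map \<nu> c) (d \<circ> cell_map \<nu> c) = 0"
    unfolding E1_def
    using sum_nonneg_eq_0_iff[of "cells \<nu>" "\<lambda>c. - Q (y \<circ> cell_map \<nu> c) (d \<circ> cell_map \<nu> c)"]
      Qle finite_cells[OF assms(1)] c(1) by (simp add: sum_negf)
  moreover have l: "(x c 1 - x c 2) * (e c 1 - e c 2) \<le> 0" "(x c 2 - x c 3) * (e c 2 - e c 3) \<le> 0"
      "(x c 3 - x c 1) * (e c 3 - e c 1) \<le> 0"
    by (rule le2[OF c(1)]; simp)+
  ultimately have X: "(x c 1 - x c 2) * (e c 1 - e c 2) = 0 \<and> (x c 2 - x c 3) * (e c 2 - e c 3) = 0
      \<and> (x c 3 - x c 1) * (e c 3 - e c 1) = 0"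
    using l unfolding Qe by linarith
  have eq: "x c a = x c b \<or> e c a = e c b"
    using c(2,3) X by (elim insertE emptyE; simp only: mult_eq_0_iff right_minus_eq; metis)
  have "e c a = 1" "x c a = 0" using z(2) by (simp_all add: e_def d_def v_def x_def)
  then have "x c b = 0" using ex[of c b] eq by (metis zero_neq_one)
  then show ?thesis by (simp add: x_def)
qed

section \<open>Symmetries of the triangle\<close>

text \<open>The affine symmetry that carries corner \<open>a\<close> to corner
  \<open>\<pi> a\<close>; rotations and reflections are covered by one formula.\<close>

definition perm_map :: "(nat \<Rightarrow> nat) \<Rightarrow> plane \<Rightarrow> plane" where
  "perm_map \<pi> z = (\<Sum>a\<in>{1,2,3}. bary a z *\<^sub>R p (\<pi> a))"

lemma permutes_in: "\<pi> permutes {1,2,3::nat} \<Longrightarrow> a \<in> {1,2,3} \<Longrightarrow> \<pi> a \<in> {1,2,3}"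
  using permutes_in_image by metis

lemma perm_map_p: "a \<in> {1,2,3} \<Longrightarrow> perm_map \<pi> (p a) = p (\<pi> a)"
  by (elim insertE emptyE) (simp_all add: perm_map_def)

lemma Q_perm:
  assumes "\<pi> permutes {1,2,3}" "\<And>a. a \<in> {1,2,3} \<Longrightarrow> x (p a) = x' (p (\<pi> a))"
    "\<And>a. a \<in> {1,2,3} \<Longrightarrow> y (p a) = y' (p (\<pi> a))"
  shows "Q x y = Q x' y'"
proof -
  have "Q x y = (\<Sum>a\<in>{1,2,3}. \<Sum>b\<in>{1,2,3}. (x' (p (\<pi> a)) - x' (p (\<pi> b))) * (y' (p (\<pi> a)) - y' (p (\<pi> b)))) / 2"
    unfolding Q_double_sum using assms(2,3) by (intro arg_cong2[of _ _ _ _ "(/)"] sum.cong refl) auto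
  also have "\<dots> = (\<Sum>a\<in>{1,2,3}. \<Sum>b\<in>{1,2,3}. (x' (p (\<pi> a)) - x' (p b)) * (y' (p (\<pi> a)) - y' (p b))) / 2"
    using sum.permute[OF assms(1), of "\<lambda>b. (x' (p (\<pi> _)) - x' (p b)) * (y' (p (\<pi> _)) - y' (p b))"]
    by (simp only: comp_def)
  also have "\<dots> = Q x' y'"
    unfolding Q_double_sum
    using sum.permute[OF assms(1), of "\<lambda>a. \<Sum>b\<in>{1,2,3}. (x' (p a) - x' (p b)) * (y' (p a) - y' (p b))"]
    by (simp only: comp_def)
  finally show ?thesis .
qed

text \<open>Coordinate \<open>a\<close> of the cell index moves to place \<open>\<pi> a\<close>,
  whence the composition with the inverse permutation.\<close>

lemma perm_map_cell:
  assumes "\<pi> permutes {1,2,3}" "\<nu> \<ge> 2" "c \<in> cells \<nu>" "b \<in> {1,2,3}"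
  shows "perm_map \<pi> (cell_map \<nu> c (p b)) = cell_map \<nu> (c \<circ> inv \<pi>) (p (\<pi> b))"
proof -
  have "perm_map \<pi> (cell_map \<nu> c (p b)) = (\<Sum>a\<in>{1,2,3}. ((bary a (p b) + real (c a)) / real \<nu>) *\<^sub>R p (\<pi> a))"
    unfolding perm_map_def using bary_cell_map[OF assms(3,2)] by (intro sum.cong) auto
  also have "\<dots> = (1 / real \<nu>) *\<^sub>R ((\<Sum>a\<in>{1,2,3}. bary a (p b) *\<^sub>R p (\<pi> a)) + (\<Sum>a\<in>{1,2,3}. real (c a) *\<^sub>R p (\<pi> a)))"
    by (simp only: sum.distrib[symmetric] scaleR_sum_right scaleR_left_distrib[symmetric] scaleR_scaleR)
       (simp add: field_simps)
  also have "(\<Sum>a\<in>{1,2,3}. bary a (p b) *\<^sub>R p (\<pi> a)) = p (\<pi> b)"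
    using perm_map_p[OF assms(4), of \<pi>] by (simp only: perm_map_def)
  also have "(\<Sum>a\<in>{1,2,3}. real (c a) *\<^sub>R p (\<pi> a)) = (\<Sum>a\<in>{1,2,3}. real ((c \<circ> inv \<pi>) a) *\<^sub>R p a)"
    using sum.permute[OF assms(1), of "\<lambda>a. real ((c \<circ> inv \<pi>) a) *\<^sub>R p a"] permutes_inverses(2)[OF assms(1)]
    by (simp only: comp_def)
  finally show ?thesis by (simp only: cell_map_def)
qed

lemma cells_comp:
  assumes "\<pi> permutes {1,2,3}" "c \<in> cells \<nu>"
  shows "c \<circ> \<pi> \<in> cells \<nu>"
  using assms(2) sum.permute[OF assms(1), of c] permutes_not_in[OF assms(1)]
  unfolding cells_def by (simp only: mem_Collect_eq comp_def) auto

lemma bij_betw_cells: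
  assumes "\<pi> permutes {1,2,3}"
  shows "bij_betw (\<lambda>c. c \<circ> inv \<pi>) (cells \<nu>) (cells \<nu>)"
proof (rule bij_betw_byWitness[where f' = "\<lambda>c. c \<circ> \<pi>"])
  show "(\<lambda>c. c \<circ> inv \<pi>) ` cells \<nu> \<subseteq> cells \<nu>" "(\<lambda>c. c \<circ> \<pi>) ` cells \<nu> \<subseteq> cells \<nu>"
    using cells_comp[OF assms] cells_comp[OF permutes_inv[OF assms]] by blast+
  show "\<forall>c\<in>cells \<nu>. (c \<circ> inv \<pi>) \<circ> \<pi> = c" "\<forall>c\<in>cells \<nu>. (c \<circ> \<pi>) \<circ> inv \<pi> = c"
    using permutes_inv_o[OF assms] by (simp_all add: comp_assoc)
qed

lemma E1_perm_map:
  assumes "\<pi> permutes {1,2,3}" "\<nu> \<ge> 2"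
  shows "E1 \<nu> (y \<circ> perm_map \<pi>) (z \<circ> perm_map \<pi>) = E1 \<nu> y z"
proof -
  have "E1 \<nu> (y \<circ> perm_map \<pi>) (z \<circ> perm_map \<pi>) =
      (\<Sum>c\<in>cells \<nu>. Q (y \<circ> cell_map \<nu> (c \<circ> inv \<pi>)) (z \<circ> cell_map \<nu> (c \<circ> inv \<pi>)))"
    unfolding E1_def
    by (intro sum.cong refl Q_perm[OF assms(1)]) (auto simp only: comp_apply perm_map_cell[OF assms])
  also have "\<dots> = E1 \<nu> y z"
    unfolding E1_def by (rule sum.reindex_bij_betw[OF bij_betw_cells[OF assms(1)]])
  finally show ?thesis .
qed

lemma perm_map_inverse_V1:
  assumes "\<pi> permutes {1,2,3}" "\<nu> \<ge> 2" "v \<in> V1 \<nu>"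
  shows "perm_map (inv \<pi>) (perm_map \<pi> v) = v"
proof -
  obtain c a where ca: "c \<in> cells \<nu>" "a \<in> {1,2,3}" "v = cell_map \<nu> c (p a)"
    using assms(3) unfolding V1_def by blast
  have c': "c \<circ> inv \<pi> \<in> cells \<nu>" by (rule cells_comp[OF permutes_inv[OF assms(1)] ca(1)])
  have i: "inv (inv \<pi>) = \<pi>" by (rule permutes_inv_inv[OF assms(1)])
  show ?thesis
    unfolding ca(3) perm_map_cell[OF assms(1,2) ca(1,2)]
      perm_map_cell[OF permutes_inv[OF assms(1)] assms(2) c' permutes_in[OF assms(1) ca(2)]] i
    using permutes_inv_o[OF assms(1)] permutes_inverses(2)[OF assms(1)] by (simp add: comp_assoc)
qed

lemma harm_perm_map:
  assumes "\<pi> permutes {1,2,3}" "\<nu> \<ge> 2" "harm \<nu> y"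
  shows "harm \<nu> (y \<circ> perm_map \<pi>)"
  unfolding harm_def
proof (intro allI impI)
  fix z :: "plane \<Rightarrow> real" assume z: "\<forall>a\<in>{1,2,3}. z (p a) = 0"
  define z' where "z' = z \<circ> perm_map (inv \<pi>)"
  have "E1 \<nu> (y \<circ> perm_map \<pi>) z = E1 \<nu> (y \<circ> perm_map \<pi>) (z' \<circ> perm_map \<pi>)"
    by (rule E1_cong) (simp_all add: z'_def perm_map_inverse_V1[OF assms(1,2)])
  also have "\<dots> = E1 \<nu> y z'" by (rule E1_perm_map[OF assms(1,2)])
  also have "\<dots> = 0"
  proof -
    have "z' (p a) = 0" if "a \<in> {1,2,3}" for a
      unfolding z'_def comp_apply perm_map_p[OF that]
      using z permutes_in[OF permutes_inv[OF assms(1)] that] by blast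
    then show ?thesis using assms(3) unfolding harm_def by blast
  qed
  finally show "E1 \<nu> (y \<circ> perm_map \<pi>) z = 0" .
qed

section \<open>Restriction of harmonic functions to the corner cells\<close>

text \<open>Harmonic functions are unique on \<open>V1 \<nu>\<close> only; elsewhere the chosen
  function is arbitrary, and nothing is claimed about it there.\<close>

definition hext :: "nat \<Rightarrow> (plane \<Rightarrow> real) \<Rightarrow> plane \<Rightarrow> real" where
  "hext \<nu> x = (SOME y. harm \<nu> y \<and> (\<forall>a\<in>{1,2,3}. y (p a) = x (p a)))"

lemma harm_hext: "\<nu> \<ge> 2 \<Longrightarrow> harm \<nu> (hext \<nu> x)"
  and hext_p: "\<nu> \<ge> 2 \<Longrightarrow> a \<in> {1,2,3} \<Longrightarrow> hext \<nu> x (p a) = x (p a)"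
  using someI_ex[OF harm_exists, of \<nu> x] unfolding hext_def by blast+

text \<open>The indicator of a single point of the plane, so that it serves both as boundary data
  and as a test function vanishing at all other vertices of the subdivision.\<close>

definition dirac :: "nat \<Rightarrow> plane \<Rightarrow> real" where
  "dirac a v = (if v = p a then 1 else 0)"

lemma dirac_p: "a \<in> {1,2,3} \<Longrightarrow> b \<in> {1,2,3} \<Longrightarrow> dirac a (p b) = (if b = a then 1 else 0)"
  using inj_onD[OF inj_p, of b a] by (auto simp: dirac_def)

lemma harm_decompose:
  assumes "\<nu> \<ge> 2" "harm \<nu> y" "v \<in> V1 \<nu>"
  shows "y v = (\<Sum>a\<in>{1,2,3}. y (p a) * hext \<nu> (dirac a) v)"
proof -
  have "harm \<nu> (\<lambda>v. y (p 1) * hext \<nu> (dirac 1) v + (y (p 2) * hext \<nu> (dirac 2) v + y (p 3) * hext \<nu> (dirac 3) v))"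
    by (intro harm_add harm_scale harm_hext assms)
  then have h: "harm \<nu> (\<lambda>v. \<Sum>a\<in>{1,2,3}. y (p a) * hext \<nu> (dirac a) v)" by simp
  show ?thesis
    by (rule harm_unique[OF assms(1,2) h _ assms(3)])
       (elim insertE emptyE; simp add: hext_p[OF assms(1)] dirac_p)
qed

text \<open>By linearity and symmetry two numbers govern the restriction to any corner cell: the
  influence of one corner on the vertices of another corner's cell, at the vertex facing the
  influencing corner (here) and at the vertex facing the third corner
  (\<open>t_other\<close>).\<close>

definition t_same :: "nat \<Rightarrow> real" where
  "t_same \<nu> = hext \<nu> (dirac 2) (cell_map \<nu> (corner_cell \<nu> 1) (p 2))"

definition t_other :: "nat \<Rightarrow> real" where
  "t_other \<nu> = hext \<nu> (dirac 2) (cell_map \<nu> (corner_cell \<nu> 1) (p 3))"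

lemma triple_perm:
  assumes "{i,j,k} = {1,2,3::nat}"
  defines "\<pi> \<equiv> \<lambda>a. if a = 1 then i else if a = 2 then j else if a = 3 then k else a"
  shows "\<pi> permutes {1,2,3}"
proof (rule bij_imp_permutes)
  have im: "\<pi> ` {1,2,3} = {1,2,3}" using assms(1) by (simp add: \<pi>_def insert_commute)
  then have "inj_on \<pi> {1,2,3}" by (intro eq_card_imp_inj_on) simp_all
  then show "bij_betw \<pi> {1,2,3} {1,2,3}" using im by (simp add: bij_betw_def)
qed (simp add: \<pi>_def)

lemma triple_distinct:
  assumes "{i,j,k} = {1,2,3::nat}"
  shows "i \<noteq> j" "j \<noteq> k" "i \<noteq> k" "i \<in> {1,2,3}" "j \<in> {1,2,3}" "k \<in> {1,2,3}"
proof -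
  have "card {i,j,k} = 3" using assms by simp
  then show "i \<noteq> j" "j \<noteq> k" "i \<noteq> k" by (auto simp: card_insert_if split: if_splits)
qed (use assms in auto)

lemma triple_sum:
  fixes f :: "nat \<Rightarrow> real"
  assumes "{i,j,k} = {1,2,3}"
  shows "(\<Sum>a\<in>{1,2,3}. f a) = f i + f j + f k"
  using triple_distinct(1-3)[OF assms] by (subst assms[symmetric]) simp

text \<open>Transport by the permutation sending 1, 2, 3 to \<open>i\<close>, \<open>j\<close>,
  \<open>k\<close>; uniqueness identifies the transported function with the extension for corner
  2.\<close>

lemma hext_dirac_corner:
  assumes "\<nu> \<ge> 2" "{i,j,k} = {1,2,3}"
  shows "hext \<nu> (dirac j) (cell_map \<nu> (corner_cell \<nu> i) (p j)) = t_same \<nu>"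
    and "hext \<nu> (dirac j) (cell_map \<nu> (corner_cell \<nu> i) (p k)) = t_other \<nu>"
proof -
  define \<pi> where "\<pi> = (\<lambda>a. if a = 1 then i else if a = 2 then j else if a = 3 then k else a)"
  have \<pi>: "\<pi> permutes {1,2,3}" unfolding \<pi>_def by (rule triple_perm[OF assms(2)])
  have \<pi>v: "\<pi> 1 = i" "\<pi> 2 = j" "\<pi> 3 = k" by (simp_all add: \<pi>_def)
  note d = triple_distinct[OF assms(2)]
  define h where "h = hext \<nu> (dirac j) \<circ> perm_map \<pi>"
  have h: "h v = hext \<nu> (dirac 2) v" if v: "v \<in> V1 \<nu>" for v
  proof (rule harm_unique[OF assms(1) _ harm_hext[OF assms(1)] _ v])
    show "harm \<nu> h" unfolding h_def by (rule harm_perm_map[OF \<pi> assms(1) harm_hext[OF assms(1)]])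
    fix a assume a: "a \<in> {1,2,3::nat}"
    have "h (p a) = dirac j (p (\<pi> a))"
      unfolding h_def comp_apply perm_map_p[OF a] by (rule hext_p[OF assms(1) permutes_in[OF \<pi> a]])
    also have "\<dots> = (if \<pi> a = \<pi> 2 then 1 else 0)"
      unfolding dirac_p[OF d(5) permutes_in[OF \<pi> a]] \<pi>v ..
    also have "\<dots> = dirac 2 (p a)"
      using dirac_p[of 2 a] a permutes_inj[OF \<pi>] by (simp add: inj_eq)
    finally show "h (p a) = hext \<nu> (dirac 2) (p a)"
      using hext_p[OF assms(1) a] by simp
  qed
  have cc: "corner_cell \<nu> 1 \<circ> inv \<pi> = corner_cell \<nu> i"
  proof
    fix a
    have "inv \<pi> a = 1 \<longleftrightarrow> a = i" using permutes_inverses[OF \<pi>] \<pi>v by metis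
    then show "(corner_cell \<nu> 1 \<circ> inv \<pi>) a = corner_cell \<nu> i a" by (simp add: corner_cell_def)
  qed
  have c1: "corner_cell \<nu> 1 \<in> cells \<nu>" by (rule corner_cell_in) simp
  have *: "hext \<nu> (dirac 2) (cell_map \<nu> (corner_cell \<nu> 1) (p b)) = hext \<nu> (dirac j) (cell_map \<nu> (corner_cell \<nu> i) (p (\<pi> b)))"
    if "b \<in> {1,2,3}" for b
    using h[OF V1I[OF c1 that]] perm_map_cell[OF \<pi> assms(1) c1 that] by (simp add: h_def cc)
  show "hext \<nu> (dirac j) (cell_map \<nu> (corner_cell \<nu> i) (p j)) = t_same \<nu>"
    using *[of 2] \<pi>v by (simp add: t_same_def)
  show "hext \<nu> (dirac j) (cell_map \<nu> (corner_cell \<nu> i) (p k)) = t_other \<nu>"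
    using *[of 3] \<pi>v by (simp add: t_other_def)
qed

text \<open>Superposition of the three \<open>dirac\<close> extensions. The constant function 1
  shows that the three weights sum to 1, which yields the weight of \<open>p i\<close>.\<close>

lemma corner_value:
  assumes "\<nu> \<ge> 2" "harm \<nu> y" "{i,j,k} = {1,2,3}"
  shows "y (cell_map \<nu> (corner_cell \<nu> i) (p j)) =
    (1 - t_same \<nu> - t_other \<nu>) * y (p i) + t_same \<nu> * y (p j) + t_other \<nu> * y (p k)"
proof -
  note d = triple_distinct[OF assms(3)]
  let ?v = "cell_map \<nu> (corner_cell \<nu> i) (p j)"
  have v: "?v \<in> V1 \<nu>" by (intro V1I corner_cell_in d)
  have j: "hext \<nu> (dirac j) ?v = t_same \<nu>" by (rule hext_dirac_corner[OF assms(1,3)])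
  have k: "hext \<nu> (dirac k) ?v = t_other \<nu>"
    by (rule hext_dirac_corner(2)[OF assms(1)]) (use assms(3) in auto)
  have "1 = (\<Sum>a\<in>{1,2,3}. 1 * hext \<nu> (dirac a) ?v)"
    using harm_decompose[OF assms(1) harm_const v, of 1] .
  then have i: "hext \<nu> (dirac i) ?v = 1 - t_same \<nu> - t_other \<nu>"
    unfolding triple_sum[OF assms(3)] j k by simp
  show ?thesis
    using harm_decompose[OF assms(1,2) v] unfolding triple_sum[OF assms(3)] i j k by simp
qed

lemma bary_not_V0: "a \<in> {1,2,3} \<Longrightarrow> 0 < bary a z \<Longrightarrow> bary a z < 1 \<Longrightarrow> z \<notin> V0"
  using bary_p by fastforce

text \<open>If the extension of corner 2 vanished next to corner 1 on the side joining them, the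
  strong minimum principle would carry the zero along this side up to \<open>p 2\<close>, where the
  value is 1. Within a cell the principle compares the remaining vertices.\<close>

lemma t_pos:
  assumes "\<nu> \<ge> 2"
  shows "t_same \<nu> > 0" "t_other \<nu> > 0" "t_same \<nu> + t_other \<nu> < 1"
proof -
  define y where "y = hext \<nu> (dirac 2)"
  \<comment> \<open>The cells along the side from \<open>p 1\<close> to \<open>p 2\<close>, from
    \<open>t = 0\<close> at corner 1 to \<open>t = \<nu> - 1\<close> at corner 2.\<close>
  define c where "c t = (\<lambda>a::nat. if a = 1 then \<nu> - 1 - t else if a = 2 then t else 0)" for t
  have hy: "harm \<nu> y" unfolding y_def by (rule harm_hext[OF assms])
  have y0: "y (p a) = dirac 2 (p a)" if "a \<in> {1,2,3}" for a unfolding y_def by (rule hext_p[OF assms that])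
  have ypos: "y (p a) \<ge> 0" if "a \<in> {1,2,3}" for a using y0[OF that] by (simp add: dirac_def)
  have c: "c t \<in> cells \<nu>" if "t \<le> \<nu> - 1" for t using that by (auto simp: cells_def c_def)
  have c0: "c 0 = corner_cell \<nu> 1" by (auto simp: c_def corner_cell_def)
  have ne: "y (cell_map \<nu> (c 0) (p 2)) \<noteq> 0"
  proof
    assume z: "y (cell_map \<nu> (c 0) (p 2)) = 0"
    have "t \<le> \<nu> - 1 \<Longrightarrow> y (cell_map \<nu> (c t) (p 2)) = 0" for t
    proof (induction t)
      case 0 then show ?case using z by simp
    next
      case (Suc t)
      have "c (Suc t) = (c t)(2 := c t 2 + 1, 1 := c t 1 - 1)" using Suc.prems by (intro ext) (auto simp: c_def)
      then have eq: "cell_map \<nu> (c (Suc t)) (p 1) = cell_map \<nu> (c t) (p 2)"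
        using neighbour_cell(2)[OF c[of t], of 2 1] Suc.prems by (simp add: c_def)
      show ?case
      proof (rule harm_zero_neighbour[OF assms hy ypos c[OF Suc.prems]])
        show "cell_map \<nu> (c (Suc t)) (p 1) \<notin> V0"
          by (rule bary_not_V0[of 2]) (use bary_cell_map[OF c[OF Suc.prems] assms, of 2] Suc.prems in \<open>auto simp: c_def\<close>)
        show "y (cell_map \<nu> (c (Suc t)) (p 1)) = 0" unfolding eq using Suc by simp
      qed auto
    qed
    then have "y (cell_map \<nu> (c (\<nu> - 1)) (p 2)) = 0" by simp
    moreover have "c (\<nu> - 1) = corner_cell \<nu> 2" by (auto simp: c_def corner_cell_def)
    ultimately show False using corner_fixed[OF assms, of 2] y0[of 2] by (simp add: dirac_p)
  qed
  have nn: "y (cell_map \<nu> (c 0) (p b)) \<ge> 0" if "b \<in> {1,2,3}" for b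
    by (rule harm_nonneg[OF assms hy ypos V1I[OF c that]]) auto
  have int: "cell_map \<nu> (c 0) (p b) \<notin> V0" if "b \<in> {2,3}" for b
    by (rule bary_not_V0[of 1]) (use bary_cell_map[OF c[of 0] assms, of 1] assms that in \<open>auto simp: c_def\<close>)
  show "t_same \<nu> > 0" using ne nn[of 2] by (simp add: t_same_def c0 y_def)
  have "y (cell_map \<nu> (c 0) (p 3)) \<noteq> 0"
    using harm_zero_neighbour[OF assms hy ypos c[of 0], of 3 2] int[of 3] ne by auto
  then show "t_other \<nu> > 0" using nn[of 3] by (simp add: t_other_def c0 y_def)
  \<comment> \<open>For the weight of the corner itself the extension of corner 1 is used: it is 1
    at \<open>p 1\<close>, so it cannot vanish at the other vertices of that cell.\<close>
  define x where "x = hext \<nu> (dirac 1)"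
  have hx: "harm \<nu> x" unfolding x_def by (rule harm_hext[OF assms])
  have x0: "x (p a) = dirac 1 (p a)" if "a \<in> {1,2,3}" for a unfolding x_def by (rule hext_p[OF assms that])
  have xpos: "x (p a) \<ge> 0" if "a \<in> {1,2,3}" for a using x0[OF that] by (simp add: dirac_def)
  have "x (cell_map \<nu> (c 0) (p 1)) = 1"
    using corner_fixed[OF assms, of 1] x0[of 1] by (simp add: c0 dirac_p)
  then have "x (cell_map \<nu> (c 0) (p 2)) \<noteq> 0"
    using harm_zero_neighbour[OF assms hx xpos c[of 0], of 2 1] int[of 2] by auto
  moreover have "x (cell_map \<nu> (c 0) (p 2)) \<ge> 0"
    by (rule harm_nonneg[OF assms hx xpos V1I[OF c]]) auto
  moreover have "x (cell_map \<nu> (c 0) (p 2)) = 1 - t_same \<nu> - t_other \<nu>"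
    using corner_value[OF assms hx, of 1 2 3] x0 by (simp add: c0 dirac_p)
  ultimately show "t_same \<nu> + t_other \<nu> < 1" by simp
qed

section \<open>The renormalisation factor and the corner eigenvalues\<close>

text \<open>A corner of the large triangle belongs to a single small one; this localises the pairing
  with \<open>dirac i\<close> in \<open>harm_flux\<close>.\<close>

lemma cell_vertex_corner:
  assumes "\<nu> \<ge> 2" "c \<in> cells \<nu>" "a \<in> {1,2,3}" "i \<in> {1,2,3}" "cell_map \<nu> c (p a) = p i"
  shows "c = corner_cell \<nu> i \<and> a = i"
proof -
  have e: "(bary b (p a) + real (c b)) / real \<nu> = bary b (p i)" if "b \<in> {1,2,3}" for b
    using bary_cell_map[OF assms(2,1) that, of "p a"] assms(5) by simp
  have z: "c b = 0 \<and> b \<noteq> a" if "b \<in> {1,2,3}" "b \<noteq> i" for b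
    using e[OF that(1)] bary_p[OF that(1) assms(3)] bary_p[OF that(1) assms(4)] that(2) assms(1)
    by (auto split: if_splits)
  have "a = i" using z[OF assms(3)] by auto
  moreover have "c b = corner_cell \<nu> i b" for b
  proof (cases "b \<in> {1,2,3}")
    case True
    show ?thesis
    proof (cases "b = i")
      case True
      then have "real (c i) = real \<nu> - 1"
        using e[OF assms(4)] bary_p[OF assms(4,4)] \<open>a = i\<close> assms(1) by (simp add: field_simps)
      then show ?thesis using True assms(1) by (simp add: corner_cell_def of_nat_diff)
    next
      case False
      then show ?thesis using z[OF \<open>b \<in> {1,2,3}\<close>] by (simp add: corner_cell_def)
    qed
  next
    case False
    then show ?thesis using assms(2,4) by (auto simp: cells_def corner_cell_def)
  qed
  ultimately show ?thesis by auto
qed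

lemma Q_dirac:
  assumes "{i,j,k} = {1,2,3}"
  shows "Q y (dirac i) = 2 * y (p i) - y (p j) - y (p k)"
proof -
  note d = triple_distinct[OF assms]
  have di: "dirac i (p i) = 1" "dirac i (p j) = 0" "dirac i (p k) = 0"
    using d by (simp_all add: dirac_p)
  have "Q y (dirac i) = (\<Sum>a\<in>{1,2,3}. \<Sum>b\<in>{1,2,3}. (y (p a) - y (p b)) * (dirac i (p a) - dirac i (p b))) / 2"
    by (rule Q_double_sum)
  also have "\<dots> = 2 * y (p i) - y (p j) - y (p k)"
    unfolding triple_sum[OF assms] di by (simp add: field_simps)
  finally show ?thesis .
qed

text \<open>Only the cell at corner \<open>i\<close> sees \<open>dirac i\<close>. Inserting
  \<open>corner_value\<close> at its two free vertices, the coefficients of the other corners add up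
  to \<open>t_same \<nu> + t_other \<nu>\<close>.\<close>

lemma harm_flux:
  assumes "\<nu> \<ge> 2" "harm \<nu> y" "{i,j,k} = {1,2,3}"
  shows "E1 \<nu> y (dirac i) = (t_same \<nu> + t_other \<nu>) * (2 * y (p i) - y (p j) - y (p k))"
proof -
  note d = triple_distinct[OF assms(3)]
  let ?c = "corner_cell \<nu> i"
  have "E1 \<nu> y (dirac i) = Q (y \<circ> cell_map \<nu> ?c) (dirac i \<circ> cell_map \<nu> ?c)"
    unfolding E1_def
  proof (rule sum.remove[OF finite_cells[OF assms(1)] corner_cell_in[OF d(4)], THEN trans])
    have "Q (y \<circ> cell_map \<nu> c) (dirac i \<circ> cell_map \<nu> c) = 0" if c: "c \<in> cells \<nu> - {?c}" for c
    proof -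
      have "dirac i (cell_map \<nu> c (p a)) = 0" if "a \<in> {1,2,3}" for a
        using cell_vertex_corner[OF assms(1) _ that d(4)] c by (auto simp: dirac_def)
      then show ?thesis by (simp add: Q_eq)
    qed
    then show "Q (y \<circ> cell_map \<nu> ?c) (dirac i \<circ> cell_map \<nu> ?c) +
        (\<Sum>x\<in>cells \<nu> - {?c}. Q (y \<circ> cell_map \<nu> x) (dirac i \<circ> cell_map \<nu> x)) =
        Q (y \<circ> cell_map \<nu> ?c) (dirac i \<circ> cell_map \<nu> ?c)" by simp
  qed
  also have "\<dots> = Q (y \<circ> cell_map \<nu> ?c) (dirac i)"
  proof (rule Q_cong)
    fix a assume a: "a \<in> {1,2,3::nat}"
    show "(dirac i \<circ> cell_map \<nu> ?c) (p a) = dirac i (p a)"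
      using cell_vertex_corner[OF assms(1) corner_cell_in[OF d(4)] a d(4)] corner_fixed[OF assms(1) d(4)] dirac_p[OF d(4) a]
      by (auto simp: dirac_def)
  qed simp
  also have "\<dots> = (t_same \<nu> + t_other \<nu>) * (2 * y (p i) - y (p j) - y (p k))"
  proof -
    have ikj: "{i,k,j} = {1,2,3}" using assms(3) by auto
    show ?thesis
      unfolding Q_dirac[OF assms(3)] comp_apply corner_fixed[OF assms(1) d(4)]
        corner_value[OF assms] corner_value[OF assms(1,2) ikj]
      by (simp add: algebra_simps)
  qed
  finally show ?thesis .
qed

text \<open>Modulo a function that vanishes at the corners, \<open>z\<close> is a combination of the
  three \<open>dirac\<close> functions; their pairings are the fluxes. The trace of the energy on
  the corners is thus a multiple of \<open>Q\<close>, and the multiple is the renormalisation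
  factor.\<close>

lemma harm_E1:
  assumes "\<nu> \<ge> 2" "harm \<nu> y"
  shows "E1 \<nu> y z = (t_same \<nu> + t_other \<nu>) * Q y z"
proof -
  define z0 where "z0 = (\<lambda>v. z v - (z (p 1) * dirac 1 v + (z (p 2) * dirac 2 v + z (p 3) * dirac 3 v)))"
  have z: "z = (\<lambda>v. z0 v + (z (p 1) * dirac 1 v + (z (p 2) * dirac 2 v + z (p 3) * dirac 3 v)))"
    by (simp add: z0_def)
  have E10: "E1 \<nu> z0 y = 0"
    using assms(2) unfolding harm_def by (subst E1_sym) (simp add: z0_def dirac_p)
  have "E1 \<nu> y z = E1 \<nu> z y" by (rule E1_sym)
  also have "\<dots> = z (p 1) * E1 \<nu> (dirac 1) y + z (p 2) * E1 \<nu> (dirac 2) y + z (p 3) * E1 \<nu> (dirac 3) y"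
    by (subst z) (simp add: E1_add E1_scale E10)
  also have "\<dots> = (t_same \<nu> + t_other \<nu>) * Q y z"
  proof -
    have "{2,1,3} = {1,2,3::nat}" "{3,1,2} = {1,2,3::nat}" by auto
    note f = harm_flux[OF assms refl] this[THEN harm_flux[OF assms]]
    show ?thesis
      unfolding E1_sym[of \<nu> "dirac _" y] f Q_eq by (simp add: algebra_simps)
  qed
  finally show ?thesis .
qed

text \<open>The infimum is attained at the harmonic extension and equals
  \<open>\<rho>0 / \<rho> * Q x x\<close>, so \<open>\<rho>0\<close> solves the defining
  equation.\<close>

lemma r_eq:
  assumes "\<nu> \<ge> 2"
  shows "r \<nu> = t_same \<nu> + t_other \<nu>"
proof -
  define \<rho>0 where "\<rho>0 = t_same \<nu> + t_other \<nu>"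
  have pos: "\<rho>0 > 0" using t_pos[OF assms] by (simp add: \<rho>0_def)
  have inf: "Inf {\<Sum>i = 1..\<nu> * (\<nu> + 1) div 2. 1 / \<rho> * Q (y \<circ> \<psi> \<nu> i) (y \<circ> \<psi> \<nu> i) | y.
                        \<forall>v\<in>{p 1, p 2, p 3}. y v = x v} = \<rho>0 / \<rho> * Q x x" if "\<rho> > 0" for \<rho> x
  proof -
    have s: "(\<Sum>i = 1..\<nu> * (\<nu> + 1) div 2. 1 / \<rho> * Q (y \<circ> \<psi> \<nu> i) (y \<circ> \<psi> \<nu> i)) = E1 \<nu> y y / \<rho>" for y
      unfolding E1_def using sum_cells[OF assms, of "\<lambda>f. 1 / \<rho> * Q (y \<circ> f) (y \<circ> f)"] by (simp add: sum_divide_distrib)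
    have h: "E1 \<nu> (hext \<nu> x) (hext \<nu> x) = \<rho>0 * Q x x"
      using harm_E1[OF assms harm_hext[OF assms], of x "hext \<nu> x"]
        Q_cong[of "hext \<nu> x" x "hext \<nu> x" x] hext_p[OF assms] by (simp add: \<rho>0_def)
    show ?thesis
      unfolding s
    proof (rule cInf_eq_minimum)
      have "\<forall>v\<in>{p 1, p 2, p 3}. hext \<nu> x v = x v" using hext_p[OF assms] by simp
      then show "\<rho>0 / \<rho> * Q x x \<in> {E1 \<nu> y y / \<rho> | y. \<forall>v\<in>{p 1, p 2, p 3}. y v = x v}"
        using h by (auto intro!: exI[of _ "hext \<nu> x"])
      fix e assume "e \<in> {E1 \<nu> y y / \<rho> | y. \<forall>v\<in>{p 1, p 2, p 3}. y v = x v}"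
      then obtain y where y: "e = E1 \<nu> y y / \<rho>" "\<forall>v\<in>{p 1, p 2, p 3}. y v = x v" by auto
      have "E1 \<nu> (hext \<nu> x) (hext \<nu> x) \<le> E1 \<nu> y y"
        by (rule harm_minimal(1)[OF assms harm_hext[OF assms]]) (use y(2) hext_p[OF assms] in auto)
      then show "\<rho>0 / \<rho> * Q x x \<le> e" using h y(1) that by (simp add: divide_right_mono)
    qed
  qed
  have "r \<nu> = \<rho>0"
    unfolding r_def
  proof (rule the_equality)
    show "\<rho>0 > 0 \<and> (\<forall>x. Q x x = Inf {\<Sum>i = 1..\<nu> * (\<nu> + 1) div 2. 1 / \<rho>0 * Q (y \<circ> \<psi> \<nu> i) (y \<circ> \<psi> \<nu> i) | y.
                        \<forall>v\<in>{p 1, p 2, p 3}. y v = x v})"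
      unfolding inf[OF pos] using pos by simp
    fix \<rho> assume \<rho>: "\<rho> > 0 \<and> (\<forall>x. Q x x = Inf {\<Sum>i = 1..\<nu> * (\<nu> + 1) div 2. 1 / \<rho> * Q (y \<circ> \<psi> \<nu> i) (y \<circ> \<psi> \<nu> i) | y.
                        \<forall>v\<in>{p 1, p 2, p 3}. y v = x v})"
    \<comment> \<open>One boundary datum of non-zero energy is enough for uniqueness.\<close>
    have "Q (dirac 1) (dirac 1) = \<rho>0 / \<rho> * Q (dirac 1) (dirac 1)"
      by (rule \<rho>[unfolded inf[OF conjunct1[OF \<rho>]], THEN conjunct2, rule_format])
    moreover have "Q (dirac 1) (dirac 1) = 2" by (simp add: Q_eq dirac_p)
    ultimately show "\<rho> = \<rho>0" using conjunct1[OF \<rho>] by (simp add: field_simps)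
  qed
  then show ?thesis by (simp add: \<rho>0_def)
qed

text \<open>Eigenvalue of the antisymmetric part at a corner, next to
  \<open>r \<nu> = t_same \<nu> + t_other \<nu>\<close> for the symmetric part. Since both summands
  are positive, \<open>\<bar>s_eig \<nu>\<bar> < r \<nu>\<close>.\<close>

definition s_eig :: "nat \<Rightarrow> real" where
  "s_eig \<nu> = t_same \<nu> - t_other \<nu>"

lemma r_pos: "\<nu> \<ge> 2 \<Longrightarrow> r \<nu> > 0" and r_less_1: "\<nu> \<ge> 2 \<Longrightarrow> r \<nu> < 1" and s_eig_less: "\<nu> \<ge> 2 \<Longrightarrow> \<bar>s_eig \<nu>\<bar> < r \<nu>"
  using t_pos[of \<nu>] r_eq[of \<nu>] by (auto simp: s_eig_def)

lemma harm_E1_r: "\<nu> \<ge> 2 \<Longrightarrow> harm \<nu> y \<Longrightarrow> E1 \<nu> y z = r \<nu> * Q y z"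
  using harm_E1 r_eq by simp

lemma r_Q_le_E1: 
  assumes "\<nu> \<ge> 2"
  shows "r \<nu> * Q y y \<le> E1 \<nu> y y"
proof -
  have "E1 \<nu> (hext \<nu> y) (hext \<nu> y) \<le> E1 \<nu> y y"
    by (rule harm_minimal(1)[OF assms harm_hext[OF assms]]) (simp add: hext_p[OF assms])
  moreover have "E1 \<nu> (hext \<nu> y) (hext \<nu> y) = r \<nu> * Q y y"
    using harm_E1_r[OF assms harm_hext[OF assms], of y "hext \<nu> y"]
      Q_cong[of "hext \<nu> y" y "hext \<nu> y" y] hext_p[OF assms] by simp
  ultimately show ?thesis by simp
qed

text \<open>The formulas of \<open>corner_value\<close> for the two free vertices differ by
  exchanging \<open>j\<close> and \<open>k\<close>; their sum and their difference give the two
  eigenvectors.\<close>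

lemma corner_eigen:
  assumes "\<nu> \<ge> 2" "harm \<nu> y" "{i,j,k} = {1,2,3}"
  defines "x \<equiv> y \<circ> \<psi> \<nu> i"
  shows "2 * x (p i) - x (p j) - x (p k) = r \<nu> * (2 * y (p i) - y (p j) - y (p k))"
    and "x (p j) - x (p k) = s_eig \<nu> * (y (p j) - y (p k))"
proof -
  note d = triple_distinct[OF assms(3)]
  have ikj: "{i,k,j} = {1,2,3}" using assms(3) by auto
  have x: "x (p i) = y (p i)"
    "x (p j) = (1 - t_same \<nu> - t_other \<nu>) * y (p i) + t_same \<nu> * y (p j) + t_other \<nu> * y (p k)"
    "x (p k) = (1 - t_same \<nu> - t_other \<nu>) * y (p i) + t_same \<nu> * y (p k) + t_other \<nu> * y (p j)"
    unfolding x_def comp_apply \<psi>_corner[OF assms(1) d(4)]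
    using corner_fixed[OF assms(1) d(4)] corner_value[OF assms(1-3)] corner_value[OF assms(1,2) ikj] by simp_all
  show "2 * x (p i) - x (p j) - x (p k) = r \<nu> * (2 * y (p i) - y (p j) - y (p k))"
    unfolding x r_eq[OF assms(1)] by (simp add: algebra_simps)
  show "x (p j) - x (p k) = s_eig \<nu> * (y (p j) - y (p k))"
    unfolding x s_eig_def by (simp add: algebra_simps)
qed

section \<open>Energies on the tree of words\<close>

lemma T_ge: "\<nu> \<in> T \<Longrightarrow> \<nu> \<ge> 2"
  using T_ge_2 by auto

definition Adm :: "letter list set" where
  "Adm = (\<Union>m. adm_words m)"

text \<open>As an operator on functions of words, its \<open>n\<close>-th iterate sums over the
  admissible extensions by \<open>n\<close> letters, and its fixed points on admissible words are
  the additive cylinder functions.\<close>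

definition tree_sum :: "(letter list \<Rightarrow> real) \<Rightarrow> letter list \<Rightarrow> real" where
  "tree_sum \<phi> w = (\<Sum>v\<in>letters (L w). \<phi> (w @ [v]))"

lemma adm_words_iff:
  "w \<in> adm_words m \<longleftrightarrow> length w = m \<and> (\<forall>k<m. w ! k \<in> letters (L (take k w)))"
proof (induction m arbitrary: w)
  case (Suc m)
  show ?case
  proof
    assume "w \<in> adm_words (Suc m)"
    then obtain u v where u: "u \<in> adm_words m" "v \<in> letters (L u)" "w = u @ [v]" by auto
    then show "length w = Suc m \<and> (\<forall>k<Suc m. w ! k \<in> letters (L (take k w)))"
      using Suc[of u] by (auto simp: nth_append less_Suc_eq)
  next
    assume w: "length w = Suc m \<and> (\<forall>k<Suc m. w ! k \<in> letters (L (take k w)))"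
    then obtain u v where u: "w = u @ [v]" "length u = m" by (metis length_Suc_conv_rev)
    have "u ! k \<in> letters (L (take k u))" if "k < m" for k
      using w[THEN conjunct2, rule_format, of k] that u by (simp add: nth_append)
    then have "u \<in> adm_words m" using Suc[of u] u by auto
    moreover have "v \<in> letters (L u)" using w[THEN conjunct2, rule_format, of m] u by (simp add: nth_append)
    ultimately show "w \<in> adm_words (Suc m)" using u by (cases v) auto
  qed
qed auto

lemma adm_words_Adm: "w \<in> adm_words m \<longleftrightarrow> w \<in> Adm \<and> length w = m"
  unfolding Adm_def using adm_words_iff by auto

lemma Nil_Adm [simp]: "[] \<in> Adm"
  using adm_words_Adm[of "[]" 0] by simp

lemma Adm_append: "u @ s \<in> Adm \<Longrightarrow> u \<in> Adm"
proof -
  assume "u @ s \<in> Adm"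
  then have *: "\<forall>k<length (u @ s). (u @ s) ! k \<in> letters (L (take k (u @ s)))"
    using adm_words_Adm adm_words_iff by blast
  have "u ! k \<in> letters (L (take k u))" if "k < length u" for k
    using *[rule_format, of k] that by (simp add: nth_append)
  then show "u \<in> Adm" using adm_words_Adm adm_words_iff by blast
qed

lemma Adm_snoc: "u @ [v] \<in> Adm \<longleftrightarrow> u \<in> Adm \<and> v \<in> letters (L u)"
proof -
  have "u @ [v] \<in> Adm \<longleftrightarrow> u @ [v] \<in> adm_words (Suc (length u))"
    by (simp only: adm_words_Adm length_append_singleton simp_thms)
  also have "\<dots> \<longleftrightarrow> u \<in> adm_words (length u) \<and> v \<in> letters (L u)" by (cases v) auto
  also have "\<dots> \<longleftrightarrow> u \<in> Adm \<and> v \<in> letters (L u)" by (simp only: adm_words_Adm simp_thms)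
  finally show ?thesis .
qed

lemma letters_image: "letters \<nu> = (\<lambda>i. (i, \<nu>)) ` {1..\<nu> * (\<nu> + 1) div 2}"
  unfolding letters_def by auto

lemma finite_letters: "finite (letters \<nu>)"
  by (simp add: letters_image)

lemma sum_letters: "(\<Sum>v\<in>letters \<nu>. \<phi> v) = (\<Sum>i = 1..\<nu> * (\<nu> + 1) div 2. \<phi> (i, \<nu>))"
  unfolding letters_image by (subst sum.reindex) (auto simp: inj_on_def)

lemma letters_snd: "v \<in> letters \<nu> \<Longrightarrow> snd v = \<nu>"
  unfolding letters_def by auto

lemma corner_letter: "\<nu> \<ge> 2 \<Longrightarrow> i \<in> {1,2,3} \<Longrightarrow> (i, \<nu>) \<in> letters \<nu>"
  using corner_index[of \<nu>] unfolding letters_def by auto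

lemma Adm_lists: "w \<in> Adm \<Longrightarrow> w \<in> lists alphabet"
proof (induction w rule: rev_induct)
  case (snoc v w)
  then have w: "w \<in> lists alphabet" "v \<in> letters (L w)" using Adm_snoc by auto
  then have "L w \<in> T" using L_in_T unfolding alphabet_def by blast
  then show ?case using w unfolding alphabet_def by auto
qed simp

lemma L_T: "w \<in> Adm \<Longrightarrow> L w \<in> T"
  using Adm_lists L_in_T unfolding alphabet_def by blast

lemma L_ge: "w \<in> Adm \<Longrightarrow> L w \<ge> 2"
  using L_T T_ge by blast

lemma finite_adm_words: "finite (adm_words m)"
proof (induction m)
  case (Suc m)
  have "{w @ [v] |v. v \<in> letters (L w)} = (\<lambda>v. w @ [v]) ` letters (L w)" for w by auto
  then show ?case using Suc finite_letters by simp
qed simp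

lemma sum_adm_words: "(\<Sum>w\<in>adm_words m. \<phi> w) = (tree_sum ^^ m) \<phi> []"
proof (induction m arbitrary: \<phi>)
  case (Suc m)
  have eq: "{w @ [v] |v. v \<in> letters (L w)} = (\<lambda>v. w @ [v]) ` letters (L w)" for w by auto
  have "(\<Sum>w\<in>adm_words (Suc m). \<phi> w) = (\<Sum>w\<in>adm_words m. \<Sum>u\<in>(\<lambda>v. w @ [v]) ` letters (L w). \<phi> u)"
    unfolding adm_words.simps eq
    by (rule sum.UNION_disjoint) (auto simp: finite_adm_words finite_letters)
  also have "\<dots> = (\<Sum>w\<in>adm_words m. tree_sum \<phi> w)"
    unfolding tree_sum_def by (intro sum.cong refl) (simp add: sum.reindex inj_on_def)
  also have "\<dots> = (tree_sum ^^ m) (tree_sum \<phi>) []" by (rule Suc)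
  finally show ?case by (simp add: funpow_swap1)
qed simp

lemma tree_sum_mono:
  assumes "w \<in> Adm" "\<And>u. u \<in> Adm \<Longrightarrow> length u > length w \<Longrightarrow> \<phi> u \<le> \<theta> u"
  shows "tree_sum \<phi> w \<le> tree_sum \<theta> w"
  unfolding tree_sum_def using assms by (intro sum_mono assms(2)) (auto simp: Adm_snoc)

lemma tree_sum_pow_mono:
  assumes "w \<in> Adm" "\<And>u. u \<in> Adm \<Longrightarrow> length u \<ge> length w \<Longrightarrow> \<phi> u \<le> \<theta> u"
  shows "(tree_sum ^^ n) \<phi> w \<le> (tree_sum ^^ n) \<theta> w"
  using assms
proof (induction n arbitrary: w)
  case (Suc n)
  have "tree_sum ((tree_sum ^^ n) \<phi>) w \<le> tree_sum ((tree_sum ^^ n) \<theta>) w"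
    by (rule tree_sum_mono[OF Suc.prems(1)], rule Suc.IH) (use Suc.prems(2) in auto)
  then show ?case by simp
qed simp

lemma tree_sum_pow_cong:
  assumes "w \<in> Adm" "\<And>u. u \<in> Adm \<Longrightarrow> length u \<ge> length w \<Longrightarrow> \<phi> u = \<theta> u"
  shows "(tree_sum ^^ n) \<phi> w = (tree_sum ^^ n) \<theta> w"
  by (rule antisym; rule tree_sum_pow_mono[OF assms(1)]; simp add: assms(2))

lemma tree_sum_zero: "tree_sum (\<lambda>_. 0) = (\<lambda>_. 0)"
  by (auto simp: tree_sum_def)

lemma tree_sum_pow_zero: "(tree_sum ^^ n) (\<lambda>_. 0) = (\<lambda>_. 0)"
  by (induction n) (auto simp: tree_sum_zero)

lemma tree_sum_pow_nonneg:
  assumes "w \<in> Adm" "\<And>u. u \<in> Adm \<Longrightarrow> length u \<ge> length w \<Longrightarrow> \<phi> u \<ge> 0"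
  shows "(tree_sum ^^ n) \<phi> w \<ge> 0"
  using tree_sum_pow_mono[OF assms(1), of "\<lambda>_. 0" \<phi> n] assms(2) by (simp add: tree_sum_pow_zero)

lemma tree_sum_linear: "tree_sum (\<lambda>w. s * \<phi> w + t * \<theta> w) = (\<lambda>w. s * tree_sum \<phi> w + t * tree_sum \<theta> w)"
  by (auto simp: tree_sum_def sum.distrib sum_distrib_left)

lemma tree_sum_pow_linear:
  "(tree_sum ^^ n) (\<lambda>w. s * \<phi> w + t * \<theta> w) = (\<lambda>w. s * (tree_sum ^^ n) \<phi> w + t * (tree_sum ^^ n) \<theta> w)"
  by (induction n) (auto simp: tree_sum_linear)

lemma tree_sum_pow_add: "(tree_sum ^^ n) ((tree_sum ^^ m) \<phi>) w = (tree_sum ^^ (n + m)) \<phi> w"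
  by (simp add: funpow_add)

lemma tree_sum_member_le:
  assumes "w \<in> Adm" "\<And>u. u \<in> Adm \<Longrightarrow> length u = length w \<Longrightarrow> \<phi> u \<ge> 0"
  shows "\<phi> w \<le> (tree_sum ^^ length w) \<phi> []"
  unfolding sum_adm_words[symmetric]
  by (rule member_le_sum) (use assms adm_words_Adm finite_adm_words in auto)

lemma tree_sum_child_le:
  assumes "w \<in> Adm" "v \<in> letters (L w)" "\<And>u. u \<in> Adm \<Longrightarrow> length u > length w \<Longrightarrow> \<phi> u \<ge> 0"
  shows "\<phi> (w @ [v]) \<le> tree_sum \<phi> w"
  unfolding tree_sum_def
  by (rule member_le_sum[of v _ "\<lambda>v. \<phi> (w @ [v])"]) (use assms finite_letters in \<open>auto simp: Adm_snoc\<close>)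

lemma \<psi>_word_append: "\<psi>_word (u @ w) = \<psi>_word u \<circ> \<psi>_word w"
  by (induction u) (auto simp: comp_assoc)

lemma r_word_append: "r_word (u @ w) = r_word u * r_word w"
  by (simp add: r_word_def)

lemma r_word_Nil [simp]: "r_word [] = 1"
  by (simp add: r_word_def)

lemma r_word_single: "r_word [v] = r (snd v)"
  by (simp add: r_word_def)

lemma r_word_pos: "w \<in> Adm \<Longrightarrow> r_word w > 0"
proof (induction w rule: rev_induct)
  case (snoc v w)
  then show ?case
    using r_pos[OF L_ge, of w] by (auto simp: Adm_snoc r_word_append r_word_single letters_snd)
qed simp

definition rmax :: real where "rmax = Max (r ` T)"

lemma r_le_rmax: "\<nu> \<in> T \<Longrightarrow> r \<nu> \<le> rmax"
  unfolding rmax_def using T_finite by simp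

lemma rmax_bounds: "0 < rmax" "rmax < 1"
proof -
  have "rmax \<in> r ` T" unfolding rmax_def using T_finite T_nonempty by (intro Max_in) auto
  then show "0 < rmax" "rmax < 1" using r_pos r_less_1 T_ge by auto
qed

lemma r_word_le: "w \<in> Adm \<Longrightarrow> r_word w \<le> rmax ^ length w"
proof (induction w rule: rev_induct)
  case (snoc v w)
  then have w: "w \<in> Adm" "v \<in> letters (L w)" by (auto simp: Adm_snoc)
  have "r_word w * r (L w) \<le> rmax ^ length w * rmax"
    using snoc.IH[OF w(1)] r_le_rmax[OF L_T[OF w(1)]] r_pos[OF L_ge[OF w(1)]] rmax_bounds
    by (intro mult_mono) auto
  then show ?case using w by (simp add: r_word_append r_word_single letters_snd mult.commute)
qed simp

section \<open>Energies of cells and their limits\<close>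

definition en :: "(plane \<Rightarrow> real) \<Rightarrow> (plane \<Rightarrow> real) \<Rightarrow> letter list \<Rightarrow> real" where
  "en f g w = Q (f \<circ> \<psi>_word w) (g \<circ> \<psi>_word w) / r_word w"

lemma level_energy_eq: "level_energy m f g = (tree_sum ^^ m) (en f g) []"
  unfolding sum_adm_words[symmetric] level_energy_def en_def by simp

lemma en_nonneg: "w \<in> Adm \<Longrightarrow> en f f w \<ge> 0"
  using Q_nonneg r_word_pos unfolding en_def by (simp add: less_imp_le)

lemma tree_sum_en:
  assumes "w \<in> Adm"
  shows "tree_sum (en f g) w = E1 (L w) (f \<circ> \<psi>_word w) (g \<circ> \<psi>_word w) / (r_word w * r (L w))"
proof -
  have "tree_sum (en f g) w = (\<Sum>i = 1..L w * (L w + 1) div 2.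
      Q ((f \<circ> \<psi>_word w) \<circ> \<psi> (L w) i) ((g \<circ> \<psi>_word w) \<circ> \<psi> (L w) i) / (r_word w * r (L w)))"
    unfolding tree_sum_def sum_letters en_def
    by (simp add: \<psi>_word_append r_word_append r_word_single comp_assoc)
  also have "\<dots> = (\<Sum>c\<in>cells (L w). Q ((f \<circ> \<psi>_word w) \<circ> cell_map (L w) c) ((g \<circ> \<psi>_word w) \<circ> cell_map (L w) c) / (r_word w * r (L w)))"
    by (rule sum_cells[OF L_ge[OF assms], of "\<lambda>h. Q ((f \<circ> \<psi>_word w) \<circ> h) ((g \<circ> \<psi>_word w) \<circ> h) / (r_word w * r (L w))"])
  finally show ?thesis unfolding E1_def by (simp add: sum_divide_distrib)
qed

text \<open>The factor \<open>r\<close> makes the least energy of an extension to the next level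
  equal to the present energy, so refinement can only raise it.\<close>

lemma en_le_tree_sum:
  assumes "w \<in> Adm"
  shows "en f f w \<le> tree_sum (en f f) w"
proof -
  have "en f f w = (r (L w) * Q (f \<circ> \<psi>_word w) (f \<circ> \<psi>_word w)) / (r_word w * r (L w))"
    unfolding en_def using r_pos[OF L_ge[OF assms]] by simp
  also have "\<dots> \<le> E1 (L w) (f \<circ> \<psi>_word w) (f \<circ> \<psi>_word w) / (r_word w * r (L w))"
    using r_Q_le_E1[OF L_ge[OF assms]] r_pos[OF L_ge[OF assms]] r_word_pos[OF assms]
    by (intro divide_right_mono) auto
  finally show ?thesis unfolding tree_sum_en[OF assms] .
qed

text \<open>The equality case of refinement. The second function is arbitrary, which later yields
  the orthogonality of the interpolation error.\<close>

lemma tree_sum_en_harm: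
  assumes "w \<in> Adm" "harm (L w) (f \<circ> \<psi>_word w)"
  shows "tree_sum (en f g) w = en f g w"
  unfolding tree_sum_en[OF assms(1)] harm_E1_r[OF L_ge[OF assms(1)] assms(2)] en_def
  using r_pos[OF L_ge[OF assms(1)]] by simp

lemma en_sym: "en f g w = en g f w"
  by (simp add: en_def Q_sym)

lemma incseq_tree_sum_en: "w \<in> Adm \<Longrightarrow> incseq (\<lambda>n. (tree_sum ^^ n) (en f f) w)"
proof (rule incseq_SucI)
  fix n assume "w \<in> Adm"
  then have "(tree_sum ^^ n) (en f f) w \<le> (tree_sum ^^ n) (tree_sum (en f f)) w"
    by (rule tree_sum_pow_mono) (rule en_le_tree_sum)
  then show "(tree_sum ^^ n) (en f f) w \<le> (tree_sum ^^ Suc n) (en f f) w" by (simp add: funpow_swap1)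
qed

lemma incseq_level_energy: "incseq (\<lambda>n. level_energy n f f)"
  unfolding level_energy_eq by (rule incseq_tree_sum_en) simp

text \<open>The energy condition of the domain without continuity: interpolated functions satisfy it
  before a continuous version is known.\<close>

definition fin_energy :: "(plane \<Rightarrow> real) \<Rightarrow> bool" where
  "fin_energy f \<longleftrightarrow> (\<exists>B. \<forall>n. level_energy n f f \<le> B)"

text \<open>The sequence is monotone, hence convergent in the extended reals, so \<open>lim\<close>
  is its supremum and finiteness means boundedness.\<close>

lemma form_domain_iff: "f \<in> form_domain \<longleftrightarrow> continuous_on gasket f \<and> fin_energy f"
proof -
  let ?X = "\<lambda>m. ereal (level_energy m f f)"
  have "incseq ?X" using incseq_level_energy[of f] by (simp add: incseq_def)
  then have lim: "lim ?X = (SUP m. ?X m)" by (intro limI LIMSEQ_SUP)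
  have "lim ?X < \<infinity> \<longleftrightarrow> fin_energy f"
  proof
    assume *: "lim ?X < \<infinity>"
    have le: "?X m \<le> lim ?X" for m unfolding lim by (rule SUP_upper) simp
    have "level_energy 0 f f \<ge> 0" unfolding level_energy_eq by (simp add: en_nonneg)
    then have "lim ?X \<noteq> -\<infinity>" using le[of 0] by auto
    then obtain B where "lim ?X = ereal B" using * by (cases "lim ?X") auto
    then show "fin_energy f" using le unfolding fin_energy_def by (auto intro!: exI[of _ B])
  next
    assume "fin_energy f"
    then obtain B where "\<And>m. level_energy m f f \<le> B" unfolding fin_energy_def by auto
    then have "lim ?X \<le> ereal B" unfolding lim by (intro SUP_least) auto
    then show "lim ?X < \<infinity>" by auto
  qed
  then show ?thesis unfolding form_domain_def by auto
qed

text \<open>The energy of \<open>f\<close> in the cell of \<open>w\<close> seen at all finer levels;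
  half the mass that the energy gives to the cylinder of \<open>w\<close>.\<close>

definition cell_energy :: "(plane \<Rightarrow> real) \<Rightarrow> letter list \<Rightarrow> real" where
  "cell_energy f w = lim (\<lambda>n. (tree_sum ^^ n) (en f f) w)"

lemma tree_sum_le_level_energy:
  assumes "w \<in> Adm"
  shows "(tree_sum ^^ n) (en f f) w \<le> level_energy (length w + n) f f"
proof -
  have "(tree_sum ^^ n) (en f f) w \<le> (tree_sum ^^ length w) ((tree_sum ^^ n) (en f f)) []"
    by (rule tree_sum_member_le[OF assms]) (rule tree_sum_pow_nonneg, auto intro: en_nonneg)
  then show ?thesis unfolding level_energy_eq tree_sum_pow_add .
qed

lemma cell_energy_LIMSEQ:
  assumes "fin_energy f" "w \<in> Adm"
  shows "(\<lambda>n. (tree_sum ^^ n) (en f f) w) \<longlonglongrightarrow> cell_energy f w"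
proof -
  obtain B where B: "\<And>n. level_energy n f f \<le> B" using assms(1) unfolding fin_energy_def by auto
  have "\<forall>n. (tree_sum ^^ n) (en f f) w \<le> B"
    using order_trans[OF tree_sum_le_level_energy[OF assms(2)] B] by blast
  then obtain l where "(\<lambda>n. (tree_sum ^^ n) (en f f) w) \<longlonglongrightarrow> l"
    using incseq_convergent[OF incseq_tree_sum_en[OF assms(2)], of f B] by blast
  then have "convergent (\<lambda>n. (tree_sum ^^ n) (en f f) w)" by (rule convergentI)
  then show ?thesis unfolding cell_energy_def by (rule convergent_LIMSEQ_iff[THEN iffD1])
qed

lemma cell_energy_ge:
  assumes "fin_energy f" "w \<in> Adm"
  shows "(tree_sum ^^ n) (en f f) w \<le> cell_energy f w"
  by (rule incseq_le[OF incseq_tree_sum_en[OF assms(2)] cell_energy_LIMSEQ[OF assms]])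

lemma cell_energy_nonneg: "fin_energy f \<Longrightarrow> w \<in> Adm \<Longrightarrow> cell_energy f w \<ge> 0"
  using cell_energy_ge[of f w 0] en_nonneg[of w f] by simp

lemma cell_energy_tree_sum:
  assumes "fin_energy f" "w \<in> Adm"
  shows "tree_sum (cell_energy f) w = cell_energy f w"
proof -
  have "(\<lambda>n. \<Sum>v\<in>letters (L w). (tree_sum ^^ n) (en f f) (w @ [v])) \<longlonglongrightarrow> tree_sum (cell_energy f) w"
    unfolding tree_sum_def[of "cell_energy f"]
    by (intro tendsto_sum cell_energy_LIMSEQ assms) (simp add: Adm_snoc assms)
  then have "(\<lambda>n. (tree_sum ^^ Suc n) (en f f) w) \<longlonglongrightarrow> tree_sum (cell_energy f) w"
    by (simp add: tree_sum_def[of "(tree_sum ^^ _) _"])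
  moreover have "(\<lambda>n. (tree_sum ^^ Suc n) (en f f) w) \<longlonglongrightarrow> cell_energy f w"
    by (rule LIMSEQ_Suc[OF cell_energy_LIMSEQ[OF assms]])
  ultimately show ?thesis using LIMSEQ_unique by blast
qed

lemma cell_energy_tree_sum_pow:
  "fin_energy f \<Longrightarrow> w \<in> Adm \<Longrightarrow> (tree_sum ^^ n) (cell_energy f) w = cell_energy f w"
proof (induction n)
  case (Suc n)
  have "(tree_sum ^^ n) (tree_sum (cell_energy f)) w = (tree_sum ^^ n) (cell_energy f) w"
    by (rule tree_sum_pow_cong[OF Suc(3)]) (rule cell_energy_tree_sum[OF Suc(2)])
  then show ?case using Suc by (simp add: funpow_swap1)
qed simp

lemma en_lincomb: 
  "en (\<lambda>x. s * f x + t * g x) (\<lambda>x. s * f x + t * g x) w = s\<^sup>2 * en f f w + 2 * s * t * en f g w + t\<^sup>2 * en g g w"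
  unfolding en_def by (simp add: Q_eq power2_eq_square add_divide_distrib[symmetric] diff_divide_distrib[symmetric] 
     algebra_simps)

lemma en_lincomb_le:
  assumes "w \<in> Adm"
  shows "en (\<lambda>x. s * f x + t * g x) (\<lambda>x. s * f x + t * g x) w \<le> 2 * s\<^sup>2 * en f f w + 2 * t\<^sup>2 * en g g w"
proof -
  have "0 \<le> en (\<lambda>x. s * f x + (- t) * g x) (\<lambda>x. s * f x + (- t) * g x) w" by (rule en_nonneg[OF assms])
  then show ?thesis unfolding en_lincomb by simp
qed

lemma fin_energy_lincomb:
  assumes "fin_energy f" "fin_energy g"
  shows "fin_energy (\<lambda>x. s * f x + t * g x)"
proof -
  obtain A B where AB: "\<And>n. level_energy n f f \<le> A" "\<And>n. level_energy n g g \<le> B"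
    using assms unfolding fin_energy_def by auto
  have "level_energy n (\<lambda>x. s * f x + t * g x) (\<lambda>x. s * f x + t * g x) \<le> 2 * s\<^sup>2 * A + 2 * t\<^sup>2 * B" for n
  proof -
    have "level_energy n (\<lambda>x. s * f x + t * g x) (\<lambda>x. s * f x + t * g x) \<le>
        (tree_sum ^^ n) (\<lambda>w. 2 * s\<^sup>2 * en f f w + 2 * t\<^sup>2 * en g g w) []"
      unfolding level_energy_eq by (rule tree_sum_pow_mono) (simp_all add: en_lincomb_le)
    also have "\<dots> = 2 * s\<^sup>2 * level_energy n f f + 2 * t\<^sup>2 * level_energy n g g"
      unfolding tree_sum_pow_linear level_energy_eq ..
    also have "\<dots> \<le> 2 * s\<^sup>2 * A + 2 * t\<^sup>2 * B" by (intro add_mono mult_left_mono AB) auto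
    finally show ?thesis .
  qed
  then show ?thesis unfolding fin_energy_def by blast
qed

lemma fin_energy_diff: "fin_energy f \<Longrightarrow> fin_energy g \<Longrightarrow> fin_energy (\<lambda>x. f x - g x)"
  using fin_energy_lincomb[of f g 1 "-1"] by simp

lemma fin_energy_add: "fin_energy f \<Longrightarrow> fin_energy g \<Longrightarrow> fin_energy (\<lambda>x. f x + g x)"
  using fin_energy_lincomb[of f g 1 1] by simp

text \<open>From \<open>f = g + (f - g)\<close> and
  \<open>(s + t)\<^sup>2 \<le> 2 * s\<^sup>2 + 2 * t\<^sup>2\<close>, level by level.\<close>

lemma cell_energy_le_diff:
  assumes "fin_energy f" "fin_energy g" "w \<in> Adm"
  shows "cell_energy f w \<le> 2 * cell_energy g w + 2 * cell_energy (\<lambda>x. f x - g x) w"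
proof (rule LIMSEQ_le[OF cell_energy_LIMSEQ[OF assms(1,3)]])
  let ?d = "\<lambda>x. f x - g x"
  show "(\<lambda>n. 2 * (tree_sum ^^ n) (en g g) w + 2 * (tree_sum ^^ n) (en ?d ?d) w) \<longlonglongrightarrow>
      2 * cell_energy g w + 2 * cell_energy ?d w"
    by (intro tendsto_add tendsto_mult tendsto_const cell_energy_LIMSEQ assms fin_energy_diff)
  have "(tree_sum ^^ n) (en f f) w \<le> 2 * (tree_sum ^^ n) (en g g) w + 2 * (tree_sum ^^ n) (en ?d ?d) w" for n
  proof -
    have "(tree_sum ^^ n) (en f f) w \<le> (tree_sum ^^ n) (\<lambda>w. 2 * en g g w + 2 * en ?d ?d w) w"
    proof (rule tree_sum_pow_mono[OF assms(3)])
      fix u assume "u \<in> Adm"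
      then show "en f f u \<le> 2 * en g g u + 2 * en ?d ?d u"
        using en_lincomb_le[of u 1 g 1 ?d] by simp
    qed
    then show ?thesis unfolding tree_sum_pow_linear .
  qed
  then show "\<exists>N. \<forall>n\<ge>N. (tree_sum ^^ n) (en f f) w \<le> 2 * (tree_sum ^^ n) (en g g) w + 2 * (tree_sum ^^ n) (en ?d ?d) w"
    by blast
qed

text \<open>Polarisation replaces a bilinear sequence, which need not be monotone, by two monotone
  ones; this makes the \<open>lim\<close> in \<open>form\<close> a genuine limit.\<close>

lemma level_energy_polar:
  "level_energy n f g = (level_energy n (\<lambda>x. f x + g x) (\<lambda>x. f x + g x) - level_energy n (\<lambda>x. f x - g x) (\<lambda>x. f x - g x)) / 4"
proof -
  have "en f g w = (1/4) * en (\<lambda>x. f x + g x) (\<lambda>x. f x + g x) w + (-1/4) * en (\<lambda>x. f x - g x) (\<lambda>x. f x - g x) w" for w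
    using en_lincomb[of 1 f 1 g w] en_lincomb[of 1 f "-1" g w] by (simp add: field_simps)
  then have "en f g = (\<lambda>w. (1/4) * en (\<lambda>x. f x + g x) (\<lambda>x. f x + g x) w + (-1/4) * en (\<lambda>x. f x - g x) (\<lambda>x. f x - g x) w)"
    by blast
  then show ?thesis unfolding level_energy_eq by (simp only: tree_sum_pow_linear) simp
qed

lemma form_LIMSEQ:
  assumes "fin_energy f" "fin_energy g"
  shows "(\<lambda>n. level_energy n f g) \<longlonglongrightarrow> form f g"
proof -
  have c: "convergent (\<lambda>n. level_energy n h h)" if "fin_energy h" for h
    using cell_energy_LIMSEQ[OF that Nil_Adm] unfolding level_energy_eq convergent_def by blast
  have "convergent (\<lambda>n. level_energy n f g)"
    unfolding level_energy_polar[of _ f g] divide_inverse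
    by (intro convergent_mult convergent_diff convergent_const c fin_energy_add fin_energy_diff assms)
  then show ?thesis unfolding form_def by (rule convergent_LIMSEQ_iff[THEN iffD1])
qed

section \<open>Geometry of the cells\<close>

lemma triangleI:
  assumes "\<And>a. a \<in> {1,2,3} \<Longrightarrow> t a \<ge> 0" "(\<Sum>a\<in>{1,2,3}. t a) = 1"
  shows "(\<Sum>a\<in>{1,2,3}. t a *\<^sub>R p a) \<in> triangle"
  unfolding triangle_def convex_hull_3
  by (rule CollectI, rule exI[of _ "t 1"], rule exI[of _ "t 2"], rule exI[of _ "t 3"])
    (use assms(1)[of 1] assms(1)[of 2] assms(1)[of 3] assms(2) in \<open>simp add: add.assoc\<close>)

lemma triangleD:
  assumes "z \<in> triangle"
  shows "a \<in> {1,2,3} \<Longrightarrow> bary a z \<ge> 0" "z = (\<Sum>a\<in>{1,2,3}. bary a z *\<^sub>R p a)"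
proof -
  obtain u v w where uvw: "0 \<le> u" "0 \<le> v" "0 \<le> w" "u + v + w = 1" "z = u *\<^sub>R p 1 + v *\<^sub>R p 2 + w *\<^sub>R p 3"
    using assms unfolding triangle_def convex_hull_3 by blast
  define t where "t = (\<lambda>a::nat. if a = 1 then u else if a = 2 then v else w)"
  have z: "z = (\<Sum>a\<in>{1,2,3}. t a *\<^sub>R p a)" using uvw(5) by (simp add: t_def add.assoc)
  have s: "(\<Sum>a\<in>{1,2,3}. t a) = 1" using uvw(4) by (simp add: t_def add.assoc)
  have b: "bary a z = t a" if "a \<in> {1,2,3}" for a
    unfolding z by (rule bary_linear_combination[OF s that])
  show "a \<in> {1,2,3} \<Longrightarrow> bary a z \<ge> 0" using b uvw by (auto simp: t_def)
  show "z = (\<Sum>a\<in>{1,2,3}. bary a z *\<^sub>R p a)" using z b by simp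
qed

lemma p_triangle: "a \<in> {1,2,3} \<Longrightarrow> p a \<in> triangle"
  unfolding triangle_def by (auto intro: hull_inc)

lemma compact_triangle: "compact triangle"
  unfolding triangle_def by (intro finite_imp_compact_convex_hull) simp

lemma triangle_vertex:
  assumes "z \<in> triangle" "a \<in> {1,2,3}" "bary a z \<ge> 1"
  shows "z = p a"
proof -
  note t = triangleD[OF assms(1)]
  have s: "bary 1 z + bary 2 z + bary 3 z = 1" using bary_sum[of z] by (simp add: add.assoc)
  have "bary b z = (if b = a then 1 else 0)" if "b \<in> {1,2,3}" for b
    using s t(1)[of 1] t(1)[of 2] t(1)[of 3] assms(2,3) that by auto
  then have "z = (\<Sum>b\<in>{1,2,3}. (if b = a then 1 else 0) *\<^sub>R p b)" by (subst t(2)) simp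
  also have "\<dots> = p a" using assms(2) by (elim insertE emptyE) simp_all
  finally show ?thesis .
qed

lemma cell_map_triangle:
  assumes "\<nu> \<ge> 2" "c \<in> cells \<nu>" "z \<in> triangle"
  shows "cell_map \<nu> c z \<in> triangle"
proof -
  let ?t = "\<lambda>a. (bary a z + real (c a)) / real \<nu>"
  have s: "(\<Sum>a\<in>{1,2,3}. c a) + 1 = \<nu>" using assms(1,2) by (simp add: cells_def)
  have "(\<Sum>a\<in>{1,2,3}. ?t a) = ((\<Sum>a\<in>{1,2,3}. bary a z) + real (\<Sum>a\<in>{1,2,3}. c a)) / real \<nu>"
    by (simp only: sum_divide_distrib[symmetric] sum.distrib of_nat_sum)
  also have "\<dots> = 1" unfolding bary_sum using s assms(1) by (metis add.commute divide_self_if not_numeral_le_zero of_nat_1 of_nat_add of_nat_eq_0_iff)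
  finally have "(\<Sum>a\<in>{1,2,3}. ?t a *\<^sub>R p a) \<in> triangle"
    using triangleD(1)[OF assms(3)] by (intro triangleI) auto
  also have "(\<Sum>a\<in>{1,2,3}. ?t a *\<^sub>R p a) = (1 / real \<nu>) *\<^sub>R ((\<Sum>a\<in>{1,2,3}. bary a z *\<^sub>R p a) + (\<Sum>a\<in>{1,2,3}. real (c a) *\<^sub>R p a))"
    by (simp only: sum.distrib[symmetric] scaleR_sum_right scaleR_left_distrib[symmetric] scaleR_scaleR) (simp add: field_simps)
  also have "\<dots> = cell_map \<nu> c z"
    unfolding cell_map_def using triangleD(2)[OF assms(3)] by simp
  finally show ?thesis .
qed

lemma cell_map_vertex:
  assumes "\<nu> \<ge> 2" "c \<in> cells \<nu>" "z \<in> triangle" "i \<in> {1,2,3}" "cell_map \<nu> c z = p i"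
  shows "z = p i"
proof (rule triangle_vertex[OF assms(3,4)])
  have e: "(bary b z + real (c b)) / real \<nu> = bary b (p i)" if "b \<in> {1,2,3}" for b
    using bary_cell_map[OF assms(2,1) that, of z] assms(5) by simp
  have "bary b z = 0" if "b \<in> {1,2,3}" "b \<noteq> i" for b
    using e[OF that(1)] bary_p[OF that(1) assms(4)] that triangleD(1)[OF assms(3) that(1)] assms(1)
    by (auto simp: add_nonneg_eq_0_iff)
  then show "bary i z \<ge> 1" using bary_sum[of z] assms(4) by (elim insertE emptyE) simp_all
qed

text \<open>The index triples are different and have equal sums, so \<open>c b < c' b\<close> for
  some \<open>b\<close>. Comparing coordinates gives \<open>bary b x \<ge> 1\<close>, which inside
  the triangle holds at a corner only.\<close>

lemma cell_map_meet:
  assumes "\<nu> \<ge> 2" "c \<in> cells \<nu>" "c' \<in> cells \<nu>" "c \<noteq> c'" "x \<in> triangle" "x' \<in> triangle"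
    "cell_map \<nu> c x = cell_map \<nu> c' x'"
  shows "x \<in> V0"
proof -
  have e: "bary b x + real (c b) = bary b x' + real (c' b)" if "b \<in> {1,2,3}" for b
    using bary_cell_map[OF assms(2,1) that, of x] bary_cell_map[OF assms(3,1) that, of x'] assms(7,1)
    by (simp add: field_simps)
  have "\<exists>b\<in>{1,2,3}. c b < c' b"
  proof (rule ccontr)
    assume "\<not> ?thesis"
    then have ge: "c 1 \<ge> c' 1" "c 2 \<ge> c' 2" "c 3 \<ge> c' 3" by auto
    have "c 1 + c 2 + c 3 = c' 1 + c' 2 + c' 3" using assms(2,3) by (simp add: cells_def)
    then have "c 1 = c' 1" "c 2 = c' 2" "c 3 = c' 3" using ge by auto
    moreover have "c a = c' a" if "a \<notin> {1,2,3}" for a using that assms(2,3) by (simp add: cells_def)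
    ultimately have "c a = c' a" for a by (cases "a \<in> {1,2,3}") auto
    then show False using assms(4) by auto
  qed
  then obtain b where b: "b \<in> {1,2,3}" "c b < c' b" by blast
  then have "real (c b) + 1 \<le> real (c' b)" by linarith
  then have "bary b x \<ge> 1" using e[OF b(1)] triangleD(1)[OF assms(6) b(1)] by linarith
  then show ?thesis using triangle_vertex[OF assms(5) b(1)] b(1) by auto
qed

lemma letter_cell:
  assumes "\<nu> \<ge> 2" "v \<in> letters \<nu>"
  obtains c where "c \<in> cells \<nu>" "\<psi> (snd v) (fst v) = cell_map \<nu> c"
proof -
  obtain i where "v = (i, \<nu>)" "i \<in> {1..\<nu> * (\<nu> + 1) div 2}" using assms(2) unfolding letters_image by auto
  then show ?thesis using \<psi>_cell[OF assms(1), of i] that by auto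
qed

lemma letter_cell_inj:
  assumes "\<nu> \<ge> 2" "v \<in> letters \<nu>" "v' \<in> letters \<nu>" "\<psi> (snd v) (fst v) = \<psi> (snd v') (fst v')"
  shows "v = v'"
proof -
  obtain i i' where i: "v = (i, \<nu>)" "i \<in> {1..\<nu> * (\<nu> + 1) div 2}" "v' = (i', \<nu>)" "i' \<in> {1..\<nu> * (\<nu> + 1) div 2}"
    using assms(2,3) unfolding letters_image by auto
  have "i = i'"
    by (rule inj_onD[OF bij_betw_imp_inj_on[OF subdivision[OF assms(1)]] _ i(2,4)]) (use assms(4) i in simp)
  then show ?thesis using i by simp
qed

lemma alphabet_letter: "v \<in> alphabet \<Longrightarrow> \<exists>\<nu>\<in>T. v \<in> letters \<nu>"
  unfolding alphabet_def by auto

lemma alphabet_cell: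
  assumes "v \<in> alphabet"
  obtains \<nu> c where "\<nu> \<ge> 2" "c \<in> cells \<nu>" "\<psi> (snd v) (fst v) = cell_map \<nu> c"
  using alphabet_letter[OF assms] T_ge letter_cell by metis

lemma \<psi>_word_triangle: "w \<in> lists alphabet \<Longrightarrow> z \<in> triangle \<Longrightarrow> \<psi>_word w z \<in> triangle"
proof (induction w)
  case (Cons v w)
  then have "\<psi>_word w z \<in> triangle" "v \<in> alphabet" by auto
  then show ?case by (metis \<psi>_word.simps(2) alphabet_cell cell_map_triangle comp_apply)
qed simp

lemma \<psi>_word_vertex: "w \<in> lists alphabet \<Longrightarrow> z \<in> triangle \<Longrightarrow> \<psi>_word w z \<in> V0 \<Longrightarrow> z \<in> V0"
proof (induction w)
  case (Cons v w)
  then have v: "\<psi>_word w z \<in> triangle" "v \<in> alphabet" "w \<in> lists alphabet" using \<psi>_word_triangle by auto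
  obtain \<nu> c where c: "\<nu> \<ge> 2" "c \<in> cells \<nu>" "\<psi> (snd v) (fst v) = cell_map \<nu> c"
    using alphabet_cell[OF v(2)] .
  obtain i where i: "i \<in> {1,2,3}" "cell_map \<nu> c (\<psi>_word w z) = p i"
    using Cons.prems(3) unfolding \<psi>_word.simps comp_apply c(3) by blast
  have "\<psi>_word w z \<in> V0" using cell_map_vertex[OF c(1,2) v(1) i] i(1) by blast
  then show ?case using Cons.IH[OF v(3) Cons.prems(2)] by blast
qed simp

lemma dist_cell_map: "\<nu> \<ge> 2 \<Longrightarrow> dist (cell_map \<nu> c x) (cell_map \<nu> c y) = dist x y / real \<nu>"
proof -
  have "cell_map \<nu> c x - cell_map \<nu> c y = (1 / real \<nu>) *\<^sub>R (x - y)"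
    unfolding cell_map_def by (simp add: algebra_simps)
  then show ?thesis unfolding dist_norm by simp
qed

lemma dist_\<psi>_word: "w \<in> lists alphabet \<Longrightarrow> \<exists>\<rho>>0. \<rho> \<le> (1/2) ^ length w \<and> (\<forall>x y. dist (\<psi>_word w x) (\<psi>_word w y) = \<rho> * dist x y)"
proof (induction w)
  case (Cons v w)
  obtain \<rho> where \<rho>: "\<rho> > 0" "\<rho> \<le> (1/2) ^ length w" "\<And>x y. dist (\<psi>_word w x) (\<psi>_word w y) = \<rho> * dist x y"
    using Cons by auto
  obtain \<nu> c where c: "\<nu> \<ge> 2" "c \<in> cells \<nu>" "\<psi> (snd v) (fst v) = cell_map \<nu> c"
    using alphabet_cell[of v] Cons.prems by auto
  have "\<rho> / real \<nu> \<le> (1/2) ^ length w / 2" using \<rho>(1,2) c(1) by (intro frac_le) auto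
  moreover have "dist (\<psi>_word (v # w) x) (\<psi>_word (v # w) y) = \<rho> / real \<nu> * dist x y" for x y
    unfolding \<psi>_word.simps comp_apply c(3) dist_cell_map[OF c(1)] \<rho>(3) by simp
  ultimately show ?case using \<rho>(1) c(1) by (intro exI[of _ "\<rho> / real \<nu>"]) auto
qed (auto intro!: exI[of _ "1::real"])

lemma \<psi>_word_inj: "w \<in> lists alphabet \<Longrightarrow> \<psi>_word w x = \<psi>_word w y \<Longrightarrow> x = y"
  using dist_\<psi>_word[of w] by (metis dist_eq_0_iff mult_eq_0_iff less_irrefl)

lemma continuous_\<psi>_word: "w \<in> lists alphabet \<Longrightarrow> continuous_on A (\<psi>_word w)"
proof -
  assume "w \<in> lists alphabet"
  then obtain \<rho> where \<rho>: "\<rho> > 0" "\<And>x y. dist (\<psi>_word w x) (\<psi>_word w y) = \<rho> * dist x y"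
    using dist_\<psi>_word by blast
  show ?thesis
    unfolding continuous_on_iff \<rho>(2)
  proof (intro ballI allI impI)
    fix x and e :: real assume "0 < e"
    then show "\<exists>d>0. \<forall>x'\<in>A. dist x' x < d \<longrightarrow> \<rho> * dist x' x < e"
      using \<rho>(1) by (intro exI[of _ "e / \<rho>"]) (auto simp: field_simps)
  qed
qed

text \<open>Cut both words at their first difference. The common prefix acts injectively, the two
  differing cells meet in corners only, and a word map takes no other point of the triangle to a
  corner.\<close>

lemma Adm_meet:
  assumes "w \<in> Adm" "w' \<in> Adm" "length w = length w'" "w \<noteq> w'" "x \<in> triangle" "x' \<in> triangle"
    "\<psi>_word w x = \<psi>_word w' x'"
  shows "x \<in> V0"
proof -
  obtain u v s v' s' where u: "v \<noteq> v'" "w = u @ [v] @ s" "w' = u @ [v'] @ s'"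
    using same_length_different[OF assms(4,3)] by blast
  have "u @ [v] \<in> Adm" "u @ [v'] \<in> Adm"
    using assms(1,2) Adm_append[of "u @ [v]" s] Adm_append[of "u @ [v']" s'] u by auto
  then have uv: "u \<in> Adm" "v \<in> letters (L u)" "v' \<in> letters (L u)" by (auto simp: Adm_snoc)
  have "w \<in> lists alphabet" "w' \<in> lists alphabet" using assms(1,2) Adm_lists by auto
  then have l: "u \<in> lists alphabet" "s \<in> lists alphabet" "s' \<in> lists alphabet" unfolding u by auto
  have ge: "L u \<ge> 2" using L_ge[OF uv(1)] .
  obtain c where c: "c \<in> cells (L u)" "\<psi> (snd v) (fst v) = cell_map (L u) c" using letter_cell[OF ge uv(2)] .
  obtain c' where c': "c' \<in> cells (L u)" "\<psi> (snd v') (fst v') = cell_map (L u) c'" using letter_cell[OF ge uv(3)] .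
  have ne: "c \<noteq> c'" using letter_cell_inj[OF ge uv(2,3)] c c' u(1) by auto
  have "\<psi>_word u (cell_map (L u) c (\<psi>_word s x)) = \<psi>_word u (cell_map (L u) c' (\<psi>_word s' x'))"
    using assms(7) unfolding u by (simp add: \<psi>_word_append c(2) c'(2))
  then have "cell_map (L u) c (\<psi>_word s x) = cell_map (L u) c' (\<psi>_word s' x')"
    by (rule \<psi>_word_inj[OF l(1)])
  then have "\<psi>_word s x \<in> V0"
    using cell_map_meet[OF ge c(1) c'(1) ne] \<psi>_word_triangle l assms(5,6) by blast
  then show ?thesis using \<psi>_word_vertex[OF l(2) assms(5)] by blast
qed

section \<open>Cells along an infinite word and the coding map\<close>

lemma space_word_space: "\<omega> \<in> space word_space \<longleftrightarrow> (\<forall>n. \<omega> n \<in> alphabet)"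
  unfolding word_space_def by (auto simp: space_PiM PiE_iff)

lemma initial_word_Suc: "initial_word (Suc n) \<omega> = initial_word n \<omega> @ [\<omega> n]"
  by (simp add: initial_word_def)

lemma length_initial_word [simp]: "length (initial_word n \<omega>) = n"
  by (simp add: initial_word_def)

lemma initial_word_0 [simp]: "initial_word 0 \<omega> = []"
  by (simp add: initial_word_def)

lemma take_initial_word: "k \<le> n \<Longrightarrow> take k (initial_word n \<omega>) = initial_word k \<omega>"
  by (simp add: initial_word_def take_map)

lemma initial_word_alphabet: "\<omega> \<in> space word_space \<Longrightarrow> initial_word n \<omega> \<in> lists alphabet"
  by (auto simp: space_word_space initial_word_def)

lemma adm_sequences_iff: "\<omega> \<in> adm_sequences \<longleftrightarrow> \<omega> \<in> space word_space \<and> (\<forall>m. initial_word m \<omega> \<in> Adm)"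
  unfolding adm_sequences_def by (simp add: adm_words_Adm)

lemma adm_sequencesI: "(\<And>m. initial_word m \<omega> \<in> Adm) \<Longrightarrow> \<omega> \<in> adm_sequences"
proof -
  assume *: "\<And>m. initial_word m \<omega> \<in> Adm"
  have "\<omega> n \<in> alphabet" for n
    using Adm_lists[OF *[of "Suc n"]] by (simp add: initial_word_Suc)
  then show ?thesis using * by (simp add: adm_sequences_iff space_word_space)
qed

lemma adm_sequences_Adm: "\<omega> \<in> adm_sequences \<Longrightarrow> initial_word n \<omega> \<in> Adm"
  by (simp add: adm_sequences_iff)

definition cell :: "letter list \<Rightarrow> plane set" where
  "cell w = \<psi>_word w ` triangle"

lemma compact_cell: "w \<in> lists alphabet \<Longrightarrow> compact (cell w)"
  unfolding cell_def by (intro compact_continuous_image continuous_\<psi>_word compact_triangle)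

lemma cell_append_subset: "s \<in> lists alphabet \<Longrightarrow> cell (w @ s) \<subseteq> cell w"
  unfolding cell_def \<psi>_word_append using \<psi>_word_triangle by auto

definition diam :: real where "diam = diameter triangle + 1"

lemma dist_cell_le:
  assumes "w \<in> lists alphabet" "x \<in> cell w" "y \<in> cell w"
  shows "dist x y \<le> (1/2) ^ length w * diam"
proof -
  obtain \<rho> where \<rho>: "\<rho> > 0" "\<rho> \<le> (1/2) ^ length w" "\<And>x y. dist (\<psi>_word w x) (\<psi>_word w y) = \<rho> * dist x y"
    using dist_\<psi>_word[OF assms(1)] by blast
  obtain x' y' where x': "x = \<psi>_word w x'" "x' \<in> triangle" "y = \<psi>_word w y'" "y' \<in> triangle"
    using assms(2,3) unfolding cell_def by auto
  have "dist x' y' \<le> diam"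
    using diameter_bounded_bound[OF compact_imp_bounded[OF compact_triangle] x'(2,4)] by (simp add: diam_def)
  then show ?thesis unfolding x' \<rho>(3) using \<rho>(1,2) by (intro mult_mono) auto
qed

lemma dist_cell_tendsto: "(\<lambda>n. (1/2) ^ n * diam) \<longlonglongrightarrow> 0"
  by (intro tendsto_mult_left_zero LIMSEQ_power_zero) simp

lemma initial_word_cell_decseq:
  assumes "\<omega> \<in> space word_space" "m \<le> n"
  shows "cell (initial_word n \<omega>) \<subseteq> cell (initial_word m \<omega>)"
proof -
  have "initial_word n \<omega> = initial_word m \<omega> @ drop m (initial_word n \<omega>)"
    using take_initial_word[OF assms(2)] append_take_drop_id by metis
  moreover have "drop m (initial_word n \<omega>) \<in> lists alphabet"
    using initial_word_alphabet[OF assms(1)] by (auto simp: in_lists_conv_set dest: in_set_dropD)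
  ultimately show ?thesis using cell_append_subset by metis
qed

lemma coding_unique_ex:
  assumes "\<omega> \<in> space word_space"
  shows "\<exists>a. (\<Inter>m. cell (initial_word m \<omega>)) = {a}"
proof -
  note l = initial_word_alphabet[OF assms]
  have "triangle \<noteq> {}" using p_triangle[of 1] by auto
  then show ?thesis
  proof (intro decreasing_closed_nest_sing)
    fix e :: real assume "e > 0"
    have "\<forall>\<^sub>F n in sequentially. (1/2) ^ n * diam < e"
      by (rule order_tendstoD(2)[OF dist_cell_tendsto \<open>e > 0\<close>])
    then obtain n where n: "(1/2) ^ n * diam < e"
      unfolding eventually_sequentially by blast
    have "dist x y < e" if "x \<in> cell (initial_word n \<omega>)" "y \<in> cell (initial_word n \<omega>)" for x y
      using dist_cell_le[OF l that] n by simp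
    then show "\<exists>n. \<forall>x\<in>cell (initial_word n \<omega>). \<forall>y\<in>cell (initial_word n \<omega>). dist x y < e"
      by blast
  next
    show "closed (cell (initial_word n \<omega>))" for n
      by (rule compact_imp_closed[OF compact_cell[OF l]])
    show "cell (initial_word n \<omega>) \<subseteq> cell (initial_word m \<omega>)" if "m \<le> n" for m n
      by (rule initial_word_cell_decseq[OF assms that])
  qed (simp add: cell_def)
qed

lemma coding_cell: "\<omega> \<in> space word_space \<Longrightarrow> coding \<omega> \<in> cell (initial_word m \<omega>)"
  and coding_eqI: "\<omega> \<in> space word_space \<Longrightarrow> (\<And>m. z \<in> cell (initial_word m \<omega>)) \<Longrightarrow> coding \<omega> = z"
proof -
  have *: "(\<forall>m. z \<in> \<psi>_word (initial_word m \<omega>) ` triangle) \<longleftrightarrow> z \<in> (\<Inter>m. cell (initial_word m \<omega>))" for z \<omega>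
    by (simp add: cell_def)
  {
    assume "\<omega> \<in> space word_space"
    then obtain a where a: "(\<Inter>m. cell (initial_word m \<omega>)) = {a}" using coding_unique_ex by blast
    have "coding \<omega> = a" unfolding coding_def * a by auto
    then show "coding \<omega> \<in> cell (initial_word m \<omega>)" using a by auto
    assume "\<And>m. z \<in> cell (initial_word m \<omega>)"
    then have "z \<in> {a}" unfolding a[symmetric] by auto
    then show "coding \<omega> = z" using \<open>coding \<omega> = a\<close> by auto
  }
qed

lemma vertex_cell: "a \<in> {1,2,3} \<Longrightarrow> \<psi>_word w (p a) \<in> cell w"
  unfolding cell_def using p_triangle by auto

lemma vertex_LIMSEQ_coding:
  assumes "\<omega> \<in> space word_space" "a \<in> {1,2,3}"
  shows "(\<lambda>n. \<psi>_word (initial_word n \<omega>) (p a)) \<longlonglongrightarrow> coding \<omega>"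
proof -
  have "(\<lambda>n. dist (\<psi>_word (initial_word n \<omega>) (p a)) (coding \<omega>)) \<longlonglongrightarrow> 0"
  proof (rule tendsto_sandwich[OF _ _ tendsto_const dist_cell_tendsto])
    show "\<forall>\<^sub>F n in sequentially. dist (\<psi>_word (initial_word n \<omega>) (p a)) (coding \<omega>) \<le> (1/2) ^ n * diam"
      using dist_cell_le[OF initial_word_alphabet[OF assms(1)] vertex_cell[OF assms(2)] coding_cell[OF assms(1)]]
      by simp
  qed simp
  then show ?thesis using tendsto_dist_iff by blast
qed

lemma Adm_corner: "w \<in> Adm \<Longrightarrow> a \<in> {1,2,3} \<Longrightarrow> w @ [(a, L w)] \<in> Adm"
  by (simp add: Adm_snoc corner_letter[OF L_ge])

lemma \<psi>_word_corner: "w \<in> Adm \<Longrightarrow> a \<in> {1,2,3} \<Longrightarrow> \<psi>_word (w @ [(a, L w)]) (p a) = \<psi>_word w (p a)"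
  using corners[OF L_ge] by (simp add: \<psi>_word_append)

text \<open>The descent into the cell at corner \<open>a\<close>. The labels are not free: each is
  the one that \<open>L\<close> prescribes after the letters before it. All these cells keep the
  vertex \<open>\<psi>_word w (p a)\<close>.\<close>

primrec corner_ext :: "nat \<Rightarrow> letter list \<Rightarrow> nat \<Rightarrow> letter list" where
  "corner_ext a w 0 = w"
| "corner_ext a w (Suc n) = corner_ext a w n @ [(a, L (corner_ext a w n))]"

lemma length_corner_ext [simp]: "length (corner_ext a w n) = length w + n"
  by (induction n) auto

lemma corner_ext_Adm: "w \<in> Adm \<Longrightarrow> a \<in> {1,2,3} \<Longrightarrow> corner_ext a w n \<in> Adm"
  by (induction n) (auto intro: Adm_corner)

lemma \<psi>_word_corner_ext: "w \<in> Adm \<Longrightarrow> a \<in> {1,2,3} \<Longrightarrow> \<psi>_word (corner_ext a w n) (p a) = \<psi>_word w (p a)"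
  by (induction n) (auto simp: \<psi>_word_corner corner_ext_Adm)

lemma take_corner_ext: "m \<le> n \<Longrightarrow> take (length w + m) (corner_ext a w n) = corner_ext a w m"
proof (induction n)
  case (Suc n)
  then show ?case by (cases "m = Suc n") auto
qed simp

lemma corner_sequence_ex:
  assumes "w \<in> Adm" "a \<in> {1,2,3}"
  obtains \<omega> where "\<omega> \<in> adm_sequences" "\<And>n. initial_word (length w + n) \<omega> = corner_ext a w n"
    "coding \<omega> = \<psi>_word w (p a)"
proof -
  \<comment> \<open>\<open>corner_ext a w (Suc n)\<close> has more than \<open>n\<close> letters, so
    the index is in range for every \<open>n\<close>, also inside \<open>w\<close>.\<close>
  define \<omega> where "\<omega> n = corner_ext a w (Suc n) ! n" for n
  have i: "initial_word (length w + n) \<omega> = corner_ext a w n" for n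
  proof (rule nth_equalityI)
    fix k assume k: "k < length (initial_word (length w + n) \<omega>)"
    have "\<omega> k = corner_ext a w (max n (Suc k)) ! k"
      unfolding \<omega>_def using take_corner_ext[of "Suc k" "max n (Suc k)" w a]
      by (metis add.commute lessI max.cobounded2 nth_take trans_less_add1 add_Suc_right less_add_Suc2)
    also have "\<dots> = corner_ext a w n ! k"
      using take_corner_ext[of n "max n (Suc k)" w a] k by (metis length_initial_word max.cobounded1 nth_take)
    finally show "initial_word (length w + n) \<omega> ! k = corner_ext a w n ! k"
      using k by (simp add: initial_word_def)
  qed simp
  have A: "initial_word (length w + n) \<omega> \<in> Adm" for n unfolding i by (rule corner_ext_Adm[OF assms])
  have "initial_word m \<omega> \<in> Adm" for m
  proof -
    have "initial_word (length w + m) \<omega> = initial_word m \<omega> @ drop m (initial_word (length w + m) \<omega>)"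
      by (metis append_take_drop_id le_add2 take_initial_word)
    then show ?thesis using A[of m] Adm_append by metis
  qed
  then have adm: "\<omega> \<in> adm_sequences" by (rule adm_sequencesI)
  then have sp: "\<omega> \<in> space word_space" by (simp add: adm_sequences_iff)
  have "coding \<omega> = \<psi>_word w (p a)"
  proof (rule coding_eqI[OF sp])
    fix m
    have "\<psi>_word w (p a) \<in> cell (initial_word (length w + m) \<omega>)"
      unfolding i using \<psi>_word_corner_ext[OF assms, of m] vertex_cell[OF assms(2), of "corner_ext a w m"] by simp
    then show "\<psi>_word w (p a) \<in> cell (initial_word m \<omega>)"
      using initial_word_cell_decseq[OF sp, of m "length w + m"] by auto
  qed
  then show ?thesis using that adm i by blast
qed

lemma vertex_gasket: "w \<in> Adm \<Longrightarrow> a \<in> {1,2,3} \<Longrightarrow> \<psi>_word w (p a) \<in> gasket"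
  unfolding gasket_def by (metis corner_sequence_ex image_eqI)

lemma V1_triangle: "\<nu> \<ge> 2 \<Longrightarrow> y \<in> V1 \<nu> \<Longrightarrow> y \<in> triangle"
  unfolding V1_def using cell_map_triangle p_triangle by auto

lemma V1_letter:
  assumes "\<nu> \<ge> 2" "y \<in> V1 \<nu>"
  obtains v a where "v \<in> letters \<nu>" "a \<in> {1,2,3}" "y = \<psi> (snd v) (fst v) (p a)"
proof -
  obtain c a where c: "c \<in> cells \<nu>" "a \<in> {1,2,3}" "y = cell_map \<nu> c (p a)" using assms(2) unfolding V1_def by blast
  then have "cell_map \<nu> c \<in> \<psi> \<nu> ` {1..\<nu> * (\<nu> + 1) div 2}" using cells_image[OF assms(1)] by auto
  then obtain i where i: "i \<in> {1..\<nu> * (\<nu> + 1) div 2}" "cell_map \<nu> c = \<psi> \<nu> i" by blast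
  then show ?thesis using that[of "(i, \<nu>)" a] c by (auto simp: letters_image)
qed

lemma letter_V1: "\<nu> \<ge> 2 \<Longrightarrow> v \<in> letters \<nu> \<Longrightarrow> a \<in> {1,2,3} \<Longrightarrow> \<psi> (snd v) (fst v) (p a) \<in> V1 \<nu>"
  using letter_cell V1I by metis

section \<open>Oscillation bounds from the energy\<close>

text \<open>\<open>osc0\<close> comes from the path bound \<open>2 * \<nu>\<close> inside one
  subdivision. \<open>osc\<close> is the geometric series with first term \<open>osc0\<close> and
  ratio \<open>sqrt rmax\<close>: each letter shrinks \<open>r_word\<close> by at least
  \<open>rmax\<close>, and the oscillation contains its root.\<close>

definition osc0 :: real where "osc0 = 2 * real (Max T)"
definition osc :: real where "osc = osc0 / (1 - sqrt rmax)"

lemma osc_bounds: "osc0 \<ge> 0" "osc \<ge> 0" "osc0 + osc * sqrt rmax = osc" "osc0 \<le> osc"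
proof -
  have s: "0 < 1 - sqrt rmax" "0 < sqrt rmax" using rmax_bounds by (auto simp: real_sqrt_lt_1_iff)
  show 1: "osc0 \<ge> 0" by (simp add: osc0_def)
  then show 2: "osc \<ge> 0" unfolding osc_def using s by simp
  show 3: "osc0 + osc * sqrt rmax = osc" unfolding osc_def using s by (simp add: field_simps)
  show "osc0 \<le> osc" using 2 3 s by (metis less_imp_le le_add_same_cancel1 mult_nonneg_nonneg)
qed

lemma V1_diff_le:
  assumes "w \<in> Adm" "u \<in> V1 (L w)" "v \<in> V1 (L w)" "tree_sum (en f f) w \<le> B"
  shows "\<bar>f (\<psi>_word w u) - f (\<psi>_word w v)\<bar> \<le> osc0 * sqrt (B * r_word w)"
proof -
  let ?E = "E1 (L w) (f \<circ> \<psi>_word w) (f \<circ> \<psi>_word w)"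
  note ge = L_ge[OF assms(1)]
  have rp: "r_word w > 0" "r (L w) > 0" "r (L w) < 1" using r_word_pos[OF assms(1)] r_pos[OF ge] r_less_1[OF ge] by auto
  have E: "?E = tree_sum (en f f) w * r_word w * r (L w)"
    unfolding tree_sum_en[OF assms(1)] using rp by simp
  have Bp: "B \<ge> 0"
    using order_trans[OF en_le_tree_sum[OF assms(1)] assms(4)] en_nonneg[OF assms(1), of f] by linarith
  have "?E \<le> tree_sum (en f f) w * r_word w"
    using E E1_nonneg[of "L w" "f \<circ> \<psi>_word w"] rp by (simp add: mult_left_le zero_le_mult_iff)
  also have "\<dots> \<le> B * r_word w" using assms(4) rp by simp
  finally have le: "sqrt ?E \<le> sqrt (B * r_word w)" by simp
  have "\<bar>f (\<psi>_word w u) - f (\<psi>_word w v)\<bar> \<le> 2 * real (L w) * sqrt ?E"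
    using E1_diff_le[OF ge assms(2,3), of "f \<circ> \<psi>_word w"] by simp
  also have "\<dots> \<le> osc0 * sqrt (B * r_word w)"
    unfolding osc0_def using Max_ge[OF T_finite L_T[OF assms(1)]] le E1_nonneg
    by (intro mult_mono) auto
  finally show ?thesis .
qed

text \<open>Telescoping along the sequence, by induction on the number \<open>k - n\<close> of
  remaining letters; the fixed-point equation \<open>osc0 + osc * sqrt rmax = osc\<close> closes the
  step.\<close>

lemma osc_sequence:
  assumes "\<omega> \<in> adm_sequences" "n \<le> k" "a \<in> {1,2,3}" "b \<in> {1,2,3}"
    and B: "\<And>j. j \<ge> n \<Longrightarrow> tree_sum (en f f) (initial_word j \<omega>) \<le> B"
  shows "\<bar>f (\<psi>_word (initial_word n \<omega>) (p a)) - f (\<psi>_word (initial_word k \<omega>) (p b))\<bar> \<le> osc * sqrt (B * r_word (initial_word n \<omega>))"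
  using assms(2) B
proof (induction "k - n" arbitrary: n)
  case 0
  let ?w = "initial_word n \<omega>"
  have w: "?w \<in> Adm" by (rule adm_sequences_Adm[OF assms(1)])
  have p: "p a \<in> V1 (L ?w)" "p b \<in> V1 (L ?w)" using V0_subset_V1[OF L_ge[OF w]] assms(3,4) by auto
  have B0: "0 \<le> B" using order_trans[OF order_trans[OF en_nonneg[OF w] en_le_tree_sum[OF w]] 0(3)[of n]] by simp
  have "\<bar>f (\<psi>_word ?w (p a)) - f (\<psi>_word ?w (p b))\<bar> \<le> osc0 * sqrt (B * r_word ?w)"
    by (rule V1_diff_le[OF w p 0(3)]) simp
  also have "\<dots> \<le> osc * sqrt (B * r_word ?w)"
    using osc_bounds(4) B0 r_word_pos[OF w] by (intro mult_right_mono) auto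
  finally show ?case using 0(1,2) by simp
next
  case (Suc d)
  let ?w = "initial_word n \<omega>" and ?w' = "initial_word (Suc n) \<omega>"
  have w: "?w \<in> Adm" "?w' \<in> Adm" by (rule adm_sequences_Adm[OF assms(1)])+
  note ge = L_ge[OF w(1)]
  have l: "\<omega> n \<in> letters (L ?w)" using w(2) by (simp add: initial_word_Suc Adm_snoc)
  have B0: "0 \<le> B" using order_trans[OF order_trans[OF en_nonneg[OF w(1)] en_le_tree_sum[OF w(1)]] Suc(4)[of n]] by simp
  have v: "p a \<in> V1 (L ?w)" "\<psi> (snd (\<omega> n)) (fst (\<omega> n)) (p a) \<in> V1 (L ?w)"
    using V0_subset_V1[OF ge] letter_V1[OF ge l assms(3)] assms(3) by auto
  have 1: "\<bar>f (\<psi>_word ?w (p a)) - f (\<psi>_word ?w' (p a))\<bar> \<le> osc0 * sqrt (B * r_word ?w)"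
    using V1_diff_le[OF w(1) v, of f B] Suc(4)[of n] by (simp add: initial_word_Suc \<psi>_word_append)
  have 2: "\<bar>f (\<psi>_word ?w' (p a)) - f (\<psi>_word (initial_word k \<omega>) (p b))\<bar> \<le> osc * sqrt (B * r_word ?w')"
    by (rule Suc(1)) (use Suc(2,3,4) in auto)
  have "r_word ?w' \<le> r_word ?w * rmax"
    using r_le_rmax[OF L_T[OF w(1)]] r_word_pos[OF w(1)] letters_snd[OF l]
    by (simp add: initial_word_Suc r_word_append r_word_single)
  then have "sqrt (B * r_word ?w') \<le> sqrt (B * (r_word ?w * rmax))"
    using B0 by (intro real_sqrt_le_mono mult_left_mono) auto
  also have "\<dots> = sqrt (B * r_word ?w) * sqrt rmax" by (simp add: real_sqrt_mult)
  finally have "osc * sqrt (B * r_word ?w') \<le> osc * sqrt rmax * sqrt (B * r_word ?w)"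
    using osc_bounds(2) by (simp add: mult_left_mono mult.commute mult.left_commute)
  then have "osc0 * sqrt (B * r_word ?w) + osc * sqrt (B * r_word ?w') \<le> (osc0 + osc * sqrt rmax) * sqrt (B * r_word ?w)"
    by (simp add: distrib_right)
  then show ?case using 1 2 unfolding osc_bounds(3) by linarith
qed

section \<open>Harmonic extension\<close>

lemma osc_tendsto: "(\<lambda>n. osc * sqrt (B * rmax ^ n)) \<longlonglongrightarrow> 0"
proof -
  have "(\<lambda>n. osc * sqrt (B * rmax ^ n)) \<longlonglongrightarrow> osc * sqrt (B * 0)"
    by (intro tendsto_intros LIMSEQ_power_zero) (use rmax_bounds in simp)
  then show ?thesis by simp
qed

lemma osc_sequence_uniform:
  assumes "\<omega> \<in> adm_sequences" "n \<le> k" "a \<in> {1,2,3}" "b \<in> {1,2,3}" "\<And>n. level_energy n f f \<le> B"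
  shows "\<bar>f (\<psi>_word (initial_word n \<omega>) (p a)) - f (\<psi>_word (initial_word k \<omega>) (p b))\<bar> \<le> osc * sqrt (B * rmax ^ n)"
proof -
  have w: "initial_word j \<omega> \<in> Adm" for j by (rule adm_sequences_Adm[OF assms(1)])
  have B: "tree_sum (en f f) (initial_word j \<omega>) \<le> B" for j
    using order_trans[OF tree_sum_le_level_energy[OF w[of j], of "Suc 0" f] assms(5)] by simp
  have B0: "0 \<le> B"
    using order_trans[OF order_trans[OF en_nonneg[OF w[of 0]] en_le_tree_sum[OF w]] B] .
  have "osc * sqrt (B * r_word (initial_word n \<omega>)) \<le> osc * sqrt (B * rmax ^ n)"
    using r_word_le[OF w[of n]] osc_bounds(2) B0 by (intro mult_left_mono real_sqrt_le_mono) auto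
  then show ?thesis using osc_sequence[OF assms(1-4) B] by (rule order_trans[rotated])
qed

lemma continuous_osc_coding:
  assumes "continuous_on gasket f" "\<omega> \<in> adm_sequences" "a \<in> {1,2,3}"
    and B: "\<And>j. j \<ge> n \<Longrightarrow> tree_sum (en f f) (initial_word j \<omega>) \<le> B"
  shows "\<bar>f (\<psi>_word (initial_word n \<omega>) (p a)) - f (coding \<omega>)\<bar> \<le> osc * sqrt (B * r_word (initial_word n \<omega>))"
proof -
  have sp: "\<omega> \<in> space word_space" using assms(2) by (simp add: adm_sequences_iff)
  have "(\<lambda>k. f (\<psi>_word (initial_word k \<omega>) (p 1))) \<longlonglongrightarrow> f (coding \<omega>)"
  proof (rule continuous_on_tendsto_compose[OF assms(1)])
    show "coding \<omega> \<in> gasket" using assms(2) by (auto simp: gasket_def)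
    show "\<forall>\<^sub>F k in sequentially. \<psi>_word (initial_word k \<omega>) (p 1) \<in> gasket"
      using vertex_gasket adm_sequences_Adm[OF assms(2)] by simp
  qed (use vertex_LIMSEQ_coding[OF sp, of 1] in simp)
  then have "(\<lambda>k. \<bar>f (\<psi>_word (initial_word n \<omega>) (p a)) - f (\<psi>_word (initial_word k \<omega>) (p 1))\<bar>)
      \<longlonglongrightarrow> \<bar>f (\<psi>_word (initial_word n \<omega>) (p a)) - f (coding \<omega>)\<bar>"
    by (intro tendsto_intros)
  then show ?thesis
  proof (rule LIMSEQ_le_const2)
    have "\<bar>f (\<psi>_word (initial_word n \<omega>) (p a)) - f (\<psi>_word (initial_word k \<omega>) (p 1))\<bar>
        \<le> osc * sqrt (B * r_word (initial_word n \<omega>))" if "k \<ge> n" for k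
      by (rule osc_sequence[OF assms(2) that assms(3)]) (use B in auto)
    then show "\<exists>N. \<forall>k\<ge>N. \<bar>f (\<psi>_word (initial_word n \<omega>) (p a)) - f (\<psi>_word (initial_word k \<omega>) (p 1))\<bar>
        \<le> osc * sqrt (B * r_word (initial_word n \<omega>))" by blast
  qed
qed

text \<open>Finite energy makes the vertex values uniformly Cauchy along admissible sequences. The
  limit depends on the coded point alone, because two cells of one level that meet share a vertex;
  the same comparison proves continuity.\<close>

lemma extension_exists:
  assumes "fin_energy f"
  shows "\<exists>g. continuous_on gasket g \<and> (\<forall>w\<in>Adm. \<forall>a\<in>{1,2,3}. g (\<psi>_word w (p a)) = f (\<psi>_word w (p a)))"
proof -
  obtain B where B: "\<And>n. level_energy n f f \<le> B" using assms unfolding fin_energy_def by auto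
  define e where "e n = osc * sqrt (B * rmax ^ n)" for n
  have e0: "e \<longlonglongrightarrow> 0" unfolding e_def by (rule osc_tendsto)
  define x where "x \<omega> n = f (\<psi>_word (initial_word n \<omega>) (p 1))" for \<omega> n
  have osc_x: "\<bar>f (\<psi>_word (initial_word n \<omega>) (p a)) - x \<omega> k\<bar> \<le> e n"
    if "\<omega> \<in> adm_sequences" "n \<le> k" "a \<in> {1,2,3}" for \<omega> n k a
    unfolding x_def e_def by (rule osc_sequence_uniform[OF that _ B]) simp
  have "convergent (x \<omega>)" if \<omega>: "\<omega> \<in> adm_sequences" for \<omega>
  proof -
    have "Cauchy (x \<omega>)"
    proof (rule metric_CauchyI)
      fix \<epsilon> :: real assume "\<epsilon> > 0"
      have "\<forall>\<^sub>F n in sequentially. e n < \<epsilon> / 2"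
        by (rule order_tendstoD(2)[OF e0]) (use \<open>\<epsilon> > 0\<close> in simp)
      then obtain N where N: "e N < \<epsilon> / 2" unfolding eventually_sequentially by blast
      have "dist (x \<omega> m) (x \<omega> n) < \<epsilon>" if "m \<ge> N" "n \<ge> N" for m n
        using osc_x[OF \<omega> that(1), of 1] osc_x[OF \<omega> that(2), of 1] N unfolding dist_real_def by simp
      then show "\<exists>M. \<forall>m\<ge>M. \<forall>n\<ge>M. dist (x \<omega> m) (x \<omega> n) < \<epsilon>" by blast
    qed
    then show ?thesis by (rule Cauchy_convergent)
  qed
  then have xlim: "x \<omega> \<longlonglongrightarrow> lim (x \<omega>)" if "\<omega> \<in> adm_sequences" for \<omega>
    using that convergent_LIMSEQ_iff by blast
  have osc_lim: "\<bar>f (\<psi>_word (initial_word n \<omega>) (p a)) - lim (x \<omega>)\<bar> \<le> e n"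
    if \<omega>: "\<omega> \<in> adm_sequences" and a: "a \<in> {1,2,3}" for \<omega> n a
  proof (rule LIMSEQ_le_const2)
    show "(\<lambda>k. \<bar>f (\<psi>_word (initial_word n \<omega>) (p a)) - x \<omega> k\<bar>) \<longlonglongrightarrow> \<bar>f (\<psi>_word (initial_word n \<omega>) (p a)) - lim (x \<omega>)\<bar>"
      by (intro tendsto_intros xlim[OF \<omega>])
    show "\<exists>N. \<forall>k\<ge>N. \<bar>f (\<psi>_word (initial_word n \<omega>) (p a)) - x \<omega> k\<bar> \<le> e n"
      using osc_x[OF \<omega> _ a] by blast
  qed
  \<comment> \<open>One \<open>e n\<close> for each sequence, from its limit to the value at a
    common vertex of the two cells of level \<open>n\<close>.\<close>
  have close: "\<bar>lim (x \<omega>) - lim (x \<omega>')\<bar> \<le> 2 * e n"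
    if \<omega>: "\<omega> \<in> adm_sequences" "\<omega>' \<in> adm_sequences" and z: "coding \<omega> \<in> cell (initial_word n \<omega>')" for \<omega> \<omega>' n
  proof -
    have sp: "\<omega> \<in> space word_space" using \<omega> by (simp add: adm_sequences_iff)
    have "\<exists>a\<in>{1,2,3}. \<exists>b\<in>{1,2,3}. \<psi>_word (initial_word n \<omega>) (p a) = \<psi>_word (initial_word n \<omega>') (p b)"
    proof (cases "initial_word n \<omega> = initial_word n \<omega>'")
      case False
      obtain y where y: "y \<in> triangle" "coding \<omega> = \<psi>_word (initial_word n \<omega>) y"
        using coding_cell[OF sp, of n] unfolding cell_def by blast
      obtain y' where y': "y' \<in> triangle" "coding \<omega> = \<psi>_word (initial_word n \<omega>') y'"
        using z unfolding cell_def by blast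
      note A = adm_sequences_Adm[OF \<omega>(1), of n] adm_sequences_Adm[OF \<omega>(2), of n]
      have "y \<in> V0" by (rule Adm_meet[OF A _ False y(1) y'(1)]) (use y y' in simp_all)
      moreover have "y' \<in> V0" by (rule Adm_meet[OF A(2,1) _ False[symmetric] y'(1) y(1)]) (use y y' in simp_all)
      ultimately show ?thesis using y(2) y'(2) by auto
    qed auto
    then obtain a b where ab: "a \<in> {1,2,3}" "b \<in> {1,2,3}" "\<psi>_word (initial_word n \<omega>) (p a) = \<psi>_word (initial_word n \<omega>') (p b)"
      by blast
    show ?thesis
      using osc_lim[OF \<omega>(1) ab(1), of n] osc_lim[OF \<omega>(2) ab(2), of n] unfolding ab(3) by linarith
  qed
  have eq: "lim (x \<omega>) = lim (x \<omega>')"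
    if \<omega>: "\<omega> \<in> adm_sequences" "\<omega>' \<in> adm_sequences" and z: "coding \<omega> = coding \<omega>'" for \<omega> \<omega>'
  proof -
    have "\<bar>lim (x \<omega>) - lim (x \<omega>')\<bar> \<le> 2 * 0"
    proof (rule LIMSEQ_le_const)
      show "(\<lambda>n. 2 * e n) \<longlonglongrightarrow> 2 * 0" by (intro tendsto_intros e0)
      have "coding \<omega> \<in> cell (initial_word n \<omega>')" for n
        unfolding z by (rule coding_cell) (use \<omega> in \<open>simp add: adm_sequences_iff\<close>)
      then show "\<exists>N. \<forall>n\<ge>N. \<bar>lim (x \<omega>) - lim (x \<omega>')\<bar> \<le> 2 * e n" using close[OF \<omega>] by blast
    qed
    then show ?thesis by simp
  qed
  define g where "g z = lim (x (SOME \<omega>. \<omega> \<in> adm_sequences \<and> coding \<omega> = z))" for z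
  have g: "g (coding \<omega>) = lim (x \<omega>)" if \<omega>: "\<omega> \<in> adm_sequences" for \<omega>
  proof -
    have "(SOME \<omega>'. \<omega>' \<in> adm_sequences \<and> coding \<omega>' = coding \<omega>) \<in> adm_sequences \<and>
        coding (SOME \<omega>'. \<omega>' \<in> adm_sequences \<and> coding \<omega>' = coding \<omega>) = coding \<omega>"
      by (rule someI[of "\<lambda>\<omega>'. \<omega>' \<in> adm_sequences \<and> coding \<omega>' = coding \<omega>" \<omega>]) (use \<omega> in simp)
    then show ?thesis unfolding g_def using eq[OF _ \<omega>] by blast
  qed
  have "continuous_on gasket g"
    unfolding continuous_on_topological
  proof (intro ballI allI impI)
    fix z U assume z: "z \<in> gasket" and U: "open U" "g z \<in> U"
    obtain \<epsilon> where \<epsilon>: "\<epsilon> > 0" "ball (g z) \<epsilon> \<subseteq> U" using U openE by blast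
    have "\<forall>\<^sub>F n in sequentially. e n < \<epsilon> / 2" by (rule order_tendstoD(2)[OF e0]) (use \<epsilon> in simp)
    then obtain n where n: "e n < \<epsilon> / 2" unfolding eventually_sequentially by blast
    \<comment> \<open>Removing the finitely many cells of level \<open>n\<close> that miss
      \<open>z\<close> leaves an open set around \<open>z\<close>; any level-\<open>n\<close> cell
      through one of its points contains \<open>z\<close>.\<close>
    define A where "A = - (\<Union>w\<in>{w \<in> adm_words n. z \<notin> cell w}. cell w)"
    have "closed (\<Union>w\<in>{w \<in> adm_words n. z \<notin> cell w}. cell w)"
    proof (rule closed_UN)
      show "finite {w \<in> adm_words n. z \<notin> cell w}" using finite_adm_words by simp
      show "\<forall>w\<in>{w \<in> adm_words n. z \<notin> cell w}. closed (cell w)"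
        by (auto simp: adm_words_Adm intro!: compact_imp_closed compact_cell Adm_lists)
    qed
    then have "open A" unfolding A_def by (rule open_Compl)
    moreover have "z \<in> A" by (simp add: A_def)
    moreover have "g y \<in> U" if y: "y \<in> gasket" "y \<in> A" for y
    proof -
      obtain \<omega> where \<omega>: "\<omega> \<in> adm_sequences" "z = coding \<omega>" using z unfolding gasket_def by blast
      obtain \<omega>' where \<omega>': "\<omega>' \<in> adm_sequences" "y = coding \<omega>'" using y(1) unfolding gasket_def by blast
      have "y \<in> cell (initial_word n \<omega>')"
        unfolding \<omega>'(2) by (rule coding_cell) (use \<omega>' in \<open>simp add: adm_sequences_iff\<close>)
      moreover have "initial_word n \<omega>' \<in> adm_words n" using \<omega>'(1) by (simp add: adm_sequences_def)
      ultimately have "z \<in> cell (initial_word n \<omega>')" using y(2) unfolding A_def by blast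
      then have "\<bar>lim (x \<omega>) - lim (x \<omega>')\<bar> \<le> 2 * e n" using close[OF \<omega>(1) \<omega>'(1)] \<omega>(2) by simp
      then have "dist (g z) (g y) < \<epsilon>" using g[OF \<omega>(1)] g[OF \<omega>'(1)] \<omega>(2) \<omega>'(2) n by (simp add: dist_real_def)
      then show ?thesis using \<epsilon>(2) by auto
    qed
    ultimately show "\<exists>A. open A \<and> z \<in> A \<and> (\<forall>y\<in>gasket. y \<in> A \<longrightarrow> g y \<in> U)" by blast
  qed
  moreover have "g (\<psi>_word w (p a)) = f (\<psi>_word w (p a))" if w: "w \<in> Adm" and a: "a \<in> {1,2,3}" for w a
  proof -
    obtain \<omega> where \<omega>: "\<omega> \<in> adm_sequences" "\<And>n. initial_word (length w + n) \<omega> = corner_ext a w n"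
      "coding \<omega> = \<psi>_word w (p a)" using corner_sequence_ex[OF w a] by blast
    have "\<bar>f (\<psi>_word w (p a)) - lim (x \<omega>)\<bar> \<le> 0"
    proof (rule LIMSEQ_le_const[OF e0])
      have "\<bar>f (\<psi>_word w (p a)) - lim (x \<omega>)\<bar> \<le> e n" if "n \<ge> length w" for n
      proof -
        have "\<psi>_word (initial_word n \<omega>) (p a) = \<psi>_word w (p a)"
          using \<omega>(2)[of "n - length w"] that \<psi>_word_corner_ext[OF w a] by simp
        then show ?thesis using osc_lim[OF \<omega>(1) a, of n] by simp
      qed
      then show "\<exists>N. \<forall>n\<ge>N. \<bar>f (\<psi>_word w (p a)) - lim (x \<omega>)\<bar> \<le> e n" by blast
    qed
    then show ?thesis using g[OF \<omega>(1)] \<omega>(3) by simp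
  qed
  ultimately show ?thesis by blast
qed

section \<open>Harmonic interpolation from a given level\<close>

text \<open>One level of interpolation: the vertices that are new at level \<open>n + 1\<close>
  receive the harmonic values of their level-\<open>n\<close> cell. A point may be represented
  through several cells, hence the choice.\<close>

definition refine :: "nat \<Rightarrow> (plane \<Rightarrow> real) \<Rightarrow> plane \<Rightarrow> real" where
  "refine n f z = (if \<exists>w y. w \<in> adm_words n \<and> y \<in> V1 (L w) \<and> z = \<psi>_word w y
     then (case SOME (w, y). w \<in> adm_words n \<and> y \<in> V1 (L w) \<and> z = \<psi>_word w y of
       (w, y) \<Rightarrow> hext (L w) (f \<circ> \<psi>_word w) y)
     else f z)"

text \<open>The choice is harmless: a point common to two different cells is a corner of both, and
  there either extension returns the value of \<open>f\<close>.\<close>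

lemma refine_eq:
  assumes "w \<in> adm_words n" "y \<in> V1 (L w)"
  shows "refine n f (\<psi>_word w y) = hext (L w) (f \<circ> \<psi>_word w) y"
proof -
  let ?P = "\<lambda>(w', y'). w' \<in> adm_words n \<and> y' \<in> V1 (L w') \<and> \<psi>_word w y = \<psi>_word w' y'"
  obtain w' y' where s: "(SOME wy. ?P wy) = (w', y')" by fastforce
  have "?P (SOME wy. ?P wy)" by (rule someI[of ?P "(w, y)"]) (use assms in simp)
  then have P: "w' \<in> adm_words n" "y' \<in> V1 (L w')" "\<psi>_word w y = \<psi>_word w' y'" unfolding s by auto
  have ex: "\<exists>w' y'. w' \<in> adm_words n \<and> y' \<in> V1 (L w') \<and> \<psi>_word w y = \<psi>_word w' y'" using assms by blast
  have A: "w \<in> Adm" "w' \<in> Adm" "length w = length w'" using assms(1) P(1) by (auto simp: adm_words_Adm)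
  note ge = L_ge[OF A(1)] L_ge[OF A(2)]
  have "hext (L w') (f \<circ> \<psi>_word w') y' = hext (L w) (f \<circ> \<psi>_word w) y"
  proof (cases "w = w'")
    case True
    then show ?thesis using P(3) \<psi>_word_inj[OF Adm_lists[OF A(1)]] by blast
  next
    case False
    have y: "y \<in> triangle" "y' \<in> triangle" using V1_triangle[OF ge(1) assms(2)] V1_triangle[OF ge(2) P(2)] by auto
    have "y \<in> V0" by (rule Adm_meet[OF A(1,2,3) False y P(3)])
    then obtain a where a: "a \<in> {1,2,3}" "y = p a" by blast
    have "y' \<in> V0" by (rule Adm_meet[OF A(2,1) A(3)[symmetric] False[symmetric] y(2,1) P(3)[symmetric]])
    then obtain b where b: "b \<in> {1,2,3}" "y' = p b" by blast
    show ?thesis using hext_p[OF ge(1) a(1)] hext_p[OF ge(2) b(1)] P(3) by (simp add: a(2) b(2))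
  qed
  then show ?thesis unfolding refine_def using ex s by simp
qed

lemma refine_vertex:
  assumes "w \<in> adm_words n" "a \<in> {1,2,3}"
  shows "refine n f (\<psi>_word w (p a)) = f (\<psi>_word w (p a))"
proof -
  have "L w \<ge> 2" using assms(1) L_ge adm_words_Adm by blast
  then show ?thesis
    using refine_eq[OF assms(1), of "p a"] V0_subset_V1[of "L w"] hext_p[of "L w" a] assms(2) by auto
qed

definition vertices :: "nat \<Rightarrow> plane set" where
  "vertices n = {\<psi>_word w (p a) | w a. w \<in> adm_words n \<and> a \<in> {1,2,3}}"

lemma verticesI: "w \<in> adm_words n \<Longrightarrow> a \<in> {1,2,3} \<Longrightarrow> \<psi>_word w (p a) \<in> vertices n"
  unfolding vertices_def by blast

lemma vertices_mono: "m \<le> n \<Longrightarrow> vertices m \<subseteq> vertices n"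
proof
  fix z assume "m \<le> n" "z \<in> vertices m"
  then obtain w a where w: "w \<in> Adm" "length w = m" "a \<in> {1,2,3}" "z = \<psi>_word w (p a)"
    unfolding vertices_def adm_words_Adm by blast
  have "corner_ext a w (n - m) \<in> adm_words n"
    using corner_ext_Adm[OF w(1,3)] w(2) \<open>m \<le> n\<close> by (simp add: adm_words_Adm)
  then show "z \<in> vertices n" using verticesI[OF _ w(3)] \<psi>_word_corner_ext[OF w(1,3)] w(4) by metis
qed

text \<open>Iterate \<open>refine\<close>. Vertices of one level are never changed at later levels,
  so the values stabilise and harmonicity can be read off one level at a time.\<close>

lemma harmonic_refinement:
  obtains g where "\<And>z. z \<in> vertices m \<Longrightarrow> g z = f z"
    "\<And>w. w \<in> Adm \<Longrightarrow> length w \<ge> m \<Longrightarrow> harm (L w) (g \<circ> \<psi>_word w)"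
proof -
  define F where "F = rec_nat f (\<lambda>k h. refine (m + k) h)"
  have F: "F 0 = f" "F (Suc k) = refine (m + k) (F k)" for k by (simp_all add: F_def)
  have Fv: "F (k + d) z = F k z" if "z \<in> vertices (m + k)" for k d z
  proof (induction d)
    case (Suc d)
    have "z \<in> vertices (m + (k + d))" using that vertices_mono[of "m + k" "m + (k + d)"] by auto
    then obtain w a where "w \<in> adm_words (m + (k + d))" "a \<in> {1,2,3}" "z = \<psi>_word w (p a)"
      unfolding vertices_def by blast
    then show ?case using Suc refine_vertex F(2)[of "k + d"] by simp
  qed simp
  \<comment> \<open>A vertex keeps the value it had at the first level where it occurs. Points that
    are never vertices get arbitrary values here; the continuous extension settles them
    afterwards.\<close>
  define g where "g z = F (LEAST k. z \<in> vertices (m + k)) z" for z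
  have g: "g z = F k z" if "z \<in> vertices (m + k)" for k z
  proof -
    define k0 where "k0 = (LEAST k. z \<in> vertices (m + k))"
    have k0: "z \<in> vertices (m + k0)" unfolding k0_def by (rule LeastI[of "\<lambda>k. z \<in> vertices (m + k)", OF that])
    have "k0 \<le> k" unfolding k0_def by (rule Least_le[of "\<lambda>k. z \<in> vertices (m + k)", OF that])
    then show ?thesis using Fv[OF k0, of "k - k0"] unfolding g_def k0_def[symmetric] by simp
  qed
  show ?thesis
  proof (rule that)
    show "g z = f z" if "z \<in> vertices m" for z using g[of z 0] that F(1) by simp
    fix w assume w: "w \<in> Adm" "length w \<ge> m"
    define k where "k = length w - m"
    have k: "length w = m + k" using w(2) by (simp add: k_def)
    have wa: "w \<in> adm_words (m + k)" using w(1) k by (simp add: adm_words_Adm)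
    note ge = L_ge[OF w(1)]
    have "hext (L w) (F k \<circ> \<psi>_word w) y = (g \<circ> \<psi>_word w) y" if y: "y \<in> V1 (L w)" for y
    proof -
      obtain v a where v: "v \<in> letters (L w)" "a \<in> {1,2,3}" "y = \<psi> (snd v) (fst v) (p a)"
        using V1_letter[OF ge y] .
      have "w @ [v] \<in> adm_words (m + Suc k)" using w(1) v(1) k by (simp only: adm_words_Adm Adm_snoc) simp
      then have "\<psi>_word w y \<in> vertices (m + Suc k)"
        using verticesI[OF _ v(2), of "w @ [v]"] v(3) by (simp add: \<psi>_word_append)
      then have "g (\<psi>_word w y) = F (Suc k) (\<psi>_word w y)" by (rule g)
      also have "\<dots> = hext (L w) (F k \<circ> \<psi>_word w) y" unfolding F(2) by (rule refine_eq[OF wa y])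
      finally show ?thesis by simp
    qed
    then show "harm (L w) (g \<circ> \<psi>_word w)" by (rule harm_cong[OF harm_hext[OF ge]])
  qed
qed

lemma tree_sum_pow_en_harm:
  assumes "\<And>w. w \<in> Adm \<Longrightarrow> length w \<ge> m \<Longrightarrow> harm (L w) (g \<circ> \<psi>_word w)" "w \<in> Adm" "length w \<ge> m"
  shows "(tree_sum ^^ n) (en g h) w = en g h w"
proof (induction n)
  case (Suc n)
  have "(tree_sum ^^ n) (tree_sum (en g h)) w = (tree_sum ^^ n) (en g h) w"
    by (rule tree_sum_pow_cong[OF assms(2)]) (rule tree_sum_en_harm, use assms in auto)
  then show ?case using Suc by (simp add: funpow_swap1)
qed simp

lemma level_energy_harm:
  assumes "\<And>w. w \<in> Adm \<Longrightarrow> length w \<ge> m \<Longrightarrow> harm (L w) (g \<circ> \<psi>_word w)" "n \<ge> m"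
  shows "level_energy n g h = level_energy m g h"
proof -
  have "level_energy n g h = (tree_sum ^^ m) ((tree_sum ^^ (n - m)) (en g h)) []"
    unfolding level_energy_eq tree_sum_pow_add using assms(2) by simp
  also have "\<dots> = (tree_sum ^^ m) (en g h) []"
    unfolding sum_adm_words[symmetric]
    by (intro sum.cong refl tree_sum_pow_en_harm[OF assms(1)]) (auto simp: adm_words_Adm)
  finally show ?thesis unfolding level_energy_eq .
qed

lemma en_cong:
  "(\<And>a. a \<in> {1,2,3} \<Longrightarrow> f (\<psi>_word w (p a)) = f' (\<psi>_word w (p a))) \<Longrightarrow>
   (\<And>a. a \<in> {1,2,3} \<Longrightarrow> g (\<psi>_word w (p a)) = g' (\<psi>_word w (p a))) \<Longrightarrow> en f g w = en f' g' w"
  unfolding en_def by (intro arg_cong2[of _ _ _ _ "(/)"] Q_cong) auto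

lemma level_energy_cong:
  "(\<And>z. z \<in> vertices n \<Longrightarrow> f z = f' z) \<Longrightarrow> (\<And>z. z \<in> vertices n \<Longrightarrow> g z = g' z) \<Longrightarrow> level_energy n f g = level_energy n f' g'"
  unfolding level_energy_eq sum_adm_words[symmetric] by (intro sum.cong refl en_cong) (auto simp: verticesI)

text \<open>From level \<open>m\<close> on the energy is conserved, hence bounded, so the vertex
  values extend continuously. Harmonicity survives since it involves vertices only.\<close>

lemma harmonic_extension:
  obtains g where "g \<in> form_domain" "\<And>z. z \<in> vertices m \<Longrightarrow> g z = f z"
    "\<And>w. w \<in> Adm \<Longrightarrow> length w \<ge> m \<Longrightarrow> harm (L w) (g \<circ> \<psi>_word w)"
proof -
  obtain h where h: "\<And>z. z \<in> vertices m \<Longrightarrow> h z = f z"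
    "\<And>w. w \<in> Adm \<Longrightarrow> length w \<ge> m \<Longrightarrow> harm (L w) (h \<circ> \<psi>_word w)"
    using harmonic_refinement[of m f] by blast
  have fin: "fin_energy h"
    unfolding fin_energy_def
  proof (intro exI allI)
    fix n
    have "level_energy n h h \<le> level_energy (max n m) h h"
      using incseq_level_energy by (simp add: incseq_def)
    also have "\<dots> = level_energy m h h" by (rule level_energy_harm[OF h(2)]) auto
    finally show "level_energy n h h \<le> level_energy m h h" .
  qed
  obtain g where g: "continuous_on gasket g" "\<And>w a. w \<in> Adm \<Longrightarrow> a \<in> {1,2,3} \<Longrightarrow> g (\<psi>_word w (p a)) = h (\<psi>_word w (p a))"
    using extension_exists[OF fin] by blast
  have gv: "g z = h z" if "z \<in> vertices n" for z n
    using that g(2) unfolding vertices_def by (auto simp: adm_words_Adm)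
  show ?thesis
  proof (rule that)
    have "level_energy n g g = level_energy n h h" for n by (intro level_energy_cong gv)
    then show "g \<in> form_domain" using g(1) fin unfolding form_domain_iff fin_energy_def by simp
    show "g z = f z" if "z \<in> vertices m" for z using gv[OF that] h(1)[OF that] by simp
    fix w assume w: "w \<in> Adm" "length w \<ge> m"
    show "harm (L w) (g \<circ> \<psi>_word w)"
    proof (rule harm_cong[OF h(2)[OF w]])
      fix y assume y: "y \<in> V1 (L w)"
      obtain v a where v: "v \<in> letters (L w)" "a \<in> {1,2,3}" "y = \<psi> (snd v) (fst v) (p a)"
        using V1_letter[OF L_ge[OF w(1)] y] .
      have "w @ [v] \<in> Adm" using w(1) v(1) by (simp add: Adm_snoc)
      then show "(h \<circ> \<psi>_word w) y = (g \<circ> \<psi>_word w) y"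
        using g(2)[of "w @ [v]" a] v(2,3) by (simp add: \<psi>_word_append)
    qed
  qed
qed

lemma form_domain_fin: "f \<in> form_domain \<Longrightarrow> fin_energy f"
  and form_domain_cont: "f \<in> form_domain \<Longrightarrow> continuous_on gasket f"
  by (simp_all add: form_domain_iff)

lemma form_domain_osc:
  assumes "f \<in> form_domain"
  obtains B where "B \<ge> 0" "\<And>n \<omega> a. \<omega> \<in> adm_sequences \<Longrightarrow> a \<in> {1,2,3} \<Longrightarrow>
    \<bar>f (\<psi>_word (initial_word n \<omega>) (p a)) - f (coding \<omega>)\<bar> \<le> osc * sqrt (B * rmax ^ n)"
proof -
  obtain B where B: "\<And>n. level_energy n f f \<le> B"
    using form_domain_fin[OF assms] unfolding fin_energy_def by auto
  have "level_energy 0 f f \<ge> 0" unfolding level_energy_eq by (simp add: en_nonneg)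
  then have B0: "B \<ge> 0" using B[of 0] by linarith
  show ?thesis
  proof (rule that[OF B0])
    fix n \<omega> and a :: nat assume \<omega>: "\<omega> \<in> adm_sequences" and a: "a \<in> {1,2,3}"
    have w: "initial_word j \<omega> \<in> Adm" for j by (rule adm_sequences_Adm[OF \<omega>])
    have B': "tree_sum (en f f) (initial_word j \<omega>) \<le> B" for j
      using order_trans[OF tree_sum_le_level_energy[OF w[of j], of "Suc 0" f] B] by simp
    have "osc * sqrt (B * r_word (initial_word n \<omega>)) \<le> osc * sqrt (B * rmax ^ n)"
      using r_word_le[OF w[of n]] osc_bounds(2) B0 by (intro mult_left_mono real_sqrt_le_mono) auto
    then show "\<bar>f (\<psi>_word (initial_word n \<omega>) (p a)) - f (coding \<omega>)\<bar> \<le> osc * sqrt (B * rmax ^ n)"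
      using continuous_osc_coding[OF form_domain_cont[OF assms] \<omega> a, of n B] B' by (simp add: order_trans)
  qed
qed

lemma form_domain_bounded:
  assumes "f \<in> form_domain"
  obtains M where "M \<ge> 0" "\<And>z. z \<in> gasket \<Longrightarrow> \<bar>f z\<bar> \<le> M"
proof -
  obtain B where B: "B \<ge> 0" "\<And>n \<omega> a. \<omega> \<in> adm_sequences \<Longrightarrow> a \<in> {1,2,3} \<Longrightarrow>
    \<bar>f (\<psi>_word (initial_word n \<omega>) (p a)) - f (coding \<omega>)\<bar> \<le> osc * sqrt (B * rmax ^ n)"
    using form_domain_osc[OF assms] by blast
  show ?thesis
  proof (rule that)
    show "\<bar>f (p 1)\<bar> + osc * sqrt B \<ge> 0" using osc_bounds B(1) by simp
    fix z assume "z \<in> gasket"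
    then obtain \<omega> where \<omega>: "\<omega> \<in> adm_sequences" "z = coding \<omega>" unfolding gasket_def by blast
    show "\<bar>f z\<bar> \<le> \<bar>f (p 1)\<bar> + osc * sqrt B" using B(2)[OF \<omega>(1), of 1 0] \<omega>(2) by simp
  qed
qed

lemma Q_mult_le:
  assumes "\<And>a. a \<in> {1,2,3} \<Longrightarrow> \<bar>x (p a)\<bar> \<le> M" "\<And>a. a \<in> {1,2,3} \<Longrightarrow> \<bar>y (p a)\<bar> \<le> N"
  shows "Q (\<lambda>v. x v * y v) (\<lambda>v. x v * y v) \<le> 2 * N\<^sup>2 * Q x x + 2 * M\<^sup>2 * Q y y"
proof -
  have edge: "(x1 * y1 - x2 * y2) * (x1 * y1 - x2 * y2) \<le> 2 * N\<^sup>2 * ((x1 - x2) * (x1 - x2)) + 2 * M\<^sup>2 * ((y1 - y2) * (y1 - y2))"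
    if "\<bar>x2\<bar> \<le> M" "\<bar>y1\<bar> \<le> N" for x1 x2 y1 y2 :: real
  proof -
    have e: "x1 * y1 - x2 * y2 = (x1 - x2) * y1 + x2 * (y1 - y2)" by (simp add: algebra_simps)
    have "(x1 * y1 - x2 * y2)\<^sup>2 \<le> 2 * ((x1 - x2) * y1)\<^sup>2 + 2 * (x2 * (y1 - y2))\<^sup>2"
      unfolding e using sum_squares_ge_zero[of "(x1 - x2) * y1 - x2 * (y1 - y2)" 0]
      by (simp add: power2_eq_square algebra_simps)
    also have "\<dots> \<le> 2 * ((x1 - x2)\<^sup>2 * N\<^sup>2) + 2 * (M\<^sup>2 * (y1 - y2)\<^sup>2)"
      unfolding power_mult_distrib
      using that by (intro add_mono mult_left_mono mult_right_mono power2_le_iff_abs_le[THEN iffD2]) auto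
    finally show ?thesis by (simp add: power2_eq_square algebra_simps)
  qed
  have "Q (\<lambda>v. x v * y v) (\<lambda>v. x v * y v) \<le>
     (2 * N\<^sup>2 * ((x (p 1) - x (p 2)) * (x (p 1) - x (p 2))) + 2 * M\<^sup>2 * ((y (p 1) - y (p 2)) * (y (p 1) - y (p 2)))) +
     (2 * N\<^sup>2 * ((x (p 2) - x (p 3)) * (x (p 2) - x (p 3))) + 2 * M\<^sup>2 * ((y (p 2) - y (p 3)) * (y (p 2) - y (p 3)))) +
     (2 * N\<^sup>2 * ((x (p 3) - x (p 1)) * (x (p 3) - x (p 1))) + 2 * M\<^sup>2 * ((y (p 3) - y (p 1)) * (y (p 3) - y (p 1))))"
    unfolding Q_eq by (intro add_mono edge assms) auto
  also have "\<dots> = 2 * N\<^sup>2 * Q x x + 2 * M\<^sup>2 * Q y y"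
    unfolding Q_eq by (simp add: distrib_left)
  finally show ?thesis .
qed

text \<open>The domain must be an algebra because energy measures are tested with
  \<open>f * g\<close> and the square of \<open>f\<close>. Boundedness of both factors and the
  discrete product rule control the energy.\<close>

lemma form_domain_mult:
  assumes "f \<in> form_domain" "g \<in> form_domain"
  shows "(\<lambda>x. f x * g x) \<in> form_domain"
proof -
  obtain M where M: "M \<ge> 0" "\<And>z. z \<in> gasket \<Longrightarrow> \<bar>f z\<bar> \<le> M" using form_domain_bounded[OF assms(1)] by blast
  obtain N where N: "N \<ge> 0" "\<And>z. z \<in> gasket \<Longrightarrow> \<bar>g z\<bar> \<le> N" using form_domain_bounded[OF assms(2)] by blast
  obtain A B where AB: "\<And>n. level_energy n f f \<le> A" "\<And>n. level_energy n g g \<le> B"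
    using assms[THEN form_domain_fin] unfolding fin_energy_def by auto
  let ?h = "\<lambda>x. f x * g x"
  have "level_energy n ?h ?h \<le> 2 * N\<^sup>2 * A + 2 * M\<^sup>2 * B" for n
  proof -
    have "level_energy n ?h ?h \<le> (tree_sum ^^ n) (\<lambda>w. 2 * N\<^sup>2 * en f f w + 2 * M\<^sup>2 * en g g w) []"
      unfolding level_energy_eq
    proof (rule tree_sum_pow_mono)
      fix w assume w: "w \<in> Adm"
      have "Q (?h \<circ> \<psi>_word w) (?h \<circ> \<psi>_word w) \<le> 2 * N\<^sup>2 * Q (f \<circ> \<psi>_word w) (f \<circ> \<psi>_word w) + 2 * M\<^sup>2 * Q (g \<circ> \<psi>_word w) (g \<circ> \<psi>_word w)"
        using Q_mult_le[of "f \<circ> \<psi>_word w" M "g \<circ> \<psi>_word w" N] M(2) N(2) vertex_gasket[OF w]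
        by (simp add: comp_def)
      then show "en ?h ?h w \<le> 2 * N\<^sup>2 * en f f w + 2 * M\<^sup>2 * en g g w"
        unfolding en_def using r_word_pos[OF w]
        by (simp add: divide_right_mono add_divide_distrib[symmetric] less_imp_le)
    qed simp
    also have "\<dots> = 2 * N\<^sup>2 * level_energy n f f + 2 * M\<^sup>2 * level_energy n g g"
      unfolding tree_sum_pow_linear level_energy_eq ..
    also have "\<dots> \<le> 2 * N\<^sup>2 * A + 2 * M\<^sup>2 * B" by (intro add_mono mult_left_mono AB) auto
    finally show ?thesis .
  qed
  then have "fin_energy ?h" unfolding fin_energy_def by blast
  moreover have "continuous_on gasket ?h" using assms[THEN form_domain_cont] by (intro continuous_intros)
  ultimately show ?thesis by (simp add: form_domain_iff)
qed

section \<open>Measures on the word space\<close>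

lemma finite_alphabet: "finite alphabet"
  unfolding alphabet_def using T_finite finite_letters by auto

lemma alphabet_ne: "alphabet \<noteq> {}"
proof -
  obtain \<nu> where \<nu>: "\<nu> \<in> T" using T_nonempty by auto
  then have "(1, \<nu>) \<in> letters \<nu>" by (intro corner_letter T_ge) auto
  then show ?thesis unfolding alphabet_def using \<nu> by blast
qed

lemma letters_alphabet: "w \<in> Adm \<Longrightarrow> letters (L w) \<subseteq> alphabet"
  unfolding alphabet_def using L_T by blast

lemma Adm_conv_snoc_alphabet: "w \<in> Adm \<Longrightarrow> (\<Sum>v\<in>alphabet. if w @ [v] \<in> Adm then a (w @ [v]) else 0) = tree_sum a w"
  unfolding tree_sum_def
  by (rule sum.mono_neutral_cong_right[OF finite_alphabet letters_alphabet]) (auto simp: Adm_snoc)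

section \<open>Construction of measures from additive cylinder functions\<close>

text \<open>A finite word in the shape of a history for the Ionescu-Tulcea theorem: a function on
  \<open>{0..<n}\<close>, undefined beyond.\<close>

definition word_fun :: "letter list \<Rightarrow> nat \<Rightarrow> letter" where
  "word_fun w = (\<lambda>i\<in>{0..<length w}. w ! i)"

lemma word_fun_snoc: "word_fun (w @ [v]) = (word_fun w)(length w := v)"
  by (auto simp: word_fun_def fun_eq_iff nth_append)

lemma word_fun_space: "w \<in> lists alphabet \<Longrightarrow> word_fun w \<in> {0..<length w} \<rightarrow>\<^sub>E alphabet"
  by (auto simp: word_fun_def in_lists_conv_set)

lemma initial_word_word_fun: "initial_word (length w) (word_fun w) = w"
  by (rule nth_equalityI) (auto simp: initial_word_def word_fun_def)

lemma initial_word_eq_iff: "initial_word (length w) \<omega> = w \<longleftrightarrow> (\<forall>i<length w. \<omega> i = w ! i)"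
  unfolding list_eq_iff_nth_eq[of "initial_word (length w) \<omega>" w] by (simp add: initial_word_def)

lemma restrict_eq_word_fun: "restrict \<omega> {0..<length w} = word_fun w \<longleftrightarrow> (\<forall>i<length w. \<omega> i = w ! i)"
proof
  assume eq: "restrict \<omega> {0..<length w} = word_fun w"
  show "\<forall>i<length w. \<omega> i = w ! i"
  proof (intro allI impI)
    fix i assume "i < length w"
    then show "\<omega> i = w ! i" using fun_cong[OF eq, of i] by (simp add: word_fun_def)
  qed
next
  assume "\<forall>i<length w. \<omega> i = w ! i"
  then show "restrict \<omega> {0..<length w} = word_fun w"
    unfolding word_fun_def by (intro restrict_ext) simp
qed

text \<open>Ionescu-Tulcea with transition probabilities \<open>a (w @ [v]) / a w\<close>, rescaled
  by the total mass \<open>a []\<close>. Total mass 0 cannot be normalised and is treated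
  apart.\<close>

lemma word_measure_exists:
  assumes pos: "\<And>w. w \<in> Adm \<Longrightarrow> a w \<ge> 0" and add: "\<And>w. w \<in> Adm \<Longrightarrow> tree_sum a w = a w"
  obtains M where "sets M = sets word_space" "finite_measure M"
    "\<And>w. w \<in> lists alphabet \<Longrightarrow> emeasure M (cylinder w) = ennreal (if w \<in> Adm then a w else 0)"
proof (cases "a [] = 0")
  case True
  have z: "a w = 0" if w: "w \<in> Adm" for w
  proof -
    have "(tree_sum ^^ n) a [] = a []" for n
    proof (induction n)
      case (Suc n)
      have "(tree_sum ^^ n) (tree_sum a) [] = (tree_sum ^^ n) a []"
        by (rule tree_sum_pow_cong) (auto simp: add)
      then show ?case using Suc by (simp add: funpow_swap1)
    qed simp
    then have "a w \<le> 0" using tree_sum_member_le[OF w, of a] pos True by simp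
    then show ?thesis using pos[OF w] by simp
  qed
  show ?thesis
    by (rule that[of "null_measure word_space"]) (auto simp: z intro!: finite_measureI)
next
  case False
  \<comment> \<open>Extension by 0 to inadmissible words makes additivity hold over the whole
    alphabet and at every word.\<close>
  define A where "A w = (if w \<in> Adm then a w else 0)" for w
  have A0: "A [] > 0" using False pos[of "[]"] by (simp add: A_def)
  have Apos: "A w \<ge> 0" for w using pos by (simp add: A_def)
  have Aadd: "(\<Sum>v\<in>alphabet. A (w @ [v])) = A w" for w
  proof (cases "w \<in> Adm")
    case True
    then show ?thesis unfolding A_def Adm_conv_snoc_alphabet[OF True] by (simp add: add)
  qed (simp add: A_def Adm_snoc)
  obtain v0 where v0: "v0 \<in> alphabet" using alphabet_ne by blast
  \<comment> \<open>A history of mass 0 has no conditional law; any probability serves there, and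
    the unit mass at \<open>v0\<close> is taken.\<close>
  define \<kappa> where "\<kappa> w v = (if A w > 0 then A (w @ [v]) / A w else if v = v0 then 1 else 0)" for w v
  have \<kappa>0: "\<kappa> w v \<ge> 0" for w v using Apos by (simp add: \<kappa>_def)
  have \<kappa>1: "(\<Sum>v\<in>alphabet. \<kappa> w v) = 1" for w
  proof (cases "A w > 0")
    case True
    then show ?thesis using Aadd[of w] by (simp add: \<kappa>_def sum_divide_distrib[symmetric])
  next
    case False
    then show ?thesis using v0 finite_alphabet by (simp add: \<kappa>_def)
  qed
  have \<kappa>A: "\<kappa> w v * A w = A (w @ [v])" if "v \<in> alphabet" for w v
  proof (cases "A w > 0")
    case False
    then have "A w = 0" using Apos[of w] by simp
    then have "A (w @ [v]) = 0"
      using Aadd[of w] sum_nonneg_eq_0_iff[OF finite_alphabet, of "\<lambda>v. A (w @ [v])"] Apos that by auto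
    then show ?thesis using \<open>A w = 0\<close> by simp
  qed (simp add: \<kappa>_def)
  define C0 where "C0 = (\<lambda>_::nat. count_space alphabet)"
  define P where "P n \<omega> = point_measure alphabet (\<lambda>v. ennreal (\<kappa> (initial_word n \<omega>) v))" for n \<omega>
  have PiM_eq: "PiM {0..<n} C0 = count_space ({0..<n} \<rightarrow>\<^sub>E alphabet)" for n
    unfolding C0_def by (rule count_space_PiM_finite) (auto intro: countable_finite finite_alphabet)
  have Pprob: "prob_space (P n \<omega>)" for n \<omega>
  proof
    have "emeasure (P n \<omega>) (space (P n \<omega>)) = (\<Sum>v\<in>alphabet. ennreal (\<kappa> (initial_word n \<omega>) v))"
      unfolding P_def space_point_measure by (rule emeasure_point_measure_finite[OF finite_alphabet]) simp
    also have "\<dots> = 1" using \<kappa>0 \<kappa>1 by (simp add: sum_ennreal)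
    finally show "emeasure (P n \<omega>) (space (P n \<omega>)) = 1" .
  qed
  have Pmeas: "P n \<in> measurable (PiM {0..<n} C0) (subprob_algebra (C0 n))" for n
    unfolding PiM_eq measurable_count_space_eq1
  proof (rule Pi_I)
    fix \<omega>
    interpret prob_space "P n \<omega>" by (rule Pprob)
    show "P n \<omega> \<in> space (subprob_algebra (C0 n))"
      by (auto simp: space_subprob_algebra C0_def P_def sets_point_measure intro: prob_space_imp_subprob_space[OF Pprob[unfolded P_def]])
  qed
  interpret IT: Ionescu_Tulcea P C0
    by (rule Ionescu_Tulcea.intro[OF Pmeas Pprob])
  let ?x = "\<lambda>_::nat. undefined :: letter"
  have sp0: "?x \<in> space (PiM {0..<0} C0)" by (simp add: space_PiM)
  have C: "emeasure (IT.C 0 (length w) ?x) {word_fun w} = ennreal (A w / A [])" if "w \<in> lists alphabet" for w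
    using that
  proof (induction w rule: rev_induct)
    case Nil
    show ?case using A0 sp0 by (simp add: word_fun_def PiM_empty restrict_def)
  next
    case (snoc v w)
    define n where "n = length w"
    have w: "w \<in> lists alphabet" "v \<in> alphabet" using snoc.prems by auto
    have wf: "word_fun w \<in> space (PiM {0..<n} C0)" using word_fun_space[OF w(1)] by (simp add: space_PiM C0_def n_def)
    have sing: "{word_fun (w @ [v])} \<in> sets (PiM {0..<Suc n} C0)"
      unfolding PiM_eq using word_fun_space[OF snoc.prems] by (simp add: n_def)
    have ker: "emeasure (IT.eP n \<omega>) {word_fun (w @ [v])} = ennreal (\<kappa> w v) * indicator {word_fun w} \<omega>"
      if \<omega>: "\<omega> \<in> space (PiM {0..<n} C0)" for \<omega>
    proof -
      have und: "\<omega> n = undefined" "word_fun w n = undefined"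
        using \<omega> by (auto simp: space_PiM n_def word_fun_def PiE_def extensional_def)
      have "(\<lambda>x. fun_upd \<omega> n x) -` {word_fun (w @ [v])} \<inter> space (C0 n) = (if \<omega> = word_fun w then {v} else {})"
      proof -
        have "fun_upd \<omega> n x = word_fun (w @ [v]) \<longleftrightarrow> \<omega> = word_fun w \<and> x = v" for x
        proof
          assume eq: "fun_upd \<omega> n x = word_fun (w @ [v])"
          have "\<omega> i = word_fun w i" for i
            using fun_cong[OF eq, of i] und by (cases "i = n") (simp_all add: word_fun_snoc n_def[symmetric])
          moreover have "x = v" using fun_cong[OF eq, of n] by (simp add: word_fun_snoc n_def[symmetric])
          ultimately show "\<omega> = word_fun w \<and> x = v" by auto
        qed (simp add: word_fun_snoc n_def)
        then show ?thesis using w(2) by (auto simp: C0_def)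
      qed
      then have "emeasure (IT.eP n \<omega>) {word_fun (w @ [v])} = emeasure (P n \<omega>) (if \<omega> = word_fun w then {v} else {})"
        using IT.emeasure_eP[OF \<omega> sing] by simp
      also have "\<dots> = ennreal (\<kappa> w v) * indicator {word_fun w} \<omega>"
        unfolding P_def using w(2) finite_alphabet
        by (auto simp: emeasure_point_measure_finite initial_word_word_fun n_def)
      finally show ?thesis .
    qed
    have "emeasure (IT.C 0 (Suc n) ?x) {word_fun (w @ [v])} = emeasure (Giry_Monad.bind (IT.C 0 n ?x) (IT.eP n)) {word_fun (w @ [v])}"
      by simp
    also have "\<dots> = (\<integral>\<^sup>+\<omega>. emeasure (IT.eP n \<omega>) {word_fun (w @ [v])} \<partial>IT.C 0 n ?x)"
    proof (rule emeasure_bind)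
      show "space (IT.C 0 n ?x) \<noteq> {}" using IT.space_C[OF sp0, of n] wf by auto
      show "IT.eP n \<in> measurable (IT.C 0 n ?x) (subprob_algebra (PiM {0..<Suc n} C0))"
      proof (subst measurable_cong_sets[OF _ refl])
        show "sets (IT.C 0 n ?x) = sets (PiM {0..<n} C0)" using IT.sets_C[OF sp0, of n] by simp
      qed (rule IT.measurable_eP)
    qed (rule sing)
    also have "\<dots> = (\<integral>\<^sup>+\<omega>. ennreal (\<kappa> w v) * indicator {word_fun w} \<omega> \<partial>IT.C 0 n ?x)"
      by (rule nn_integral_cong) (use ker IT.space_C[OF sp0, of n] in simp)
    also have "\<dots> = ennreal (\<kappa> w v) * emeasure (IT.C 0 n ?x) {word_fun w}"
    proof (rule nn_integral_cmult_indicator)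
      show "{word_fun w} \<in> sets (IT.C 0 n ?x)"
        using IT.sets_C[OF sp0, of n] wf unfolding PiM_eq by simp
    qed
    also have "\<dots> = ennreal (\<kappa> w v * (A w / A []))"
      using snoc.IH[OF w(1)] \<kappa>0 by (simp add: n_def ennreal_mult'[symmetric])
    also have "\<dots> = ennreal (A (w @ [v]) / A [])" using \<kappa>A[OF w(2), of w] by simp
    finally show ?case by (simp add: n_def)
  qed
  have spW: "PiM UNIV C0 = word_space" by (simp add: word_space_def C0_def)
  have lim: "emeasure IT.PF.lim (cylinder w) = ennreal (A w / A [])" if w: "w \<in> lists alphabet" for w
  proof -
    let ?J = "{0..<length w}"
    have s: "{word_fun w} \<in> sets (PiM ?J C0)" unfolding PiM_eq using word_fun_space[OF w] by simp
    have "cylinder w = prod_emb UNIV C0 ?J {word_fun w}"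
    proof -
      have "cylinder w = {\<omega> \<in> space word_space. restrict \<omega> ?J = word_fun w}"
        unfolding cylinder_def initial_word_eq_iff restrict_eq_word_fun ..
      then show ?thesis by (auto simp: prod_emb_def spW[symmetric] space_PiM)
    qed
    then have "emeasure IT.PF.lim (cylinder w) = emeasure (IT.CI ?J) {word_fun w}"
      using IT.lim[OF _ s] by simp
    also have "\<dots> = emeasure (IT.C 0 (length w) ?x) (prod_emb ?J C0 ?J {word_fun w})"
      by (rule IT.emeasure_CI[OF _ s]) simp
    also have "prod_emb ?J C0 ?J {word_fun w} = {word_fun w}"
      by (rule prod_emb_id) (use word_fun_space[OF w] in \<open>simp add: C0_def\<close>)
    finally show ?thesis using C[OF w] by simp
  qed
  define M where "M = scale_measure (ennreal (A [])) IT.PF.lim"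
  have M: "emeasure M (cylinder w) = ennreal (A w)" if "w \<in> lists alphabet" for w
    unfolding M_def emeasure_scale_measure lim[OF that] using A0 Apos[of w]
    by (simp add: ennreal_mult'[symmetric])
  show ?thesis
  proof (rule that)
    show "sets M = sets word_space" by (simp add: M_def spW)
    have "cylinder [] = space M" by (simp add: cylinder_def M_def spW[symmetric] space_scale_measure)
    then show "finite_measure M" using M[of "[]"] by (intro finite_measureI) simp
    show "emeasure M (cylinder w) = ennreal (if w \<in> Adm then a w else 0)" if "w \<in> lists alphabet" for w
      using M[OF that] by (simp add: A_def)
  qed
qed

section \<open>Cylinders as a generator of the word space\<close>

lemma cylinder_Nil: "cylinder [] = space word_space"
  by (auto simp: cylinder_def)

lemma cylinder_subset: "cylinder w \<subseteq> space word_space"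
  by (auto simp: cylinder_def)

lemma measurable_coordinate: "(\<lambda>\<omega>. \<omega> i) \<in> measurable word_space (count_space alphabet)"
  unfolding word_space_def by (rule measurable_component_singleton) simp

lemma sets_cylinder [measurable]: "cylinder w \<in> sets word_space"
proof -
  have "{\<omega> \<in> space word_space. \<omega> i = v} \<in> sets word_space" for i v
  proof (cases "v \<in> alphabet")
    case True
    have "(\<lambda>\<omega>. \<omega> i) -` {v} \<inter> space word_space \<in> sets word_space"
      by (rule measurable_sets[OF measurable_coordinate]) (use True in simp)
    moreover have "(\<lambda>\<omega>. \<omega> i) -` {v} \<inter> space word_space = {\<omega> \<in> space word_space. \<omega> i = v}" by auto
    ultimately show ?thesis by simp
  next
    case False
    then have "{\<omega> \<in> space word_space. \<omega> i = v} = {}" by (auto simp: space_word_space)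
    then show ?thesis by (metis sets.empty_sets)
  qed
  then have "{\<omega> \<in> space word_space. \<forall>i\<in>{..<length w}. \<omega> i = w ! i} \<in> sets word_space"
    by (rule sets.sets_Collect_finite_All) (rule finite_lessThan)
  then show ?thesis unfolding cylinder_def initial_word_eq_iff Ball_def lessThan_iff .
qed

text \<open>The longer of two words either extends the shorter one or contradicts it. With the empty
  set added, cylinders are thus stable under intersection.\<close>

lemma cylinder_Int:
  "cylinder w \<inter> cylinder w' = {} \<or> cylinder w \<inter> cylinder w' = cylinder w \<or> cylinder w \<inter> cylinder w' = cylinder w'"
proof -
  have *: "cylinder u \<inter> cylinder u' = {} \<or> cylinder u \<inter> cylinder u' = cylinder u'" if "length u \<le> length u'" for u u'
  proof (cases "take (length u) u' = u")
    case True
    have "cylinder u' \<subseteq> cylinder u"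
      unfolding cylinder_def using True by (auto simp: take_initial_word[OF that, symmetric])
    then show ?thesis by auto
  next
    case False
    then show ?thesis
      unfolding cylinder_def by (auto simp: take_initial_word[OF that, symmetric])
  qed
  show ?thesis using *[of w w'] *[of w' w] by (cases "length w \<le> length w'") auto
qed

text \<open>An event about coordinate \<open>i\<close> is a finite union of cylinders of length
  \<open>i + 1\<close>, the alphabet being finite.\<close>

lemma sets_word_space: "sets word_space = sigma_sets (space word_space) (insert {} (cylinder ` lists alphabet))"
  (is "_ = sigma_sets ?\<Omega> ?E")
proof
  have sp: "?\<Omega> = (\<Pi>\<^sub>E i\<in>UNIV. space (count_space alphabet))" by (simp add: word_space_def space_PiM)
  show "sets word_space \<subseteq> sigma_sets ?\<Omega> ?E"
  proof -
    have "sets word_space = sigma_sets ?\<Omega> {{f\<in>\<Pi>\<^sub>E i\<in>UNIV. space (count_space alphabet). f i \<in> A} | i A. i \<in> UNIV \<and> A \<in> sets (count_space alphabet)}"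
      unfolding sp unfolding word_space_def by (rule sets_PiM_single)
    also have "\<dots> \<subseteq> sigma_sets ?\<Omega> ?E"
    proof (rule sigma_sets_mono, clarify)
      fix i A assume A: "A \<in> sets (count_space alphabet)"
      let ?W = "{w \<in> lists alphabet. length w = Suc i \<and> w ! i \<in> A}"
      have "finite {w. set w \<subseteq> alphabet \<and> length w = Suc i}" by (rule finite_lists_length_eq[OF finite_alphabet])
      then have fin: "finite ?W" by (rule rev_finite_subset) (auto simp: in_lists_conv_set)
      have "{f\<in>\<Pi>\<^sub>E i\<in>UNIV. space (count_space alphabet). f i \<in> A} = (\<Union>w\<in>?W. cylinder w)"
      proof (intro equalityI subsetI)
        fix \<omega> assume "\<omega> \<in> {f\<in>\<Pi>\<^sub>E i\<in>UNIV. space (count_space alphabet). f i \<in> A}"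
        then have \<omega>: "\<omega> \<in> ?\<Omega>" "\<omega> i \<in> A" using sp by auto
        have "initial_word (Suc i) \<omega> \<in> ?W"
          using initial_word_alphabet[OF \<omega>(1)] \<omega>(1)[unfolded space_word_space] \<omega>(2) by (simp add: initial_word_Suc nth_append)
        moreover have "\<omega> \<in> cylinder (initial_word (Suc i) \<omega>)" using \<omega>(1) by (simp add: cylinder_def)
        ultimately show "\<omega> \<in> (\<Union>w\<in>?W. cylinder w)" by blast
      next
        fix \<omega> assume "\<omega> \<in> (\<Union>w\<in>?W. cylinder w)"
        then obtain w where w: "length w = Suc i" "w ! i \<in> A" "\<omega> \<in> ?\<Omega>" "initial_word (length w) \<omega> = w"
          unfolding cylinder_def by blast
        then have "\<omega> i = w ! i" using initial_word_eq_iff[of w \<omega>] by simp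
        then show "\<omega> \<in> {f\<in>\<Pi>\<^sub>E i\<in>UNIV. space (count_space alphabet). f i \<in> A}" using w sp by auto
      qed
      also have "\<dots> \<in> sigma_sets ?\<Omega> ?E"
      proof -
        interpret sigma_algebra ?\<Omega> "sigma_sets ?\<Omega> ?E"
          by (rule sigma_algebra_sigma_sets) (auto simp: cylinder_def)
        show ?thesis using fin by (intro finite_UN) auto
      qed
      finally show "{f\<in>\<Pi>\<^sub>E i\<in>UNIV. space (count_space alphabet). f i \<in> A} \<in> sigma_sets ?\<Omega> ?E" .
    qed
    finally show ?thesis .
  qed
  show "sigma_sets ?\<Omega> ?E \<subseteq> sets word_space"
    by (rule sets.sigma_sets_subset) auto
qed

lemma word_measure_unique:
  assumes "sets M = sets word_space" "sets N = sets word_space" "finite_measure M"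
    "\<And>w. w \<in> lists alphabet \<Longrightarrow> emeasure M (cylinder w) = emeasure N (cylinder w)"
  shows "M = N"
proof (rule measure_eqI_generator_eq)
  let ?E = "insert {} (cylinder ` lists alphabet)"
  show "Int_stable ?E"
  proof (rule Int_stableI)
    fix a b assume ab: "a \<in> ?E" "b \<in> ?E"
    show "a \<inter> b \<in> ?E"
    proof (cases "a = {} \<or> b = {}")
      case False
      then obtain w w' where w: "w \<in> lists alphabet" "a = cylinder w" "w' \<in> lists alphabet" "b = cylinder w'"
        using ab by blast
      then show ?thesis using cylinder_Int[of w w'] by auto
    qed auto
  qed
  show "?E \<subseteq> Pow (space word_space)" by (auto simp: cylinder_def)
  show "emeasure M X = emeasure N X" if "X \<in> ?E" for X using that assms(4) by auto
  show "sets M = sigma_sets (space word_space) ?E" "sets N = sigma_sets (space word_space) ?E"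
    using assms(1,2) sets_word_space by auto
  show "range (\<lambda>_. cylinder []) \<subseteq> ?E" by auto
  show "(\<Union>i::nat. cylinder []) = space word_space" by (simp add: cylinder_Nil)
  show "emeasure M (cylinder []) \<noteq> \<infinity>" using finite_measure.emeasure_finite[OF assms(3)] by simp
qed

lemma measurable_initial_word: "initial_word n \<in> measurable word_space (count_space UNIV)"
proof (rule measurable_count_space_eq2_countable[THEN iffD2])
  show "initial_word n \<in> space word_space \<rightarrow> UNIV \<and> (\<forall>w\<in>UNIV. initial_word n -` {w} \<inter> space word_space \<in> sets word_space)"
  proof (intro conjI ballI)
    fix w
    show "initial_word n -` {w} \<inter> space word_space \<in> sets word_space"
    proof (cases "length w = n")
      case True
      then have "initial_word n -` {w} \<inter> space word_space = cylinder w" by (auto simp: cylinder_def)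
      then show ?thesis by simp
    next
      case False
      then have "initial_word n -` {w} \<inter> space word_space = {}" by auto
      then show ?thesis by simp
    qed
  qed simp
qed

lemma sets_adm_sequences [measurable]: "adm_sequences \<in> sets word_space"
proof -
  have "{\<omega> \<in> space word_space. initial_word m \<omega> \<in> adm_words m} \<in> sets word_space" for m
      proof -
    have "initial_word m -` adm_words m \<inter> space word_space \<in> sets word_space"
      by (rule measurable_sets[OF measurable_initial_word]) simp
    moreover have "initial_word m -` adm_words m \<inter> space word_space = {\<omega> \<in> space word_space. initial_word m \<omega> \<in> adm_words m}"
      by auto
    ultimately show ?thesis by simp
  qed
  then have "{\<omega> \<in> space word_space. \<forall>m. initial_word m \<omega> \<in> adm_words m} \<in> sets word_space"
    by (intro sets.sets_Collect_countable_All)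
  then show ?thesis unfolding adm_sequences_def .
qed

lemma tree_sum_pow_invariant:
  assumes "\<And>u. u \<in> Adm \<Longrightarrow> tree_sum \<phi> u = \<phi> u" "w \<in> Adm"
  shows "(tree_sum ^^ n) \<phi> w = \<phi> w"
proof (induction n)
  case (Suc n)
  have "(tree_sum ^^ n) (tree_sum \<phi>) w = (tree_sum ^^ n) \<phi> w"
    by (rule tree_sum_pow_cong[OF assms(2)]) (rule assms(1))
  then show ?case using Suc by (simp add: funpow_swap1)
qed simp

end

section \<open>Word measures and their images on the gasket\<close>

text \<open>Common frame for the two measures to be compared: \<open>a\<close> is the product of the
  weights in one case and twice the cell energy in the other.\<close>

locale word_measure = inhomogeneous_gasket +
  fixes a :: "letter list \<Rightarrow> real" and M :: "(nat \<Rightarrow> letter) measure"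
  assumes a_nonneg: "w \<in> Adm \<Longrightarrow> a w \<ge> 0" and a_add: "w \<in> Adm \<Longrightarrow> tree_sum a w = a w"
    and sets_M [measurable_cong]: "sets M = sets word_space" and fin_M: "finite_measure M"
    and cyl_M: "w \<in> lists alphabet \<Longrightarrow> emeasure M (cylinder w) = ennreal (if w \<in> Adm then a w else 0)"
begin

sublocale finite_measure M by (rule fin_M)

lemma space_M: "space M = space word_space"
  by (rule sets_eq_imp_space_eq[OF sets_M])

lemma measure_cylinder: "w \<in> Adm \<Longrightarrow> measure M (cylinder w) = a w"
  using cyl_M[OF Adm_lists] a_nonneg by (simp add: measure_def)

lemma disjoint_cylinders: "disjoint_family_on cylinder (adm_words n)"
  unfolding disjoint_family_on_def cylinder_def by (auto simp: adm_words_Adm)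

lemma measure_UN_cylinder:
  assumes "W \<subseteq> adm_words n"
  shows "measure M (\<Union>w\<in>W. cylinder w) = (\<Sum>w\<in>W. a w)"
proof -
  have "measure M (\<Union>w\<in>W. cylinder w) = (\<Sum>w\<in>W. measure M (cylinder w))"
    using assms finite_adm_words disjoint_family_on_mono[OF assms disjoint_cylinders]
    by (intro finite_measure_finite_Union) (auto simp: sets_M intro: finite_subset)
  also have "\<dots> = (\<Sum>w\<in>W. a w)" using assms by (intro sum.cong measure_cylinder) (auto simp: adm_words_Adm)
  finally show ?thesis .
qed

lemma measure_space_M: "measure M (space M) = a []"
  using measure_cylinder[of "[]"] by (simp add: cylinder_Nil space_M)

lemma sum_adm_words_a: "(\<Sum>w\<in>adm_words n. a w) = a []"
  unfolding sum_adm_words by (rule tree_sum_pow_invariant[OF a_add]) auto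

text \<open>At every level the admissible cylinders already carry the total mass
  \<open>a []\<close>.\<close>

lemma AE_adm_sequences: "AE \<omega> in M. \<omega> \<in> adm_sequences"
proof -
  have "AE \<omega> in M. initial_word m \<omega> \<in> adm_words m" for m
  proof -
    let ?U = "\<Union>w\<in>adm_words m. cylinder w"
    have s: "?U \<in> sets M" using finite_adm_words by (auto simp: sets_M)
    have "measure M (space M - ?U) = 0"
      using finite_measure_compl[OF s] measure_UN_cylinder[OF order_refl, of m] sum_adm_words_a measure_space_M by simp
    then have "space M - ?U \<in> null_sets M" using s by (auto simp: null_sets_def emeasure_eq_measure)
    then show ?thesis by (rule AE_I') (auto simp: cylinder_def space_M adm_words_Adm)
  qed
  then have "AE \<omega> in M. \<forall>m. initial_word m \<omega> \<in> adm_words m" by (subst AE_all_countable) blast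
  then show ?thesis
    by (rule AE_mp) (auto intro!: AE_I2 simp: adm_sequences_def space_M)
qed

lemma measurable_vertex: "(\<lambda>\<omega>. \<psi>_word (initial_word n \<omega>) (p 1)) \<in> borel_measurable word_space"
  by (rule measurable_compose[OF measurable_initial_word]) simp

lemma measurable_coding: "coding \<in> measurable word_space borel"
  by (rule borel_measurable_LIMSEQ_metric[OF measurable_vertex]) (rule vertex_LIMSEQ_coding, auto)

lemma measurable_coding_restrict:
  "coding \<in> measurable (restrict_space M adm_sequences) (restrict_space borel gasket)"
proof (rule measurable_restrict_space3)
  show "coding \<in> measurable M borel" using measurable_coding by (simp add: measurable_cong_sets[OF sets_M refl])
qed (auto simp: gasket_def)

text \<open>Written in the shape of \<open>gasket_measure\<close>, which is thereby an instance;
  that the energy measure is another one has to be proved.\<close>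

definition image_measure :: "plane measure" where
  "image_measure = distr (restrict_space M adm_sequences) (restrict_space borel gasket) coding"

lemma sets_image_measure: "sets image_measure = sets (restrict_space borel gasket)"
  by (simp add: image_measure_def)

lemma space_image_measure: "space image_measure = gasket"
  by (simp add: image_measure_def space_restrict_space)

lemma emeasure_image_measure:
  assumes "A \<in> sets (restrict_space borel gasket)"
  shows "emeasure image_measure A = emeasure M {\<omega> \<in> adm_sequences. coding \<omega> \<in> A}"
proof -
  have sp: "space (restrict_space M adm_sequences) = adm_sequences"
    using sets.sets_into_space[OF sets_adm_sequences] by (auto simp: space_restrict_space space_M)
  have "emeasure image_measure A = emeasure (restrict_space M adm_sequences) (coding -` A \<inter> adm_sequences)"
    unfolding image_measure_def by (subst emeasure_distr[OF measurable_coding_restrict assms]) (simp add: sp)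
  also have "\<dots> = emeasure M (coding -` A \<inter> adm_sequences)"
    by (rule emeasure_restrict_space) (auto simp: sets_M sets.sets_into_space)
  also have "coding -` A \<inter> adm_sequences = {\<omega> \<in> adm_sequences. coding \<omega> \<in> A}" by auto
  finally show ?thesis .
qed

lemma sets_coding_vimage:
  assumes "A \<in> sets (restrict_space borel gasket)"
  shows "{\<omega> \<in> adm_sequences. coding \<omega> \<in> A} \<in> sets M"
proof -
  obtain B where B: "B \<in> sets borel" "A = gasket \<inter> B" using assms by (auto simp: sets_restrict_space)
  have "{\<omega> \<in> adm_sequences. coding \<omega> \<in> A} = adm_sequences \<inter> (coding -` B \<inter> space word_space)"
    using sets.sets_into_space[OF sets_adm_sequences] by (auto simp: B gasket_def)
  then show ?thesis using measurable_sets[OF measurable_coding B(1)] by (simp add: sets_M)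
qed

lemma finite_image_measure: "finite_measure image_measure"
proof
  have "gasket \<in> sets (restrict_space borel gasket)" using sets.top[of "restrict_space borel gasket"]
    by (simp add: space_restrict_space)
  then show "emeasure image_measure (space image_measure) \<noteq> \<infinity>"
    unfolding space_image_measure by (simp add: emeasure_image_measure)
qed

lemma integral_image_measure:
  fixes g :: "plane \<Rightarrow> real"
  assumes "g \<in> borel_measurable (restrict_space borel gasket)"
  shows "(\<integral>x. g x \<partial>image_measure) = (\<integral>\<omega>. indicator adm_sequences \<omega> * g (coding \<omega>) \<partial>M)"
proof -
  have "(\<integral>x. g x \<partial>image_measure) = (\<integral>\<omega>. g (coding \<omega>) \<partial>restrict_space M adm_sequences)"
    unfolding image_measure_def by (rule integral_distr[OF measurable_coding_restrict assms])
  also have "\<dots> = (\<integral>\<omega>. indicator adm_sequences \<omega> *\<^sub>R g (coding \<omega>) \<partial>M)"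
    by (rule integral_restrict_space) (simp add: sets_M space_M sets.sets_into_space Int_absorb2)
  finally show ?thesis by simp
qed

lemma integral_initial_word:
  "(\<integral>\<omega>. indicator adm_sequences \<omega> * h (initial_word n \<omega>) \<partial>M) = (\<Sum>w\<in>adm_words n. h w * a w)" for h :: "letter list \<Rightarrow> real"
proof -
  have "(\<integral>\<omega>. indicator adm_sequences \<omega> * h (initial_word n \<omega>) \<partial>M) = (\<integral>\<omega>. (\<Sum>w\<in>adm_words n. h w * indicator (cylinder w) \<omega>) \<partial>M)"
  proof (rule integral_cong_AE)
    have [measurable]: "initial_word n \<in> measurable M (count_space UNIV)"
      using measurable_initial_word by (simp add: measurable_cong_sets[OF sets_M refl])
    have [measurable]: "adm_sequences \<in> sets M" by (simp add: sets_M)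
    have [measurable]: "cylinder w \<in> sets M" for w by (simp add: sets_M)
    show "(\<lambda>\<omega>. indicator adm_sequences \<omega> * h (initial_word n \<omega>)) \<in> borel_measurable M" by measurable
    show "(\<lambda>\<omega>. \<Sum>w\<in>adm_words n. h w * indicator (cylinder w) \<omega>) \<in> borel_measurable M" by measurable
    show "AE \<omega> in M. indicator adm_sequences \<omega> * h (initial_word n \<omega>) = (\<Sum>w\<in>adm_words n. h w * indicator (cylinder w) \<omega>)"
      using AE_adm_sequences
    proof (rule AE_mp, intro AE_I2 impI)
      fix \<omega> assume \<omega>: "\<omega> \<in> adm_sequences"
      have sp: "\<omega> \<in> space word_space" using \<omega> by (simp add: adm_sequences_def)
      have i: "initial_word n \<omega> \<in> adm_words n" using \<omega> by (simp add: adm_sequences_def)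
      have "(\<Sum>w\<in>adm_words n. h w * indicator (cylinder w) \<omega>) = (\<Sum>w\<in>adm_words n. if w = initial_word n \<omega> then h w else 0)"
        by (rule sum.cong) (use sp in \<open>auto simp: cylinder_def indicator_def adm_words_Adm\<close>)
      also have "\<dots> = h (initial_word n \<omega>)" using i finite_adm_words by simp
      finally show "indicator adm_sequences \<omega> * h (initial_word n \<omega>) = (\<Sum>w\<in>adm_words n. h w * indicator (cylinder w) \<omega>)"
        using \<omega> by simp
    qed
  qed
  also have "\<dots> = (\<Sum>w\<in>adm_words n. h w * a w)"
  proof (subst Bochner_Integration.integral_sum)
    show "integrable M (\<lambda>\<omega>. h w * indicator (cylinder w) \<omega>)" for w
      by (intro integrable_mult_right integrable_real_indicator) (auto simp: sets_M emeasure_finite less_top[symmetric])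
    show "(\<Sum>w\<in>adm_words n. \<integral>\<omega>. h w * indicator (cylinder w) \<omega> \<partial>M) = (\<Sum>w\<in>adm_words n. h w * a w)"
      using cylinder_subset by (intro sum.cong refl) (simp add: adm_words_Adm measure_cylinder space_M Int_absorb2)
  qed
  finally show ?thesis .
qed

end

section \<open>The energy measure\<close>

context inhomogeneous_gasket
begin

lemma word_measureI:
  assumes "\<And>w. w \<in> Adm \<Longrightarrow> a w \<ge> 0" "\<And>w. w \<in> Adm \<Longrightarrow> tree_sum a w = a w"
    "sets M = sets word_space" "finite_measure M"
    "\<And>w. w \<in> lists alphabet \<Longrightarrow> emeasure M (cylinder w) = ennreal (if w \<in> Adm then a w else 0)"
  shows "word_measure p \<psi> T L a M"
  by (intro word_measure.intro word_measure_axioms.intro inhomogeneous_gasket_axioms assms)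

definition word_weight :: "(letter \<Rightarrow> real) \<Rightarrow> letter list \<Rightarrow> real" where
  "word_weight q w = (\<Prod>v\<leftarrow>w. q v)"

lemma word_weight_append: "word_weight q (u @ w) = word_weight q u * word_weight q w"
  by (simp add: word_weight_def)

lemma word_weight_Nil [simp]: "word_weight q [] = 1"
  by (simp add: word_weight_def)

lemma word_weight_single: "word_weight q [v] = q v"
  by (simp add: word_weight_def)

lemma word_weight_pos:
  assumes "q \<in> weights" "w \<in> lists alphabet"
  shows "word_weight q w > 0"
  using assms(2) by (induction w) (use assms(1) in \<open>auto simp: word_weight_def weights_def\<close>)

lemma tree_sum_word_weight:
  assumes "q \<in> weights" "w \<in> Adm"
  shows "tree_sum (word_weight q) w = word_weight q w"
  using assms(1) L_T[OF assms(2)]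
  by (simp add: tree_sum_def word_weight_append word_weight_single sum_distrib_left[symmetric] weights_def)

text \<open>Resolves the definite description: existence is \<open>word_measure_exists\<close> for
  the product weights, uniqueness holds because cylinders generate.\<close>

lemma path_measure_spec:
  assumes q: "q \<in> weights"
  shows "word_measure p \<psi> T L (word_weight q) (path_measure q)"
proof -
  have nn: "word_weight q w \<ge> 0" if "w \<in> Adm" for w
    using word_weight_pos[OF q Adm_lists[OF that]] by simp
  obtain M where M: "sets M = sets word_space" "finite_measure M"
    "\<And>w. w \<in> lists alphabet \<Longrightarrow> emeasure M (cylinder w) = ennreal (if w \<in> Adm then word_weight q w else 0)"
    using word_measure_exists[of "word_weight q", OF nn tree_sum_word_weight[OF q]] by blast
  interpret M: word_measure p \<psi> T L "word_weight q" M
    by (rule word_measureI[OF nn tree_sum_word_weight[OF q] M])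
  have pM: "prob_space M"
    by (rule prob_spaceI) (use M(3)[of "[]"] M.space_M in \<open>simp add: cylinder_Nil\<close>)
  have mM: "measure M (cylinder w) = (if w \<in> (\<Union>m. adm_words m) then \<Prod>v\<leftarrow>w. q v else 0)" if "w \<in> lists alphabet" for w
    unfolding Adm_def[symmetric] word_weight_def[symmetric] measure_def M(3)[OF that] using nn by simp
  have "path_measure q = M"
    unfolding path_measure_def
  proof (rule the_equality)
    show "sets M = sets word_space \<and> prob_space M \<and>
     (\<forall>w\<in>lists alphabet. measure M (cylinder w) = (if w \<in> (\<Union>m. adm_words m) then \<Prod>v\<leftarrow>w. q v else 0))"
      using M(1) pM mM by blast
    fix N assume N: "sets N = sets word_space \<and> prob_space N \<and>
     (\<forall>w\<in>lists alphabet. measure N (cylinder w) = (if w \<in> (\<Union>m. adm_words m) then \<Prod>v\<leftarrow>w. q v else 0))"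
    then have fN: "finite_measure N" using prob_space_def by blast
    show "N = M"
    proof (rule word_measure_unique)
      fix w assume w: "w \<in> lists alphabet"
      then have "measure N (cylinder w) = measure M (cylinder w)" using N mM by simp
      then show "emeasure N (cylinder w) = emeasure M (cylinder w)"
        using finite_measure.emeasure_eq_measure[OF fN] M.emeasure_eq_measure by simp
    qed (use N M(1) fN in auto)
  qed
  then show ?thesis using M.word_measure_axioms by simp
qed

lemma gasket_measure_eq:
  assumes "q \<in> weights"
  shows "gasket_measure q = word_measure.image_measure p \<psi> T L (path_measure q)"
  unfolding gasket_measure_def word_measure.image_measure_def[OF path_measure_spec[OF assms]] ..

text \<open>The energies of the children of a harmonic cell add up to its own, so no deeper cell
  exceeds it. The oscillation is then controlled by the boundary values on this cell, uniformly in
  \<open>n\<close>, and not by the total energy of \<open>g\<close>.\<close>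

lemma harmonic_osc:
  assumes "g \<in> form_domain" "\<And>w. w \<in> Adm \<Longrightarrow> length w \<ge> n \<Longrightarrow> harm (L w) (g \<circ> \<psi>_word w)"
    "\<omega> \<in> adm_sequences" "a \<in> {1,2,3}"
  defines "w \<equiv> initial_word n \<omega>"
  shows "\<bar>g (\<psi>_word w (p a)) - g (coding \<omega>)\<bar> \<le> osc * sqrt (Q (g \<circ> \<psi>_word w) (g \<circ> \<psi>_word w))"
proof -
  have A: "initial_word j \<omega> \<in> Adm" for j by (rule adm_sequences_Adm[OF assms(3)])
  have ts: "tree_sum (en g g) (initial_word j \<omega>) = en g g (initial_word j \<omega>)" if "j \<ge> n" for j
    by (rule tree_sum_en_harm[OF A assms(2)[OF A]]) (use that in simp)
  have le: "en g g (initial_word (n + d) \<omega>) \<le> en g g w" for d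
  proof (induction d)
    case (Suc d)
    let ?u = "initial_word (n + d) \<omega>"
    have s: "initial_word (n + Suc d) \<omega> = ?u @ [\<omega> (n + d)]" by (simp add: initial_word_Suc)
    then have "\<omega> (n + d) \<in> letters (L ?u)" using A[of "n + Suc d"] by (simp add: Adm_snoc)
    then have "en g g (?u @ [\<omega> (n + d)]) \<le> tree_sum (en g g) ?u"
      by (rule tree_sum_child_le[OF A]) (rule en_nonneg)
    then show ?case using Suc ts[of "n + d"] s by simp
  qed (simp add: w_def)
  have "tree_sum (en g g) (initial_word j \<omega>) \<le> en g g w" if "j \<ge> n" for j
    using ts[OF that] le[of "j - n"] that by simp
  then have "\<bar>g (\<psi>_word w (p a)) - g (coding \<omega>)\<bar> \<le> osc * sqrt (en g g w * r_word w)"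
    unfolding w_def by (intro continuous_osc_coding[OF form_domain_cont[OF assms(1)] assms(3,4)]) (simp add: w_def)
  then show ?thesis unfolding en_def using r_word_pos[OF A[of n]] by (simp add: w_def)
qed

text \<open>Interpolate harmonically the indicator of those level-\<open>n\<close> vertices whose
  cells meet \<open>C\<close>. A cell that meets \<open>C\<close> has boundary values 1, and a cell
  far from \<open>C\<close> has boundary values 0 once \<open>n\<close> is large.\<close>

lemma closed_approximation:
  assumes C: "closed C"
  obtains g :: "nat \<Rightarrow> plane \<Rightarrow> real" and K
  where "\<And>n. g n \<in> form_domain" "\<And>n z. z \<in> gasket \<Longrightarrow> \<bar>g n z\<bar> \<le> K"
    "\<And>z. z \<in> gasket \<Longrightarrow> (\<lambda>n. g n z) \<longlonglongrightarrow> indicator C z"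
proof -
  define S where "S n = {\<psi>_word w (p a) | w a. w \<in> adm_words n \<and> a \<in> {1,2,3} \<and> cell w \<inter> C \<noteq> {}}" for n
  have "\<exists>g. g \<in> form_domain \<and> (\<forall>z\<in>vertices n. g z = indicator (S n) z) \<and>
      (\<forall>w\<in>Adm. length w \<ge> n \<longrightarrow> harm (L w) (g \<circ> \<psi>_word w))" for n
    using harmonic_extension[of n "indicator (S n)"] by metis
  then obtain g where g: "\<And>n. g n \<in> form_domain" "\<And>n z. z \<in> vertices n \<Longrightarrow> g n z = indicator (S n) z"
    "\<And>n w. w \<in> Adm \<Longrightarrow> length w \<ge> n \<Longrightarrow> harm (L w) (g n \<circ> \<psi>_word w)"
    by metis
  have osc_g: "\<bar>g n (\<psi>_word (initial_word n \<omega>) (p a)) - g n (coding \<omega>)\<bar> \<le>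
      osc * sqrt (Q (g n \<circ> \<psi>_word (initial_word n \<omega>)) (g n \<circ> \<psi>_word (initial_word n \<omega>)))"
    if "\<omega> \<in> adm_sequences" "a \<in> {1,2,3}" for n \<omega> a
    by (rule harmonic_osc[OF g(1) g(3) that]) auto
  have vert: "\<psi>_word (initial_word n \<omega>) (p a) \<in> vertices n" if "\<omega> \<in> adm_sequences" "a \<in> {1,2,3}" for n \<omega> a
    by (rule verticesI[OF _ that(2)]) (use that(1) in \<open>simp add: adm_sequences_def\<close>)
  \<comment> \<open>Constant boundary data means \<open>Q = 0\<close>, and
    \<open>harmonic_osc\<close> then leaves no oscillation in the cell.\<close>
  have const: "g n (coding \<omega>) = c"
    if \<omega>: "\<omega> \<in> adm_sequences" and c: "\<And>a. a \<in> {1,2,3} \<Longrightarrow> indicator (S n) (\<psi>_word (initial_word n \<omega>) (p a)) = c" for n \<omega> c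
  proof -
    have e: "g n (\<psi>_word (initial_word n \<omega>) (p a)) = c" if "a \<in> {1,2,3}" for a
      using g(2)[OF vert[OF \<omega> that]] c[OF that] by simp
    then have "Q (g n \<circ> \<psi>_word (initial_word n \<omega>)) (g n \<circ> \<psi>_word (initial_word n \<omega>)) = 0" by (simp add: Q_eq)
    then show ?thesis using osc_g[OF \<omega>, of 1 n] e[of 1] by simp
  qed
  show ?thesis
  proof (rule that)
    show "g n \<in> form_domain" for n by (rule g(1))
    \<comment> \<open>Boundary data in \<open>{0, 1}\<close> give \<open>Q \<le> 3\<close>, hence a
      bound independent of \<open>n\<close>, as dominated convergence requires.\<close>
    show "\<bar>g n z\<bar> \<le> 1 + osc * sqrt 3" if z: "z \<in> gasket" for n z
    proof -
      obtain \<omega> where \<omega>: "\<omega> \<in> adm_sequences" "z = coding \<omega>" using z unfolding gasket_def by blast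
      let ?x = "g n \<circ> \<psi>_word (initial_word n \<omega>)"
      have x: "?x (p a) = 0 \<or> ?x (p a) = 1" if "a \<in> {1,2,3}" for a
        using g(2)[OF vert[OF \<omega>(1) that]] by (simp add: indicator_def)
      have sq: "(s - t) * (s - t) \<le> 1" if "s = 0 \<or> s = 1" "t = 0 \<or> t = 1" for s t :: real using that by auto
      have "Q ?x ?x \<le> 1 + 1 + 1"
        unfolding Q_eq by (intro add_mono sq x) auto
      then have "osc * sqrt (Q ?x ?x) \<le> osc * sqrt 3" using osc_bounds(2) by (intro mult_left_mono) auto
      then have "\<bar>?x (p 1) - g n z\<bar> \<le> osc * sqrt 3" using osc_g[OF \<omega>(1), of 1 n] \<omega>(2) by simp
      then show ?thesis using x[of 1] by auto
    qed
    show "(\<lambda>n. g n z) \<longlonglongrightarrow> indicator C z" if z: "z \<in> gasket" for z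
    proof -
      obtain \<omega> where \<omega>: "\<omega> \<in> adm_sequences" "z = coding \<omega>" using z unfolding gasket_def by blast
      have sp: "\<omega> \<in> space word_space" using \<omega>(1) by (simp add: adm_sequences_def)
      have zc: "z \<in> cell (initial_word n \<omega>)" for n unfolding \<omega>(2) by (rule coding_cell[OF sp])
      have wn: "initial_word n \<omega> \<in> adm_words n" for n using \<omega>(1) by (simp add: adm_sequences_def)
      have "\<forall>\<^sub>F n in sequentially. g n z = indicator C z"
      proof (cases "z \<in> C")
        case True
        have "g n z = 1" for n
          unfolding \<omega>(2)
        proof (rule const[OF \<omega>(1)])
          fix a assume "a \<in> {1,2,3::nat}"
          then have "\<psi>_word (initial_word n \<omega>) (p a) \<in> S n"
            unfolding S_def using wn[of n] zc[of n] True by blast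
          then show "indicator (S n) (\<psi>_word (initial_word n \<omega>) (p a)) = (1::real)" by simp
        qed
        then show ?thesis using True by simp
      next
        case False
        then obtain \<epsilon> where \<epsilon>: "\<epsilon> > 0" "ball z \<epsilon> \<subseteq> - C"
          using C openE[of "- C" z] by (auto simp: open_Compl)
        have "\<forall>\<^sub>F n in sequentially. (1/2) ^ n * diam < \<epsilon> / 2"
          by (rule order_tendstoD(2)[OF dist_cell_tendsto]) (use \<epsilon> in simp)
        then show ?thesis
        proof eventually_elim
          case (elim n)
          have "g n z = 0"
            unfolding \<omega>(2)
          proof (rule const[OF \<omega>(1)])
            fix a assume a: "a \<in> {1,2,3::nat}"
            let ?v = "\<psi>_word (initial_word n \<omega>) (p a)"
            have "?v \<notin> S n"
            proof
              assume "?v \<in> S n"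
              then obtain w b y where w: "w \<in> adm_words n" "b \<in> {1,2,3}" "?v = \<psi>_word w (p b)" "y \<in> cell w" "y \<in> C"
                unfolding S_def by blast
              have wl: "w \<in> lists alphabet" "length w = n" using w(1) Adm_lists by (auto simp: adm_words_Adm)
              have "dist y ?v \<le> (1/2) ^ n * diam"
                using dist_cell_le[OF wl(1) w(4) vertex_cell[OF w(2)]] w(3) wl(2) by simp
              moreover have "dist ?v z \<le> (1/2) ^ n * diam"
                using dist_cell_le[OF initial_word_alphabet[OF sp] vertex_cell[OF a] zc[of n]] by simp
              ultimately have "dist z y < \<epsilon>"
                using elim dist_triangle[of y z ?v] by (simp add: dist_commute)
              then show False using \<epsilon>(2) w(5) by auto
            qed
            then show "indicator (S n) ?v = (0::real)" by simp
          qed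
          then show ?case using False by simp
        qed
      qed
      then show ?thesis by (rule tendsto_eventually)
    qed
  qed
qed

lemma form_domain_measurable: "g \<in> form_domain \<Longrightarrow> g \<in> borel_measurable (restrict_space borel gasket)"
  by (rule borel_measurable_continuous_on_restrict) (rule form_domain_cont)

lemma sets_restrict_gasket:
  "sets (restrict_space borel gasket) = sigma_sets gasket {C \<inter> gasket | C. closed C}"
proof -
  have b: "sets (borel :: plane measure) = sigma_sets UNIV (Collect closed)"
    by (subst borel_eq_closed) (rule sets_measure_of, simp)
  have "sets (restrict_space (borel :: plane measure) gasket) = {id -` A \<inter> gasket | A. A \<in> sigma_sets UNIV (Collect closed)}"
    unfolding sets_restrict_space b by auto
  also have "\<dots> = sigma_sets gasket {id -` A \<inter> gasket | A. A \<in> Collect closed}"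
    by (rule sigma_sets_vimage_commute) simp
  also have "{id -` A \<inter> gasket | A. A \<in> Collect closed} = {C \<inter> gasket | C. closed C}" by simp
  finally show ?thesis .
qed

text \<open>Traces of closed sets generate the Borel sets and are stable under intersection; their
  masses are limits of integrals of functions in the domain.\<close>

lemma gasket_measure_unique:
  assumes M: "sets M = sets (restrict_space borel gasket)" "finite_measure M"
    and N: "sets N = sets (restrict_space borel gasket)" "finite_measure N"
    and eq: "\<And>g. g \<in> form_domain \<Longrightarrow> (\<integral>x. g x \<partial>M) = (\<integral>x. g x \<partial>N)"
  shows "M = N"
proof (rule measure_eqI_generator_eq)
  let ?E = "{C \<inter> gasket | C. closed (C :: plane set)}"
  show "Int_stable ?E"
  proof (rule Int_stableI)
    fix a b assume "a \<in> ?E" "b \<in> ?E"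
    then obtain C D where CD: "closed C" "closed D" "a = C \<inter> gasket" "b = D \<inter> gasket" by blast
    then have "a \<inter> b = (C \<inter> D) \<inter> gasket" by auto
    then show "a \<inter> b \<in> ?E" using closed_Int[OF CD(1,2)] by blast
  qed
  show "?E \<subseteq> Pow gasket" by auto
  show "sets M = sigma_sets gasket ?E" "sets N = sigma_sets gasket ?E"
    using M(1) N(1) sets_restrict_gasket by auto
  show "range (\<lambda>_::nat. gasket) \<subseteq> ?E" by (auto intro!: exI[of _ UNIV])
  show "(\<Union>i::nat. gasket) = gasket" by simp
  show "emeasure M gasket \<noteq> \<infinity>" using finite_measure.emeasure_finite[OF M(2)] by simp
  fix X assume "X \<in> ?E"
  then obtain C where C: "closed C" "X = C \<inter> gasket" by blast
  obtain g :: "nat \<Rightarrow> plane \<Rightarrow> real" and K where g: "\<And>n. g n \<in> form_domain" "\<And>n z. z \<in> gasket \<Longrightarrow> \<bar>g n z\<bar> \<le> K"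
    "\<And>z. z \<in> gasket \<Longrightarrow> (\<lambda>n. g n z) \<longlonglongrightarrow> indicator C z"
    using closed_approximation[OF C(1)] by blast
  have lim: "(\<lambda>n. \<integral>x. g n x \<partial>P) \<longlonglongrightarrow> measure P X"
    if P: "sets P = sets (restrict_space borel gasket)" "finite_measure P" for P
  proof -
    interpret P: finite_measure P by (rule P(2))
    have sp: "space P = gasket" using sets_eq_imp_space_eq[OF P(1)] by (simp add: space_restrict_space)
    have X: "X \<in> sets P" unfolding P(1) sets_restrict_gasket using C by (auto intro: sigma_sets.Basic)
    have meas: "h \<in> borel_measurable P" if "h \<in> borel_measurable (restrict_space borel gasket)" for h :: "plane \<Rightarrow> real"
      using that by (simp add: measurable_cong_sets[OF P(1) refl])
    have "(\<lambda>n. \<integral>x. g n x \<partial>P) \<longlonglongrightarrow> (\<integral>x. indicator X x \<partial>P)"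
    proof (rule integral_dominated_convergence[where w = "\<lambda>_. K"])
      show "g n \<in> borel_measurable P" for n by (intro meas form_domain_measurable g(1))
      show "indicator X \<in> borel_measurable P" using X by simp
      show "AE x in P. (\<lambda>n. g n x) \<longlonglongrightarrow> indicator X x"
        using g(3) by (intro AE_I2) (auto simp: sp C(2) indicator_def)
      show "AE x in P. norm (g n x) \<le> K" for n using g(2) by (intro AE_I2) (simp add: sp)
    qed simp
    then show ?thesis using X sets.sets_into_space[OF X] by (simp add: Int_absorb2)
  qed
  have "measure M X = measure N X"
    using lim[OF M] lim[OF N] eq[OF g(1)] by (simp add: LIMSEQ_unique)
  then show "emeasure M X = emeasure N X"
    using finite_measure.emeasure_eq_measure[OF M(2)] finite_measure.emeasure_eq_measure[OF N(2)] by simp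
qed

text \<open>On one edge the expression is \<open>(x1 - x2)\<^sup>2 * (y1 + y2)\<close>. Where
  \<open>y\<close> is nearly \<open>G\<close> this is about \<open>2 * G\<close> times the energy of
  the edge, which is the origin of the factor 2 in the cylinder masses.\<close>

lemma Q_energy_density:
  assumes "\<And>a. a \<in> {1,2,3} \<Longrightarrow> \<bar>y (p a) - G\<bar> \<le> \<delta>"
  shows "\<bar>2 * Q x (\<lambda>v. x v * y v) - Q (\<lambda>v. (x v)\<^sup>2) y - 2 * G * Q x x\<bar> \<le> 2 * \<delta> * Q x x"
proof -
  have e: "2 * ((x1 - x2) * (x1 * y1 - x2 * y2)) - (x1\<^sup>2 - x2\<^sup>2) * (y1 - y2) - 2 * G * ((x1 - x2) * (x1 - x2))
      = (x1 - x2)\<^sup>2 * ((y1 - G) + (y2 - G))" for x1 x2 y1 y2 :: real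
    by (simp add: power2_eq_square algebra_simps)
  have le: "\<bar>2 * ((x1 - x2) * (x1 * y1 - x2 * y2)) - (x1\<^sup>2 - x2\<^sup>2) * (y1 - y2) - 2 * G * ((x1 - x2) * (x1 - x2))\<bar>
      \<le> 2 * \<delta> * ((x1 - x2) * (x1 - x2))" if "\<bar>y1 - G\<bar> \<le> \<delta>" "\<bar>y2 - G\<bar> \<le> \<delta>" for x1 x2 y1 y2 :: real
  proof -
    have "\<bar>(x1 - x2)\<^sup>2 * ((y1 - G) + (y2 - G))\<bar> \<le> (x1 - x2)\<^sup>2 * (2 * \<delta>)"
      unfolding abs_mult using that by (intro mult_mono) auto
    then show ?thesis unfolding e by (simp add: power2_eq_square mult.commute mult.left_commute)
  qed
  define t where "t a b = 2 * ((x (p a) - x (p b)) * (x (p a) * y (p a) - x (p b) * y (p b))) -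
    ((x (p a))\<^sup>2 - (x (p b))\<^sup>2) * (y (p a) - y (p b)) - 2 * G * ((x (p a) - x (p b)) * (x (p a) - x (p b)))" for a b
  define d where "d a b = 2 * \<delta> * ((x (p a) - x (p b)) * (x (p a) - x (p b)))" for a b
  have l: "\<bar>t a b\<bar> \<le> d a b" if "a \<in> {1,2,3}" "b \<in> {1,2,3}" for a b
    unfolding t_def d_def by (intro le assms that)
  have "2 * Q x (\<lambda>v. x v * y v) - Q (\<lambda>v. (x v)\<^sup>2) y - 2 * G * Q x x = t 1 2 + t 2 3 + t 3 1"
    unfolding Q_eq t_def by (simp add: algebra_simps)
  moreover have "2 * \<delta> * Q x x = d 1 2 + d 2 3 + d 3 1"
    unfolding Q_eq d_def by (simp add: distrib_left)
  moreover have "\<bar>t 1 2\<bar> \<le> d 1 2" "\<bar>t 2 3\<bar> \<le> d 2 3" "\<bar>t 3 1\<bar> \<le> d 3 1" by (rule l; simp)+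
  ultimately show ?thesis by linarith
qed

lemma energy_word_measure_exists:
  assumes "f \<in> form_domain"
  obtains M where "word_measure p \<psi> T L (\<lambda>w. 2 * cell_energy f w) M"
proof -
  note fin = form_domain_fin[OF assms]
  have nn: "2 * cell_energy f w \<ge> 0" if "w \<in> Adm" for w using cell_energy_nonneg[OF fin that] by simp
  have add: "tree_sum (\<lambda>w. 2 * cell_energy f w) w = 2 * cell_energy f w" if "w \<in> Adm" for w
    using cell_energy_tree_sum[OF fin that] by (simp add: tree_sum_def sum_distrib_left[symmetric])
  obtain M where M: "sets M = sets word_space" "finite_measure M"
    "\<And>w. w \<in> lists alphabet \<Longrightarrow> emeasure M (cylinder w) = ennreal (if w \<in> Adm then 2 * cell_energy f w else 0)"
    using word_measure_exists[of "\<lambda>w. 2 * cell_energy f w", OF nn add] by blast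
  have "word_measure p \<psi> T L (\<lambda>w. 2 * cell_energy f w) M"
    by (rule word_measureI[OF nn add M])
  then show ?thesis by (rule that)
qed

text \<open>Both sides are limits: \<open>X n\<close> is a Riemann sum of \<open>g\<close> for the
  word measure, \<open>D n\<close> the level-\<open>n\<close> value of the right-hand side. Their
  difference tends to 0.\<close>

lemma energy_integral:
  assumes f: "f \<in> form_domain" and M: "word_measure p \<psi> T L (\<lambda>w. 2 * cell_energy f w) M" and g: "g \<in> form_domain"
  shows "(\<integral>x. g x \<partial>word_measure.image_measure p \<psi> T L M) = 2 * form f (\<lambda>x. f x * g x) - form (\<lambda>x. (f x)\<^sup>2) g"
proof -
  interpret M: word_measure p \<psi> T L "\<lambda>w. 2 * cell_energy f w" M by (rule M)
  note fin = form_domain_fin[OF f]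
  obtain B where B: "B \<ge> 0" "\<And>n \<omega> a. \<omega> \<in> adm_sequences \<Longrightarrow> a \<in> {1,2,3} \<Longrightarrow>
    \<bar>g (\<psi>_word (initial_word n \<omega>) (p a)) - g (coding \<omega>)\<bar> \<le> osc * sqrt (B * rmax ^ n)"
    using form_domain_osc[OF g] by blast
  obtain K where K: "K \<ge> 0" "\<And>z. z \<in> gasket \<Longrightarrow> \<bar>g z\<bar> \<le> K" using form_domain_bounded[OF g] by blast
  define G where "G w = g (\<psi>_word w (p 1))" for w
  define \<delta> where "\<delta> n = 2 * (osc * sqrt (B * rmax ^ n))" for n
  have \<delta>0: "\<delta> \<longlonglongrightarrow> 0" unfolding \<delta>_def using tendsto_mult[OF tendsto_const osc_tendsto, of 2 B] by simp
  have osc_w: "\<bar>g (\<psi>_word w (p a)) - G w\<bar> \<le> \<delta> (length w)" if w: "w \<in> Adm" and a: "a \<in> {1,2,3}" for w a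
  proof -
    obtain \<omega> where \<omega>: "\<omega> \<in> adm_sequences" "\<And>n. initial_word (length w + n) \<omega> = corner_ext a w n"
      using corner_sequence_ex[OF w a] by blast
    have i: "initial_word (length w) \<omega> = w" using \<omega>(2)[of 0] by simp
    show ?thesis
      using B(2)[OF \<omega>(1) a, of "length w"] B(2)[OF \<omega>(1), of 1 "length w"] unfolding i G_def \<delta>_def by simp
  qed
  define D where "D n = 2 * level_energy n f (\<lambda>x. f x * g x) - level_energy n (\<lambda>x. (f x)\<^sup>2) g" for n
  have Dlim: "D \<longlonglongrightarrow> 2 * form f (\<lambda>x. f x * g x) - form (\<lambda>x. (f x)\<^sup>2) g"
    unfolding D_def
    using form_domain_mult[OF f f] form_domain_mult[OF f g]
    by (intro tendsto_intros form_LIMSEQ form_domain_fin f g) (simp_all add: power2_eq_square)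
  define X where "X n = (\<Sum>w\<in>adm_words n. G w * (2 * cell_energy f w))" for n
  have Xlim: "X \<longlonglongrightarrow> (\<integral>x. g x \<partial>M.image_measure)"
  proof -
    have "(\<lambda>n. \<integral>\<omega>. indicator adm_sequences \<omega> * G (initial_word n \<omega>) \<partial>M) \<longlonglongrightarrow> (\<integral>\<omega>. indicator adm_sequences \<omega> * g (coding \<omega>) \<partial>M)"
    proof (rule integral_dominated_convergence[where w = "\<lambda>_. K"])
      have [measurable]: "initial_word n \<in> measurable M (count_space UNIV)" for n
        using measurable_initial_word by (simp add: measurable_cong_sets[OF M.sets_M refl])
      have [measurable]: "adm_sequences \<in> sets M" by (simp add: M.sets_M)
      show m: "(\<lambda>\<omega>. indicator adm_sequences \<omega> * G (initial_word n \<omega>)) \<in> borel_measurable M" for n by measurable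
      have lim: "(\<lambda>n. indicator adm_sequences \<omega> * G (initial_word n \<omega>)) \<longlonglongrightarrow> indicator adm_sequences \<omega> * g (coding \<omega>)" for \<omega>
      proof (cases "\<omega> \<in> adm_sequences")
        case True
        have "(\<lambda>n. \<bar>G (initial_word n \<omega>) - g (coding \<omega>)\<bar>) \<longlonglongrightarrow> 0"
          by (rule tendsto_sandwich[OF _ _ tendsto_const osc_tendsto[of B]])
            (use B(2)[OF True, of 1] in \<open>simp_all add: G_def\<close>)
        then show ?thesis using True by (simp add: tendsto_rabs_zero_iff LIM_zero_iff)
      qed simp
      show "(\<lambda>\<omega>. indicator adm_sequences \<omega> * g (coding \<omega>)) \<in> borel_measurable M"
        by (rule borel_measurable_LIMSEQ_real[OF lim m])
      show "AE \<omega> in M. (\<lambda>n. indicator adm_sequences \<omega> * G (initial_word n \<omega>)) \<longlonglongrightarrow> indicator adm_sequences \<omega> * g (coding \<omega>)"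
        by (intro AE_I2 lim)
      have "\<bar>G (initial_word n \<omega>)\<bar> \<le> K" if "\<omega> \<in> adm_sequences" for n \<omega>
        unfolding G_def by (intro K(2) vertex_gasket adm_sequences_Adm[OF that]) simp
      then show "AE \<omega> in M. norm (indicator adm_sequences \<omega> * G (initial_word n \<omega>)) \<le> K" for n
        using K(1) by (intro AE_I2) (simp add: indicator_def)
    qed simp
    then show ?thesis
      unfolding X_def M.integral_initial_word M.integral_image_measure[OF form_domain_measurable[OF g]] .
  qed
  have diff: "\<bar>D n - X n\<bar> \<le> 2 * \<delta> n * cell_energy f [] + K * (2 * cell_energy f [] - 2 * level_energy n f f)" for n
  proof -
    \<comment> \<open>The intermediate sum uses level-\<open>n\<close> energies. \<open>D n\<close>
      differs from it by the oscillation of \<open>g\<close> inside cells, \<open>X n\<close> by the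
      energy that level \<open>n\<close> does not yet see.\<close>
    define Y where "Y = (\<Sum>w\<in>adm_words n. G w * (2 * en f f w))"
    have \<delta>n: "\<delta> n \<ge> 0" unfolding \<delta>_def using osc_bounds B(1) rmax_bounds by simp
    have D: "D n = (\<Sum>w\<in>adm_words n. 2 * en f (\<lambda>x. f x * g x) w - en (\<lambda>x. (f x)\<^sup>2) g w)"
      unfolding D_def level_energy_eq sum_adm_words[symmetric] by (simp add: sum_subtractf sum_distrib_left)
    have "\<bar>D n - Y\<bar> \<le> (\<Sum>w\<in>adm_words n. \<bar>2 * en f (\<lambda>x. f x * g x) w - en (\<lambda>x. (f x)\<^sup>2) g w - G w * (2 * en f f w)\<bar>)"
      unfolding D Y_def sum_subtractf[symmetric] by (rule sum_abs)
    also have "\<dots> \<le> (\<Sum>w\<in>adm_words n. 2 * \<delta> n * en f f w)"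
    proof (rule sum_mono)
      fix w assume "w \<in> adm_words n"
      then have w: "w \<in> Adm" "length w = n" by (auto simp: adm_words_Adm)
      have "\<bar>2 * Q (f \<circ> \<psi>_word w) (\<lambda>v. (f \<circ> \<psi>_word w) v * (g \<circ> \<psi>_word w) v) - Q (\<lambda>v. ((f \<circ> \<psi>_word w) v)\<^sup>2) (g \<circ> \<psi>_word w) - 2 * G w * Q (f \<circ> \<psi>_word w) (f \<circ> \<psi>_word w)\<bar>
          \<le> 2 * \<delta> n * Q (f \<circ> \<psi>_word w) (f \<circ> \<psi>_word w)"
        using osc_w[OF w(1)] w(2) by (intro Q_energy_density) simp
      then have "\<bar>2 * Q (f \<circ> \<psi>_word w) (\<lambda>v. (f \<circ> \<psi>_word w) v * (g \<circ> \<psi>_word w) v) - Q (\<lambda>v. ((f \<circ> \<psi>_word w) v)\<^sup>2) (g \<circ> \<psi>_word w) - 2 * G w * Q (f \<circ> \<psi>_word w) (f \<circ> \<psi>_word w)\<bar> / r_word w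
          \<le> 2 * \<delta> n * Q (f \<circ> \<psi>_word w) (f \<circ> \<psi>_word w) / r_word w"
        using r_word_pos[OF w(1)] by (intro divide_right_mono) auto
      moreover have "2 * en f (\<lambda>x. f x * g x) w - en (\<lambda>x. (f x)\<^sup>2) g w - G w * (2 * en f f w) =
          (2 * Q (f \<circ> \<psi>_word w) (\<lambda>v. (f \<circ> \<psi>_word w) v * (g \<circ> \<psi>_word w) v) - Q (\<lambda>v. ((f \<circ> \<psi>_word w) v)\<^sup>2) (g \<circ> \<psi>_word w) - 2 * G w * Q (f \<circ> \<psi>_word w) (f \<circ> \<psi>_word w)) / r_word w"
        unfolding en_def by (simp add: comp_def diff_divide_distrib mult.commute mult.left_commute)
      ultimately show "\<bar>2 * en f (\<lambda>x. f x * g x) w - en (\<lambda>x. (f x)\<^sup>2) g w - G w * (2 * en f f w)\<bar> \<le> 2 * \<delta> n * en f f w"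
        using r_word_pos[OF w(1)] by (simp add: en_def abs_divide)
    qed
    also have "\<dots> = 2 * \<delta> n * level_energy n f f"
      unfolding level_energy_eq sum_adm_words[symmetric] by (simp add: sum_distrib_left)
    also have "\<dots> \<le> 2 * \<delta> n * cell_energy f []"
      using cell_energy_ge[OF fin, of "[]" n] \<delta>n unfolding level_energy_eq by (intro mult_left_mono) auto
    finally have 1: "\<bar>D n - Y\<bar> \<le> 2 * \<delta> n * cell_energy f []" .
    have "\<bar>Y - X n\<bar> \<le> (\<Sum>w\<in>adm_words n. \<bar>G w * (2 * en f f w) - G w * (2 * cell_energy f w)\<bar>)"
      unfolding X_def Y_def sum_subtractf[symmetric] by (rule sum_abs)
    also have "\<dots> \<le> (\<Sum>w\<in>adm_words n. K * (2 * cell_energy f w - 2 * en f f w))"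
    proof (rule sum_mono)
      fix w assume "w \<in> adm_words n"
      then have w: "w \<in> Adm" by (auto simp: adm_words_Adm)
      have "\<bar>G w\<bar> \<le> K" unfolding G_def by (intro K(2) vertex_gasket[OF w]) simp
      moreover have "en f f w \<le> cell_energy f w" using cell_energy_ge[OF fin w, of 0] by simp
      ultimately have "\<bar>G w\<bar> * (2 * cell_energy f w - 2 * en f f w) \<le> K * (2 * cell_energy f w - 2 * en f f w)"
        by (intro mult_right_mono) auto
      moreover have "\<bar>G w * (2 * en f f w) - G w * (2 * cell_energy f w)\<bar> = \<bar>G w\<bar> * (2 * cell_energy f w - 2 * en f f w)"
        using \<open>en f f w \<le> cell_energy f w\<close> unfolding right_diff_distrib[symmetric] abs_mult by simp
      ultimately show "\<bar>G w * (2 * en f f w) - G w * (2 * cell_energy f w)\<bar> \<le> K * (2 * cell_energy f w - 2 * en f f w)"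
        by simp
    qed
    also have "\<dots> = K * (2 * cell_energy f [] - 2 * level_energy n f f)"
      using M.sum_adm_words_a[of n] unfolding level_energy_eq sum_adm_words[symmetric]
      by (simp add: sum_distrib_left[symmetric] sum_subtractf)
    finally show ?thesis using 1 by linarith
  qed
  have "(\<lambda>n. 2 * \<delta> n * cell_energy f [] + K * (2 * cell_energy f [] - 2 * level_energy n f f)) \<longlonglongrightarrow>
      2 * 0 * cell_energy f [] + K * (2 * cell_energy f [] - 2 * cell_energy f [])"
    unfolding level_energy_eq by (intro tendsto_intros \<delta>0 cell_energy_LIMSEQ[OF fin Nil_Adm])
  then have R: "(\<lambda>n. 2 * \<delta> n * cell_energy f [] + K * (2 * cell_energy f [] - 2 * level_energy n f f)) \<longlonglongrightarrow> 0"
    by (simp only: diff_self mult_zero_right mult_zero_left add_0_left)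
  have "(\<lambda>n. D n - X n) \<longlonglongrightarrow> 0"
    by (rule Lim_null_comparison[OF _ R]) (use diff in simp)
  then have "(\<lambda>n. X n + (D n - X n)) \<longlonglongrightarrow> (\<integral>x. g x \<partial>M.image_measure) + 0"
    by (intro tendsto_add Xlim)
  then show ?thesis using LIMSEQ_unique[OF Dlim] by simp
qed

lemma energy_measure_eq:
  assumes f: "f \<in> form_domain" and M: "word_measure p \<psi> T L (\<lambda>w. 2 * cell_energy f w) M"
  shows "energy_measure f = word_measure.image_measure p \<psi> T L M"
proof -
  interpret M: word_measure p \<psi> T L "\<lambda>w. 2 * cell_energy f w" M by (rule M)
  show ?thesis
    unfolding energy_measure_def
  proof (rule the_equality)
    show "sets M.image_measure = sets (restrict_space borel gasket) \<and> finite_measure M.image_measure \<and>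
     (\<forall>g\<in>form_domain. (\<integral>x. g x \<partial>M.image_measure) = 2 * form f (\<lambda>x. f x * g x) - form (\<lambda>x. (f x)\<^sup>2) g)"
      using M.sets_image_measure M.finite_image_measure energy_integral[OF f M] by blast
    fix N assume N: "sets N = sets (restrict_space borel gasket) \<and> finite_measure N \<and>
     (\<forall>g\<in>form_domain. (\<integral>x. g x \<partial>N) = 2 * form f (\<lambda>x. f x * g x) - form (\<lambda>x. (f x)\<^sup>2) g)"
    show "N = M.image_measure"
      by (rule gasket_measure_unique) (use N M.sets_image_measure M.finite_image_measure energy_integral[OF f M] in auto)
  qed
qed

section \<open>Spreading of the density\<close>

text \<open>The energy of the part of \<open>y\<close> symmetric under the reflection fixing corner
  \<open>i\<close>. The squared term is \<open>2 * y (p i) - y (p j) - y (p k)\<close>, written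
  without naming the other corners.\<close>

definition sym_energy :: "nat \<Rightarrow> (plane \<Rightarrow> real) \<Rightarrow> real" where
  "sym_energy i y = (3 * y (p i) - (\<Sum>a\<in>{1,2,3}. y (p a)))\<^sup>2 / 2"

definition anti_energy :: "nat \<Rightarrow> (plane \<Rightarrow> real) \<Rightarrow> real" where
  "anti_energy i y = Q y y - sym_energy i y"

lemma triple_ex: "i \<in> {1,2,3::nat} \<Longrightarrow> \<exists>j k. {i,j,k} = {1,2,3}"
  by (elim insertE emptyE) (auto intro: exI[of _ 2] exI[of _ 3] exI[of _ 1])

lemma sym_anti_energy:
  assumes "{i,j,k} = {1,2,3}"
  shows "sym_energy i y = (2 * y (p i) - y (p j) - y (p k))\<^sup>2 / 2"
    and "anti_energy i y = 3 * (y (p j) - y (p k))\<^sup>2 / 2"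
proof -
  show 1: "sym_energy i y = (2 * y (p i) - y (p j) - y (p k))\<^sup>2 / 2"
    unfolding sym_energy_def triple_sum[OF assms] by (simp add: algebra_simps)
  show "anti_energy i y = 3 * (y (p j) - y (p k))\<^sup>2 / 2"
    unfolding anti_energy_def 1 Q_double_sum triple_sum[OF assms]
    by (simp add: power2_eq_square field_simps)
qed

lemma sym_energy_nonneg: "sym_energy i y \<ge> 0"
  by (simp add: sym_energy_def)

lemma anti_energy_nonneg:
  assumes "i \<in> {1,2,3}"
  shows "anti_energy i y \<ge> 0"
proof -
  obtain j k where ijk: "{i,j,k} = {1,2,3}" using triple_ex[OF assms] by blast
  show ?thesis unfolding sym_anti_energy(2)[OF ijk] by simp
qed

text \<open>The symmetric shares of the energy at the three corners lie between 0 and 1 and sum to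
  3/2. So one is at least 1/2, and they cannot all be close to 0 or 1, where their sum would be
  close to an integer.\<close>

lemma sym_energy_sum: "sym_energy 1 y + sym_energy 2 y + sym_energy 3 y = 3 / 2 * Q y y"
proof -
  have e: "(3 * a - (a + b + c))\<^sup>2 + (3 * b - (a + b + c))\<^sup>2 + (3 * c - (a + b + c))\<^sup>2 =
      3 * ((a - b) * (a - b) + (b - c) * (b - c) + (c - a) * (c - a))" for a b c :: real
    by (simp add: power2_eq_square algebra_simps)
  have s: "(\<Sum>a\<in>{1,2,3}. y (p a)) = y (p 1) + y (p 2) + y (p 3)" by simp
  show ?thesis
    unfolding sym_energy_def s Q_eq using e[of "y (p 1)" "y (p 2)" "y (p 3)"] by (simp only: add_divide_distrib[symmetric])
qed

lemma corner_energies: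
  assumes "\<nu> \<ge> 2" "harm \<nu> y" "i \<in> {1,2,3}"
  shows "sym_energy i (y \<circ> \<psi> \<nu> i) = (r \<nu>)\<^sup>2 * sym_energy i y"
    and "anti_energy i (y \<circ> \<psi> \<nu> i) = (s_eig \<nu>)\<^sup>2 * anti_energy i y"
proof -
  obtain j k where ijk: "{i,j,k} = {1,2,3}" using triple_ex[OF assms(3)] by blast
  show "sym_energy i (y \<circ> \<psi> \<nu> i) = (r \<nu>)\<^sup>2 * sym_energy i y"
    unfolding sym_anti_energy(1)[OF ijk] corner_eigen(1)[OF assms(1,2) ijk] by (simp add: power_mult_distrib)
  show "anti_energy i (y \<circ> \<psi> \<nu> i) = (s_eig \<nu>)\<^sup>2 * anti_energy i y"
    unfolding sym_anti_energy(2)[OF ijk] corner_eigen(2)[OF assms(1,2) ijk] by (simp add: power_mult_distrib)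
qed

text \<open>The factor by which a corner step with label \<open>\<nu>\<close> lowers the ratio of
  antisymmetric to symmetric energy. Its maximum \<open>kappa\<close> over the finite set
  \<open>T\<close> is still below 1.\<close>

definition sigma_eig :: "nat \<Rightarrow> real" where
  "sigma_eig \<nu> = (s_eig \<nu> / r \<nu>)\<^sup>2"

definition kappa :: real where
  "kappa = Max (sigma_eig ` T)"

lemma sigma_eig_bounds: "\<nu> \<in> T \<Longrightarrow> 0 \<le> sigma_eig \<nu>" "\<nu> \<in> T \<Longrightarrow> sigma_eig \<nu> \<le> kappa"
  and kappa_bounds: "0 \<le> kappa" "kappa < 1"
proof -
  show 1: "0 \<le> sigma_eig \<nu>" if "\<nu> \<in> T" for \<nu> by (simp add: sigma_eig_def)
  show 2: "sigma_eig \<nu> \<le> kappa" if "\<nu> \<in> T" for \<nu> unfolding kappa_def using T_finite that by simp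
  have "kappa \<in> sigma_eig ` T" unfolding kappa_def using T_finite T_nonempty by (intro Max_in) auto
  then obtain \<nu> where \<nu>: "\<nu> \<in> T" "kappa = sigma_eig \<nu>" by blast
  then show "0 \<le> kappa" using 1 by simp
  have "\<bar>s_eig \<nu> / r \<nu>\<bar> < 1" using s_eig_less[OF T_ge[OF \<nu>(1)]] r_pos[OF T_ge[OF \<nu>(1)]] by (simp add: abs_divide)
  then show "kappa < 1" unfolding \<nu>(2) sigma_eig_def by (simp add: abs_square_less_1)
qed

text \<open>Each corner step multiplies the two parts by the squares of their eigenvalues. The ratio
  estimate is cross-multiplied, so that it makes sense even if the symmetric part vanishes.\<close>

lemma corner_chain:
  assumes "w \<in> Adm" "i \<in> {1,2,3}" and harm: "\<And>u. u \<in> Adm \<Longrightarrow> length u \<ge> length w \<Longrightarrow> harm (L u) (g \<circ> \<psi>_word u)"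
  defines "x t \<equiv> g \<circ> \<psi>_word (corner_ext i w t)"
  shows "\<exists>R>0. sym_energy i (x t) = R * sym_energy i (x 0)"
    and "anti_energy i (x t) * sym_energy i (x 0) \<le> kappa ^ t * sym_energy i (x t) * anti_energy i (x 0)"
proof -
  have x: "x (Suc t) = x t \<circ> \<psi> (L (corner_ext i w t)) i" for t
    by (simp add: x_def \<psi>_word_append comp_assoc)
  have A: "corner_ext i w t \<in> Adm" for t by (rule corner_ext_Adm[OF assms(1,2)])
  have h: "harm (L (corner_ext i w t)) (x t)" for t unfolding x_def by (rule harm[OF A]) simp
  note ce = corner_energies[OF L_ge[OF A] h assms(2), folded x]
  show "\<exists>R>0. sym_energy i (x t) = R * sym_energy i (x 0)"
  proof (induction t)
    case (Suc t)
    then obtain R where R: "R > 0" "sym_energy i (x t) = R * sym_energy i (x 0)" by blast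
    have "sym_energy i (x (Suc t)) = ((r (L (corner_ext i w t)))\<^sup>2 * R) * sym_energy i (x 0)"
      unfolding ce(1) R(2) by simp
    moreover have "(r (L (corner_ext i w t)))\<^sup>2 * R > 0" using r_pos[OF L_ge[OF A]] R(1) by (simp add: less_imp_neq[symmetric])
    ultimately show ?case by blast
  qed (auto intro: exI[of _ 1])
  show "anti_energy i (x t) * sym_energy i (x 0) \<le> kappa ^ t * sym_energy i (x t) * anti_energy i (x 0)"
  proof (induction t)
    case (Suc t)
    let ?\<nu> = "L (corner_ext i w t)"
    have s: "(s_eig ?\<nu>)\<^sup>2 = sigma_eig ?\<nu> * (r ?\<nu>)\<^sup>2"
      unfolding sigma_eig_def using r_pos[OF L_ge[OF A[of t]]] by (simp add: power_divide)
    have "anti_energy i (x (Suc t)) * sym_energy i (x 0) = (sigma_eig ?\<nu> * (r ?\<nu>)\<^sup>2) * (anti_energy i (x t) * sym_energy i (x 0))"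
      unfolding ce(2) s by simp
    also have "\<dots> \<le> (kappa * (r ?\<nu>)\<^sup>2) * (kappa ^ t * sym_energy i (x t) * anti_energy i (x 0))"
    proof (rule mult_mono[OF _ Suc])
      show "sigma_eig ?\<nu> * (r ?\<nu>)\<^sup>2 \<le> kappa * (r ?\<nu>)\<^sup>2"
        using sigma_eig_bounds[OF L_T[OF A[of t]]] by (intro mult_right_mono) auto
      show "0 \<le> kappa * (r ?\<nu>)\<^sup>2" using kappa_bounds by simp
      show "0 \<le> anti_energy i (x t) * sym_energy i (x 0)"
        by (intro mult_nonneg_nonneg anti_energy_nonneg[OF assms(2)] sym_energy_nonneg)
    qed
    also have "\<dots> = kappa ^ Suc t * sym_energy i (x (Suc t)) * anti_energy i (x 0)"
      unfolding ce(1) by simp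
    finally show ?case .
  qed simp
qed

section \<open>Densities along corner words\<close>

text \<open>If \<open>g\<close> is harmonic from \<open>w\<close> on, this is half the ratio of the
  energy mass to the weight of the cylinder; a constant factor does not affect relative
  spreading.\<close>

definition dens :: "(letter \<Rightarrow> real) \<Rightarrow> (plane \<Rightarrow> real) \<Rightarrow> letter list \<Rightarrow> real" where
  "dens q g w = en g g w / word_weight q w"

definition anti_share :: "nat \<Rightarrow> (plane \<Rightarrow> real) \<Rightarrow> letter list \<Rightarrow> real" where
  "anti_share i g w = anti_energy i (g \<circ> \<psi>_word w) / Q (g \<circ> \<psi>_word w) (g \<circ> \<psi>_word w)"

text \<open>\<open>Q\<close> scales by \<open>r\<^sup>2\<close> up to the bracket, the
  renormalisation of the new letter divides by \<open>r\<close>, and its weight divides by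
  \<open>q\<close>; this leaves \<open>r / q\<close> in front.\<close>

lemma dens_corner:
  assumes "q \<in> weights" "w \<in> Adm" "harm (L w) (g \<circ> \<psi>_word w)" "i \<in> {1,2,3}" "Q (g \<circ> \<psi>_word w) (g \<circ> \<psi>_word w) > 0"
  shows "dens q g (w @ [(i, L w)]) = r (L w) / q (i, L w) * (1 - (1 - sigma_eig (L w)) * anti_share i g w) * dens q g w"
proof -
  let ?x = "g \<circ> \<psi>_word w" and ?\<nu> = "L w"
  have rp: "r ?\<nu> > 0" "r_word w > 0" using r_pos[OF L_ge] r_word_pos assms(2) by auto
  have qp: "q (i, ?\<nu>) > 0" "word_weight q w > 0"
    using word_weight_pos[OF assms(1) Adm_lists[OF assms(2)]] assms(1) corner_letter[OF L_ge[OF assms(2)] assms(4)] letters_alphabet[OF assms(2)]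
    by (auto simp: weights_def)
  have x': "g \<circ> \<psi>_word (w @ [(i, ?\<nu>)]) = ?x \<circ> \<psi> ?\<nu> i" by (simp add: \<psi>_word_append comp_assoc)
  have s: "(s_eig ?\<nu>)\<^sup>2 = sigma_eig ?\<nu> * (r ?\<nu>)\<^sup>2"
    unfolding sigma_eig_def using rp by (simp add: power_divide)
  have "Q (?x \<circ> \<psi> ?\<nu> i) (?x \<circ> \<psi> ?\<nu> i) = sym_energy i (?x \<circ> \<psi> ?\<nu> i) + anti_energy i (?x \<circ> \<psi> ?\<nu> i)"
    by (simp add: anti_energy_def)
  also have "\<dots> = (r ?\<nu>)\<^sup>2 * (sym_energy i ?x + sigma_eig ?\<nu> * anti_energy i ?x)"
    unfolding corner_energies[OF L_ge[OF assms(2)] assms(3,4)] s by (simp add: algebra_simps)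
  also have "sym_energy i ?x + sigma_eig ?\<nu> * anti_energy i ?x = Q ?x ?x * (1 - (1 - sigma_eig ?\<nu>) * anti_share i g w)"
    unfolding anti_share_def using assms(5) by (simp add: anti_energy_def field_simps)
  finally have Q: "Q (?x \<circ> \<psi> ?\<nu> i) (?x \<circ> \<psi> ?\<nu> i) = (r ?\<nu>)\<^sup>2 * (Q ?x ?x * (1 - (1 - sigma_eig ?\<nu>) * anti_share i g w))" .
  show ?thesis
    unfolding dens_def en_def x' Q r_word_append r_word_single word_weight_append word_weight_single snd_conv
    using rp qp by (simp add: power2_eq_square field_simps)
qed

text \<open>Both numbers lie between \<open>S / 2\<close> and \<open>3/2 * S\<close>, so the squares
  differ by at most
  \<open>2 * \<delta> * S * (3 * S) = 24 * \<delta> * (S / 2)\<^sup>2\<close>.\<close>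

lemma close_squares:
  fixes \<delta> S x y :: real
  assumes "0 < \<delta>" "\<delta> \<le> 1/2" "S > 0" "\<bar>x - S\<bar> < \<delta> * S" "\<bar>y - S\<bar> < \<delta> * S"
  shows "\<bar>x\<^sup>2 - y\<^sup>2\<bar> \<le> 24 * \<delta> * y\<^sup>2" "y > 0"
proof -
  have dS: "\<delta> * S \<le> S / 2" using assms(2,3) by simp
  have b: "S / 2 < x" "x < 3/2 * S" "S / 2 < y" "y < 3/2 * S" using assms(4,5) dS by linarith+
  then show "y > 0" using assms(3) by linarith
  have "\<bar>x\<^sup>2 - y\<^sup>2\<bar> = \<bar>x - y\<bar> * \<bar>x + y\<bar>" unfolding abs_mult[symmetric] by (simp add: power2_eq_square algebra_simps)
  also have "\<dots> \<le> (2 * (\<delta> * S)) * (3 * S)"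
    using assms b by (intro mult_mono) auto
  also have "\<dots> = 24 * \<delta> * (S / 2)\<^sup>2" by (simp add: power2_eq_square)
  also have "\<dots> \<le> 24 * \<delta> * y\<^sup>2" using b assms by (intro mult_left_mono power_mono) auto
  finally show "\<bar>x\<^sup>2 - y\<^sup>2\<bar> \<le> 24 * \<delta> * y\<^sup>2" .
qed

text \<open>Phrased with square roots of the density, since a Hellinger sum is the weighted sum of
  these.\<close>

definition spreads :: "(letter \<Rightarrow> real) \<Rightarrow> nat \<Rightarrow> real \<Rightarrow> (plane \<Rightarrow> real) \<Rightarrow> letter list \<Rightarrow> bool" where
  "spreads q N \<delta> g w \<longleftrightarrow> (\<exists>t. w @ t \<in> Adm \<and> length t \<le> N \<and>
     \<bar>sqrt (dens q g (w @ t)) - sqrt (dens q g w)\<bar> \<ge> \<delta> * sqrt (dens q g w))"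

lemma weights_alphabet: "q \<in> weights \<Longrightarrow> v \<in> alphabet \<Longrightarrow> 0 < q v \<and> q v \<le> 1"
proof -
  assume q: "q \<in> weights" and v: "v \<in> alphabet"
  then obtain \<nu> where \<nu>: "\<nu> \<in> T" "v \<in> letters \<nu>" using alphabet_letter by blast
  have pos: "q u > 0" if "u \<in> letters \<nu>" for u using q that \<nu> by (auto simp: weights_def alphabet_def)
  have "q v \<le> (\<Sum>u\<in>letters \<nu>. q u)"
    by (rule member_le_sum) (use \<nu> pos finite_letters in \<open>auto simp: less_imp_le\<close>)
  then show "0 < q v \<and> q v \<le> 1" using q \<nu> pos[OF \<nu>(2)] by (simp add: weights_def)
qed

lemma not_spreads_close:
  assumes q: "q \<in> weights" and w: "w \<in> Adm" and Qw: "Q (g \<circ> \<psi>_word w) (g \<circ> \<psi>_word w) > 0"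
    and \<delta>: "0 < \<delta>" "\<delta> \<le> 1/2" and ns: "\<not> spreads q N \<delta> g w"
    and u: "w @ t \<in> Adm" "w @ t' \<in> Adm" "length t \<le> N" "length t' \<le> N"
  shows "\<bar>dens q g (w @ t) - dens q g (w @ t')\<bar> \<le> 24 * \<delta> * dens q g (w @ t')" "dens q g (w @ t') > 0"
proof -
  have d0: "dens q g w' \<ge> 0" if "w' \<in> Adm" for w'
    unfolding dens_def using en_nonneg[OF that] word_weight_pos[OF q Adm_lists[OF that]] by simp
  have "dens q g w > 0"
    unfolding dens_def en_def using Qw r_word_pos[OF w] word_weight_pos[OF q Adm_lists[OF w]] by simp
  then have S: "sqrt (dens q g w) > 0" by simp
  have c: "\<bar>sqrt (dens q g (w @ t)) - sqrt (dens q g w)\<bar> < \<delta> * sqrt (dens q g w)"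
    "\<bar>sqrt (dens q g (w @ t')) - sqrt (dens q g w)\<bar> < \<delta> * sqrt (dens q g w)"
    using ns u unfolding spreads_def by (auto simp: not_le)
  show "\<bar>dens q g (w @ t) - dens q g (w @ t')\<bar> \<le> 24 * \<delta> * dens q g (w @ t')"
    using close_squares(1)[OF \<delta> S c] d0[OF u(1)] d0[OF u(2)] by simp
  show "dens q g (w @ t') > 0" using close_squares(2)[OF \<delta> S c] by simp
qed

lemma dens_pos_iff:
  assumes "q \<in> weights" "w \<in> Adm"
  shows "dens q g w > 0 \<longleftrightarrow> Q (g \<circ> \<psi>_word w) (g \<circ> \<psi>_word w) > 0"
  unfolding dens_def en_def using r_word_pos[OF assms(2)] word_weight_pos[OF assms(1) Adm_lists[OF assms(2)]]
  by (simp add: pos_less_divide_eq)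

lemma corner_ext_prefix: "\<exists>t. corner_ext i w n = w @ t \<and> length t = n"
proof (induction n)
  case (Suc n)
  then obtain t where "corner_ext i w n = w @ t" "length t = n" by blast
  then show ?case by (intro exI[of _ "t @ [(i, L (corner_ext i w n))]"]) simp
qed simp

text \<open>Without spreading, the word and its corner child, both within \<open>N\<close> letters
  of \<open>w\<close>, have nearly equal densities; \<open>dens_corner\<close> turns their quotient
  into the factor.\<close>

lemma ratio_near_1:
  assumes q: "q \<in> weights" and w: "w \<in> Adm" and Qw: "Q (g \<circ> \<psi>_word w) (g \<circ> \<psi>_word w) > 0"
    and \<delta>: "0 < \<delta>" "\<delta> \<le> 1/2" and ns: "\<not> spreads q N \<delta> g w"
    and harm: "\<And>u. u \<in> Adm \<Longrightarrow> length u \<ge> length w \<Longrightarrow> harm (L u) (g \<circ> \<psi>_word u)"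
    and t: "w @ t \<in> Adm" "length t < N" and i: "i \<in> {1,2,3}"
  shows "\<bar>r (L (w @ t)) / q (i, L (w @ t)) * (1 - (1 - sigma_eig (L (w @ t))) * anti_share i g (w @ t)) - 1\<bar> \<le> 24 * \<delta>"
proof -
  let ?u = "w @ t"
  define \<rho> where "\<rho> = r (L ?u) / q (i, L ?u) * (1 - (1 - sigma_eig (L ?u)) * anti_share i g ?u)"
  have A: "w @ (t @ [(i, L ?u)]) \<in> Adm" using Adm_corner[OF t(1) i] by simp
  note c = not_spreads_close[OF q w Qw \<delta> ns A t(1)]
  have pos: "dens q g ?u > 0" using c(2) t(2) by simp
  have "dens q g (w @ (t @ [(i, L ?u)])) = \<rho> * dens q g ?u"
    using dens_corner[OF q t(1) harm[OF t(1)] i] dens_pos_iff[OF q t(1)] pos by (simp add: \<rho>_def)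
  then have "\<bar>\<rho> * dens q g ?u - dens q g ?u\<bar> \<le> 24 * \<delta> * dens q g ?u"
    using c(1) t(2) by simp
  moreover have "\<rho> * dens q g ?u - dens q g ?u = (\<rho> - 1) * dens q g ?u" by (simp add: left_diff_distrib)
  ultimately have "\<bar>\<rho> - 1\<bar> * dens q g ?u \<le> 24 * \<delta> * dens q g ?u"
    using pos by (simp only: abs_mult abs_of_pos)
  then show ?thesis using pos unfolding \<rho>_def by (simp only: mult_le_cancel_right_pos)
qed

lemma spread_if_weights_differ:
  assumes q: "q \<in> weights" and ne: "\<forall>i\<in>{1,2,3}. \<forall>\<nu>\<in>T. q (i, \<nu>) \<noteq> r \<nu>"
  obtains N \<delta> where "\<delta> > 0" "\<And>g w. w \<in> Adm \<Longrightarrow> (\<And>u. u \<in> Adm \<Longrightarrow> length u \<ge> length w \<Longrightarrow> harm (L u) (g \<circ> \<psi>_word u)) \<Longrightarrow>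
    Q (g \<circ> \<psi>_word w) (g \<circ> \<psi>_word w) > 0 \<Longrightarrow> spreads q N \<delta> g w"
proof -
  define \<gamma> where "\<gamma> = Min ((\<lambda>(i, \<nu>). \<bar>r \<nu> / q (i, \<nu>) - 1\<bar>) ` ({1,2,3} \<times> T))"
  define K where "K = Max ((\<lambda>(i, \<nu>). r \<nu> / q (i, \<nu>)) ` ({1,2,3} \<times> T))"
  have fin: "finite ({1,2,3::nat} \<times> T)" "{1,2,3::nat} \<times> T \<noteq> {}" using T_finite T_nonempty by auto
  have qpos: "q (i, \<nu>) > 0" if "i \<in> {1,2,3}" "\<nu> \<in> T" for i \<nu>
    using weights_alphabet[OF q] corner_letter[OF T_ge[OF that(2)] that(1)] that(2) unfolding alphabet_def by blast
  have \<gamma>le: "\<gamma> \<le> \<bar>r \<nu> / q (i, \<nu>) - 1\<bar>" if "i \<in> {1,2,3}" "\<nu> \<in> T" for i \<nu>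
    unfolding \<gamma>_def using fin that by (intro Min_le) (auto intro!: rev_image_eqI[of "(i, \<nu>)"])
  have Kge: "r \<nu> / q (i, \<nu>) \<le> K" if "i \<in> {1,2,3}" "\<nu> \<in> T" for i \<nu>
    unfolding K_def using fin that by (intro Max_ge) (auto intro!: rev_image_eqI[of "(i, \<nu>)"])
  have "\<gamma> \<in> (\<lambda>(i, \<nu>). \<bar>r \<nu> / q (i, \<nu>) - 1\<bar>) ` ({1,2,3} \<times> T)"
    unfolding \<gamma>_def using fin by (intro Min_in) auto
  then obtain i0 \<nu>0 where i0: "i0 \<in> {1,2,3}" "\<nu>0 \<in> T" "\<gamma> = \<bar>r \<nu>0 / q (i0, \<nu>0) - 1\<bar>" by auto
  have "r \<nu>0 / q (i0, \<nu>0) \<noteq> 1"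
    using ne i0(1,2) by (metis divide_eq_1_iff)
  then have \<gamma>: "\<gamma> > 0" unfolding i0(3) by (simp only: zero_less_abs_iff right_minus_eq not_False_eq_True)
  have K: "K > 0"
    by (rule less_le_trans[OF divide_pos_pos[OF r_pos[OF T_ge[OF i0(2)]] qpos[OF i0(1,2)]] Kge[OF i0(1,2)]])
  have "(\<lambda>n. kappa ^ n) \<longlonglongrightarrow> 0" by (rule LIMSEQ_power_zero) (use kappa_bounds in simp)
  then have "\<forall>\<^sub>F n in sequentially. kappa ^ n < \<gamma> / (2 * K)" by (rule order_tendstoD) (use \<gamma> K in simp)
  \<comment> \<open>After \<open>l\<close> corner steps the antisymmetric share is at most
    \<open>kappa ^ l\<close>, so it shifts the factor by at most
    \<open>K * \<gamma> / (2 * K) = \<gamma> / 2\<close>.\<close>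
  then obtain l where l: "kappa ^ l < \<gamma> / (2 * K)" unfolding eventually_sequentially by blast
  \<comment> \<open>With the constant 24 of \<open>close_squares\<close> the tolerance becomes
    \<open>\<gamma> / 4\<close>, less than the distance \<open>\<gamma> - \<gamma> / 2\<close> of
    the factor from 1.\<close>
  define \<delta> where "\<delta> = min (1/2) (\<gamma> / 96)"
  have \<delta>: "0 < \<delta>" "\<delta> \<le> 1/2" "24 * \<delta> \<le> \<gamma> / 4" using \<gamma> by (auto simp: \<delta>_def)
  \<comment> \<open>\<open>l\<close> letters lead into the corner, and one more is needed to form
    the quotient of densities.\<close>
  have "spreads q (Suc l) \<delta> g w"
    if w: "w \<in> Adm" and harm: "\<And>u. u \<in> Adm \<Longrightarrow> length u \<ge> length w \<Longrightarrow> harm (L u) (g \<circ> \<psi>_word u)"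
      and Qw: "Q (g \<circ> \<psi>_word w) (g \<circ> \<psi>_word w) > 0" for g w
  proof (rule ccontr)
    assume ns: "\<not> spreads q (Suc l) \<delta> g w"
    let ?x = "g \<circ> \<psi>_word w"
    \<comment> \<open>The three values sum to \<open>3/2 * Q\<close>, so one is at least half of
      \<open>Q\<close>; at that corner the antisymmetric part starts no larger than the symmetric
      one.\<close>
    have "\<exists>i\<in>{1,2,3}. sym_energy i ?x \<ge> Q ?x ?x / 2"
      using sym_energy_sum[of ?x] by (simp add: not_le del: One_nat_def) linarith
    then obtain i where i: "i \<in> {1,2,3}" "sym_energy i ?x \<ge> Q ?x ?x / 2" by blast
    let ?y = "g \<circ> \<psi>_word (corner_ext i w l)"
    have a0: "anti_energy i ?x \<le> sym_energy i ?x" "sym_energy i ?x > 0" using i(2) Qw by (simp_all add: anti_energy_def)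
    obtain R where R: "R > 0" "sym_energy i ?y = R * sym_energy i ?x"
      using corner_chain(1)[OF w i(1) harm, of l] by auto
    have sy: "sym_energy i ?y > 0" using R a0 by simp
    have "anti_energy i ?y * sym_energy i ?x \<le> kappa ^ l * sym_energy i ?y * anti_energy i ?x"
      using corner_chain(2)[OF w i(1) harm, of l] by simp
    also have "\<dots> \<le> kappa ^ l * sym_energy i ?y * sym_energy i ?x"
      using a0 sy kappa_bounds by (intro mult_left_mono) auto
    finally have ay: "anti_energy i ?y \<le> kappa ^ l * sym_energy i ?y" using a0(2) by simp
    have Qy: "Q ?y ?y = sym_energy i ?y + anti_energy i ?y" by (simp add: anti_energy_def)
    let ?u = "corner_ext i w l"
    have sh: "0 \<le> anti_share i g ?u" "anti_share i g ?u \<le> kappa ^ l"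
    proof -
      have an: "anti_energy i ?y \<ge> 0" by (rule anti_energy_nonneg[OF i(1)])
      then show "0 \<le> anti_share i g ?u" unfolding anti_share_def by (simp add: Q_nonneg)
      have "kappa ^ l * sym_energy i ?y \<le> kappa ^ l * Q ?y ?y"
        unfolding Qy using an kappa_bounds by (intro mult_left_mono) auto
      then have "anti_energy i ?y \<le> kappa ^ l * Q ?y ?y" using ay by linarith
      then show "anti_share i g ?u \<le> kappa ^ l" unfolding anti_share_def using sy an Qy by (simp add: divide_le_eq)
    qed
    obtain t where t: "?u = w @ t" "length t = l" using corner_ext_prefix by blast
    have uA: "?u \<in> Adm" by (rule corner_ext_Adm[OF w i(1)])
    let ?\<nu> = "L ?u"
    have near: "\<bar>r ?\<nu> / q (i, ?\<nu>) * (1 - (1 - sigma_eig ?\<nu>) * anti_share i g ?u) - 1\<bar> \<le> 24 * \<delta>"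
      using ratio_near_1[OF q w Qw \<delta>(1,2) ns harm _ _ i(1), of t] uA t by simp
    have \<nu>T: "?\<nu> \<in> T" by (rule L_T[OF uA])
    have rq: "r ?\<nu> / q (i, ?\<nu>) > 0" using qpos[OF i(1) \<nu>T] r_pos[OF T_ge[OF \<nu>T]] by simp
    have sg: "0 \<le> 1 - sigma_eig ?\<nu>" "1 - sigma_eig ?\<nu> \<le> 1" using sigma_eig_bounds[OF \<nu>T] kappa_bounds by auto
    have "(1 - sigma_eig ?\<nu>) * anti_share i g ?u \<le> 1 * kappa ^ l" using sg sh by (intro mult_mono) auto
    then have "r ?\<nu> / q (i, ?\<nu>) * ((1 - sigma_eig ?\<nu>) * anti_share i g ?u) \<le> K * (\<gamma> / (2 * K))"
      using Kge[OF i(1) \<nu>T] rq sg sh l K by (intro mult_mono) auto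
    then have e1: "r ?\<nu> / q (i, ?\<nu>) * ((1 - sigma_eig ?\<nu>) * anti_share i g ?u) \<le> \<gamma> / 2" using K by simp
    have e0: "r ?\<nu> / q (i, ?\<nu>) * ((1 - sigma_eig ?\<nu>) * anti_share i g ?u) \<ge> 0" using rq sg sh by (intro mult_nonneg_nonneg) auto
    have "r ?\<nu> / q (i, ?\<nu>) * (1 - (1 - sigma_eig ?\<nu>) * anti_share i g ?u) =
      r ?\<nu> / q (i, ?\<nu>) - r ?\<nu> / q (i, ?\<nu>) * ((1 - sigma_eig ?\<nu>) * anti_share i g ?u)"
      by (simp only: right_diff_distrib mult_1_right)
    then show False using near e0 e1 \<gamma>le[OF i(1) \<nu>T] \<delta>(3) \<gamma> by linarith
  qed
  then show ?thesis using that[OF \<delta>(1), of "Suc l"] by blast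
qed

text \<open>The property \<open>(\<star>)\<close> with \<open>l\<^sub>0 = l\<^sub>1 = 1\<close> and \<open>i = 1\<close>.\<close>

definition recurrent :: "nat \<Rightarrow> letter list \<Rightarrow> bool" where
  "recurrent l w \<longleftrightarrow> (\<forall>j\<in>{1,2,3}. \<exists>t\<in>{1..l}. L (corner_ext j (w @ [(1, L w)]) t) = L (w @ [(1, L w)]))"

lemma spread_if_recurrent:
  assumes q: "q \<in> weights"
  obtains \<delta> where "\<delta> > 0" "\<And>g w. w \<in> Adm \<Longrightarrow> recurrent l w \<Longrightarrow>
    (\<And>u. u \<in> Adm \<Longrightarrow> length u \<ge> length w \<Longrightarrow> harm (L u) (g \<circ> \<psi>_word u)) \<Longrightarrow>
    Q (g \<circ> \<psi>_word w) (g \<circ> \<psi>_word w) > 0 \<Longrightarrow> spreads q (l + 2) \<delta> g w"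
proof -
  define \<rho> where "\<rho> = Min (r ` T)"
  have "\<rho> \<in> r ` T" unfolding \<rho>_def using T_finite T_nonempty by (intro Min_in) auto
  then have \<rho>: "\<rho> > 0" using r_pos T_ge by auto
  have \<rho>le: "\<rho> \<le> r \<nu>" if "\<nu> \<in> T" for \<nu> unfolding \<rho>_def using T_finite that by simp
  \<comment> \<open>Lower bound for the difference of two corner factors with the same label:
    \<open>\<rho>\<close> for \<open>r / q\<close> (as \<open>q \<le> 1\<close>),
    \<open>1 - kappa\<close> for \<open>1 - sigma_eig\<close>, and \<open>(1 - kappa) / 64\<close>
    for the drop of the antisymmetric share.\<close>
  define c where "c = \<rho> * (1 - kappa) * ((1 - kappa) / 64)"
  have c: "c > 0" unfolding c_def using \<rho> kappa_bounds by simp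
  \<comment> \<open>Two factors, each within \<open>c / 4\<close> of 1, differ by at most
    \<open>c / 2\<close>, which contradicts the lower bound \<open>c\<close>.\<close>
  define \<delta> where "\<delta> = min (1/2) (c / 96)"
  have \<delta>: "0 < \<delta>" "\<delta> \<le> 1/2" "24 * \<delta> \<le> c / 4" using c by (auto simp: \<delta>_def)
  \<comment> \<open>The letter leading to \<open>w1\<close>, at most \<open>l\<close> corner letters
    up to the repeated label, and one more for the second quotient.\<close>
  have "spreads q (l + 2) \<delta> g w"
    if w: "w \<in> Adm" and rec: "recurrent l w"
      and harm: "\<And>u. u \<in> Adm \<Longrightarrow> length u \<ge> length w \<Longrightarrow> harm (L u) (g \<circ> \<psi>_word u)"
      and Qw: "Q (g \<circ> \<psi>_word w) (g \<circ> \<psi>_word w) > 0" for g w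
  proof (rule ccontr)
    assume ns: "\<not> spreads q (l + 2) \<delta> g w"
    define w1 where "w1 = w @ [(1, L w)]"
    have w1: "w1 \<in> Adm" unfolding w1_def by (rule Adm_corner[OF w]) simp
    let ?x = "g \<circ> \<psi>_word w1"
    have "dens q g w1 > 0"
      using not_spreads_close(2)[OF q w Qw \<delta>(1,2) ns, of "[]" "[(1, L w)]"] w w1 by (simp add: w1_def)
    then have Qx: "Q ?x ?x > 0" using dens_pos_iff[OF q w1] by simp
    \<comment> \<open>Otherwise each share is below 1/8 or above 7/8. With no large share the sum is
      below 3/8, with one it is below 5/4, with two or more it exceeds 7/4; never 3/2.\<close>
    have "\<exists>j\<in>{1,2,3}. sym_energy j ?x \<ge> Q ?x ?x / 8 \<and> anti_energy j ?x \<ge> Q ?x ?x / 8"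
    proof (rule ccontr)
      assume no: "\<not> ?thesis"
      have "sym_energy j ?x \<le> Q ?x ?x \<and> (sym_energy j ?x < Q ?x ?x / 8 \<or> sym_energy j ?x > 7/8 * Q ?x ?x)"
        if "j \<in> {1,2,3}" for j
      proof -
        have "\<not> (sym_energy j ?x \<ge> Q ?x ?x / 8 \<and> anti_energy j ?x \<ge> Q ?x ?x / 8)" using no that by blast
        moreover have "anti_energy j ?x = Q ?x ?x - sym_energy j ?x" by (simp add: anti_energy_def)
        ultimately show ?thesis using anti_energy_nonneg[OF that, of ?x] by linarith
      qed
      from this[of 1] this[of 2] this[of 3] show False
        using sym_energy_sum[of ?x] Qx sym_energy_nonneg[of 1 ?x] sym_energy_nonneg[of 2 ?x] sym_energy_nonneg[of 3 ?x]
        by simp linarith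
    qed
    then obtain j where j: "j \<in> {1,2,3}" "sym_energy j ?x \<ge> Q ?x ?x / 8" "anti_energy j ?x \<ge> Q ?x ?x / 8" by blast
    obtain t where t: "t \<in> {1..l}" "L (corner_ext j w1 t) = L w1"
      using rec j(1) unfolding recurrent_def w1_def by blast
    let ?u = "corner_ext j w1 t" let ?y = "g \<circ> \<psi>_word ?u"
    have uA: "?u \<in> Adm" by (rule corner_ext_Adm[OF w1 j(1)])
    have harm1: "harm (L u) (g \<circ> \<psi>_word u)" if "u \<in> Adm" "length u \<ge> length w1" for u
      by (rule harm[OF that(1)]) (use that(2) in \<open>simp add: w1_def\<close>)
    define a0 where "a0 = sym_energy j ?x"
    define b0 where "b0 = anti_energy j ?x"
    define c1 where "c1 = sym_energy j ?y"
    define d1 where "d1 = anti_energy j ?y"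
    have a0: "a0 > 0" "b0 > 0" using j(2,3) Qx by (auto simp: a0_def b0_def)
    obtain R where R: "R > 0" "c1 = R * a0"
      using corner_chain(1)[OF w1 j(1) harm1, of t] by (auto simp: c1_def a0_def)
    have c1: "c1 > 0" using R a0 by simp
    have d1: "d1 \<ge> 0" unfolding d1_def by (rule anti_energy_nonneg[OF j(1)])
    have "kappa ^ t \<le> kappa ^ 1" using t(1) kappa_bounds by (intro power_decreasing) auto
    then have kt: "kappa ^ t \<le> kappa" by simp
    have "d1 * a0 \<le> kappa ^ t * c1 * b0"
      using corner_chain(2)[OF w1 j(1) harm1, of t] by (simp add: c1_def a0_def d1_def b0_def)
    also have "\<dots> \<le> kappa * c1 * b0" using kt c1 a0 by (intro mult_right_mono) auto
    finally have chain: "d1 * a0 \<le> kappa * (c1 * b0)" by simp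
    have Q0: "Q ?x ?x = a0 + b0" by (simp add: a0_def b0_def anti_energy_def)
    have Qt: "Q ?y ?y = c1 + d1" by (simp add: c1_def d1_def anti_energy_def)
    define \<tau>0 where "\<tau>0 = anti_share j g w1"
    define \<tau>t where "\<tau>t = anti_share j g ?u"
    have \<tau>: "\<tau>0 = b0 / (a0 + b0)" "\<tau>t = d1 / (c1 + d1)"
      unfolding \<tau>0_def \<tau>t_def anti_share_def Q0 Qt by (simp_all add: b0_def d1_def)
    \<comment> \<open>The drop is \<open>b0 * c1 - d1 * a0\<close> over the product of the two
      totals. The chain estimate keeps \<open>(1 - kappa) * (b0 * c1)\<close> of the numerator, and
      both \<open>b0 / (a0 + b0)\<close> and \<open>c1 / (c1 + d1)\<close> are at least 1/8.\<close>
    have gap: "\<tau>0 - \<tau>t \<ge> (1 - kappa) / 64"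
    proof -
      have p: "a0 + b0 > 0" "c1 + d1 > 0" using a0 c1 d1 by auto
      have "\<tau>0 - \<tau>t = (b0 * c1 - d1 * a0) / ((a0 + b0) * (c1 + d1))"
        unfolding \<tau> using p by (simp add: field_simps)
      moreover have "b0 * c1 - d1 * a0 \<ge> (1 - kappa) * (b0 * c1)" using chain by (simp add: algebra_simps)
      ultimately have 1: "\<tau>0 - \<tau>t \<ge> (1 - kappa) * (b0 * c1) / ((a0 + b0) * (c1 + d1))"
        using p by (simp add: divide_right_mono)
      have 2: "b0 / (a0 + b0) \<ge> 1 / 8" using j(3) p(1) unfolding Q0 b0_def[symmetric] by (simp add: field_simps)
      have "kappa * (c1 * b0) \<le> 1 * (c1 * b0)" using kappa_bounds c1 a0 by (intro mult_right_mono) auto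
      then have "d1 * a0 \<le> c1 * b0" using chain by linarith
      then have "a0 / (a0 + b0) \<le> c1 / (c1 + d1)" using p by (simp add: field_simps)
      moreover have "a0 / (a0 + b0) \<ge> 1 / 8" using j(2) p(1) unfolding Q0 a0_def[symmetric] by (simp add: field_simps)
      ultimately have 3: "c1 / (c1 + d1) \<ge> 1 / 8" by linarith
      have "(1 / 8) * (1 / 8) \<le> b0 / (a0 + b0) * (c1 / (c1 + d1))" using 2 3 a0 p by (intro mult_mono) auto
      then have "(1 - kappa) * (1 / 64) \<le> (1 - kappa) * (b0 / (a0 + b0) * (c1 / (c1 + d1)))"
        using kappa_bounds by (intro mult_left_mono) auto
      moreover have "(1 - kappa) * (b0 / (a0 + b0) * (c1 / (c1 + d1))) = (1 - kappa) * (b0 * c1) / ((a0 + b0) * (c1 + d1))"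
        by simp
      ultimately show ?thesis using 1 by linarith
    qed
    let ?\<nu> = "L w1"
    have \<nu>T: "?\<nu> \<in> T" by (rule L_T[OF w1])
    have "(j, ?\<nu>) \<in> alphabet" using corner_letter[OF T_ge[OF \<nu>T] j(1)] \<nu>T unfolding alphabet_def by blast
    then have qj: "0 < q (j, ?\<nu>)" "q (j, ?\<nu>) \<le> 1" using weights_alphabet[OF q] by auto
    have sg: "1 - kappa \<le> 1 - sigma_eig ?\<nu>" using sigma_eig_bounds[OF \<nu>T] by simp
    have rq: "\<rho> \<le> r ?\<nu> / q (j, ?\<nu>)"
    proof -
      have "\<rho> * q (j, ?\<nu>) \<le> \<rho> * 1" using qj \<rho> by (intro mult_left_mono) auto
      then show ?thesis using \<rho>le[OF \<nu>T] qj by (simp add: le_divide_eq)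
    qed
    obtain s where s: "?u = w1 @ s" "length s = t" using corner_ext_prefix by blast
    have n0: "\<bar>r ?\<nu> / q (j, ?\<nu>) * (1 - (1 - sigma_eig ?\<nu>) * \<tau>0) - 1\<bar> \<le> 24 * \<delta>"
      using ratio_near_1[OF q w Qw \<delta>(1,2) ns harm _ _ j(1), of "[(1, L w)]"] w1 by (simp add: w1_def[symmetric] \<tau>0_def)
    have nt: "\<bar>r ?\<nu> / q (j, ?\<nu>) * (1 - (1 - sigma_eig ?\<nu>) * \<tau>t) - 1\<bar> \<le> 24 * \<delta>"
    proof -
      have u: "w @ ((1, L w) # s) = ?u" using s(1) by (simp add: w1_def)
      show ?thesis
        using ratio_near_1[OF q w Qw \<delta>(1,2) ns harm _ _ j(1), of "(1, L w) # s", unfolded u] uA s(2) t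
        by (simp add: \<tau>t_def)
    qed
    have eq: "k * d * (x - y) = k * (1 - d * y) - k * (1 - d * x)" for k d x y :: real
      by (simp add: algebra_simps)
    have "\<rho> * (1 - kappa) * ((1 - kappa) / 64) \<le> r ?\<nu> / q (j, ?\<nu>) * (1 - sigma_eig ?\<nu>) * (\<tau>0 - \<tau>t)"
      using rq sg gap \<rho> kappa_bounds by (intro mult_mono mult_nonneg_nonneg) auto
    also have "\<dots> = r ?\<nu> / q (j, ?\<nu>) * (1 - (1 - sigma_eig ?\<nu>) * \<tau>t) - r ?\<nu> / q (j, ?\<nu>) * (1 - (1 - sigma_eig ?\<nu>) * \<tau>0)"
      by (rule eq)
    finally show False using n0 nt \<delta>(3) c unfolding c_def[symmetric] by linarith
  qed
  then show ?thesis using that[OF \<delta>(1)] by blast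
qed

end

section \<open>Hellinger sums\<close>

text \<open>Borel-Cantelli: for bounds \<open>(1/2) ^ k\<close> the limsup of the sets is null for
  \<open>M\<close>. Its complement is a countable union of intersections of tails of complements,
  each of them null for \<open>N\<close>.\<close>

lemma mutually_singularI:
  assumes "finite_measure M" "finite_measure N" "sets M = sets N"
    and ex: "\<And>\<epsilon>. \<epsilon> > 0 \<Longrightarrow> \<exists>A\<in>sets M. measure M A \<le> \<epsilon> \<and> measure N (space N - A) \<le> \<epsilon>"
  shows "mutually_singular M N"
proof -
  interpret M: finite_measure M by fact
  interpret N: finite_measure N by fact
  have "\<exists>A\<in>sets M. measure M A \<le> (1/2) ^ k \<and> measure N (space N - A) \<le> (1/2) ^ k" for k :: nat
    by (rule ex) simp
  then obtain A where A: "\<And>k. A k \<in> sets M" "\<And>k. measure M (A k) \<le> (1/2) ^ k" "\<And>k. measure N (space N - A k) \<le> (1/2) ^ k"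
    by metis
  have AN: "A k \<in> sets N" for k using A(1) assms(3) by simp
  have "limsup A \<in> null_sets M"
  proof (rule borel_cantelli_limsup1[OF A(1)])
    show "emeasure M (A n) < \<infinity>" for n by (simp add: M.emeasure_eq_measure)
    show "summable (\<lambda>n. measure M (A n))"
      by (rule summable_comparison_test'[of "\<lambda>n. (1/2) ^ n" 0]) (simp_all add: A(2) summable_geometric)
  qed
  moreover have "space N - limsup A \<in> null_sets N"
  proof -
    have eq: "space N - limsup A = (\<Union>n. \<Inter>k\<in>{n..}. space N - A k)"
      by (auto simp: limsup_INF_SUP)
    have "(\<Inter>k\<in>{n..}. space N - A k) \<in> null_sets N" for n
    proof -
      have s: "(\<Inter>k\<in>{n..}. space N - A k) \<in> sets N"
        using AN by (intro sets.countable_INT') auto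
      have "measure N (\<Inter>k\<in>{n..}. space N - A k) \<le> 0"
      proof (rule LIMSEQ_le_const)
        show "(\<lambda>k. (1/2::real) ^ k) \<longlonglongrightarrow> 0" by (rule LIMSEQ_power_zero) simp
        have "measure N (\<Inter>k\<in>{n..}. space N - A k) \<le> (1/2) ^ k" if "k \<ge> n" for k
          by (rule order_trans[OF N.finite_measure_mono A(3)[of k]]) (use AN that in auto)
        then show "\<exists>K. \<forall>k\<ge>K. measure N (\<Inter>k\<in>{n..}. space N - A k) \<le> (1/2) ^ k" by blast
      qed
      then show ?thesis using s by (simp add: null_sets_def N.emeasure_eq_measure measure_le_0_iff)
    qed
    then show ?thesis unfolding eq by (intro null_sets_UN)
  qed
  ultimately show ?thesis
    unfolding mutually_singular_def using assms(3) by (auto intro!: bexI[of _ "limsup A"])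
qed

context inhomogeneous_gasket
begin

lemma tree_sum_pow_member_le:
  assumes "w @ t \<in> Adm" "\<And>u. u \<in> Adm \<Longrightarrow> \<phi> u \<ge> 0"
  shows "\<phi> (w @ t) \<le> (tree_sum ^^ length t) \<phi> w"
  using assms(1)
proof (induction t arbitrary: w)
  case (Cons v t)
  have A: "(w @ [v]) @ t \<in> Adm" using Cons.prems by simp
  then have wv: "w \<in> Adm" "v \<in> letters (L w)" using Adm_append[of "w @ [v]" t] by (auto simp: Adm_snoc)
  have "\<phi> (w @ v # t) \<le> (tree_sum ^^ length t) \<phi> (w @ [v])" using Cons.IH[OF A] by simp
  also have "\<dots> \<le> tree_sum ((tree_sum ^^ length t) \<phi>) w"
    by (rule tree_sum_child_le[OF wv]) (rule tree_sum_pow_nonneg, use assms(2) in auto)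
  finally show ?case by simp
qed simp

text \<open>Cauchy-Schwarz over the children of \<open>w\<close>.\<close>

lemma tree_sum_sqrt_mult:
  assumes "w \<in> Adm" "\<And>u. u \<in> Adm \<Longrightarrow> length u \<ge> length w \<Longrightarrow> \<phi> u \<ge> 0" "\<And>u. u \<in> Adm \<Longrightarrow> length u \<ge> length w \<Longrightarrow> \<theta> u \<ge> 0"
  shows "tree_sum (\<lambda>u. sqrt (\<phi> u) * sqrt (\<theta> u)) w \<le> sqrt (tree_sum \<phi> w) * sqrt (tree_sum \<theta> w)"
proof -
  have nn: "\<phi> (w @ [v]) \<ge> 0" "\<theta> (w @ [v]) \<ge> 0" if "v \<in> letters (L w)" for v
    using assms that by (auto simp: Adm_snoc)
  have "tree_sum (\<lambda>u. sqrt (\<phi> u) * sqrt (\<theta> u)) w = (\<Sum>v\<in>letters (L w). \<bar>sqrt (\<phi> (w @ [v]))\<bar> * \<bar>sqrt (\<theta> (w @ [v]))\<bar>)"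
    unfolding tree_sum_def using nn by (intro sum.cong) auto
  also have "\<dots> \<le> L2_set (\<lambda>v. sqrt (\<phi> (w @ [v]))) (letters (L w)) * L2_set (\<lambda>v. sqrt (\<theta> (w @ [v]))) (letters (L w))"
    by (rule L2_set_mult_ineq)
  also have "\<dots> = sqrt (tree_sum \<phi> w) * sqrt (tree_sum \<theta> w)"
    unfolding L2_set_def tree_sum_def using nn by (simp cong: sum.cong)
  finally show ?thesis .
qed

lemma tree_sum_pow_sqrt_mult:
  assumes "w \<in> Adm" "\<And>u. u \<in> Adm \<Longrightarrow> length u \<ge> length w \<Longrightarrow> \<phi> u \<ge> 0" "\<And>u. u \<in> Adm \<Longrightarrow> length u \<ge> length w \<Longrightarrow> \<theta> u \<ge> 0"
  shows "(tree_sum ^^ n) (\<lambda>u. sqrt (\<phi> u) * sqrt (\<theta> u)) w \<le> sqrt ((tree_sum ^^ n) \<phi> w) * sqrt ((tree_sum ^^ n) \<theta> w)"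
  using assms
proof (induction n arbitrary: w)
  case (Suc n)
  have "tree_sum ((tree_sum ^^ n) (\<lambda>u. sqrt (\<phi> u) * sqrt (\<theta> u))) w \<le>
      tree_sum (\<lambda>u. sqrt ((tree_sum ^^ n) \<phi> u) * sqrt ((tree_sum ^^ n) \<theta> u)) w"
    by (rule tree_sum_mono[OF Suc.prems(1)], rule Suc.IH) (use Suc.prems in auto)
  also have "\<dots> \<le> sqrt (tree_sum ((tree_sum ^^ n) \<phi>) w) * sqrt (tree_sum ((tree_sum ^^ n) \<theta>) w)"
    by (rule tree_sum_sqrt_mult[OF Suc.prems(1)]; rule tree_sum_pow_nonneg; (use Suc.prems in auto))
  finally show ?case by simp
qed simp

section \<open>Descent to the first good word\<close>

text \<open>The part of the \<open>n\<close>-th iterated child sum that comes from paths without a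
  \<open>G\<close>-word among their first \<open>n\<close> words, \<open>w\<close> included; the end
  word itself is not tested.\<close>

primrec avoiding :: "(letter list \<Rightarrow> bool) \<Rightarrow> (letter list \<Rightarrow> real) \<Rightarrow> nat \<Rightarrow> letter list \<Rightarrow> real" where
  "avoiding G \<phi> 0 w = \<phi> w"
| "avoiding G \<phi> (Suc n) w = (if G w then 0 else tree_sum (avoiding G \<phi> n) w)"

lemma avoiding_nonneg:
  assumes "\<And>u. u \<in> Adm \<Longrightarrow> length u \<ge> length w \<Longrightarrow> \<phi> u \<ge> 0" "w \<in> Adm"
  shows "avoiding G \<phi> n w \<ge> 0"
  using assms
proof (induction n arbitrary: w)
  case (Suc n)
  have "tree_sum (avoiding G \<phi> n) w \<ge> tree_sum (\<lambda>_. 0) w"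
    by (rule tree_sum_mono[OF Suc.prems(2)], rule Suc.IH) (use Suc.prems in auto)
  then show ?case by (simp add: tree_sum_zero)
qed simp

lemma avoiding_sqrt_mult:
  assumes "w \<in> Adm" "\<And>u. u \<in> Adm \<Longrightarrow> length u \<ge> length w \<Longrightarrow> \<phi> u \<ge> 0" "\<And>u. u \<in> Adm \<Longrightarrow> length u \<ge> length w \<Longrightarrow> \<theta> u \<ge> 0"
    and add: "\<And>u. u \<in> Adm \<Longrightarrow> length u \<ge> length w \<Longrightarrow> tree_sum \<phi> u = \<phi> u"
  shows "avoiding G (\<lambda>u. sqrt (\<phi> u) * sqrt (\<theta> u)) n w \<le> sqrt (\<phi> w) * sqrt (avoiding G \<theta> n w)"
  using assms
proof (induction n arbitrary: w)
  case (Suc n)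
  have "tree_sum (avoiding G (\<lambda>u. sqrt (\<phi> u) * sqrt (\<theta> u)) n) w \<le> tree_sum (\<lambda>u. sqrt (\<phi> u) * sqrt (avoiding G \<theta> n u)) w"
    by (rule tree_sum_mono[OF Suc.prems(1)], rule Suc.IH) (use Suc.prems in auto)
  also have "\<dots> \<le> sqrt (tree_sum \<phi> w) * sqrt (tree_sum (avoiding G \<theta> n) w)"
    by (rule tree_sum_sqrt_mult[OF Suc.prems(1,2)]) (use Suc.prems in \<open>auto intro: avoiding_nonneg\<close>)
  also have "tree_sum \<phi> w = \<phi> w" by (rule Suc.prems(4)[OF Suc.prems(1)]) simp
  finally show ?case using Suc.prems(2)[OF Suc.prems(1)] by auto
qed simp

text \<open>The value is the mass of the admissible sequences through \<open>w\<close> that miss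
  \<open>G\<close> at \<open>n\<close> consecutive lengths. These events decrease to a null event,
  since almost every sequence meets \<open>G\<close> again.\<close>

lemma avoiding_weight_tendsto:
  assumes M: "word_measure p \<psi> T L b M" and w: "w \<in> Adm"
    and io: "AE \<omega> in M. \<exists>\<^sub>\<infinity>k. G (initial_word k \<omega>)"
  shows "(\<lambda>n. avoiding G b n w) \<longlonglongrightarrow> 0"
proof -
  interpret M: word_measure p \<psi> T L b M by (rule M)
  define B where "B n w = {\<omega> \<in> cylinder w \<inter> adm_sequences. \<forall>j<n. \<not> G (initial_word (length w + j) \<omega>)}" for n w
  have sB: "B n w \<in> sets M" for n w
  proof -
    have "initial_word k -` {u. \<not> G u} \<inter> space word_space \<in> sets word_space" for k
      by (rule measurable_sets[OF measurable_initial_word]) simp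
    moreover have "initial_word k -` {u. \<not> G u} \<inter> space word_space = {\<omega> \<in> space word_space. \<not> G (initial_word k \<omega>)}" for k by auto
    ultimately have "{\<omega> \<in> space word_space. \<not> G (initial_word k \<omega>)} \<in> sets word_space" for k by simp
    then have "{\<omega> \<in> space word_space. \<forall>j\<in>{..<n}. \<not> G (initial_word (length w + j) \<omega>)} \<in> sets word_space"
      by (intro sets.sets_Collect_finite_All) (auto simp del: bex_simps ball_simps)
    moreover have "B n w = (cylinder w \<inter> adm_sequences) \<inter> {\<omega> \<in> space word_space. \<forall>j\<in>{..<n}. \<not> G (initial_word (length w + j) \<omega>)}"
      using cylinder_subset unfolding B_def by auto
    ultimately show ?thesis unfolding M.sets_M by (simp only: sets.Int sets_cylinder sets_adm_sequences)
  qed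
  have meas: "avoiding G b n w = measure M (B n w)" if "w \<in> Adm" for n w
    using that
  proof (induction n arbitrary: w)
    case 0
    have "measure M (cylinder w) = measure M (B 0 w)"
    proof (rule measure_eq_AE)
      show "AE x in M. (x \<in> cylinder w) = (x \<in> B 0 w)"
        using M.AE_adm_sequences by (rule AE_mp) (auto intro!: AE_I2 simp: B_def)
    qed (use sB in \<open>auto simp: M.sets_M\<close>)
    then show ?case using M.measure_cylinder[OF 0] by simp
  next
    case (Suc n)
    show ?case
    proof (cases "G w")
      case True
      then have "B (Suc n) w = {}" unfolding B_def by (auto simp: cylinder_def)
      then show ?thesis using True by simp
    next
      case False
      have "B (Suc n) w = (\<Union>v\<in>letters (L w). B n (w @ [v]))"
      proof (intro equalityI subsetI)
        fix \<omega> assume \<omega>: "\<omega> \<in> B (Suc n) w"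
        then have c: "\<omega> \<in> space word_space" "initial_word (length w) \<omega> = w" "\<omega> \<in> adm_sequences"
          by (auto simp: B_def cylinder_def)
        let ?v = "\<omega> (length w)"
        have i: "initial_word (Suc (length w)) \<omega> = w @ [?v]" using c(2) by (simp add: initial_word_Suc)
        then have "?v \<in> letters (L w)" using adm_sequences_Adm[OF c(3), of "Suc (length w)"] by (simp add: Adm_snoc)
        moreover have "\<not> G (initial_word (Suc (length w) + j) \<omega>)" if "j < n" for j
        proof -
          have "\<not> G (initial_word (length w + Suc j) \<omega>)" using \<omega> that unfolding B_def by blast
          then show ?thesis by simp
        qed
        then have "\<omega> \<in> B n (w @ [?v])" using c i unfolding B_def by (simp add: cylinder_def)
        ultimately show "\<omega> \<in> (\<Union>v\<in>letters (L w). B n (w @ [v]))" by blast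
      next
        fix \<omega> assume "\<omega> \<in> (\<Union>v\<in>letters (L w). B n (w @ [v]))"
        then obtain v where v: "\<omega> \<in> B n (w @ [v])" by blast
        then have c: "\<omega> \<in> space word_space" "initial_word (Suc (length w)) \<omega> = w @ [v]" "\<omega> \<in> adm_sequences"
          by (auto simp: B_def cylinder_def)
        then have i: "initial_word (length w) \<omega> = w" by (simp add: initial_word_Suc)
        have "\<not> G (initial_word (length w + j) \<omega>)" if "j < Suc n" for j
        proof (cases j)
          case 0
          then show ?thesis using i False by simp
        next
          case (Suc k)
          then have "\<not> G (initial_word (length (w @ [v]) + k) \<omega>)" using v that unfolding B_def by blast
          then show ?thesis using Suc by simp
        qed
        then show "\<omega> \<in> B (Suc n) w" using c i unfolding B_def by (simp add: cylinder_def)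
      qed
      moreover have "measure M (\<Union>v\<in>letters (L w). B n (w @ [v])) = (\<Sum>v\<in>letters (L w). measure M (B n (w @ [v])))"
      proof (rule M.finite_measure_finite_Union)
        show "disjoint_family_on (\<lambda>v. B n (w @ [v])) (letters (L w))"
          unfolding disjoint_family_on_def B_def cylinder_def by auto
      qed (use sB finite_letters in auto)
      moreover have "(\<Sum>v\<in>letters (L w). measure M (B n (w @ [v]))) = tree_sum (avoiding G b n) w"
        unfolding tree_sum_def using Suc by (intro sum.cong) (auto simp: Adm_snoc)
      ultimately show ?thesis using False by simp
    qed
  qed
  have "(\<lambda>n. measure M (B n w)) \<longlonglongrightarrow> measure M (\<Inter>n. B n w)"
  proof (rule M.finite_Lim_measure_decseq)
    show "range (\<lambda>n. B n w) \<subseteq> sets M" using sB by blast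
    show "decseq (\<lambda>n. B n w)" unfolding decseq_def B_def by (blast intro: less_le_trans)
  qed
  moreover have "measure M (\<Inter>n. B n w) = 0"
  proof -
    have "(\<Inter>n. B n w) \<in> null_sets M"
    proof (rule AE_iff_null_sets[THEN iffD2])
      show "(\<Inter>n. B n w) \<in> sets M" using sB by (intro sets.countable_INT) auto
      show "AE x in M. x \<notin> (\<Inter>n. B n w)"
        using io
      proof (rule AE_mp, intro AE_I2 impI notI)
        fix \<omega> assume inf: "\<exists>\<^sub>\<infinity>k. G (initial_word k \<omega>)" and B: "\<omega> \<in> (\<Inter>n. B n w)"
        obtain k where k: "k \<ge> length w" "G (initial_word k \<omega>)" using inf unfolding INFM_nat_le by blast
        have "\<omega> \<in> B (Suc (k - length w)) w" using B by blast
        then have "\<not> G (initial_word (length w + (k - length w)) \<omega>)" unfolding B_def by blast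
        then show False using k by simp
      qed
    qed
    then show ?thesis by (simp add: null_sets_def measure_def)
  qed
  ultimately show ?thesis using meas[OF w] by simp
qed

text \<open>
  The limit of the Hellinger sums below \<open>w\<close> is itself additive, hence it contracts by \<open>\<theta>\<close> at the first
  \<open>G\<close>-word below \<open>w\<close>; this can be iterated.
\<close>

lemma hellinger_descent:
  assumes M: "word_measure p \<psi> T L b M"
    and io: "AE \<omega> in M. \<exists>\<^sub>\<infinity>k. G (initial_word k \<omega>)"
    and e: "\<And>w. w \<in> Adm \<Longrightarrow> e w \<ge> 0" "\<And>w. w \<in> Adm \<Longrightarrow> length w \<ge> m \<Longrightarrow> tree_sum e w = e w"
    and \<theta>: "0 \<le> \<theta>" "\<theta> < 1"
    and good: "\<And>w. w \<in> Adm \<Longrightarrow> length w \<ge> m \<Longrightarrow> G w \<Longrightarrow>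
      (tree_sum ^^ N) (\<lambda>u. sqrt (e u) * sqrt (b u)) w \<le> \<theta> * (sqrt (e w) * sqrt (b w))"
    and w: "w \<in> Adm" "length w \<ge> m"
  shows "(\<lambda>n. (tree_sum ^^ n) (\<lambda>u. sqrt (e u) * sqrt (b u)) w) \<longlonglongrightarrow> 0"
proof -
  interpret M: word_measure p \<psi> T L b M by (rule M)
  define h where "h u = sqrt (e u) * sqrt (b u)" for u
  have hfun: "h = (\<lambda>u. sqrt (e u) * sqrt (b u))" by (rule ext) (rule h_def)
  have h0: "h u \<ge> 0" if "u \<in> Adm" for u unfolding h_def using e(1)[OF that] M.a_nonneg[OF that] by simp
  have hdec: "tree_sum h u \<le> h u" if "u \<in> Adm" "length u \<ge> m" for u
  proof -
    have "tree_sum h u \<le> sqrt (tree_sum e u) * sqrt (tree_sum b u)"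
      unfolding hfun by (rule tree_sum_sqrt_mult[OF that(1)]) (simp_all add: e(1) M.a_nonneg)
    then show ?thesis unfolding M.a_add[OF that(1)] e(2)[OF that] h_def .
  qed
  have dec: "decseq (\<lambda>n. (tree_sum ^^ n) h u)" if u: "u \<in> Adm" "length u \<ge> m" for u
  proof (rule decseq_SucI)
    fix n
    have "(tree_sum ^^ n) (tree_sum h) u \<le> (tree_sum ^^ n) h u"
      by (rule tree_sum_pow_mono[OF u(1)], rule hdec) (use u in auto)
    then show "(tree_sum ^^ Suc n) h u \<le> (tree_sum ^^ n) h u" by (simp add: funpow_swap1)
  qed
  have nn: "(tree_sum ^^ n) h u \<ge> 0" if "u \<in> Adm" for u n
    by (rule tree_sum_pow_nonneg[OF that]) (rule h0)
  \<comment> \<open>The sums decrease in \<open>n\<close> by Cauchy-Schwarz, so the limit exists;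
    unlike \<open>h\<close>, it is exactly additive.\<close>
  define H where "H u = lim (\<lambda>n. (tree_sum ^^ n) h u)" for u
  have Hlim: "(\<lambda>n. (tree_sum ^^ n) h u) \<longlonglongrightarrow> H u" if u: "u \<in> Adm" "length u \<ge> m" for u
  proof -
    obtain l where "(\<lambda>n. (tree_sum ^^ n) h u) \<longlonglongrightarrow> l"
      using decseq_convergent[OF dec[OF u], of 0] nn[OF u(1)] by blast
    then show ?thesis unfolding H_def by (metis limI)
  qed
  have H0: "H u \<ge> 0" if "u \<in> Adm" "length u \<ge> m" for u
    by (rule LIMSEQ_le_const[OF Hlim[OF that]]) (use nn that in auto)
  have Hh: "H u \<le> h u" if "u \<in> Adm" "length u \<ge> m" for u
    using decseq_ge[OF dec[OF that] Hlim[OF that], of 0] by simp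
  have Hadd: "tree_sum H u = H u" if u: "u \<in> Adm" "length u \<ge> m" for u
  proof -
    have "(\<lambda>n. \<Sum>v\<in>letters (L u). (tree_sum ^^ n) h (u @ [v])) \<longlonglongrightarrow> tree_sum H u"
      unfolding tree_sum_def[of H] by (intro tendsto_sum Hlim) (use u in \<open>auto simp: Adm_snoc\<close>)
    then have "(\<lambda>n. (tree_sum ^^ Suc n) h u) \<longlonglongrightarrow> tree_sum H u"
      by (simp add: tree_sum_def[of "(tree_sum ^^ _) _"])
    then show ?thesis using LIMSEQ_Suc[OF Hlim[OF u]] LIMSEQ_unique by blast
  qed
  have Hpow: "(tree_sum ^^ n) H u = H u" if u: "u \<in> Adm" "length u \<ge> m" for u n
  proof (induction n)
    case (Suc n)
    have "(tree_sum ^^ n) (tree_sum H) u = (tree_sum ^^ n) H u"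
      by (rule tree_sum_pow_cong[OF u(1)], rule Hadd) (use u in auto)
    then show ?case using Suc by (simp add: funpow_swap1)
  qed simp
  \<comment> \<open>Improves a bound \<open>H \<le> c * h\<close>, valid for all words from length
    \<open>m\<close> on, by the factor \<open>\<theta>\<close>.\<close>
  have step: "H u \<le> c * \<theta> * h u"
    if c: "c \<ge> 0" and IH: "\<And>u. u \<in> Adm \<Longrightarrow> length u \<ge> m \<Longrightarrow> H u \<le> c * h u" and u: "u \<in> Adm" "length u \<ge> m" "c * \<theta> \<le> c" for c u
  proof -
    have G: "H u \<le> c * \<theta> * h u" if "G u" "u \<in> Adm" "length u \<ge> m" for u
    proof -
      have "H u = (tree_sum ^^ N) H u" using Hpow that by simp
      also have "\<dots> \<le> (tree_sum ^^ N) (\<lambda>u. c * h u + 0 * h u) u"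
        by (rule tree_sum_pow_mono[OF that(2)]) (use IH that in auto)
      also have "\<dots> = c * (tree_sum ^^ N) h u" unfolding tree_sum_pow_linear by simp
      also have "\<dots> \<le> c * (\<theta> * h u)"
        using good[OF that(2,3,1)] c unfolding hfun by (rule mult_left_mono)
      finally show ?thesis by simp
    qed
    \<comment> \<open>At a \<open>G\<close>-word the contraction applies; any other word is passed
      on to its children, and \<open>avoiding\<close> collects what has met no \<open>G\<close>-word
      so far.\<close>
    have main: "H u \<le> c * \<theta> * h u + avoiding G h n u" if "u \<in> Adm" "length u \<ge> m" for n u
      using that
    proof (induction n arbitrary: u)
      case 0
      have "0 \<le> c * \<theta> * h u" using c \<theta> h0[OF 0(1)] by simp
      then show ?case using Hh[OF 0] by simp
    next
      case (Suc n)
      show ?case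
      proof (cases "G u")
        case True
        then show ?thesis using G[OF True Suc.prems] by simp
      next
        case False
        have "H u = tree_sum H u" using Hadd[OF Suc.prems] by simp
        also have "\<dots> \<le> tree_sum (\<lambda>u. c * \<theta> * h u + 1 * avoiding G h n u) u"
          by (rule tree_sum_mono[OF Suc.prems(1)]) (use Suc in auto)
        also have "\<dots> = c * \<theta> * tree_sum h u + tree_sum (avoiding G h n) u" unfolding tree_sum_linear by simp
        also have "\<dots> \<le> c * \<theta> * h u + tree_sum (avoiding G h n) u"
          using hdec[OF Suc.prems] c \<theta> by (intro add_right_mono mult_left_mono) auto
        finally show ?thesis using False by simp
      qed
    qed
    \<comment> \<open>Cauchy-Schwarz again: the energy factor stays bounded, while the weight of the
      avoiding paths tends to 0.\<close>
    have "avoiding G h n u \<le> sqrt (e u) * sqrt (avoiding G b n u)" for n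
      unfolding hfun by (rule avoiding_sqrt_mult[OF u(1)]) (use e M.a_nonneg u in auto)
    then have le: "H u \<le> c * \<theta> * h u + sqrt (e u) * sqrt (avoiding G b n u)" for n
      using main[OF u(1,2), of n] by (metis add_left_mono order_trans)
    have lim: "(\<lambda>n. c * \<theta> * h u + sqrt (e u) * sqrt (avoiding G b n u)) \<longlonglongrightarrow> c * \<theta> * h u + sqrt (e u) * sqrt 0"
      by (intro tendsto_intros avoiding_weight_tendsto[OF M u(1) io])
    have "H u \<le> c * \<theta> * h u + sqrt (e u) * sqrt 0"
      by (rule LIMSEQ_le_const[OF lim]) (use le in blast)
    then show ?thesis by simp
  qed
  have "H u \<le> \<theta> ^ k * h u" if "u \<in> Adm" "length u \<ge> m" for k u
    using that
  proof (induction k arbitrary: u)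
    case (Suc k)
    have "\<theta> ^ k * \<theta> \<le> \<theta> ^ k" using \<theta> by (simp add: mult_left_le)
    then show ?case using step[of "\<theta> ^ k" u] Suc \<theta> by (simp add: mult.commute)
  qed (simp add: Hh)
  then have le: "H w \<le> \<theta> ^ k * h w" for k using w by blast
  have lim: "(\<lambda>k. \<theta> ^ k * h w) \<longlonglongrightarrow> 0 * h w"
    by (intro tendsto_intros LIMSEQ_power_zero) (use \<theta> in simp)
  have "H w \<le> 0 * h w" by (rule LIMSEQ_le_const[OF lim]) (use le in blast)
  then have "H w = 0" using H0[OF w] by simp
  then show ?thesis using Hlim[OF w] unfolding hfun by simp
qed

definition qmin :: "(letter \<Rightarrow> real) \<Rightarrow> real" where
  "qmin q = Min (q ` alphabet)"

lemma qmin_bounds: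
  assumes "q \<in> weights"
  shows "0 < qmin q" "qmin q \<le> 1" "v \<in> alphabet \<Longrightarrow> qmin q \<le> q v"
proof -
  have "qmin q \<in> q ` alphabet" unfolding qmin_def using finite_alphabet alphabet_ne by (intro Min_in) auto
  then show "0 < qmin q" "qmin q \<le> 1" using weights_alphabet[OF assms] by auto
  show "v \<in> alphabet \<Longrightarrow> qmin q \<le> q v" unfolding qmin_def using finite_alphabet by simp
qed

lemma word_weight_ge:
  assumes "q \<in> weights" "t \<in> lists alphabet"
  shows "qmin q ^ length t \<le> word_weight q t"
  using assms(2)
proof (induction t)
  case (Cons v t)
  then have "qmin q * qmin q ^ length t \<le> q v * word_weight q t"
    using qmin_bounds[OF assms(1)] weights_alphabet[OF assms(1), of v] by (intro mult_mono) auto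
  then show ?case by (simp add: word_weight_def)
qed simp

text \<open>With \<open>s\<close> the root of the density and \<open>b\<close> the weight,
  additivity of energy and weight gives \<open>\<Sum> b * (s - s w)\<^sup>2 = 2 * (s w)\<^sup>2 * b
  w - 2 * s w * \<Sum> h\<close>. One word deviating by \<open>\<delta> * s w\<close>, of weight at
  least \<open>qmin q ^ N * b w\<close>, already forces the loss.\<close>

lemma hellinger_contraction:
  assumes q: "q \<in> weights" and w: "w \<in> Adm" and \<delta>: "\<delta> > 0"
    and harm: "\<And>u. u \<in> Adm \<Longrightarrow> length u \<ge> length w \<Longrightarrow> harm (L u) (g \<circ> \<psi>_word u)"
    and sp: "Q (g \<circ> \<psi>_word w) (g \<circ> \<psi>_word w) > 0 \<Longrightarrow> spreads q N \<delta> g w"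
  defines "h \<equiv> \<lambda>u. sqrt (en g g u) * sqrt (word_weight q u)"
  shows "(tree_sum ^^ N) h w \<le> (1 - \<delta>\<^sup>2 * qmin q ^ N / 2) * h w"
proof -
  define b where "b = word_weight q"
  have bp: "b u > 0" if "u \<in> Adm" for u unfolding b_def by (rule word_weight_pos[OF q Adm_lists[OF that]])
  have binv: "(tree_sum ^^ n) b w = b w" for n
    unfolding b_def by (rule tree_sum_pow_invariant[OF tree_sum_word_weight[OF q] w])
  have einv: "(tree_sum ^^ n) (en g g) w = en g g w" for n
    by (rule tree_sum_pow_en_harm[OF harm w]) auto
  have hdec: "(tree_sum ^^ n) h w \<le> h w" for n
    using tree_sum_pow_sqrt_mult[OF w, of "en g g" b n] en_nonneg bp binv einv
    unfolding h_def b_def by (simp add: less_imp_le)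
  show ?thesis
  proof (cases "Q (g \<circ> \<psi>_word w) (g \<circ> \<psi>_word w) > 0")
    case False
    then have "en g g w = 0" using Q_nonneg[of "g \<circ> \<psi>_word w"] by (simp add: en_def)
    then have "h w = 0" by (simp add: h_def)
    then show ?thesis using hdec[of N] by simp
  next
    case True
    define s where "s u = sqrt (dens q g u)" for u
    have s2: "en g g u = (s u)\<^sup>2 * b u" "h u = s u * b u" "s u \<ge> 0" if "u \<in> Adm" for u
    proof -
      have d: "dens q g u \<ge> 0" unfolding dens_def using en_nonneg[OF that] bp[OF that] by (simp add: b_def)
      show "s u \<ge> 0" unfolding s_def using d by simp
      show e: "en g g u = (s u)\<^sup>2 * b u" unfolding s_def using d bp[OF that] by (simp add: dens_def b_def)
      show "h u = s u * b u"
        unfolding h_def e b_def[symmetric] using \<open>s u \<ge> 0\<close> bp[OF that] by (simp add: real_sqrt_mult mult.assoc)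
    qed
    have sw: "s w > 0" unfolding s_def using dens_pos_iff[OF q w] True by simp
    obtain t where t: "w @ t \<in> Adm" "length t \<le> N" "\<bar>s (w @ t) - s w\<bar> \<ge> \<delta> * s w"
      using sp[OF True] unfolding spreads_def s_def by blast
    let ?n = "length t"
    define \<phi> where "\<phi> u = b u * (s u - s w)\<^sup>2" for u
    have "\<phi> (w @ t) \<le> (tree_sum ^^ ?n) \<phi> w"
      by (rule tree_sum_pow_member_le[OF t(1)]) (use bp in \<open>simp add: \<phi>_def less_imp_le\<close>)
    also have "(tree_sum ^^ ?n) \<phi> w = (tree_sum ^^ ?n) (\<lambda>u. 1 * (1 * en g g u + (s w)\<^sup>2 * b u) + (- 2 * s w) * h u) w"
      by (rule tree_sum_pow_cong[OF w]) (simp add: \<phi>_def s2 power2_eq_square algebra_simps)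
    also have "\<dots> = 2 * (s w)\<^sup>2 * b w - 2 * s w * (tree_sum ^^ ?n) h w"
      unfolding tree_sum_pow_linear einv binv s2(1)[OF w] by simp
    finally have 1: "\<phi> (w @ t) \<le> 2 * (s w)\<^sup>2 * b w - 2 * s w * (tree_sum ^^ ?n) h w" .
    have tl: "t \<in> lists alphabet" using Adm_lists[OF t(1)] by simp
    have "qmin q ^ N \<le> qmin q ^ ?n" using qmin_bounds[OF q] t(2) by (intro power_decreasing) auto
    also have "\<dots> \<le> word_weight q t" by (rule word_weight_ge[OF q tl])
    finally have "b w * qmin q ^ N \<le> b (w @ t)"
      unfolding b_def word_weight_append using bp[OF w] by (simp add: b_def)
    moreover have "(\<delta> * s w)\<^sup>2 \<le> (s (w @ t) - s w)\<^sup>2"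
      using t(3) \<delta> sw by (simp add: abs_le_square_iff[symmetric] abs_mult)
    ultimately have "(b w * qmin q ^ N) * (\<delta> * s w)\<^sup>2 \<le> \<phi> (w @ t)"
      unfolding \<phi>_def using bp[OF t(1)] by (intro mult_mono) auto
    then have "(b w * qmin q ^ N) * (\<delta> * s w)\<^sup>2 \<le> 2 * (s w)\<^sup>2 * b w - 2 * s w * (tree_sum ^^ ?n) h w" using 1 by linarith
    then have "2 * s w * (tree_sum ^^ ?n) h w \<le> 2 * s w * ((1 - \<delta>\<^sup>2 * qmin q ^ N / 2) * (s w * b w))"
      by (simp add: power2_eq_square algebra_simps)
    then have "(tree_sum ^^ ?n) h w \<le> (1 - \<delta>\<^sup>2 * qmin q ^ N / 2) * h w"
      using sw unfolding s2(2)[OF w] by simp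
    \<comment> \<open>The deviation occurs after \<open>length t \<le> N\<close> letters; going
      further down only lowers the sum.\<close>
    moreover have "(tree_sum ^^ N) h w \<le> (tree_sum ^^ ?n) h w"
    proof -
      have "(tree_sum ^^ ?n) ((tree_sum ^^ (N - ?n)) h) w \<le> (tree_sum ^^ ?n) h w"
      proof (rule tree_sum_pow_mono[OF w])
        fix u assume u: "u \<in> Adm" "length u \<ge> length w"
        have "(tree_sum ^^ k) b u = b u" for k
          unfolding b_def by (rule tree_sum_pow_invariant[OF tree_sum_word_weight[OF q] u(1)])
        moreover have "(tree_sum ^^ k) (en g g) u = en g g u" for k
          by (rule tree_sum_pow_en_harm[of "length w"]) (use harm u in auto)
        ultimately show "(tree_sum ^^ (N - ?n)) h u \<le> h u"
          using tree_sum_pow_sqrt_mult[OF u(1), of "en g g" b "N - ?n"] en_nonneg bp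
          unfolding h_def b_def by (simp add: less_imp_le)
      qed
      then show ?thesis unfolding tree_sum_pow_add using t(2) by simp
    qed
    ultimately show ?thesis by simp
  qed
qed

section \<open>Vertices carry no mass of the reference measure\<close>

lemma cell_vertex:
  assumes "z \<in> vertices n" "w \<in> adm_words n" "z \<in> cell w"
  shows "\<exists>a\<in>{1,2,3}. z = \<psi>_word w (p a)"
proof -
  obtain w' a where w': "w' \<in> adm_words n" "a \<in> {1,2,3}" "z = \<psi>_word w' (p a)"
    using assms(1) unfolding vertices_def by blast
  obtain x where x: "x \<in> triangle" "z = \<psi>_word w x" using assms(3) unfolding cell_def by blast
  show ?thesis
  proof (cases "w = w'")
    case False
    have "x \<in> V0"
      by (rule Adm_meet[OF _ _ _ False x(1) p_triangle[OF w'(2)]]) (use assms(2) w' x in \<open>auto simp: adm_words_Adm\<close>)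
    then show ?thesis using x(2) by blast
  qed (use w' in blast)
qed

lemma finite_vertices: "finite (vertices n)"
proof -
  have "vertices n = (\<lambda>(w, a). \<psi>_word w (p a)) ` (adm_words n \<times> {1,2,3})" unfolding vertices_def by auto
  then show ?thesis using finite_adm_words by simp
qed

text \<open>Every label has at least two letters, all of positive weight, and the weights sum to
  1.\<close>

lemma weights_less_1:
  assumes "q \<in> weights" "v \<in> alphabet"
  shows "q v < 1"
proof -
  obtain \<nu> where \<nu>: "\<nu> \<in> T" "v \<in> letters \<nu>" using alphabet_letter[OF assms(2)] by blast
  have pos: "q u > 0" if "u \<in> letters \<nu>" for u using assms(1) that \<nu> by (auto simp: weights_def alphabet_def)
  obtain i where i: "i \<in> {1,2,3::nat}" "(i, \<nu>) \<noteq> v"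
    by (metis fst_conv insertCI n_not_Suc_n numeral_2_eq_2 One_nat_def)
  have u: "(i, \<nu>) \<in> letters \<nu>" by (rule corner_letter[OF T_ge[OF \<nu>(1)] i(1)])
  have "q v + q (i, \<nu>) = (\<Sum>u\<in>{v, (i, \<nu>)}. q u)" using i(2) by simp
  also have "\<dots> \<le> (\<Sum>u\<in>letters \<nu>. q u)"
    by (rule sum_mono2) (use u \<nu> pos finite_letters in \<open>auto simp: less_imp_le\<close>)
  also have "\<dots> = 1" using assms(1) \<nu> by (simp add: weights_def)
  finally show ?thesis using pos[OF u] by simp
qed

text \<open>A cell with vertex \<open>z\<close> passes this vertex on to its corner child only. The
  total weight of the cells at \<open>z\<close> therefore shrinks by the largest weight, which is
  below 1, at each level.\<close>

lemma path_measure_vertices_null: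
  assumes q: "q \<in> weights"
  shows "AE \<omega> in path_measure q. coding \<omega> \<notin> (\<Union>n. vertices n)"
proof -
  interpret M: word_measure p \<psi> T L "word_weight q" "path_measure q" by (rule path_measure_spec[OF q])
  define \<kappa> where "\<kappa> = Max (q ` alphabet)"
  have "\<kappa> \<in> q ` alphabet" unfolding \<kappa>_def using finite_alphabet alphabet_ne by (intro Max_in) auto
  then have \<kappa>: "0 < \<kappa>" "\<kappa> < 1" using weights_alphabet[OF q] weights_less_1[OF q] by auto
  have q\<kappa>: "q v \<le> \<kappa>" if "v \<in> alphabet" for v unfolding \<kappa>_def using finite_alphabet that by simp
  have sz: "{\<omega> \<in> adm_sequences. coding \<omega> = z} \<in> sets (path_measure q)" for z
  proof (cases "z \<in> gasket")
    case True
    then have z: "gasket \<inter> {z} = {z}" by auto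
    have "gasket \<inter> {z} \<in> sets (restrict_space borel gasket)" unfolding sets_restrict_space by (rule imageI) simp
    then have "{z} \<in> sets (restrict_space borel gasket)" unfolding z .
    then show ?thesis using M.sets_coding_vimage[of "{z}"] by simp
  next
    case False
    then have "{\<omega> \<in> adm_sequences. coding \<omega> = z} = {}" by (auto simp: gasket_def)
    then show ?thesis by (metis sets.empty_sets)
  qed
  have null: "{\<omega> \<in> adm_sequences. coding \<omega> = z} \<in> null_sets (path_measure q)" if z: "z \<in> vertices m" for z m
  proof -
    define X where "X n = {w \<in> adm_words n. \<exists>a\<in>{1,2,3}. z = \<psi>_word w (p a)}" for n
    have fX: "finite (X n)" for n unfolding X_def using finite_adm_words by simp
    have pw: "word_weight q w \<ge> 0" if "w \<in> Adm" for w using word_weight_pos[OF q Adm_lists[OF that]] by simp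
    have zv: "z \<in> vertices (m + d)" for d using z vertices_mono[of m "m + d"] by auto
    have S: "(\<Sum>w\<in>X (m + d). word_weight q w) \<le> \<kappa> ^ d" for d
    proof (induction d)
      case 0
      have "(\<Sum>w\<in>X m. word_weight q w) \<le> (\<Sum>w\<in>adm_words m. word_weight q w)"
        by (rule sum_mono2) (use finite_adm_words pw in \<open>auto simp: X_def adm_words_Adm\<close>)
      also have "\<dots> = 1" unfolding M.sum_adm_words_a by simp
      finally show ?case by simp
    next
      case (Suc d)
      \<comment> \<open>The corner child at \<open>z\<close>, the only child that can still have
        \<open>z\<close> as a vertex.\<close>
      define f where "f w = w @ [(SOME a. a \<in> {1,2,3} \<and> z = \<psi>_word w (p a), L w)]" for w
      have sub: "X (m + Suc d) \<subseteq> f ` X (m + d)"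
      proof
        fix u assume u: "u \<in> X (m + Suc d)"
        then obtain b where b: "u \<in> Adm" "length u = Suc (m + d)" "b \<in> {1,2,3}" "z = \<psi>_word u (p b)"
          unfolding X_def by (auto simp del: adm_words.simps simp: adm_words_Adm)
        then obtain w v where wv: "u = w @ [v]" "length w = m + d" by (metis length_Suc_conv_rev)
        have w: "w \<in> Adm" "v \<in> letters (L w)" using b(1) wv by (auto simp: Adm_snoc)
        note ge = L_ge[OF w(1)]
        obtain c where c: "c \<in> cells (L w)" "\<psi> (snd v) (fst v) = cell_map (L w) c" using letter_cell[OF ge w(2)] .
        have z1: "z = \<psi>_word w (cell_map (L w) c (p b))" using b(4) c(2) by (simp add: wv \<psi>_word_append)
        have tr: "cell_map (L w) c (p b) \<in> triangle" by (rule cell_map_triangle[OF ge c(1) p_triangle[OF b(3)]])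
        have "z \<in> cell w" unfolding cell_def z1 using tr by blast
        then have ex: "\<exists>a. a \<in> {1,2,3} \<and> z = \<psi>_word w (p a)"
          using cell_vertex[OF zv[of d], of w] w(1) wv(2) by (auto simp: adm_words_Adm)
        define a where "a = (SOME a. a \<in> {1,2,3} \<and> z = \<psi>_word w (p a))"
        have a: "a \<in> {1,2,3}" "z = \<psi>_word w (p a)" using someI_ex[OF ex] unfolding a_def by auto
        have "cell_map (L w) c (p b) = p a" using \<psi>_word_inj[OF Adm_lists[OF w(1)]] a(2) z1 by metis
        then have "c = corner_cell (L w) a" using cell_vertex_corner[OF ge c(1) b(3) a(1)] by blast
        then have "\<psi> (snd v) (fst v) = \<psi> (L w) a" using \<psi>_corner[OF ge a(1)] c(2) by simp
        then have "v = (a, L w)"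
          using letter_cell_inj[OF ge w(2) corner_letter[OF ge a(1)]] by simp
        then have "u = f w" unfolding f_def a_def[symmetric] wv by simp
        moreover have "w \<in> X (m + d)" unfolding X_def using w(1) wv(2) a by (auto simp: adm_words_Adm)
        ultimately show "u \<in> f ` X (m + d)" by blast
      qed
      have fA: "f w \<in> Adm \<and> word_weight q (f w) \<le> \<kappa> * word_weight q w" if w: "w \<in> X (m + d)" for w
      proof -
        have ex: "\<exists>a. a \<in> {1,2,3} \<and> z = \<psi>_word w (p a)" and A: "w \<in> Adm" using w unfolding X_def by (auto simp: adm_words_Adm)
        define a where "a = (SOME a. a \<in> {1,2,3} \<and> z = \<psi>_word w (p a))"
        have a: "a \<in> {1,2,3}" using someI_ex[OF ex] unfolding a_def by auto
        have fA: "f w \<in> Adm" unfolding f_def a_def[symmetric] by (rule Adm_corner[OF A a])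
        have "(a, L w) \<in> alphabet" using corner_letter[OF L_ge[OF A] a] letters_alphabet[OF A] by blast
        then have "word_weight q w * q (a, L w) \<le> word_weight q w * \<kappa>" using q\<kappa> pw[OF A] by (intro mult_left_mono) auto
        then show ?thesis using fA unfolding f_def a_def[symmetric] by (simp add: word_weight_append word_weight_single mult.commute)
      qed
      have inj: "inj_on f (X (m + d))" by (rule inj_onI) (simp add: f_def)
      have "(\<Sum>w\<in>X (m + Suc d). word_weight q w) \<le> (\<Sum>u\<in>f ` X (m + d). word_weight q u)"
        by (rule sum_mono2[OF _ sub]) (use fX fA pw in auto)
      also have "\<dots> = (\<Sum>w\<in>X (m + d). word_weight q (f w))" using inj by (simp add: sum.reindex)
      also have "\<dots> \<le> (\<Sum>w\<in>X (m + d). \<kappa> * word_weight q w)" using fA by (intro sum_mono) auto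
      also have "\<dots> = \<kappa> * (\<Sum>w\<in>X (m + d). word_weight q w)" by (simp add: sum_distrib_left)
      also have "\<dots> \<le> \<kappa> * \<kappa> ^ d" using Suc \<kappa> by (intro mult_left_mono) auto
      finally show ?case by simp
    qed
    have le: "measure (path_measure q) {\<omega> \<in> adm_sequences. coding \<omega> = z} \<le> \<kappa> ^ d" for d
    proof -
      have "{\<omega> \<in> adm_sequences. coding \<omega> = z} \<subseteq> (\<Union>w\<in>X (m + d). cylinder w)"
      proof
        fix \<omega> assume "\<omega> \<in> {\<omega> \<in> adm_sequences. coding \<omega> = z}"
        then have \<omega>: "\<omega> \<in> adm_sequences" "coding \<omega> = z" "\<omega> \<in> space word_space" by (auto simp: adm_sequences_def)
        let ?w = "initial_word (m + d) \<omega>"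
        have w: "?w \<in> adm_words (m + d)" using \<omega>(1) by (simp add: adm_sequences_def)
        have "\<exists>a\<in>{1,2,3}. z = \<psi>_word ?w (p a)"
          by (rule cell_vertex[OF zv w]) (use coding_cell[OF \<omega>(3)] \<omega>(2) in auto)
        then have "?w \<in> X (m + d)" unfolding X_def using w by blast
        moreover have "\<omega> \<in> cylinder ?w" using \<omega>(3) by (simp add: cylinder_def)
        ultimately show "\<omega> \<in> (\<Union>w\<in>X (m + d). cylinder w)" by blast
      qed
      then have "measure (path_measure q) {\<omega> \<in> adm_sequences. coding \<omega> = z} \<le> measure (path_measure q) (\<Union>w\<in>X (m + d). cylinder w)"
        using fX by (intro M.finite_measure_mono sets.finite_UN) (auto simp: M.sets_M)
      also have "\<dots> = (\<Sum>w\<in>X (m + d). word_weight q w)" by (rule M.measure_UN_cylinder[of _ "m + d"]) (auto simp: X_def)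
      finally show ?thesis using S[of d] by linarith
    qed
    have "(\<lambda>d. \<kappa> ^ d) \<longlonglongrightarrow> 0" by (rule LIMSEQ_power_zero) (use \<kappa> in simp)
    then have "measure (path_measure q) {\<omega> \<in> adm_sequences. coding \<omega> = z} \<le> 0"
      by (rule LIMSEQ_le_const) (use le in blast)
    then show ?thesis using sz[of z] by (simp add: null_sets_def M.emeasure_eq_measure measure_le_0_iff)
  qed
  have "(\<Union>z\<in>(\<Union>n. vertices n). {\<omega> \<in> adm_sequences. coding \<omega> = z}) \<in> null_sets (path_measure q)"
    by (rule null_sets_UN') (use finite_vertices null in \<open>auto intro: countable_finite\<close>)
  then have "AE \<omega> in path_measure q. \<omega> \<notin> (\<Union>z\<in>(\<Union>n. vertices n). {\<omega> \<in> adm_sequences. coding \<omega> = z})"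
    by (rule AE_not_in)
  then show ?thesis
    using M.AE_adm_sequences by eventually_elim auto
qed

section \<open>Singularity\<close>

text \<open>Words with \<open>a w < word_weight q w\<close> form \<open>A\<close>. On them
  \<open>a\<close>, and on the others the weight, is at most the geometric mean of the two, so both
  masses are bounded by the Hellinger sum.\<close>

lemma singular_if_hellinger_small:
  assumes q: "q \<in> weights" and M: "word_measure p \<psi> T L a M"
    and small: "\<And>\<epsilon>. \<epsilon> > 0 \<Longrightarrow> \<exists>n. (\<Sum>w\<in>adm_words n. sqrt (a w) * sqrt (word_weight q w)) \<le> \<epsilon>"
  shows "mutually_singular (word_measure.image_measure p \<psi> T L M) (gasket_measure q)"
proof -
  interpret M: word_measure p \<psi> T L a M by (rule M)
  interpret N: word_measure p \<psi> T L "word_weight q" "path_measure q" by (rule path_measure_spec[OF q])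
  let ?V = "\<Union>n. vertices n"
  have "mutually_singular M.image_measure N.image_measure"
  proof (rule mutually_singularI[OF M.finite_image_measure N.finite_image_measure])
    show "sets M.image_measure = sets N.image_measure" by (simp add: M.sets_image_measure N.sets_image_measure)
    fix \<epsilon> :: real assume "\<epsilon> > 0"
    then obtain n where n: "(\<Sum>w\<in>adm_words n. sqrt (a w) * sqrt (word_weight q w)) \<le> \<epsilon>" using small by blast
    define W where "W = {w \<in> adm_words n. a w < word_weight q w}"
    \<comment> \<open>Without vertices a point of \<open>A\<close> determines its word of length
      \<open>n\<close>, so no energy of adjacent cells enters. The vertices go to the complement,
      where they are null for \<open>\<mu>\<^sub>q\<close>.\<close>
    define A where "A = gasket \<inter> ((\<Union>w\<in>W. cell w) - ?V)"
    have fW: "finite W" unfolding W_def using finite_adm_words by simp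
    have an: "a w \<ge> 0" "word_weight q w \<ge> 0" if "w \<in> adm_words n" for w
      using M.a_nonneg N.a_nonneg that by (auto simp: adm_words_Adm)
    have V: "?V \<in> sets borel"
      by (rule sets.countable_UN) (use finite_vertices in \<open>auto intro: finite_imp_closed borel_closed\<close>)
    have "cell w \<in> sets borel" if "w \<in> W" for w
      using that compact_cell[OF Adm_lists] unfolding W_def by (auto simp: adm_words_Adm intro: borel_compact)
    then have "(\<Union>w\<in>W. cell w) - ?V \<in> sets borel" by (rule sets.Diff[OF sets.finite_UN[OF fW] V])
    then have A: "A \<in> sets (restrict_space borel gasket)" unfolding A_def sets_restrict_space by (rule imageI)
    have in_adm: "\<omega> \<in> cylinder (initial_word n \<omega>)" "initial_word n \<omega> \<in> adm_words n" "coding \<omega> \<in> cell (initial_word n \<omega>)"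
      if "\<omega> \<in> adm_sequences" for \<omega>
      using that coding_cell by (auto simp: adm_sequences_def cylinder_def)
    have "measure M.image_measure A \<le> \<epsilon>"
    proof -
      have "measure M.image_measure A = measure M {\<omega> \<in> adm_sequences. coding \<omega> \<in> A}"
        using M.emeasure_image_measure[OF A] by (simp add: measure_def)
      also have "\<dots> \<le> measure M (\<Union>w\<in>W. cylinder w)"
      proof (rule M.finite_measure_mono)
        show "{\<omega> \<in> adm_sequences. coding \<omega> \<in> A} \<subseteq> (\<Union>w\<in>W. cylinder w)"
        proof
          fix \<omega> assume \<omega>: "\<omega> \<in> {\<omega> \<in> adm_sequences. coding \<omega> \<in> A}"
          then obtain w where w: "w \<in> W" "coding \<omega> \<in> cell w" and nv: "coding \<omega> \<notin> ?V" unfolding A_def by blast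
          have \<omega>a: "\<omega> \<in> adm_sequences" using \<omega> by blast
          let ?u = "initial_word n \<omega>"
          have wn: "w \<in> adm_words n" using w(1) by (simp add: W_def)
          have "?u = w"
          proof (rule ccontr)
            assume ne: "?u \<noteq> w"
            obtain x where x: "x \<in> triangle" "coding \<omega> = \<psi>_word ?u x" using in_adm(3)[OF \<omega>a] unfolding cell_def by blast
            obtain y where y: "y \<in> triangle" "coding \<omega> = \<psi>_word w y" using w(2) unfolding cell_def by blast
            have "y \<in> V0"
              by (rule Adm_meet[of w ?u y x]) (use wn in_adm(2)[OF \<omega>a] ne x y in \<open>simp_all add: adm_words_Adm\<close>)
            then obtain b where b: "b \<in> {1,2,3}" "y = p b" by blast
            have "coding \<omega> \<in> vertices n" unfolding y(2) b(2) by (rule verticesI[OF wn b(1)])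
            then show False using nv by blast
          qed
          then show "\<omega> \<in> (\<Union>w\<in>W. cylinder w)" using in_adm(1)[OF \<omega>a] w(1) by auto
        qed
      qed (use fW in \<open>auto simp: M.sets_M\<close>)
      also have "\<dots> = (\<Sum>w\<in>W. a w)" by (rule M.measure_UN_cylinder[of _ n]) (auto simp: W_def)
      also have "\<dots> \<le> (\<Sum>w\<in>W. sqrt (a w) * sqrt (word_weight q w))"
      proof (rule sum_mono)
        fix w assume w: "w \<in> W"
        then have "a w \<ge> 0" using an by (auto simp: W_def)
        have "a w = sqrt (a w) * sqrt (a w)" using \<open>a w \<ge> 0\<close> by simp
        also have "\<dots> \<le> sqrt (a w) * sqrt (word_weight q w)"
          using w \<open>a w \<ge> 0\<close> by (intro mult_left_mono) (auto simp: W_def)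
        finally show "a w \<le> sqrt (a w) * sqrt (word_weight q w)" .
      qed
      also have "\<dots> \<le> (\<Sum>w\<in>adm_words n. sqrt (a w) * sqrt (word_weight q w))"
        by (rule sum_mono2) (use an finite_adm_words in \<open>auto simp: W_def\<close>)
      finally show ?thesis using n by linarith
    qed
    moreover have "measure N.image_measure (space N.image_measure - A) \<le> \<epsilon>"
    proof -
      define W' where "W' = {w \<in> adm_words n. \<not> a w < word_weight q w}"
      have fW': "finite W'" unfolding W'_def using finite_adm_words by simp
      have GA: "gasket - A \<in> sets (restrict_space borel gasket)"
        using sets.compl_sets[OF A] by (simp add: space_restrict_space)
      have "measure N.image_measure (space N.image_measure - A) = measure (path_measure q) {\<omega> \<in> adm_sequences. coding \<omega> \<in> gasket - A}"
        using N.emeasure_image_measure[OF GA] by (simp add: measure_def N.space_image_measure)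
      also have "\<dots> \<le> measure (path_measure q) (\<Union>w\<in>W'. cylinder w)"
      proof (rule N.finite_measure_mono_AE)
        show "AE \<omega> in path_measure q. \<omega> \<in> {\<omega> \<in> adm_sequences. coding \<omega> \<in> gasket - A} \<longrightarrow> \<omega> \<in> (\<Union>w\<in>W'. cylinder w)"
          using path_measure_vertices_null[OF q]
        proof eventually_elim
          case (elim \<omega>)
          show ?case
          proof
            assume \<omega>: "\<omega> \<in> {\<omega> \<in> adm_sequences. coding \<omega> \<in> gasket - A}"
            then have \<omega>a: "\<omega> \<in> adm_sequences" by blast
            have "initial_word n \<omega> \<notin> W"
              using \<omega> elim in_adm(3)[OF \<omega>a] unfolding A_def by blast
            then have "initial_word n \<omega> \<in> W'" using in_adm(2)[OF \<omega>a] unfolding W_def W'_def by blast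
            then show "\<omega> \<in> (\<Union>w\<in>W'. cylinder w)" using in_adm(1)[OF \<omega>a] by blast
          qed
        qed
      qed (use fW' in \<open>auto simp: N.sets_M\<close>)
      also have "\<dots> = (\<Sum>w\<in>W'. word_weight q w)" by (rule N.measure_UN_cylinder[of _ n]) (auto simp: W'_def)
      also have "\<dots> \<le> (\<Sum>w\<in>W'. sqrt (a w) * sqrt (word_weight q w))"
      proof (rule sum_mono)
        fix w assume w: "w \<in> W'"
        then have "word_weight q w \<ge> 0" using an by (auto simp: W'_def)
        have "word_weight q w = sqrt (word_weight q w) * sqrt (word_weight q w)" using \<open>word_weight q w \<ge> 0\<close> by simp
        also have "\<dots> \<le> sqrt (a w) * sqrt (word_weight q w)"
          using w \<open>word_weight q w \<ge> 0\<close> by (intro mult_right_mono) (auto simp: W'_def)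
        finally show "word_weight q w \<le> sqrt (a w) * sqrt (word_weight q w)" .
      qed
      also have "\<dots> \<le> (\<Sum>w\<in>adm_words n. sqrt (a w) * sqrt (word_weight q w))"
        by (rule sum_mono2) (use an finite_adm_words in \<open>auto simp: W'_def\<close>)
      finally show ?thesis using n by linarith
    qed
    ultimately show "\<exists>A\<in>sets M.image_measure. measure M.image_measure A \<le> \<epsilon> \<and> measure N.image_measure (space N.image_measure - A) \<le> \<epsilon>"
      using A unfolding M.sets_image_measure by blast
  qed
  then show ?thesis unfolding gasket_measure_eq[OF q] .
qed

text \<open>The descent is applied below each of the finitely many words of length \<open>m\<close>,
  from which on \<open>g\<close> is harmonic and its energy additive.\<close>

lemma harmonic_hellinger:
  assumes q: "q \<in> weights" and \<delta>: "\<delta> > 0"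
    and spread: "\<And>g w. w \<in> Adm \<Longrightarrow> G w \<Longrightarrow> (\<And>u. u \<in> Adm \<Longrightarrow> length u \<ge> length w \<Longrightarrow> harm (L u) (g \<circ> \<psi>_word u)) \<Longrightarrow>
      Q (g \<circ> \<psi>_word w) (g \<circ> \<psi>_word w) > 0 \<Longrightarrow> spreads q N \<delta> g w"
    and io: "AE \<omega> in path_measure q. \<exists>\<^sub>\<infinity>k. G (initial_word k \<omega>)"
    and harm: "\<And>u. u \<in> Adm \<Longrightarrow> length u \<ge> m \<Longrightarrow> harm (L u) (g \<circ> \<psi>_word u)"
  shows "(\<lambda>n. \<Sum>w\<in>adm_words n. sqrt (en g g w) * sqrt (word_weight q w)) \<longlonglongrightarrow> 0"
proof -
  let ?h = "\<lambda>u. sqrt (en g g u) * sqrt (word_weight q u)"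
  \<comment> \<open>The maximum with 0 keeps the factor non-negative when \<open>\<delta>\<close> is
    large.\<close>
  define \<theta> where "\<theta> = max 0 (1 - \<delta>\<^sup>2 * qmin q ^ N / 2)"
  have \<theta>: "0 \<le> \<theta>" "\<theta> < 1" unfolding \<theta>_def using \<delta> qmin_bounds(1)[OF q] by auto
  have lim: "(\<lambda>n. (tree_sum ^^ n) ?h w) \<longlonglongrightarrow> 0" if w: "w \<in> Adm" "length w \<ge> m" for w
  proof (rule hellinger_descent[OF path_measure_spec[OF q] io _ _ \<theta> _ w])
    fix w assume w: "w \<in> Adm" "length w \<ge> m" "G w"
    have h: "harm (L u) (g \<circ> \<psi>_word u)" if "u \<in> Adm" "length u \<ge> length w" for u
      using harm[OF that(1)] that(2) w(2) by simp
    have "(tree_sum ^^ N) ?h w \<le> (1 - \<delta>\<^sup>2 * qmin q ^ N / 2) * ?h w"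
      by (rule hellinger_contraction[OF q w(1) \<delta> h spread[OF w(1,3) h]])
    also have "\<dots> \<le> \<theta> * ?h w"
      using en_nonneg[OF w(1)] word_weight_pos[OF q Adm_lists[OF w(1)]]
      by (intro mult_right_mono) (auto simp: \<theta>_def)
    finally show "(tree_sum ^^ N) ?h w \<le> \<theta> * ?h w" .
  qed (auto intro: en_nonneg tree_sum_en_harm harm)
  have "(\<lambda>n. \<Sum>w\<in>adm_words m. (tree_sum ^^ n) ?h w) \<longlonglongrightarrow> (\<Sum>w\<in>adm_words m. 0)"
    by (intro tendsto_sum lim) (auto simp: adm_words_Adm)
  moreover have "(\<Sum>w\<in>adm_words m. (tree_sum ^^ n) ?h w) = (\<Sum>w\<in>adm_words (n + m). ?h w)" for n
    unfolding sum_adm_words tree_sum_pow_add by (simp add: add.commute)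
  ultimately show ?thesis by (simp add: LIMSEQ_offset[of _ m])
qed

text \<open>Interpolating \<open>f\<close> at level \<open>m\<close> leaves an error of energy at
  most \<open>cell_energy f [] - level_energy m f f\<close>. By Cauchy-Schwarz its Hellinger sum is
  at most the root of this at every level, so \<open>m\<close> can be fixed before the level at
  which the part of \<open>g\<close> is small.\<close>

lemma energy_measure_singular:
  assumes q: "q \<in> weights" and \<delta>: "\<delta> > 0" and f: "f \<in> form_domain"
    and spread: "\<And>g w. w \<in> Adm \<Longrightarrow> G w \<Longrightarrow> (\<And>u. u \<in> Adm \<Longrightarrow> length u \<ge> length w \<Longrightarrow> harm (L u) (g \<circ> \<psi>_word u)) \<Longrightarrow>
      Q (g \<circ> \<psi>_word w) (g \<circ> \<psi>_word w) > 0 \<Longrightarrow> spreads q N \<delta> g w"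
    and io: "AE \<omega> in path_measure q. \<exists>\<^sub>\<infinity>k. G (initial_word k \<omega>)"
  shows "mutually_singular (energy_measure f) (gasket_measure q)"
proof -
  obtain M where M: "word_measure p \<psi> T L (\<lambda>w. 2 * cell_energy f w) M"
    using energy_word_measure_exists[OF f] by blast
  interpret N: word_measure p \<psi> T L "word_weight q" "path_measure q" by (rule path_measure_spec[OF q])
  note fin = form_domain_fin[OF f]
  let ?b = "word_weight q"
  have bnn: "?b w \<ge> 0" if "w \<in> Adm" for w using N.a_nonneg[OF that] .
  have "\<exists>n. (\<Sum>w\<in>adm_words n. sqrt (2 * cell_energy f w) * sqrt (?b w)) \<le> \<epsilon>" if \<epsilon>: "\<epsilon> > 0" for \<epsilon>
  proof -
    have "(\<lambda>m. 2 * sqrt (cell_energy f [] - level_energy m f f)) \<longlonglongrightarrow> 2 * sqrt (cell_energy f [] - cell_energy f [])"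
      unfolding level_energy_eq by (intro tendsto_intros cell_energy_LIMSEQ[OF fin Nil_Adm])
    then have "(\<lambda>m. 2 * sqrt (cell_energy f [] - level_energy m f f)) \<longlonglongrightarrow> 0" by simp
    then have "\<forall>\<^sub>F m in sequentially. 2 * sqrt (cell_energy f [] - level_energy m f f) < \<epsilon> / 2"
      by (rule order_tendstoD(2)) (use \<epsilon> in simp)
    then obtain m where m: "2 * sqrt (cell_energy f [] - level_energy m f f) < \<epsilon> / 2"
      unfolding eventually_sequentially by blast
    obtain g where g: "g \<in> form_domain" "\<And>z. z \<in> vertices m \<Longrightarrow> g z = f z"
      "\<And>w. w \<in> Adm \<Longrightarrow> length w \<ge> m \<Longrightarrow> harm (L w) (g \<circ> \<psi>_word w)"
      using harmonic_extension[of m f] by blast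
    note fing = form_domain_fin[OF g(1)]
    let ?d = "\<lambda>x. f x - g x"
    have find: "fin_energy ?d" by (rule fin_energy_diff[OF fin fing])
    \<comment> \<open>Orthogonality: the mixed energy with \<open>g\<close> does not change after
      level \<open>m\<close>, and at level \<open>m\<close> the functions agree.\<close>
    have "level_energy n ?d ?d \<le> cell_energy f [] - level_energy m f f" if "n \<ge> m" for n
    proof -
      have 1: "level_energy n g h = level_energy m g h" for h by (rule level_energy_harm[OF g(3) that])
      have 2: "level_energy m g g = level_energy m f f" "level_energy m g f = level_energy m f f"
        by (rule level_energy_cong; simp add: g(2))+
      have e: "en ?d ?d = (\<lambda>w. 1 * (1 * en f f w + (- 2) * en g f w) + 1 * en g g w)"
        using en_lincomb[of 1 f "- 1" g] by (auto simp: en_sym[of g f])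
      have "level_energy n ?d ?d = level_energy n f f - 2 * level_energy n g f + level_energy n g g"
        unfolding level_energy_eq e tree_sum_pow_linear by simp
      also have "\<dots> = level_energy n f f - level_energy m f f" unfolding 1 2 by simp
      also have "level_energy n f f \<le> cell_energy f []"
        unfolding level_energy_eq by (rule cell_energy_ge[OF fin Nil_Adm])
      finally show ?thesis by simp
    qed
    then have dE: "cell_energy ?d [] \<le> cell_energy f [] - level_energy m f f"
      using LIMSEQ_le_const2[OF cell_energy_LIMSEQ[OF find Nil_Adm]] unfolding level_energy_eq by blast
    have "(\<lambda>n. 2 * (\<Sum>w\<in>adm_words n. sqrt (en g g w) * sqrt (?b w))) \<longlonglongrightarrow> 2 * 0"
      by (intro tendsto_intros harmonic_hellinger[OF q \<delta> spread io g(3)])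
    then have "\<forall>\<^sub>F n in sequentially. 2 * (\<Sum>w\<in>adm_words n. sqrt (en g g w) * sqrt (?b w)) < \<epsilon> / 2"
      by (rule order_tendstoD(2)) (use \<epsilon> in simp)
    then obtain n0 where n0: "\<And>n. n \<ge> n0 \<Longrightarrow> 2 * (\<Sum>w\<in>adm_words n. sqrt (en g g w) * sqrt (?b w)) < \<epsilon> / 2"
      unfolding eventually_sequentially by blast
    \<comment> \<open>At least \<open>n0\<close> for the Hellinger sum of \<open>g\<close>, and at
      least \<open>m\<close> so that the energy of \<open>g\<close> in each cell is its level
      energy.\<close>
    define n where "n = max n0 m"
    have ceg: "cell_energy g w = en g g w" if "w \<in> adm_words n" for w
    proof -
      have w: "w \<in> Adm" "length w \<ge> m" using that by (auto simp: adm_words_Adm n_def)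
      show ?thesis
        unfolding cell_energy_def using tree_sum_pow_en_harm[OF g(3) w, of _ g] by (simp add: limI)
    qed
    have "(\<Sum>w\<in>adm_words n. sqrt (2 * cell_energy f w) * sqrt (?b w)) \<le>
        (\<Sum>w\<in>adm_words n. 2 * (sqrt (en g g w) * sqrt (?b w)) + 2 * (sqrt (cell_energy ?d w) * sqrt (?b w)))"
    proof (rule sum_mono)
      fix w assume wn: "w \<in> adm_words n"
      then have w: "w \<in> Adm" by (simp add: adm_words_Adm)
      have "2 * cell_energy f w \<le> 4 * en g g w + 4 * cell_energy ?d w"
        using cell_energy_le_diff[OF fin fing w] ceg[OF wn] by simp
      then have "sqrt (2 * cell_energy f w) \<le> sqrt (4 * en g g w + 4 * cell_energy ?d w)" by simp
      also have "\<dots> \<le> sqrt (4 * en g g w) + sqrt (4 * cell_energy ?d w)"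
        by (rule sqrt_add_le_add_sqrt) (use en_nonneg[OF w, of g] cell_energy_nonneg[OF find w] in auto)
      also have "\<dots> = 2 * sqrt (en g g w) + 2 * sqrt (cell_energy ?d w)" by (simp add: real_sqrt_mult)
      finally have "sqrt (2 * cell_energy f w) * sqrt (?b w) \<le> (2 * sqrt (en g g w) + 2 * sqrt (cell_energy ?d w)) * sqrt (?b w)"
        using bnn[OF w] by (intro mult_right_mono) auto
      then show "sqrt (2 * cell_energy f w) * sqrt (?b w) \<le> 2 * (sqrt (en g g w) * sqrt (?b w)) + 2 * (sqrt (cell_energy ?d w) * sqrt (?b w))"
        by (simp add: algebra_simps)
    qed
    also have "\<dots> = 2 * (\<Sum>w\<in>adm_words n. sqrt (en g g w) * sqrt (?b w)) + 2 * (\<Sum>w\<in>adm_words n. sqrt (cell_energy ?d w) * sqrt (?b w))"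
      by (simp add: sum.distrib sum_distrib_left)
    also have "(\<Sum>w\<in>adm_words n. sqrt (cell_energy ?d w) * sqrt (?b w)) \<le> sqrt (cell_energy ?d [])"
    proof -
      have "(tree_sum ^^ n) (\<lambda>u. sqrt (cell_energy ?d u) * sqrt (?b u)) [] \<le> sqrt ((tree_sum ^^ n) (cell_energy ?d) []) * sqrt ((tree_sum ^^ n) ?b [])"
        by (rule tree_sum_pow_sqrt_mult) (simp_all add: cell_energy_nonneg[OF find] bnn)
      also have "(tree_sum ^^ n) ?b [] = ?b []" by (rule tree_sum_pow_invariant[OF N.a_add]) auto
      also have "(tree_sum ^^ n) (cell_energy ?d) [] = cell_energy ?d []" by (rule cell_energy_tree_sum_pow[OF find]) simp
      finally show ?thesis unfolding sum_adm_words by simp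
    qed
    also have "sqrt (cell_energy ?d []) \<le> sqrt (cell_energy f [] - level_energy m f f)" using dE by simp
    finally show ?thesis using n0[of n] m by (intro exI[of _ n]) (simp add: n_def)
  qed
  then show ?thesis
    unfolding energy_measure_eq[OF f M] by (rule singular_if_hellinger_small[OF q M])
qed

lemma corner_ext_eq: "corner_ext j w n = w @ map (\<lambda>t. (j, L (corner_ext j w t))) [0..<n]"
  by (induction n) auto

text \<open>The labels \<open>\<nu>\<close> are taken to be those that \<open>L\<close> forces along
  the corner word, which makes the word in the hypothesis admissible. The left-hand label set is
  then a single label, and the inclusion says that it recurs.\<close>

lemma recurrent_if_star:
  assumes w: "w \<in> Adm" "length w = k"
    and star: "\<forall>i\<in>{1, 2, 3}. \<forall>j\<in>{1, 2, 3}. \<forall>\<nu> :: nat \<Rightarrow> nat.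
            (\<forall>m\<in>{k + 1..k + 1 + 1 + l2}. \<nu> m \<in> T) \<longrightarrow>
            w
              @ map (\<lambda>m. (i, \<nu> m)) [k + 1..<k + 1 + 1]
              @ map (\<lambda>m. (j, \<nu> m)) [k + 1 + 1..<k + 1 + 1 + 1]
              @ map (\<lambda>m. (j, \<nu> m)) [k + 1 + 1 + 1..<k + 1 + 1 + l2 + 1]
              \<in> adm_words (k + 1 + 1 + l2) \<longrightarrow>
            \<nu> ` {k + 1 + 1..k + 1 + 1} \<subseteq> \<nu> ` {k + 1 + 1 + 1..k + 1 + 1 + l2}"
  shows "recurrent l2 w"
  unfolding recurrent_def
proof
  fix j assume j: "j \<in> {1,2,3::nat}"
  define w1 where "w1 = w @ [(1, L w)]"
  have w1: "w1 \<in> Adm" unfolding w1_def by (rule Adm_corner[OF w(1)]) simp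
  \<comment> \<open>Position \<open>k + 1\<close> is the letter appended to \<open>w\<close>;
    position \<open>k + 2 + t\<close> is the letter appended to \<open>corner_ext j w1 t\<close>,
    hence the shift by \<open>k + 2\<close>.\<close>
  define \<nu> where "\<nu> m = (if m \<le> k + 1 then L w else L (corner_ext j w1 (m - (k + 2))))" for m
  have T: "\<forall>m\<in>{k + 1..k + 1 + 1 + l2}. \<nu> m \<in> T"
    using L_T[OF w(1)] L_T[OF corner_ext_Adm[OF w1 j]] by (simp add: \<nu>_def)
  have up: "[k + 1 + 1..<k + 1 + 1 + 1] @ [k + 1 + 1 + 1..<k + 1 + 1 + l2 + 1] = map (\<lambda>t. t + (k + 2)) [0..<Suc l2]"
  proof -
    have e: "k + 1 + 1 + l2 + 1 = k + 1 + 1 + 1 + l2" "Suc l2 + (k + 2) = k + 1 + 1 + 1 + l2"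
      by simp_all
    have "[k + 1 + 1..<k + 1 + 1 + 1] @ [k + 1 + 1 + 1..<k + 1 + 1 + 1 + l2] = [k + 1 + 1..<k + 1 + 1 + 1 + l2]"
      by (rule upt_add_eq_append[symmetric]) simp
    also have "[k + 1 + 1..<k + 1 + 1 + 1 + l2] = [k + 2..<k + 1 + 1 + 1 + l2]"
      by (rule arg_cong[where f = "\<lambda>i. [i..<k + 1 + 1 + 1 + l2]"]) simp
    finally show ?thesis unfolding map_add_upt e .
  qed
  have one: "map (\<lambda>m. (1, \<nu> m)) [k + 1..<k + 1 + 1] = [(1, L w)]"
    by (subst upt_rec) (simp add: \<nu>_def)
  have two: "map (\<lambda>m. (j, \<nu> m)) [k + 1 + 1..<k + 1 + 1 + 1] @ map (\<lambda>m. (j, \<nu> m)) [k + 1 + 1 + 1..<k + 1 + 1 + l2 + 1]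
      = map (\<lambda>t. (j, L (corner_ext j w1 t))) [0..<Suc l2]"
    unfolding map_append[symmetric] up by (simp add: \<nu>_def comp_def del: upt_Suc)
  have "w @ map (\<lambda>m. (1, \<nu> m)) [k + 1..<k + 1 + 1]
              @ map (\<lambda>m. (j, \<nu> m)) [k + 1 + 1..<k + 1 + 1 + 1]
              @ map (\<lambda>m. (j, \<nu> m)) [k + 1 + 1 + 1..<k + 1 + 1 + l2 + 1] = corner_ext j w1 (Suc l2)"
    unfolding corner_ext_eq[of j w1 "Suc l2"] one two by (simp only: w1_def append_assoc append_Cons append_Nil)
  moreover have "corner_ext j w1 (Suc l2) \<in> adm_words (k + 1 + 1 + l2)"
    using corner_ext_Adm[OF w1 j, of "Suc l2"] w(2) by (simp add: adm_words_Adm w1_def del: corner_ext.simps)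
  ultimately have "\<nu> ` {k + 1 + 1..k + 1 + 1} \<subseteq> \<nu> ` {k + 1 + 1 + 1..k + 1 + 1 + l2}"
    using star[rule_format, of 1 j \<nu>] j T by simp
  then have "\<nu> (k + 1 + 1) \<in> \<nu> ` {k + 1 + 1 + 1..k + 1 + 1 + l2}" by auto
  then obtain m where m: "m \<in> {k + 1 + 1 + 1..k + 1 + 1 + l2}" "\<nu> m = \<nu> (k + 1 + 1)" by (metis imageE)
  have "\<nu> (k + 1 + 1) = L w1" by (simp add: \<nu>_def)
  moreover have "\<nu> m = L (corner_ext j w1 (m - (k + 2)))" using m(1) by (simp add: \<nu>_def)
  ultimately have "L (corner_ext j w1 (m - (k + 2))) = L w1" using m(2) by simp
  moreover have "m - (k + 2) \<in> {1..l2}" using m(1) by auto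
  ultimately show "\<exists>t\<in>{1..l2}. L (corner_ext j (w @ [(1, L w)]) t) = L (w @ [(1, L w)])"
    unfolding w1_def by blast
qed

end

theorem theorem2p3:
  fixes p :: "nat \<Rightarrow> plane"
    and \<psi> :: "nat \<Rightarrow> nat \<Rightarrow> plane \<Rightarrow> plane"
    and T :: "nat set"
    and L :: "letter list \<Rightarrow> nat"
    and q :: "letter \<Rightarrow> real"
  assumes gasket: "inhomogeneous_gasket p \<psi> T L"
    and q: "q \<in> inhomogeneous_gasket.weights T"
    and A_or_B:
      "(\<forall>i\<in>{1, 2, 3}. \<forall>\<nu>\<in>T. q (i, \<nu>) \<noteq> inhomogeneous_gasket.r p \<psi> \<nu>) \<or>
       (\<forall>l0\<ge>1. \<forall>l1\<ge>1. \<exists>l2\<ge>1. AE \<omega> in inhomogeneous_gasket.path_measure T L q.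
          \<exists>\<^sub>\<infinity>k. \<forall>i\<in>{1, 2, 3}. \<forall>j\<in>{1, 2, 3}. \<forall>\<nu> :: nat \<Rightarrow> nat.
            (\<forall>m\<in>{k + 1..k + l0 + l1 + l2}. \<nu> m \<in> T) \<longrightarrow>
            initial_word k \<omega>
              @ map (\<lambda>m. (i, \<nu> m)) [k + 1..<k + l0 + 1]
              @ map (\<lambda>m. (j, \<nu> m)) [k + l0 + 1..<k + l0 + l1 + 1]
              @ map (\<lambda>m. (j, \<nu> m)) [k + l0 + l1 + 1..<k + l0 + l1 + l2 + 1]
              \<in> inhomogeneous_gasket.adm_words L (k + l0 + l1 + l2) \<longrightarrow>
            \<nu> ` {k + l0 + 1..k + l0 + l1} \<subseteq> \<nu> ` {k + l0 + l1 + 1..k + l0 + l1 + l2})"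
  shows "\<forall>f\<in>inhomogeneous_gasket.form_domain p \<psi> T L.
    mutually_singular (inhomogeneous_gasket.energy_measure p \<psi> T L f)
      (inhomogeneous_gasket.gasket_measure p \<psi> T L q)"
proof
  interpret inhomogeneous_gasket p \<psi> T L by (rule gasket)
  fix f assume f: "f \<in> form_domain"
  from A_or_B show "mutually_singular (energy_measure f) (gasket_measure q)"
  proof
    assume A: "\<forall>i\<in>{1, 2, 3}. \<forall>\<nu>\<in>T. q (i, \<nu>) \<noteq> r \<nu>"
    show ?thesis
    proof (rule spread_if_weights_differ[OF q A])
      fix N \<delta> assume \<delta>: "\<delta> > 0" and spread: "\<And>g w. w \<in> Adm \<Longrightarrow>
        (\<And>u. u \<in> Adm \<Longrightarrow> length u \<ge> length w \<Longrightarrow> harm (L u) (g \<circ> \<psi>_word u)) \<Longrightarrow>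
        Q (g \<circ> \<psi>_word w) (g \<circ> \<psi>_word w) > 0 \<Longrightarrow> spreads q N \<delta> g w"
      \<comment> \<open>Under this condition every admissible word spreads, so every word counts as
        good.\<close>
      show ?thesis
        by (rule energy_measure_singular[OF q \<delta> f, where G = "\<lambda>_. True"], rule spread) simp_all
    qed
  next
    assume B: "\<forall>l0\<ge>1. \<forall>l1\<ge>1. \<exists>l2\<ge>1. AE \<omega> in path_measure q.
          \<exists>\<^sub>\<infinity>k. \<forall>i\<in>{1, 2, 3}. \<forall>j\<in>{1, 2, 3}. \<forall>\<nu> :: nat \<Rightarrow> nat.
            (\<forall>m\<in>{k + 1..k + l0 + l1 + l2}. \<nu> m \<in> T) \<longrightarrow>
            initial_word k \<omega>
              @ map (\<lambda>m. (i, \<nu> m)) [k + 1..<k + l0 + 1]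
              @ map (\<lambda>m. (j, \<nu> m)) [k + l0 + 1..<k + l0 + l1 + 1]
              @ map (\<lambda>m. (j, \<nu> m)) [k + l0 + l1 + 1..<k + l0 + l1 + l2 + 1]
              \<in> adm_words (k + l0 + l1 + l2) \<longrightarrow>
            \<nu> ` {k + l0 + 1..k + l0 + l1} \<subseteq> \<nu> ` {k + l0 + l1 + 1..k + l0 + l1 + l2}"
    obtain l2 where star: "AE \<omega> in path_measure q.
          \<exists>\<^sub>\<infinity>k. \<forall>i\<in>{1, 2, 3}. \<forall>j\<in>{1, 2, 3}. \<forall>\<nu> :: nat \<Rightarrow> nat.
            (\<forall>m\<in>{k + 1..k + 1 + 1 + l2}. \<nu> m \<in> T) \<longrightarrow>
            initial_word k \<omega>
              @ map (\<lambda>m. (i, \<nu> m)) [k + 1..<k + 1 + 1]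
              @ map (\<lambda>m. (j, \<nu> m)) [k + 1 + 1..<k + 1 + 1 + 1]
              @ map (\<lambda>m. (j, \<nu> m)) [k + 1 + 1 + 1..<k + 1 + 1 + l2 + 1]
              \<in> adm_words (k + 1 + 1 + l2) \<longrightarrow>
            \<nu> ` {k + 1 + 1..k + 1 + 1} \<subseteq> \<nu> ` {k + 1 + 1 + 1..k + 1 + 1 + l2}"
      using B[THEN spec, THEN mp, OF order_refl, THEN spec, THEN mp, OF order_refl]
      by (elim exE conjE) (rule that)
    interpret N: word_measure p \<psi> T L "word_weight q" "path_measure q" by (rule path_measure_spec[OF q])
    have io: "AE \<omega> in path_measure q. \<exists>\<^sub>\<infinity>k. recurrent l2 (initial_word k \<omega>)"
      using star N.AE_adm_sequences
    proof eventually_elim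
      case (elim \<omega>)
      show ?case
        by (rule INFM_mono[OF elim(1)], rule recurrent_if_star[OF adm_sequences_Adm[OF elim(2)] length_initial_word])
    qed
    show ?thesis
    proof (rule spread_if_recurrent[OF q, of l2])
      fix \<delta> assume \<delta>: "\<delta> > 0" and spread: "\<And>g w. w \<in> Adm \<Longrightarrow> recurrent l2 w \<Longrightarrow>
        (\<And>u. u \<in> Adm \<Longrightarrow> length u \<ge> length w \<Longrightarrow> harm (L u) (g \<circ> \<psi>_word u)) \<Longrightarrow>
        Q (g \<circ> \<psi>_word w) (g \<circ> \<psi>_word w) > 0 \<Longrightarrow> spreads q (l2 + 2) \<delta> g w"
      show ?thesis
        by (rule energy_measure_singular[OF q \<delta> f, where G = "recurrent l2"], rule spread) (assumption | rule io)+
    qed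
  qed
qed

end
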